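(* Let $X$ be a quasi-Banach space. Then $X^*$ has weak cotype $2$ if and only if there is a constant $C$ such that $\mathrm{vr}^*(E)\le C$ for every finite-dimensional quotient $E$ of $X$.
   Context: A quasi-Banach space is a complete quasi-normed space, not necessarily locally convex; by the Aoki–Rolewicz theorem its quasi-norm may be taken, up to equivalence, to be an $r$-norm for some $0<r\le1$, i.e. $\|x+y\|^r\le\|x\|^r+\|y\|^r$ (in particular continuous). The dual $X^*$ is the Banach space of all bounded linear functionals on $X$. A finite-dimensional quotient of $X$ is $X/N$ with the quotient quasi-norm, where $N$ is a closed subspace of finite codimension. For a finite-dimensional continuously quasi-normed space $E$ with unit ball $B_E$ and $n=\dim E$, the outer volume-ratio is $\mathrm{vr}^*(E)=(\mathrm{Vol}\,\mathcal F/\mathrm{Vol}\,B_E)^{1/n}$, where $\mathcal F$ is an ellipsoid of minimal volume containing $B_E$. A Banach space $Z$ is of weak cotype $2$ if there is a constant $C$ such that whenever $H$ is a finite-dimensional Hilbert space with orthonormal basis $(e_1,\dots,e_n)$ and $u:H\to Z$ is linear, then $a_k(u)\le Ck^{-1/2}\ell(u)$ for $1\le k\le n$. Here $\ell(u)=\left(\mathbb E\|\sum_{k=1}^n g_k u(e_k)\|^2\right)^{1/2}$, where $g_1,\dots,g_n$ are independent normalized Gaussian random variables, and $a_k(u)=\inf\{\|u-v\|: v:H\to Z \text{ linear},\ \mathrm{rank}\,v<k\}$. *)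

theory Defs
  imports "HOL-Probability.Probability"
begin

section \<open>Quasi-Banach spaces\<close>

class quasi_normed_vector = real_vector +
  fixes qnorm :: "'a \<Rightarrow> real"
  assumes qnorm_ge_zero: "0 \<le> qnorm x"
    and qnorm_eq_zero: "qnorm x = 0 \<longleftrightarrow> x = 0"
    and qnorm_scaleR: "qnorm (a *\<^sub>R x) = \<bar>a\<bar> * qnorm x"
    and qnorm_quasi_triangle: "\<exists>K. \<forall>x y. qnorm (x + y) \<le> K * (qnorm x + qnorm y)"

class quasi_banach = quasi_normed_vector +
  assumes qnorm_complete:
    "(\<forall>e>0. \<exists>M. \<forall>m\<ge>M. \<forall>n\<ge>M. qnorm (s m - s n) < e) \<Longrightarrow>
      \<exists>x. (\<lambda>n. qnorm (s n - x)) \<longlonglongrightarrow> 0"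

text \<open>
  The unit ball of a discontinuous quasi-norm need not be measurable. By the Aoki-Rolewicz theorem
  every quasi-norm has an equivalent \<open>r\<close>-norm, and volumes are taken with respect to such a renorming.
\<close>

definition is_r_norm :: "real \<Rightarrow> ('a::real_vector \<Rightarrow> real) \<Rightarrow> bool" where
  "is_r_norm r p \<longleftrightarrow> 0 < r \<and> r \<le> 1 \<and> (\<forall>x. 0 \<le> p x) \<and> (\<forall>x. p x = 0 \<longleftrightarrow> x = 0)
     \<and> (\<forall>a x. p (a *\<^sub>R x) = \<bar>a\<bar> * p x)
     \<and> (\<forall>x y. p (x + y) powr r \<le> p x powr r + p y powr r)"

definition equivalent_qnorm :: "('a::quasi_normed_vector \<Rightarrow> real) \<Rightarrow> bool" where
  "equivalent_qnorm p \<longleftrightarrow>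
     (\<exists>c>0. \<exists>d>0. \<forall>x. c * qnorm x \<le> p x \<and> p x \<le> d * qnorm x)"

definition qclosed :: "'a::quasi_normed_vector set \<Rightarrow> bool" where
  "qclosed N \<longleftrightarrow>
     (\<forall>s x. (\<forall>n::nat. s n \<in> N) \<and> (\<lambda>n. qnorm (s n - x)) \<longlonglongrightarrow> 0 \<longrightarrow> x \<in> N)"

section \<open>The dual space\<close>

typedef (overloaded) ('a::quasi_normed_vector) qdual =
  "{f :: 'a \<Rightarrow> real. linear f \<and> (\<exists>K. \<forall>x. \<bar>f x\<bar> \<le> K * qnorm x)}"
  morphisms qdual_apply Abs_qdual
  by (rule exI[of _ "\<lambda>_. 0"]) (auto simp: linear_iff intro: exI[of _ 0])

lemma linear_qdual: "linear (qdual_apply f)"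
  using qdual_apply[of f] by simp

lemma bounded_qdual: "\<exists>K. \<forall>x. \<bar>qdual_apply f x\<bar> \<le> K * qnorm x"
  using qdual_apply[of f] by simp

lemma qdual_eqI: "(\<And>x. qdual_apply f x = qdual_apply g x) \<Longrightarrow> f = g"
  by (metis ext qdual_apply_inject)

lemma qdual_apply_Abs:
  "linear f \<Longrightarrow> (\<And>x. \<bar>f x\<bar> \<le> K * qnorm x) \<Longrightarrow> qdual_apply (Abs_qdual f) = f"
  by (rule Abs_qdual_inverse) auto

instantiation qdual :: (quasi_normed_vector) real_vector
begin

definition zero_qdual :: "'a qdual" where
  "0 = Abs_qdual (\<lambda>_. 0)"
definition plus_qdual :: "'a qdual \<Rightarrow> 'a qdual \<Rightarrow> 'a qdual" where
  "f + g = Abs_qdual (\<lambda>x. qdual_apply f x + qdual_apply g x)"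
definition uminus_qdual :: "'a qdual \<Rightarrow> 'a qdual" where
  "- f = Abs_qdual (\<lambda>x. - qdual_apply f x)"
definition minus_qdual :: "'a qdual \<Rightarrow> 'a qdual \<Rightarrow> 'a qdual" where
  "f - g = Abs_qdual (\<lambda>x. qdual_apply f x - qdual_apply g x)"
definition scaleR_qdual :: "real \<Rightarrow> 'a qdual \<Rightarrow> 'a qdual" where
  "c *\<^sub>R f = Abs_qdual (\<lambda>x. c * qdual_apply f x)"

lemma qdual_apply_zero: "qdual_apply 0 x = (0::real)"
  unfolding zero_qdual_def by (subst qdual_apply_Abs[where K=0]) (auto simp: linear_iff)

lemma qdual_apply_plus:
  "qdual_apply (f + g) x = qdual_apply f x + qdual_apply (g :: 'a qdual) x"
proof -
  obtain K L where K: "\<And>x. \<bar>qdual_apply f x\<bar> \<le> K * qnorm x"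
    and L: "\<And>x. \<bar>qdual_apply g x\<bar> \<le> L * qnorm x"
    using bounded_qdual by metis
  have "\<bar>qdual_apply f x + qdual_apply g x\<bar> \<le> (K + L) * qnorm x" for x
    using K[of x] L[of x] by (simp add: distrib_right)
  then show ?thesis
    unfolding plus_qdual_def
    by (subst qdual_apply_Abs[where K="K + L"])
       (auto intro: linear_compose_add linear_qdual)
qed

lemma qdual_apply_scaleR:
  "qdual_apply (c *\<^sub>R f) x = c * qdual_apply (f :: 'a qdual) x"
proof -
  obtain K where K: "\<And>x. \<bar>qdual_apply f x\<bar> \<le> K * qnorm x"
    using bounded_qdual by metis
  have "\<bar>c * qdual_apply f x\<bar> \<le> (\<bar>c\<bar> * K) * qnorm x" for x
    using mult_left_mono[OF K[of x], of "\<bar>c\<bar>"] by (simp add: abs_mult mult.assoc)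
  moreover have "linear (\<lambda>x. c * qdual_apply f x)"
    using linear_compose_scale_right[OF linear_qdual[of f], of c] by simp
  ultimately show ?thesis
    unfolding scaleR_qdual_def by (subst qdual_apply_Abs[where K="\<bar>c\<bar> * K"]) auto
qed

lemma qdual_apply_uminus: "qdual_apply (- f) x = - qdual_apply (f :: 'a qdual) x"
proof -
  have "- f = (-1) *\<^sub>R f" by (simp add: uminus_qdual_def scaleR_qdual_def)
  then show ?thesis by (simp add: qdual_apply_scaleR)
qed

lemma qdual_apply_minus:
  "qdual_apply (f - g) x = qdual_apply f x - qdual_apply (g :: 'a qdual) x"
proof -
  have "f - g = f + (- g)"
    by (simp add: minus_qdual_def plus_qdual_def qdual_apply_uminus)
  then show ?thesis by (simp add: qdual_apply_plus qdual_apply_uminus)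
qed

instance
  by standard
     (auto intro!: qdual_eqI simp: qdual_apply_zero qdual_apply_plus qdual_apply_scaleR
        qdual_apply_uminus qdual_apply_minus algebra_simps)

end

instantiation qdual :: (quasi_normed_vector) real_normed_vector
begin

definition norm_qdual :: "'a qdual \<Rightarrow> real" where
  "norm f = (SUP x\<in>{x. qnorm x \<le> 1}. \<bar>qdual_apply f x\<bar>)"
definition dist_qdual :: "'a qdual \<Rightarrow> 'a qdual \<Rightarrow> real" where
  "dist_qdual f g = norm (f - g)"
definition sgn_qdual :: "'a qdual \<Rightarrow> 'a qdual" where
  "sgn_qdual f = f /\<^sub>R norm f"
definition uniformity_qdual :: "('a qdual \<times> 'a qdual) filter" where
  "uniformity_qdual = (INF e\<in>{0<..}. principal {(f, g). dist f g < e})"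
definition open_qdual :: "'a qdual set \<Rightarrow> bool" where
  "open_qdual U \<longleftrightarrow> (\<forall>f\<in>U. eventually (\<lambda>(f', g). f' = f \<longrightarrow> g \<in> U) uniformity)"

lemma qdual_unit_le_norm:
  assumes "qnorm x \<le> 1"
  shows "\<bar>qdual_apply f x\<bar> \<le> norm (f :: 'a qdual)"
proof -
  obtain K where K: "\<And>x. \<bar>qdual_apply f x\<bar> \<le> K * qnorm x"
    using bounded_qdual by metis
  have "\<bar>qdual_apply f x\<bar> \<le> \<bar>K\<bar>" if "qnorm x \<le> 1" for x
  proof -
    have "K * qnorm x \<le> \<bar>K\<bar> * 1"
      using that qnorm_ge_zero[of x] by (intro mult_mono) auto
    then show ?thesis using K[of x] by simp
  qed
  then have "bdd_above ((\<lambda>x. \<bar>qdual_apply f x\<bar>) ` {x. qnorm x \<le> 1})"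
    by (auto intro!: bdd_aboveI2[where M="\<bar>K\<bar>"])
  then show ?thesis
    unfolding norm_qdual_def using assms by (intro cSUP_upper) auto
qed

lemma qdual_norm_ge_zero: "0 \<le> norm (f :: 'a qdual)"
  using qdual_unit_le_norm[of 0 f] by (simp add: qnorm_eq_zero[THEN iffD2])

lemma qdual_le_norm: "\<bar>qdual_apply f x\<bar> \<le> norm (f :: 'a qdual) * qnorm x"
proof (cases "x = 0")
  case True
  then show ?thesis
    using linear_0[OF linear_qdual[of f]] qdual_norm_ge_zero[of f]
    by (simp add: qnorm_ge_zero)
next
  case False
  then have pos: "qnorm x > 0"
    using qnorm_ge_zero[of x] qnorm_eq_zero[of x] by linarith
  have "\<bar>qdual_apply f (inverse (qnorm x) *\<^sub>R x)\<bar> \<le> norm f"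
    using pos by (intro qdual_unit_le_norm) (simp add: qnorm_scaleR)
  then show ?thesis
    using pos by (simp add: linear_scale[OF linear_qdual] abs_mult field_simps)
qed

lemma qdual_norm_leI:
  assumes "\<And>x. \<bar>qdual_apply f x\<bar> \<le> K * qnorm x" "0 \<le> K"
  shows "norm (f :: 'a qdual) \<le> K"
  unfolding norm_qdual_def
proof (rule cSUP_least)
  show "{x :: 'a. qnorm x \<le> 1} \<noteq> {}"
    using qnorm_eq_zero[of "0::'a"] by (auto intro!: exI[of _ 0])
next
  fix x :: 'a assume "x \<in> {x. qnorm x \<le> 1}"
  then have "K * qnorm x \<le> K * 1"
    using assms(2) by (intro mult_left_mono) auto
  then show "\<bar>qdual_apply f x\<bar> \<le> K" using assms(1)[of x] by simp
qed

instance
proof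
  fix f g :: "'a qdual" and c :: real and U :: "'a qdual set"
  show "dist f g = norm (f - g)" by (rule dist_qdual_def)
  show "sgn f = f /\<^sub>R norm f" by (rule sgn_qdual_def)
  show "uniformity = (INF e\<in>{0<..}. principal {(f::'a qdual, g). dist f g < e})"
    by (rule uniformity_qdual_def)
  show "open U = (\<forall>f\<in>U. \<forall>\<^sub>F (f', g) in uniformity. f' = f \<longrightarrow> g \<in> U)"
    by (rule open_qdual_def)
  show "norm f = 0 \<longleftrightarrow> f = 0"
  proof
    assume "norm f = 0"
    then show "f = 0"
      using qdual_le_norm[of f] by (intro qdual_eqI) (simp add: qdual_apply_zero)
  next
    assume "f = 0"
    then have "norm f \<le> 0" by (intro qdual_norm_leI) (auto simp: qdual_apply_zero)
    then show "norm f = 0" using qdual_norm_ge_zero[of f] by simp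
  qed
  show "norm (f + g) \<le> norm f + norm g"
  proof (rule qdual_norm_leI)
    fix x
    show "\<bar>qdual_apply (f + g) x\<bar> \<le> (norm f + norm g) * qnorm x"
      using qdual_le_norm[of f x] qdual_le_norm[of g x]
      by (simp add: qdual_apply_plus distrib_right)
  qed (simp add: qdual_norm_ge_zero)
  have le: "norm (c *\<^sub>R f) \<le> \<bar>c\<bar> * norm f" for c and f :: "'a qdual"
  proof (rule qdual_norm_leI)
    fix x
    show "\<bar>qdual_apply (c *\<^sub>R f) x\<bar> \<le> \<bar>c\<bar> * norm f * qnorm x"
      using mult_left_mono[OF qdual_le_norm[of f x], of "\<bar>c\<bar>"]
      by (simp add: qdual_apply_scaleR abs_mult mult.assoc)
  qed (simp add: qdual_norm_ge_zero)
  show "norm (c *\<^sub>R f) = \<bar>c\<bar> * norm f"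
  proof (cases "c = 0")
    case True
    then show ?thesis using le[of c f] qdual_norm_ge_zero[of "c *\<^sub>R f"] by simp
  next
    case False
    have "norm f \<le> \<bar>inverse c\<bar> * norm (c *\<^sub>R f)"
      using le[of "inverse c" "c *\<^sub>R f"] False by simp
    then have "\<bar>c\<bar> * norm f \<le> norm (c *\<^sub>R f)"
      using False by (simp add: field_simps abs_inverse)
    then show ?thesis using le[of c f] by simp
  qed
qed

end

instance qdual :: (quasi_normed_vector) banach
proof
  fix F :: "nat \<Rightarrow> 'a qdual"
  assume F: "Cauchy F"
  have cau: "Cauchy (\<lambda>n. qdual_apply (F n) x)" for x
  proof (rule metric_CauchyI)
    fix e :: real assume e: "e > 0"
    have q: "qnorm x + 1 > 0" using qnorm_ge_zero[of x] by simp
    then obtain M where M: "\<And>m n. m \<ge> M \<Longrightarrow> n \<ge> M \<Longrightarrow> dist (F m) (F n) < e / (qnorm x + 1)"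
      using metric_CauchyD[OF F, of "e / (qnorm x + 1)"] e by auto
    have "dist (qdual_apply (F m) x) (qdual_apply (F n) x) < e" if "m \<ge> M" "n \<ge> M" for m n
    proof -
      have "dist (qdual_apply (F m) x) (qdual_apply (F n) x) \<le> dist (F m) (F n) * qnorm x"
        using qdual_le_norm[of "F m - F n" x]
        by (simp add: dist_norm qdual_apply_minus)
      also have "\<dots> \<le> dist (F m) (F n) * (qnorm x + 1)"
        by (intro mult_left_mono) auto
      also have "\<dots> < e" using M[OF that] q by (simp add: pos_less_divide_eq)
      finally show ?thesis .
    qed
    then show "\<exists>M. \<forall>m\<ge>M. \<forall>n\<ge>M. dist (qdual_apply (F m) x) (qdual_apply (F n) x) < e"
      by blast
  qed
  define f where "f = (\<lambda>x. lim (\<lambda>n. qdual_apply (F n) x))"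
  have lim: "(\<lambda>n. qdual_apply (F n) x) \<longlonglongrightarrow> f x" for x
    using cau[of x] unfolding f_def by (simp add: Cauchy_convergent convergent_LIMSEQ_iff[symmetric])
  have lin: "linear f"
  proof (rule linearI)
    fix x y
    have "(\<lambda>n. qdual_apply (F n) (x + y)) \<longlonglongrightarrow> f x + f y"
      using tendsto_add[OF lim[of x] lim[of y]] by (simp add: linear_add[OF linear_qdual])
    then show "f (x + y) = f x + f y" using lim LIMSEQ_unique by blast
  next
    fix c x
    have "(\<lambda>n. qdual_apply (F n) (c *\<^sub>R x)) \<longlonglongrightarrow> c *\<^sub>R f x"
      using tendsto_mult_left[OF lim[of x], of c] by (simp add: linear_scale[OF linear_qdual])
    then show "f (c *\<^sub>R x) = c *\<^sub>R f x" using lim LIMSEQ_unique by blast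
  qed
  have key: "\<bar>qdual_apply (F n) x - f x\<bar> \<le> e * qnorm x"
    if M: "\<And>m. m \<ge> M \<Longrightarrow> dist (F n) (F m) < e" for e n M x
  proof (rule tendsto_upperbound)
    show "(\<lambda>m. \<bar>qdual_apply (F n) x - qdual_apply (F m) x\<bar>) \<longlonglongrightarrow> \<bar>qdual_apply (F n) x - f x\<bar>"
      by (intro tendsto_intros lim)
    have "\<bar>qdual_apply (F n) x - qdual_apply (F m) x\<bar> \<le> e * qnorm x" if "m \<ge> M" for m
    proof -
      have "\<bar>qdual_apply (F n) x - qdual_apply (F m) x\<bar> \<le> dist (F n) (F m) * qnorm x"
        using qdual_le_norm[of "F n - F m" x] by (simp add: dist_norm qdual_apply_minus)
      also have "\<dots> \<le> e * qnorm x"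
        using M[OF that] qnorm_ge_zero[of x] by (intro mult_right_mono) auto
      finally show ?thesis .
    qed
    then show "\<forall>\<^sub>F m in sequentially. \<bar>qdual_apply (F n) x - qdual_apply (F m) x\<bar> \<le> e * qnorm x"
      unfolding eventually_sequentially by blast
  qed simp
  obtain M where M: "\<And>m n. m \<ge> M \<Longrightarrow> n \<ge> M \<Longrightarrow> dist (F m) (F n) < 1"
    using metric_CauchyD[OF F, of 1] by auto
  have "\<bar>f x\<bar> \<le> (norm (F M) + 1) * qnorm x" for x
    using key[of M M 1 x] M qdual_le_norm[of "F M" x] by (simp add: distrib_right)
  then have app: "qdual_apply (Abs_qdual f) = f"
    by (intro qdual_apply_Abs lin)
  have "F \<longlonglongrightarrow> Abs_qdual f"
  proof (rule metric_LIMSEQ_I)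
    fix e :: real assume e: "e > 0"
    then obtain M where M: "\<And>m n. m \<ge> M \<Longrightarrow> n \<ge> M \<Longrightarrow> dist (F m) (F n) < e / 2"
      using metric_CauchyD[OF F, of "e / 2"] by auto
    have "dist (F n) (Abs_qdual f) < e" if "n \<ge> M" for n
    proof -
      have "norm (F n - Abs_qdual f) \<le> e / 2"
        using e that M key[of M n "e / 2"]
        by (intro qdual_norm_leI) (simp_all add: qdual_apply_minus app)
      then show ?thesis using e by (simp add: dist_norm)
    qed
    then show "\<exists>M. \<forall>n\<ge>M. dist (F n) (Abs_qdual f) < e" by blast
  qed
  then show "convergent F" by (rule convergentI)
qed

section \<open>Weak cotype 2\<close>

text \<open>
  A finite-dimensional Hilbert space with an orthonormal basis of length \<open>n\<close> is identified with
  Euclidean coordinate space, and a linear map \<open>u\<close> from it into \<open>Z\<close> with the family \<open>u k\<close>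
  (\<open>k < n\<close>) of the images of the basis vectors; values \<open>u k\<close> for \<open>k \<ge> n\<close> play no role.
\<close>

definition lin_map :: "nat \<Rightarrow> (nat \<Rightarrow> 'z::real_vector) \<Rightarrow> (nat \<Rightarrow> real) \<Rightarrow> 'z" where
  "lin_map n u x = (\<Sum>k<n. x k *\<^sub>R u k)"

definition op_norm :: "nat \<Rightarrow> (nat \<Rightarrow> 'z::real_normed_vector) \<Rightarrow> real" where
  "op_norm n u = (SUP x\<in>{x. (\<Sum>k<n. (x k)\<^sup>2) \<le> 1}. norm (lin_map n u x))"

definition lin_rank :: "nat \<Rightarrow> (nat \<Rightarrow> 'z::real_vector) \<Rightarrow> nat" where
  "lin_rank n u = dim (range (lin_map n u))"

definition approx_number :: "nat \<Rightarrow> nat \<Rightarrow> (nat \<Rightarrow> 'z::real_normed_vector) \<Rightarrow> real" where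
  "approx_number k n u = (INF v\<in>{v. lin_rank n v < k}. op_norm n (\<lambda>i. u i - v i))"

definition ell_norm :: "nat \<Rightarrow> (nat \<Rightarrow> 'z::real_normed_vector) \<Rightarrow> real" where
  "ell_norm n u =
     sqrt (\<integral>g. (norm (lin_map n u g))\<^sup>2 \<partial>(\<Pi>\<^sub>M k\<in>{..<n}. std_normal_distribution))"

definition weak_cotype_2 :: "'z::banach itself \<Rightarrow> bool" where
  "weak_cotype_2 _ \<longleftrightarrow>
     (\<exists>C. \<forall>n. \<forall>u :: nat \<Rightarrow> 'z. \<forall>k. 1 \<le> k \<and> k \<le> n \<longrightarrow>
        approx_number k n u \<le> C * real k powr (- 1 / 2) * ell_norm n u)"

section \<open>Outer volume-ratio\<close>

definition coord_space :: "nat \<Rightarrow> (nat \<Rightarrow> real) set" where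
  "coord_space n = PiE {..<n} (\<lambda>_. UNIV)"

definition vol :: "nat \<Rightarrow> (nat \<Rightarrow> real) set \<Rightarrow> real" where
  "vol n = measure (\<Pi>\<^sub>M i\<in>{..<n}. lborel)"

definition affine_map ::
    "nat \<Rightarrow> (nat \<Rightarrow> nat \<Rightarrow> real) \<Rightarrow> (nat \<Rightarrow> real) \<Rightarrow> (nat \<Rightarrow> real) \<Rightarrow> nat \<Rightarrow> real" where
  "affine_map n A c x = (\<lambda>i\<in>{..<n}. c i + (\<Sum>j<n. A i j * x j))"

definition ellipsoid :: "nat \<Rightarrow> (nat \<Rightarrow> real) set \<Rightarrow> bool" where
  "ellipsoid n F \<longleftrightarrow>
     (\<exists>A c. bij_betw (affine_map n A c) (coord_space n) (coord_space n) \<and>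
            F = affine_map n A c ` {x \<in> coord_space n. (\<Sum>i<n. (x i)\<^sup>2) \<le> 1})"

text \<open>
  Here \<open>\<nu>\<close> is the quasi-norm of an \<open>n\<close>-dimensional space written in coordinates with respect to
  some basis. A change of basis multiplies all volumes by the same factor, so the ratio does not
  depend on the basis. For \<open>n = 0\<close> the value is \<open>1\<close>.
\<close>

definition outer_volume_ratio :: "nat \<Rightarrow> ((nat \<Rightarrow> real) \<Rightarrow> real) \<Rightarrow> real" where
  "outer_volume_ratio n \<nu> =
     (let B = {a \<in> coord_space n. \<nu> a \<le> 1};
          F = arg_min (vol n) (\<lambda>F. ellipsoid n F \<and> B \<subseteq> F)
      in (vol n F / vol n B) powr (1 / real n))"

section \<open>Finite-dimensional quotients\<close>

text \<open>The quotient quasi-norm of the coset of \<open>x\<close> modulo \<open>N\<close>.\<close>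

definition quotient_qnorm :: "('a::real_vector \<Rightarrow> real) \<Rightarrow> 'a set \<Rightarrow> 'a \<Rightarrow> real" where
  "quotient_qnorm p N x = (INF z\<in>N. p (x + z))"

text \<open>The cosets of \<open>b 0, \<dots>, b (n - 1)\<close> form a basis of the quotient by \<open>N\<close>.\<close>

definition quotient_basis :: "'a::real_vector set \<Rightarrow> nat \<Rightarrow> (nat \<Rightarrow> 'a) \<Rightarrow> bool" where
  "quotient_basis N n b \<longleftrightarrow>
     (\<forall>x. \<exists>a. x - lin_map n b a \<in> N) \<and>
     (\<forall>a. lin_map n b a \<in> N \<longrightarrow> (\<forall>i<n. a i = 0))"

definition quotient_outer_volume_ratio ::
    "('a::real_vector \<Rightarrow> real) \<Rightarrow> 'a set \<Rightarrow> nat \<Rightarrow> (nat \<Rightarrow> 'a) \<Rightarrow> real" where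
  "quotient_outer_volume_ratio p N n b =
     outer_volume_ratio n (\<lambda>a. quotient_qnorm p N (lin_map n b a))"

end

theory Submission imports Defs "HOL-Real_Asymp.Real_Asymp"
begin

text \<open>A quotient of $X$ of dimension $n$ is studied in coordinates: its unit ball becomes a symmetric $r$-convex body $K$ in $\mathbb R^n$, and
functionals on it become vectors, normed by the support function of $K$.

\<^bold>\<open>From volume ratios to weak cotype 2.\<close> If $a_k(u) > \alpha$, then about $k/2$ orthonormal vectors $x_l$ and points $e_l$ of the unit
ball can be chosen one after the other such that the functional $u(x_l)$ is at least a multiple of $\alpha$ at $e_l$ and vanishes at
the earlier $e_j$ (\<open>triangular_system\<close>). Pass to the quotient by the common kernel of these $m$ functionals. There the $e_l$ form a
triangular system, and every ellipsoid that contains it together with its negative has volume at least $(c\alpha)^m$ times that of the Euclidean ball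
(\<open>ellipsoid_volume_lower\<close>). The unit ball of the quotient, however, is a projection of a set whose Gaussian width is at most a
multiple of $\ell(u)$; by Sudakov's inequality its volume is at most $(C\ell(u)/\sqrt m)^m$ times that of the Euclidean ball
(\<open>urysohn_projection\<close>). If the volume ratio is bounded, then $\alpha \le C'\ell(u)/\sqrt k$.

\<^bold>\<open>From weak cotype 2 to volume ratios.\<close> Start from any Hilbertian norm $|M\cdot|$ whose unit ball contains $K$ and is contained in $AK$,
with no control on $A$. The heart of the proof is a step (\<open>position_step\<close>) that adds a small ellipsoid to the body; this replaces $A$ by
$\sqrt A$, and the volume grows by a factor of at most $\exp(Cn/(\ln A)^2)$. As $\ln A$ is halved in each step, the sum of the exponents is
dominated by its last term, and the steps end with a bounded $A$ and a body of volume at most $e^{C'n}$ times that of $K$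
(\<open>small_hilbert_ball\<close>). The Hilbert ball around that body is an ellipsoid around $K$.

One step combines four facts. (1) There is a linear position of the body in which its $\ell$-norm is at most $\sqrt n$ while the gauge $N$ of its
closed convex hull has Gaussian norm at most $W A^\delta\sqrt n$, with $\delta$ as small as we please (\<open>good_position\<close>). This is Lewis'
determinant argument together with $K$-convexity with a power of $A$ as constant (\<open>K_convexity\<close>), which is proved on the discrete
cube and carried over by the central limit theorem. (2) By weak cotype 2 the body is, in this position, within distance $C(\ln A)^2$ of a
subspace of dimension at most $n/(\ln A)^4$. The constant of (2) does not deteriorate from step to step, because each of the bodies is the sum of $K$
and one linear image of a Euclidean ball (\<open>wct_sum\<close>). (3) By the dual Sudakov inequality, few translates of a multiple of the convex hull
cover the Hilbert ball $F$ that belongs to (2). (4) A point of the convex hull is, up to a small error in the Hilbert norm, an average of few points of the body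
(\<open>maurey\<close>), and by $r$-convexity such an average lies in a moderate multiple of the body; this is how a body that is not
convex can be treated. Iteration removes the error (\<open>cover_by_body\<close>). So few translates of a multiple of the body cover $F$, whence a
small multiple of $F$ can be added to the body at little cost in volume.\<close>

unbundle inner_syntax

section \<open>Finitely supported sequences\<close>

text \<open>All spaces $\mathbb R^n$ live in one type, so that statements can quantify over the dimension and relate different dimensions.\<close>
typedef fsvec = "{f :: nat => real. finite {i. f i ~= 0}}"
 morphisms cf Abs_fsvec
 by (rule exI[of _ "%_. 0"]) auto

lemma finite_cf: "finite {i. cf x i ~= 0}"
 using cf[of x] by simp

lemma fsvec_eqI: "(!!i. cf x i = cf y i) ==> x = y"
 by (metis ext cf_inject)

lemma cf_Abs: "finite {i. f i ~= 0} ==> cf (Abs_fsvec f) = f"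
 by (rule Abs_fsvec_inverse) auto

instantiation fsvec :: real_vector
begin

definition zero_fsvec :: fsvec where "0 = Abs_fsvec (%_. 0)"
definition plus_fsvec :: "fsvec => fsvec => fsvec" where
 "x + y = Abs_fsvec (%i. cf x i + cf y i)"
definition uminus_fsvec :: "fsvec => fsvec" where
 "- x = Abs_fsvec (%i. - cf x i)"
definition minus_fsvec :: "fsvec => fsvec => fsvec" where
 "x - y = Abs_fsvec (%i. cf x i - cf y i)"
definition scaleR_fsvec :: "real => fsvec => fsvec" where
 "c *\<^sub>R x = Abs_fsvec (%i. c * cf x i)"

lemma cf_zero [simp]: "cf 0 i = 0"
 by (simp add: zero_fsvec_def cf_Abs)

lemma cf_plus [simp]: "cf (x + y) i = cf x i + cf y i"
proof -
 have "finite {i. cf x i + cf y i ~= 0}"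
  by (rule finite_subset[OF _ finite_UnI[OF finite_cf[of x] finite_cf[of y]]]) auto
 then show ?thesis by (simp add: plus_fsvec_def cf_Abs)
qed

lemma cf_uminus [simp]: "cf (- x) i = - cf x i"
 by (simp add: uminus_fsvec_def cf_Abs finite_cf)

lemma cf_minus [simp]: "cf (x - y) i = cf x i - cf y i"
proof -
 have "finite {i. cf x i - cf y i ~= 0}"
  by (rule finite_subset[OF _ finite_UnI[OF finite_cf[of x] finite_cf[of y]]]) auto
 then show ?thesis by (simp add: minus_fsvec_def cf_Abs)
qed

lemma cf_scaleR [simp]: "cf (c *\<^sub>R x) i = c * cf x i"
proof -
 have "finite {i. c * cf x i ~= 0}"
  by (rule finite_subset[OF _ finite_cf[of x]]) auto
 then show ?thesis by (simp add: scaleR_fsvec_def cf_Abs)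
qed

instance
 by standard (auto intro!: fsvec_eqI simp: algebra_simps)

end

instantiation fsvec :: real_inner
begin

definition inner_fsvec :: "fsvec => fsvec => real" where
 "inner x y = (\<Sum>i\<in>{i. cf x i ~= 0}. cf x i * cf y i)"
definition norm_fsvec :: "fsvec => real" where
 "norm (x::fsvec) = sqrt (inner x x)"
definition dist_fsvec :: "fsvec => fsvec => real" where
 "dist_fsvec x y = norm (x - y)"
definition sgn_fsvec :: "fsvec => fsvec" where
 "sgn_fsvec x = x /\<^sub>R norm x"
definition uniformity_fsvec :: "(fsvec \<times> fsvec) filter" where
 "uniformity_fsvec = (INF e\<in>{0<..}. principal {(x, y). dist x y < e})"
definition open_fsvec :: "fsvec set => bool" where
 "open_fsvec U \<longleftrightarrow> (\<forall>x\<in>U. eventually (%(x', y). x' = x --> y \<in> U) uniformity)"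

lemma inner_fsvec_superset:
 assumes "finite S" "{i. cf x i ~= 0} \<inter> {i. cf y i ~= 0} <= S"
 shows "inner x y = (\<Sum>i\<in>S. cf x i * cf y i)"
proof -
 have "inner x y = (\<Sum>i\<in>{i. cf x i ~= 0} \<union> S. cf x i * cf y i)"
  unfolding inner_fsvec_def using assms finite_cf[of x]
  by (intro sum.mono_neutral_left) auto
 also have "... = (\<Sum>i\<in>S. cf x i * cf y i)"
  using assms finite_cf[of x] by (intro sum.mono_neutral_right) auto
 finally show ?thesis .
qed

instance
proof
 fix x y z :: fsvec and r :: real and U :: "fsvec set"
 show "dist x y = norm (x - y)" by (rule dist_fsvec_def)
 show "sgn x = x /\<^sub>R norm x" by (rule sgn_fsvec_def)
 show "uniformity = (INF e\<in>{0<..}. principal {(x::fsvec, y). dist x y < e})"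
  by (rule uniformity_fsvec_def)
 show "open U = (\<forall>x\<in>U. \<forall>\<^sub>F (x', y) in uniformity. x' = x --> y \<in> U)"
  by (rule open_fsvec_def)
 let ?S = "{i. cf x i ~= 0} \<union> {i. cf y i ~= 0} \<union> {i. cf z i ~= 0}"
 have S: "finite ?S" by (simp add: finite_cf)
 show "x \<bullet> y = y \<bullet> x"
  by (subst (1 2) inner_fsvec_superset[OF S]) (auto simp: mult.commute)
 show "(x + y) \<bullet> z = x \<bullet> z + y \<bullet> z"
  by (subst (1 2 3) inner_fsvec_superset[OF S]) (auto simp: distrib_right sum.distrib)
 show "(r *\<^sub>R x) \<bullet> y = r * (x \<bullet> y)"
  by (subst (1 2) inner_fsvec_superset[OF S]) (auto simp: sum_distrib_left mult.assoc)
 show "0 <= x \<bullet> x" unfolding inner_fsvec_def by (intro sum_nonneg) auto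
 show "(x \<bullet> x = 0) = (x = 0)"
  unfolding inner_fsvec_def
  by (subst sum_nonneg_eq_0_iff) (auto simp: finite_cf intro!: fsvec_eqI)
 show "norm x = sqrt (x \<bullet> x)" by (rule norm_fsvec_def)
qed

end

lemma cf_sum: "cf (\<Sum>i\<in>I. f i) j = (\<Sum>i\<in>I. cf (f i) j)"
 by (induction I rule: infinite_finite_induct) auto

definition ax :: "nat => fsvec" where
 "ax i = Abs_fsvec (%j. if j = i then 1 else 0)"

lemma cf_ax: "cf (ax i) j = (if j = i then 1 else 0)"
 unfolding ax_def by (subst cf_Abs) auto

definition cvec :: "nat => (nat => real) => fsvec" where
 "cvec n a = (\<Sum>i<n. a i *\<^sub>R ax i)"

definition Rn :: "nat => fsvec set" where
 "Rn n = {x. \<forall>i\<ge>n. cf x i = 0}"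

abbreviation comb :: "nat => (nat => 'v::real_vector) => fsvec => 'v" where
 "comb n s x == (\<Sum>i<n. cf x i *\<^sub>R s i)"

lemma cf_cvec: "cf (cvec n a) i = (if i < n then a i else 0)"
 by (simp add: cvec_def cf_sum cf_ax if_distrib[of "%x. _ * x"] cong: if_cong)

lemma cvec_in_Rn [simp, intro]: "cvec n a \<in> Rn n"
 by (simp add: Rn_def cf_cvec)

lemma cvec_cf: "x \<in> Rn n ==> cvec n (cf x) = x"
 by (rule fsvec_eqI) (auto simp: Rn_def cf_cvec)

lemma cvec_cong: "(!!i. i < n ==> a i = b i) ==> cvec n a = cvec n b"
 by (simp add: cvec_def)

lemma inner_Rn: "x \<in> Rn n ==> x \<bullet> y = (\<Sum>i<n. cf x i * cf y i)"
 by (rule inner_fsvec_superset) (force simp: Rn_def not_less[symmetric])+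

lemma inner_ax [simp]: "x \<bullet> ax i = cf x i"
 by (subst inner_fsvec_superset[of "{i}"]) (auto simp: cf_ax)

lemma inner_ax' [simp]: "ax i \<bullet> x = cf x i"
 by (subst inner_commute) simp

lemma inner_cvec: "cvec n a \<bullet> x = (\<Sum>i<n. a i * cf x i)"
 by (simp add: cvec_def inner_sum_left)

lemma norm_cvec: "(norm (cvec n a))^2 = (\<Sum>i<n. (a i)^2)"
 by (simp add: power2_norm_eq_inner inner_cvec cf_cvec) (simp add: power2_eq_square)

lemma ax_in_Rn: "i < n ==> ax i \<in> Rn n"
 by (auto simp: Rn_def cf_ax)

lemma subspace_Rn [simp]: "subspace (Rn n)"
 by (auto simp: Rn_def subspace_def)

lemma Rn_simps [simp]:
 "0 \<in> Rn n" "x \<in> Rn n ==> y \<in> Rn n ==> x + y \<in> Rn n"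
 "x \<in> Rn n ==> y \<in> Rn n ==> x - y \<in> Rn n"
 "x \<in> Rn n ==> - x \<in> Rn n" "x \<in> Rn n ==> c *\<^sub>R x \<in> Rn n"
 by (auto simp: Rn_def)

lemma Rn_sum: "(!!i. i \<in> I ==> f i \<in> Rn n) ==> (\<Sum>i\<in>I. f i) \<in> Rn n"
 by (rule subspace_sum[OF subspace_Rn])

lemma abs_cf_le_norm: "\<bar>cf x i\<bar> <= norm x"
 using Cauchy_Schwarz_ineq2[of x "ax i"]
 by (simp add: norm_eq_sqrt_inner[of "ax i"] cf_ax)

lemma cvec_add: "cvec n a + cvec n b = cvec n (%i. a i + b i)"
 by (simp add: cvec_def scaleR_left_distrib sum.distrib)

lemma cvec_scaleR: "c *\<^sub>R cvec n a = cvec n (%i. c * a i)"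
 by (simp add: cvec_def scaleR_right.sum)

lemma cvec_minus: "- cvec n a = cvec n (%i. - a i)"
 by (simp add: cvec_def sum_negf)

lemma continuous_on_cvec [continuous_intros]: "continuous_on S (cvec n)"
 unfolding cvec_def
 by (intro continuous_intros continuous_on_subset[OF continuous_on_product_coordinates]) auto

lemma compact_box: "compact (PiE {..<n::nat} (%_. {-R..R::real}) :: (nat => real) set)"
proof -
 let ?B = "PiE UNIV (%i. if i < n then {-R..R} else {undefined::real})"
 have "(PiE {..<n::nat} (%_. {-R..R::real}) :: (nat => real) set) = ?B"
  by (auto simp: PiE_def Pi_def extensional_def split: if_splits)
 moreover have "compactin (product_topology (%_. euclidean) UNIV) ?B"
  by (subst compactin_PiE) (auto simp: compactin_euclidean_iff)
 then have "compact ?B"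
  by (simp add: euclidean_product_topology)
 ultimately show ?thesis by simp
qed

lemma compact_Rn_ball: "compact (Rn n \<inter> cball 0 R)"
proof -
 have 1: "compact (cvec n ` (PiE {..<n} (%_. {-R..R})))"
  by (intro compact_continuous_image continuous_intros compact_box)
 have 2: "closed {x::fsvec. norm x <= R}"
  by (intro closed_Collect_le continuous_intros)
 have "Rn n \<inter> cball 0 R = cvec n ` (PiE {..<n} (%_. {-R..R})) \<inter> {x. norm x <= R}"
 proof (intro equalityI subsetI)
  fix x assume x: "x \<in> Rn n \<inter> cball 0 R"
  have "x = cvec n (restrict (cf x) {..<n})"
   using x by (subst cvec_cf[of x n, symmetric]) (auto intro!: cvec_cong)
  moreover have "\<bar>cf x i\<bar> <= R" for i
   using x abs_cf_le_norm[of x i] by simp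
  then have "restrict (cf x) {..<n} \<in> PiE {..<n} (%_. {-R..R})"
   by (auto simp: abs_le_iff minus_le_iff)
  ultimately show "x \<in> cvec n ` (PiE {..<n} (%_. {-R..R})) \<inter> {x. norm x <= R}"
   using x by auto
 qed auto
 then show ?thesis using compact_Int_closed[OF 1 2] by simp
qed

section \<open>Gaussian and Lebesgue measure\<close>

lemma sets_lborel_PiM [measurable_cong]: "sets (PiM {..<n} (%_. lborel :: real measure)) = sets (PiM {..<n} (%_. borel))"
 by (rule sets_PiM_cong) auto

lemma sets_normal_PiM [measurable_cong]: "sets (PiM {..<n} (%_. std_normal_distribution)) = sets (PiM {..<n} (%_. borel))"
 by (rule sets_PiM_cong) auto

lemma space_coord_PiM [simp]:
 "space (PiM {..<n} (%_. borel :: real measure)) = coord_space n"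
 "space (PiM {..<n} (%_. lborel :: real measure)) = coord_space n"
 "space (PiM {..<n} (%_. std_normal_distribution)) = coord_space n"
 by (simp_all add: space_PiM coord_space_def)

lemma measurable_cvec:
 assumes "continuous_on UNIV (f :: fsvec => real)"
 shows "(%a. f (cvec n a)) \<in> borel_measurable (PiM {..<n} (%_. borel))"
proof -
 have "continuous_on UNIV (%a. f (cvec n a))"
  using continuous_on_compose2[OF assms continuous_on_cvec[of UNIV n]] by auto
 then have "(%a. f (cvec n a)) \<in> borel_measurable borel"
  by (rule borel_measurable_continuous_onI)
 then have 1: "(%a. f (cvec n a)) \<in> borel_measurable (PiM UNIV (%_. borel))"
  using measurable_cong_sets[OF sets_PiM_equal_borel refl] by blast
 have 2: "(%a i. if i < n then a i else 0) \<in> measurable (PiM {..<n} (%_. borel)) (PiM UNIV (%_. borel :: real measure))"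
 proof (rule measurable_PiM_single')
  fix i :: nat
  show "(%a. if i < n then a i else 0) \<in> borel_measurable (PiM {..<n} (%_. borel :: real measure))"
   by (cases "i < n") (auto intro!: measurable_component_singleton)
 qed auto
 have "(%a. f (cvec n a)) = (%a. f (cvec n a)) \<circ> (%a i. if i < n then a i else 0)"
  by (auto simp: fun_eq_iff intro!: arg_cong[of _ _ f] cvec_cong)
 then show ?thesis using measurable_comp[OF 2 1] by metis
qed

definition gs :: "nat => (nat => real) measure" where
 "gs n = PiM {..<n} (%_. std_normal_distribution)"

text \<open>Product measures live on functions that are undefined outside \<open>{..<n}\<close>; sets of vectors are measured through their coordinates there.\<close>
definition cset :: "nat => fsvec set => (nat => real) set" where
 "cset n K = {a \<in> coord_space n. cvec n a \<in> K}"

definition cms :: "nat => fsvec set => bool" where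
 "cms n K \<longleftrightarrow> cset n K \<in> sets (PiM {..<n} (%_. borel))"

lemma sets_gs [measurable_cong]: "sets (gs n) = sets (PiM {..<n} (%_. borel))"
 unfolding gs_def by (rule sets_normal_PiM)

lemma space_gs [simp]: "space (gs n) = coord_space n"
 unfolding gs_def by simp

lemma measurable_gs: "continuous_on UNIV (f :: fsvec => real) ==> (%a. f (cvec n a)) \<in> borel_measurable (gs n)"
 using measurable_cvec[of f n] measurable_cong_sets[OF sets_gs refl] by blast

lemma cms_le:
 assumes "continuous_on UNIV (f :: fsvec => real)"
 shows "cms n {x. f x <= c}" "cms n {x. f x < c}"
 unfolding cms_def cset_def
 using measurable_cvec[OF assms, of n]
 by (auto simp flip: space_coord_PiM(1))

abbreviation gmean :: "nat => (fsvec => real) => real" where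
 "gmean n h == (\<integral>a. (h (cvec n a))^2 \<partial>gs n)"

abbreviation gsquare :: "nat => (fsvec => real) => bool" where
 "gsquare n h == integrable (gs n) (%a. (h (cvec n a))^2)"

lemma prob_gs: "prob_space (gs n)"
 unfolding gs_def by (intro prob_space_PiM prob_space_normal_density) auto

lemma normal_shift:
 assumes "A \<in> sets borel"
 shows "emeasure std_normal_distribution {x. x + c \<in> A}
  = (\<integral>\<^sup>+x. ennreal (exp (x * c - c\<^sup>2 / 2)) * indicator A x \<partial>std_normal_distribution)"
proof -
 have [measurable]: "A \<in> sets borel" by fact
 have m: "{x. x + c \<in> A} \<in> sets borel"
  using measurable_sets[of "%x. x + c" borel borel A] assms by (simp add: vimage_def)
 have "emeasure std_normal_distribution {x. x + c \<in> A}
  = (\<integral>\<^sup>+x. ennreal (std_normal_density x) * indicator A (x + c) \<partial>lborel)"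
  using m by (subst emeasure_density) (auto intro!: nn_integral_cong split: split_indicator)
 also have "... = (\<integral>\<^sup>+x. ennreal (std_normal_density (x - c)) * indicator A x \<partial>lborel)"
  by (subst nn_integral_real_affine[where c=1 and t="-c"]) (auto simp: algebra_simps)
 also have "... = (\<integral>\<^sup>+x. ennreal (std_normal_density x) * (ennreal (exp (x * c - c\<^sup>2 / 2)) * indicator A x) \<partial>lborel)"
 proof (intro nn_integral_cong)
  fix x
  have "std_normal_density (x - c) = std_normal_density x * exp (x * c - c\<^sup>2 / 2)"
   by (simp add: std_normal_density_def flip: exp_add)
     (simp add: power2_eq_square field_simps)
  then show "ennreal (std_normal_density (x - c)) * indicator A x
   = ennreal (std_normal_density x) * (ennreal (exp (x * c - c\<^sup>2 / 2)) * indicator A x)"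
   by (simp add: ennreal_mult normal_density_nonneg mult.assoc)
 qed
 also have "... = (\<integral>\<^sup>+x. ennreal (exp (x * c - c\<^sup>2 / 2)) * indicator A x \<partial>std_normal_distribution)"
  by (subst nn_integral_density) auto
 finally show ?thesis .
qed

lemma PiM_box_transform:
 fixes T :: "nat => real => real"
 shows "(%a. \<lambda>i\<in>{..<n}. T i (a i)) -` PiE {..<n} A \<inter> coord_space n = PiE {..<n} (%i. {x. T i x \<in> A i})"
 by (auto simp: coord_space_def PiE_def Pi_def extensional_def restrict_def)

text \<open>The Cameron--Martin formula, from its one-dimensional case on boxes.\<close>
lemma gs_translate:
 "distr (gs n) (gs n) (%a. \<lambda>i\<in>{..<n}. a i + c i)
  = density (gs n) (%a. ennreal (\<Prod>i<n. exp (a i * c i - (c i)\<^sup>2 / 2)))" (is "?L = ?R")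
proof -
 define N where "N = (%i. distr std_normal_distribution borel (%x. x + c i))"
 have pr: "prob_space (N i)" for i
  unfolding N_def by (intro prob_space.prob_space_distr prob_space_normal_density) auto
 interpret N: product_prob_space N UNIV
  by (intro product_prob_spaceI pr)
 interpret S: product_prob_space "%_::nat. std_normal_distribution" UNIV
  by (intro product_prob_spaceI prob_space_normal_density) auto
 have sN: "sets (PiM {..<n} N) = sets (PiM {..<n} (%_. borel))"
  by (rule sets_PiM_cong) (auto simp: N_def)
 have eN: "emeasure (N i) A = emeasure std_normal_distribution {x. x + c i \<in> A}" if "A \<in> sets borel" for i A
  using that by (simp add: N_def emeasure_distr vimage_def)
 have ms: "{x. x + d \<in> A} \<in> sets borel" if "A \<in> sets borel" for A and d :: real
  using measurable_sets[of "%x. x + d" borel borel A] that by (simp add: vimage_def)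
 have mT: "(%a. \<lambda>i\<in>{..<n}. a i + c i) \<in> measurable (gs n) (gs n)"
  unfolding gs_def by (intro measurable_restrict) measurable
 have "?L = PiM {..<n} N"
 proof (rule N.PiM_eqI)
  fix A assume A: "!!i. i \<in> {..<n} ==> A i \<in> sets (N i)"
  then have A': "!!i. i < n ==> A i \<in> sets borel" by (auto simp: N_def)
  have "PiE {..<n} A \<in> sets (gs n)"
   unfolding gs_def using A' by (intro sets_PiM_I_finite) auto
  then have "emeasure ?L (PiE {..<n} A) = emeasure (gs n) (PiE {..<n} (%i. {x. x + c i \<in> A i}))"
   using PiM_box_transform[where n=n and T="%i x. x + c i" and A=A] by (subst emeasure_distr[OF mT]) simp_all
  also have "... = (\<Prod>i<n. emeasure std_normal_distribution {x. x + c i \<in> A i})"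
   unfolding gs_def using A' ms by (subst S.emeasure_PiM) auto
  also have "... = (\<Prod>i<n. emeasure (N i) (A i))"
   using A' by (intro prod.cong) (auto simp: eN)
  finally show "emeasure ?L (PiE {..<n} A) = (\<Prod>i<n. emeasure (N i) (A i))" .
 qed (auto simp: sets_gs sN)
 moreover have "?R = PiM {..<n} N"
 proof (rule N.PiM_eqI)
  fix A assume A: "!!i. i \<in> {..<n} ==> A i \<in> sets (N i)"
  then have A': "!!i. i < n ==> A i \<in> sets borel" by (auto simp: N_def)
  have bx: "PiE {..<n} A \<in> sets (gs n)"
   unfolding gs_def using A' by (intro sets_PiM_I_finite) auto
  have meas: "(%a. ennreal (\<Prod>i<n. exp (a i * c i - (c i)\<^sup>2 / 2))) \<in> borel_measurable (gs n)"
   unfolding gs_def by measurable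
  have "emeasure ?R (PiE {..<n} A) = (\<integral>\<^sup>+a. ennreal (\<Prod>i<n. exp (a i * c i - (c i)\<^sup>2 / 2)) * indicator (PiE {..<n} A) a \<partial>gs n)"
   using bx meas by (subst emeasure_density) auto
  also have "... = (\<integral>\<^sup>+a. (\<Prod>i<n. ennreal (exp (a i * c i - (c i)\<^sup>2 / 2)) * indicator (A i) (a i)) \<partial>gs n)"
  proof (intro nn_integral_cong)
   fix a assume a: "a \<in> space (gs n)"
   then have "indicator (PiE {..<n} A) a = (\<Prod>i<n. indicator (A i) (a i) :: ennreal)"
    by (auto simp: coord_space_def PiE_def Pi_def indicator_def prod_zero_iff)
   then show "ennreal (\<Prod>i<n. exp (a i * c i - (c i)\<^sup>2 / 2)) * indicator (PiE {..<n} A) a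
    = (\<Prod>i<n. ennreal (exp (a i * c i - (c i)\<^sup>2 / 2)) * indicator (A i) (a i))"
    by (simp add: prod_ennreal prod.distrib)
  qed
  also have "... = (\<Prod>i<n. (\<integral>\<^sup>+x. ennreal (exp (x * c i - (c i)\<^sup>2 / 2)) * indicator (A i) x \<partial>std_normal_distribution))"
   unfolding gs_def using A'
   by (subst S.product_nn_integral_prod[where f="%i x. ennreal (exp (x * c i - (c i)\<^sup>2 / 2)) * indicator (A i) x"]) auto
  also have "... = (\<Prod>i<n. emeasure (N i) (A i))"
   using A' by (intro prod.cong) (auto simp: eN normal_shift)
  finally show "emeasure ?R (PiE {..<n} A) = (\<Prod>i<n. emeasure (N i) (A i))" .
 qed (auto simp: sets_gs sN)
 ultimately show ?thesis by simp
qed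

lemma normal_reflect: "A \<in> sets borel ==> emeasure std_normal_distribution {x. - x \<in> A} = emeasure std_normal_distribution A"
proof -
 assume [measurable]: "A \<in> sets borel"
 have m: "{x. - x \<in> A} \<in> sets borel"
  using measurable_sets[of "%x. - x" borel borel A] by (simp add: vimage_def)
 have "emeasure std_normal_distribution A
  = (\<integral>\<^sup>+x. ennreal (std_normal_density x) * indicator A x \<partial>lborel)"
  by (subst emeasure_density) auto
 also have "... = (\<integral>\<^sup>+x. ennreal (std_normal_density (- x)) * indicator A (- x) \<partial>lborel)"
  by (subst nn_integral_real_affine[where c="-1" and t=0]) auto
 also have "... = (\<integral>\<^sup>+x. ennreal (std_normal_density x) * indicator {x. - x \<in> A} x \<partial>lborel)"
  by (auto intro!: nn_integral_cong simp: std_normal_density_def split: split_indicator)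
 also have "... = emeasure std_normal_distribution {x. - x \<in> A}"
  using m by (subst emeasure_density) auto
 finally show ?thesis by simp
qed

lemma gs_reflect: "distr (gs n) (gs n) (%a. \<lambda>i\<in>{..<n}. - a i) = gs n" (is "?L = _")
proof -
 interpret S: product_prob_space "%_::nat. std_normal_distribution" UNIV
  by (intro product_prob_spaceI prob_space_normal_density) auto
 have ms: "{x. - x \<in> A} \<in> sets borel" if "A \<in> sets borel" for A :: "real set"
  using measurable_sets[of "%x. - x" borel borel A] that by (simp add: vimage_def)
 have mT: "(%a. \<lambda>i\<in>{..<n}. - a i) \<in> measurable (gs n) (gs n)"
  unfolding gs_def by (intro measurable_restrict) measurable
 have "?L = PiM {..<n} (%_. std_normal_distribution)"
 proof (rule S.PiM_eqI)
  fix A :: "nat => real set" assume A: "!!i. i \<in> {..<n} ==> A i \<in> sets std_normal_distribution"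
  then have A': "!!i. i < n ==> A i \<in> sets borel" by auto
  have "PiE {..<n} A \<in> sets (gs n)"
   unfolding gs_def using A' by (intro sets_PiM_I_finite) auto
  then have "emeasure ?L (PiE {..<n} A) = emeasure (gs n) (PiE {..<n} (%i. {x. - x \<in> A i}))"
   using PiM_box_transform[where n=n and T="%_ x. - x" and A=A] by (subst emeasure_distr[OF mT]) simp_all
  also have "... = (\<Prod>i<n. emeasure std_normal_distribution {x. - x \<in> A i})"
   unfolding gs_def using A' ms by (subst S.emeasure_PiM) auto
  also have "... = (\<Prod>i<n. emeasure std_normal_distribution (A i))"
   using A' by (intro prod.cong) (auto simp: normal_reflect)
  finally show "emeasure ?L (PiE {..<n} A) = (\<Prod>i<n. emeasure std_normal_distribution (A i))" .
 qed (auto simp: sets_gs sets_normal_PiM)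
 then show ?thesis unfolding gs_def .
qed

text \<open>By the Cameron--Martin formula the measure of the translate is the integral of $e^{\langle a,y\rangle-|y|^2/2}$ over $K$. Since $K$ is
symmetric, the first factor may be replaced by a hyperbolic cosine, which is at least 1.\<close>
lemma gs_shift_lower:
 assumes K: "cms n K" and sym: "!!x. x \<in> K ==> - x \<in> K" and y: "y \<in> Rn n"
 shows "measure (gs n) (cset n {x. x + y \<in> K}) >= exp (- (norm y)\<^sup>2 / 2) * measure (gs n) (cset n K)"
proof -
 interpret prob_space "gs n" by (rule prob_gs)
 have K': "cset n K \<in> sets (gs n)" using K by (simp add: cms_def sets_gs)
 define w where "w a = (\<Prod>i<n. exp (a i * cf y i - (cf y i)\<^sup>2 / 2))" for a
 define c where "c = exp (- (norm y)\<^sup>2 / 2)"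
 have ny: "(norm y)^2 = (\<Sum>i<n. (cf y i)^2)"
  using norm_cvec[of n "cf y"] cvec_cf[OF y] by simp
 have w_eq: "w a = c * exp (\<Sum>i<n. a i * cf y i)" for a
  by (simp add: w_def c_def ny exp_sum[symmetric] sum_subtractf sum_divide_distrib flip: exp_add)
 have mw: "(%a. ennreal (w a)) \<in> borel_measurable (gs n)"
  unfolding w_def gs_def by measurable
 have mT: "(%a. \<lambda>i\<in>{..<n}. a i + cf y i) \<in> measurable (gs n) (gs n)"
  unfolding gs_def by (intro measurable_restrict) measurable
 have mR: "(%a. \<lambda>i\<in>{..<n}. - a i) \<in> measurable (gs n) (gs n)"
  unfolding gs_def by (intro measurable_restrict) measurable
 have pre: "(%a. \<lambda>i\<in>{..<n}. a i + cf y i) -` cset n K \<inter> space (gs n) = cset n {x. x + y \<in> K}"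
 proof -
  have "cvec n (\<lambda>i\<in>{..<n}. a i + cf y i) = cvec n a + y" for a
   using cvec_add[of n a "cf y"] cvec_cf[OF y] by (simp add: cvec_cong[of n "\<lambda>i\<in>{..<n}. a i + cf y i" "%i. a i + cf y i"])
  then show ?thesis by (auto simp: cset_def coord_space_def)
 qed
 have e1: "emeasure (gs n) (cset n {x. x + y \<in> K}) = (\<integral>\<^sup>+a. ennreal (w a) * indicator (cset n K) a \<partial>gs n)"
  using arg_cong[OF gs_translate[of n "cf y"], of "%M. emeasure M (cset n K)"] K' mw
  by (simp add: emeasure_distr[OF mT K'] pre[simplified] emeasure_density w_def)
 have "(\<integral>\<^sup>+a. ennreal (w a) * indicator (cset n K) a \<partial>gs n)
   = (\<integral>\<^sup>+a. ennreal (w a) * indicator (cset n K) a \<partial>distr (gs n) (gs n) (%a. \<lambda>i\<in>{..<n}. - a i))"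
  by (simp add: gs_reflect)
 also have "... = (\<integral>\<^sup>+a. ennreal (w (\<lambda>i\<in>{..<n}. - a i)) * indicator (cset n K) (\<lambda>i\<in>{..<n}. - a i) \<partial>gs n)"
  using mw K' by (subst nn_integral_distr[OF mR]) auto
 also have "... = (\<integral>\<^sup>+a. ennreal (c * exp (- (\<Sum>i<n. a i * cf y i))) * indicator (cset n K) a \<partial>gs n)"
 proof (intro nn_integral_cong)
  fix a assume a: "a \<in> space (gs n)"
  have "cvec n (\<lambda>i\<in>{..<n}. - a i) = - cvec n a"
   by (simp add: cvec_minus cvec_cong[of n "\<lambda>i\<in>{..<n}. - a i" "%i. - a i"])
  then have "(\<lambda>i\<in>{..<n}. - a i) \<in> cset n K \<longleftrightarrow> a \<in> cset n K"
   using sym[of "cvec n a"] sym[of "- cvec n a"] a by (auto simp: cset_def coord_space_def)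
  moreover have "w (\<lambda>i\<in>{..<n}. - a i) = c * exp (- (\<Sum>i<n. a i * cf y i))"
   by (simp add: w_eq sum_negf)
  ultimately show "ennreal (w (\<lambda>i\<in>{..<n}. - a i)) * indicator (cset n K) (\<lambda>i\<in>{..<n}. - a i)
   = ennreal (c * exp (- (\<Sum>i<n. a i * cf y i))) * indicator (cset n K) a"
   by (simp add: indicator_def)
 qed
 finally have e2: "emeasure (gs n) (cset n {x. x + y \<in> K}) = ..." using e1 by simp
 have mw': "(%a. ennreal (c * exp (- (\<Sum>i<n. a i * cf y i)))) \<in> borel_measurable (gs n)"
  unfolding gs_def by measurable
 have c0: "c > 0" by (simp add: c_def)
 have ex: "2 <= exp s + exp (- s)" for s :: real
  using exp_ge_add_one_self[of s] exp_ge_add_one_self[of "- s"] by linarith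
 have "ennreal (2 * c) * emeasure (gs n) (cset n K) = (\<integral>\<^sup>+a. ennreal (2 * c) * indicator (cset n K) a \<partial>gs n)"
  using K' by (subst nn_integral_cmult_indicator) auto
 also have "... <= (\<integral>\<^sup>+a. ennreal (w a) * indicator (cset n K) a + ennreal (c * exp (- (\<Sum>i<n. a i * cf y i))) * indicator (cset n K) a \<partial>gs n)"
  using c0 mult_left_mono[OF ex, of c]
  by (intro nn_integral_mono)
    (auto simp: w_eq distrib_left mult.commute ennreal_plus[symmetric] simp del: ennreal_plus split: split_indicator intro!: ennreal_leI)
 also have "... = emeasure (gs n) (cset n {x. x + y \<in> K}) + emeasure (gs n) (cset n {x. x + y \<in> K})"
  using K' mw mw' by (subst nn_integral_add) (auto simp: e1[symmetric] e2[symmetric])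
 finally have "2 * c * measure (gs n) (cset n K) <= 2 * measure (gs n) (cset n {x. x + y \<in> K})"
  using c0 by (simp add: emeasure_eq_measure flip: ennreal_mult ennreal_plus)
 then show ?thesis by (simp add: c_def)
qed

lemma gs_coord_moment:
 "integrable (gs n) (%a. a i * a j)"
 "i < n ==> j < n ==> (\<integral>a. a i * a j \<partial>gs n) = (if i = j then 1 else 0)" if "i < n" "j < n" for i j
proof -
 interpret S: product_prob_space "%_::nat. std_normal_distribution" UNIV
  by (intro product_prob_spaceI prob_space_normal_density) auto
 have pr: "prob_space std_normal_distribution" by (rule prob_space_normal_density) simp
 define f where "f k x = (if k = i then x else 1) * (if k = j then x else 1 :: real)" for k :: nat and x :: real
 have i1: "integrable std_normal_distribution (%x. x)" and v1: "(\<integral>x. x \<partial>std_normal_distribution) = 0"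
  using integrable_std_normal_distribution_moment[of 1] integral_std_normal_distribution_moment_odd[of 1] by simp_all
 have i2: "integrable std_normal_distribution (%x. x * x)" and v2: "(\<integral>x. x * x \<partial>std_normal_distribution) = 1"
  using integrable_std_normal_distribution_moment[of 2] std_normal_distribution_even_moments(1)[of 1]
  by (simp_all add: power2_eq_square fact_numeral)
 have v0: "(\<integral>x. 1 \<partial>std_normal_distribution) = (1::real)"
  using prob_space.prob_space[OF pr] by simp
 have f_cases: "f k = (if k = i \<and> k = j then (%x. x * x) else if k = i \<or> k = j then (%x. x) else (%x. 1))" for k
  by (auto simp: f_def fun_eq_iff)
 have int: "integrable std_normal_distribution (f k)" for k
  using i1 i2 finite_measure.integrable_const[OF prob_space.finite_measure[OF pr], of "1::real"] by (simp only: f_cases split: if_split) blast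
 have val: "(\<integral>x. f k x \<partial>std_normal_distribution) = (if k = i \<and> k ~= j \<or> k = j \<and> k ~= i then 0 else 1)" for k
  using v0 v1 v2 by (simp only: f_cases split: if_split) blast
 have pf: "(\<Prod>k<n. f k (a k)) = a i * a j" for a
  using that by (simp add: f_def prod.distrib prod.delta)
 show "integrable (gs n) (%a. a i * a j)"
  using S.product_integrable_prod[of "{..<n}" f] int unfolding gs_def by (simp add: pf)
 show "(\<integral>a. a i * a j \<partial>gs n) = (if i = j then 1 else 0)"
 proof -
  have "(\<integral>a. a i * a j \<partial>gs n) = (\<Prod>k<n. \<integral>x. f k x \<partial>std_normal_distribution)"
   using S.product_integral_prod[of "{..<n}" f] int unfolding gs_def by (simp add: pf)
  also have "... = (if i = j then 1 else 0)"
   using that by (auto simp: val intro!: prod_zero)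
  finally show ?thesis .
 qed
qed

lemma gs_inner_moment:
 shows "integrable (gs n) (%a. (cvec n a \<bullet> x) * (cvec n a \<bullet> y))"
  and "(\<integral>a. (cvec n a \<bullet> x) * (cvec n a \<bullet> y) \<partial>gs n) = (\<Sum>i<n. cf x i * cf y i)"
proof -
 have eq: "(cvec n a \<bullet> x) * (cvec n a \<bullet> y) = (\<Sum>i<n. \<Sum>j<n. (cf x i * cf y j) * (a i * a j))" for a
  by (simp add: inner_cvec sum_product mult_ac)
 show "integrable (gs n) (%a. (cvec n a \<bullet> x) * (cvec n a \<bullet> y))"
  unfolding eq by (intro Bochner_Integration.integrable_sum integrable_mult_right gs_coord_moment) auto
 show "(\<integral>a. (cvec n a \<bullet> x) * (cvec n a \<bullet> y) \<partial>gs n) = (\<Sum>i<n. cf x i * cf y i)"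
 proof -
  have "(\<integral>a. (cvec n a \<bullet> x) * (cvec n a \<bullet> y) \<partial>gs n)
   = (\<Sum>i<n. \<integral>a. (\<Sum>j<n. (cf x i * cf y j) * (a i * a j)) \<partial>gs n)"
   unfolding eq
   by (intro Bochner_Integration.integral_sum Bochner_Integration.integrable_sum integrable_mult_right gs_coord_moment) auto
  also have "... = (\<Sum>i<n. \<Sum>j<n. \<integral>a. (cf x i * cf y j) * (a i * a j) \<partial>gs n)"
   by (intro sum.cong refl Bochner_Integration.integral_sum integrable_mult_right gs_coord_moment) auto
  also have "... = (\<Sum>i<n. \<Sum>j<n. (cf x i * cf y j) * (if i = j then 1 else 0))"
   by (intro sum.cong refl) (simp add: gs_coord_moment)
  also have "... = (\<Sum>i<n. cf x i * cf y i)"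
   by (simp add: if_distrib[of "%x. _ * x"] cong: if_cong)
  finally show ?thesis .
 qed
qed

lemma gs_norm_integrable: "gsquare n norm"
 unfolding norm_cvec unfolding power2_eq_square by (intro Bochner_Integration.integrable_sum gs_coord_moment) auto

definition cvol :: "nat => fsvec set => real" where
 "cvol n K = vol n (cset n K)"

lemma lborel_PiM_affine:
 fixes t :: real
 assumes t: "t > 0" and B: "B \<in> sets (PiM {..<n} (%_. borel))"
 shows "emeasure (PiM {..<n} (%_. lborel)) B
  = ennreal (t ^ n) * emeasure (PiM {..<n} (%_. lborel)) ((%a. \<lambda>i\<in>{..<n}. c i + t * a i) -` B \<inter> coord_space n)"
proof -
 let ?L = "PiM {..<n} (%_. lborel :: real measure)"
 let ?T = "%a. \<lambda>i\<in>{..<n}. c i + t * a i"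
 interpret S: product_sigma_finite "%_::nat. lborel :: real measure" ..
 have mT: "?T \<in> measurable ?L ?L"
  by (intro measurable_restrict) measurable
 have ms: "{x. d + t * x \<in> A} \<in> sets borel" if "A \<in> sets borel" for A and d :: real
  using measurable_sets[of "%x. d + t * x" borel borel A] that by (simp add: vimage_def)
 have one: "ennreal t * emeasure lborel {x. d + t * x \<in> A} = emeasure lborel A" if A[measurable]: "A \<in> sets borel" for A and d :: real
 proof -
  have "emeasure lborel A = (\<integral>\<^sup>+x. indicator A x \<partial>lborel)" by simp
  also have "... = ennreal \<bar>t\<bar> * (\<integral>\<^sup>+x. indicator A (d + t * x) \<partial>lborel)"
   using t by (intro nn_integral_real_affine) auto
  also have "(\<integral>\<^sup>+x. indicator A (d + t * x) \<partial>lborel) = (\<integral>\<^sup>+x. indicator {x. d + t * x \<in> A} x \<partial>lborel)"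
   by (intro nn_integral_cong) (auto split: split_indicator)
  also have "... = emeasure lborel {x. d + t * x \<in> A}" using ms[OF A] by simp
  finally show ?thesis using t by simp
 qed
 have "density (distr ?L ?L ?T) (%_. ennreal (t ^ n)) = ?L"
 proof (rule S.PiM_eqI)
  fix A :: "nat => real set" assume A: "!!i. i \<in> {..<n} ==> A i \<in> sets lborel"
  then have A': "!!i. i < n ==> A i \<in> sets borel" by auto
  have bx: "PiE {..<n} A \<in> sets ?L"
   using A by (intro sets_PiM_I_finite) auto
  have "emeasure (density (distr ?L ?L ?T) (%_. ennreal (t ^ n))) (PiE {..<n} A)
   = ennreal (t ^ n) * emeasure (distr ?L ?L ?T) (PiE {..<n} A)"
   using bx by (subst emeasure_density_const) auto
  also have "emeasure (distr ?L ?L ?T) (PiE {..<n} A) = emeasure ?L (PiE {..<n} (%i. {x. c i + t * x \<in> A i}))"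
   using PiM_box_transform[where n=n and T="%i x. c i + t * x" and A=A] bx by (subst emeasure_distr[OF mT]) simp_all
  also have "... = (\<Prod>i<n. emeasure lborel {x. c i + t * x \<in> A i})"
   using A' ms by (subst S.emeasure_PiM) auto
  also have "ennreal (t ^ n) * ... = (\<Prod>i<n. ennreal t * emeasure lborel {x. c i + t * x \<in> A i})"
   using t by (simp add: prod.distrib ennreal_power)
  also have "... = (\<Prod>i<n. emeasure lborel (A i))"
   using A' by (intro prod.cong) (auto simp: one)
  finally show "emeasure (density (distr ?L ?L ?T) (%_. ennreal (t ^ n))) (PiE {..<n} A) = (\<Prod>i<n. emeasure lborel (A i))" .
 qed auto
 then have "emeasure ?L B = emeasure (density (distr ?L ?L ?T) (%_. ennreal (t ^ n))) B" by simp
 also have "... = ennreal (t ^ n) * emeasure (distr ?L ?L ?T) B"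
  using B by (subst emeasure_density_const) (auto simp: sets_lborel_PiM)
 also have "emeasure (distr ?L ?L ?T) B = emeasure ?L (?T -` B \<inter> coord_space n)"
  using B by (subst emeasure_distr[OF mT]) (simp_all add: sets_lborel_PiM)
 finally show ?thesis .
qed

lemma cset_affine:
 assumes "y \<in> Rn n"
 shows "(%a. \<lambda>i\<in>{..<n}. cf y i + t * a i) -` cset n K \<inter> coord_space n = cset n {x. y + t *\<^sub>R x \<in> K}"
proof -
 have "cvec n (\<lambda>i\<in>{..<n}. cf y i + t * a i) = y + t *\<^sub>R cvec n a" for a
 proof -
  have "cvec n (\<lambda>i\<in>{..<n}. cf y i + t * a i) = cvec n (%i. cf y i + t * a i)"
   by (rule cvec_cong) simp
  also have "... = y + t *\<^sub>R cvec n a"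
   using cvec_cf[OF assms] by (simp add: cvec_scaleR cvec_add[symmetric])
  finally show ?thesis .
 qed
 then show ?thesis by (auto simp: cset_def coord_space_def)
qed

lemma cms_affine:
 assumes "cms n K" "y \<in> Rn n"
 shows "cms n {x. y + t *\<^sub>R x \<in> K}"
proof -
 have "(%a. \<lambda>i\<in>{..<n}. cf y i + t * a i) \<in> measurable (PiM {..<n} (%_. borel)) (PiM {..<n} (%_. borel))"
  by (intro measurable_restrict) measurable
 from measurable_sets[OF this, of "cset n K"] show ?thesis
  using assms cset_affine[OF assms(2), of t K] by (simp add: cms_def)
qed

lemma cvol_affine:
 assumes K: "cms n K" and y: "y \<in> Rn n" and t: "t > 0"
 shows "cvol n K = t ^ n * cvol n {x. y + t *\<^sub>R x \<in> K}"
 using lborel_PiM_affine[OF t, of "cset n K" n "cf y"] K t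
 unfolding cvol_def vol_def measure_def cset_affine[OF y] cms_def
 by (simp add: enn2real_mult)

lemma cvol_scale:
 assumes K: "cms n K" and y: "y \<in> Rn n" and t: "t > 0"
 shows "cms n {x. (1 / t) *\<^sub>R (x - y) \<in> K}"
  and "cvol n {x. (1 / t) *\<^sub>R (x - y) \<in> K} = t ^ n * cvol n K"
proof -
 let ?K = "{x. (1 / t) *\<^sub>R (x - y) \<in> K}"
 have eq: "?K = {x. - (1 / t) *\<^sub>R y + (1 / t) *\<^sub>R x \<in> K}"
  by (simp add: scaleR_diff_right)
 show m: "cms n ?K" unfolding eq using K y by (intro cms_affine) auto
 have "{x. y + t *\<^sub>R x \<in> ?K} = K" using t by auto
 then show "cvol n ?K = t ^ n * cvol n K" using cvol_affine[OF m y t] by simp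
qed

lemma cset_bounded_finite:
 assumes "bounded K"
 shows "emeasure (PiM {..<n} (%_. lborel)) (cset n K) < \<infinity>"
proof -
 interpret S: product_sigma_finite "%_::nat. lborel :: real measure" ..
 obtain R where R: "!!x. x \<in> K ==> norm x <= R" "R > 0"
  using assms bounded_pos by metis
 have sub: "cset n K <= PiE {..<n} (%_. {-R..R})"
 proof
  fix a assume a: "a \<in> cset n K"
  then have "\<bar>a i\<bar> <= R" if "i < n" for i
   using abs_cf_le_norm[of "cvec n a" i] R(1)[of "cvec n a"] that by (auto simp: cset_def cf_cvec)
  then show "a \<in> PiE {..<n} (%_. {-R..R})"
   using a by (auto simp: cset_def coord_space_def PiE_def abs_le_iff minus_le_iff)
 qed
 have "emeasure (PiM {..<n} (%_. lborel)) (cset n K) <= emeasure (PiM {..<n} (%_. lborel)) (PiE {..<n} (%_. {-R..R}))"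
  by (rule emeasure_mono[OF sub]) (auto intro!: sets_PiM_I_finite)
 also have "... = (\<Prod>i<n. emeasure lborel {-R..R})"
  by (subst S.emeasure_PiM) auto
 also have "... < \<infinity>" using R by (simp add: ennreal_power[symmetric] power_less_top_ennreal)
 finally show ?thesis .
qed

lemma cset_fmeasurable:
 "cms n K ==> bounded K ==> cset n K \<in> fmeasurable (PiM {..<n} (%_. lborel))"
 using cset_bounded_finite[of K n] by (auto simp: fmeasurable_def cms_def sets_lborel_PiM)

lemma cvol_mono:
 assumes "cms n K'" "bounded K'" "!!x. x \<in> Rn n ==> x \<in> K ==> x \<in> K'"
 shows "cvol n K <= cvol n K'"
proof (cases "cset n K \<in> sets (PiM {..<n} (%_. lborel))")
 case True
 then show ?thesis
  unfolding cvol_def vol_def using cset_fmeasurable[OF assms(1,2)] assms(3)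
  by (intro measure_mono_fmeasurable) (auto simp: cset_def)
next
 case False
 then show ?thesis
  unfolding cvol_def vol_def by (simp add: measure_notin_sets)
qed

lemma cvol_nonneg [simp]: "cvol n K >= 0"
 by (simp add: cvol_def vol_def)

lemma cms_UN: "finite I ==> (!!i. i \<in> I ==> cms n (K i)) ==> cms n (\<Union>i\<in>I. K i)"
proof -
 have "cset n (\<Union>i\<in>I. K i) = (\<Union>i\<in>I. cset n (K i))" by (auto simp: cset_def)
 then show "finite I ==> (!!i. i \<in> I ==> cms n (K i)) ==> cms n (\<Union>i\<in>I. K i)"
  by (auto simp: cms_def intro!: sets.finite_UN)
qed

lemma cvol_UN_le:
 assumes "finite I" "!!i. i \<in> I ==> cms n (K i)" "!!i. i \<in> I ==> bounded (K i)"
  and "!!x. x \<in> Rn n ==> x \<in> S ==> \<exists>i\<in>I. x \<in> K i"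
 shows "cvol n S <= (\<Sum>i\<in>I. cvol n (K i))"
proof -
 have eq: "cset n (\<Union>i\<in>I. K i) = (\<Union>i\<in>I. cset n (K i))" by (auto simp: cset_def)
 have "cvol n S <= cvol n (\<Union>i\<in>I. K i)"
  using assms by (intro cvol_mono cms_UN bounded_UN) auto
 also have "... <= (\<Sum>i\<in>I. cvol n (K i))"
  unfolding cvol_def vol_def eq using assms
  by (intro measure_UNION_le) (auto simp: cms_def sets_lborel_PiM)
 finally show ?thesis .
qed

lemma cvol_UN_disjoint:
 assumes "finite I" "!!i. i \<in> I ==> cms n (K i)" "!!i. i \<in> I ==> bounded (K i)"
  and "!!i j. i \<in> I ==> j \<in> I ==> i ~= j ==> K i \<inter> K j = {}"
  and S: "cms n S" "bounded S" "!!i. i \<in> I ==> K i <= S"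
 shows "(\<Sum>i\<in>I. cvol n (K i)) <= cvol n S"
proof -
 have eq: "cset n (\<Union>i\<in>I. K i) = (\<Union>i\<in>I. cset n (K i))" by (auto simp: cset_def)
 have "(\<Sum>i\<in>I. cvol n (K i)) = cvol n (\<Union>i\<in>I. K i)"
  unfolding cvol_def vol_def eq
 proof (rule measure_finite_Union[symmetric])
  show "disjoint_family_on (%i. cset n (K i)) I"
   unfolding disjoint_family_on_def
  proof (intro ballI impI)
   fix i j assume "i \<in> I" "j \<in> I" "i ~= j"
   from assms(4)[OF this] show "cset n (K i) \<inter> cset n (K j) = {}"
    by (auto simp: cset_def)
  qed
  show "(%i. cset n (K i)) ` I <= sets (PiM {..<n} (%_. lborel))"
   using assms(2) by (auto simp: cms_def sets_lborel_PiM)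
  show "emeasure (PiM {..<n} (%_. lborel)) (cset n (K i)) ~= \<infinity>" if "i \<in> I" for i
   using cset_bounded_finite[OF assms(3)[OF that], of n] by simp
 qed fact
 also have "... <= cvol n S"
  using S by (intro cvol_mono) auto
 finally show ?thesis .
qed

lemma norm_cvec_le: "norm (cvec n a) <= (\<Sum>i<n. \<bar>a i\<bar>)"
proof -
 have "norm (ax i) = 1" for i
  by (simp add: norm_eq_sqrt_inner cf_ax)
 then show ?thesis
  unfolding cvec_def by (intro order_trans[OF norm_sum]) simp
qed

lemma cms_ball: "cms n {x. norm x < r}" "cms n {x. norm x <= r}"
 by (intro cms_le continuous_intros)+

lemma bounded_norm_ball: "bounded {x::'a::real_normed_vector. norm x < r}" "bounded {x::'a. norm x <= r}"
 by (auto intro!: boundedI[of _ r])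

lemma cvol_ball_pos:
 assumes r: "r > 0"
 shows "cvol n {x. norm x < r} > 0"
proof -
 interpret S: product_sigma_finite "%_::nat. lborel :: real measure" ..
 define s where "s = r / (real n + 1)"
 have s: "s > 0" using r by (simp add: s_def)
 let ?L = "PiM {..<n} (%_. lborel :: real measure)"
 have sub: "PiE {..<n} (%_. {-s..s}) <= cset n {x. norm x < r}"
 proof
  fix a assume a: "a \<in> PiE {..<n} (%_. {-s..s})"
  have "(\<Sum>i<n. \<bar>a i\<bar>) <= (\<Sum>i<n. s)" using a by (intro sum_mono) (auto simp: PiE_def Pi_def abs_le_iff minus_le_iff)
  also have "... < r" using r by (simp add: s_def field_simps)
  finally show "a \<in> cset n {x. norm x < r}"
   using a norm_cvec_le[of n a] by (auto simp: cset_def coord_space_def PiE_def)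
 qed
 have e: "emeasure ?L (PiE {..<n} (%_. {-s..s})) = (\<Prod>i<n. ennreal (2 * s))"
  using s by (subst S.emeasure_PiM) auto
 have m: "cset n {x. norm x < r} \<in> fmeasurable ?L"
  by (intro cset_fmeasurable cms_ball bounded_norm_ball)
 have "0 < (2 * s) ^ n" using s by simp
 also have "(2 * s) ^ n = measure ?L (PiE {..<n} (%_. {-s..s}))"
  using s by (simp add: measure_def e ennreal_power del: ennreal_mult'' )
 also have "... <= measure ?L (cset n {x. norm x < r})"
  using sub m by (intro measure_mono_fmeasurable) (auto intro!: sets_PiM_I_finite)
 finally show ?thesis by (simp add: cvol_def vol_def)
qed

text \<open>Balls of radius $\rho/2$ around the points of $Z$ are disjoint and lie in a ball of radius $r+\rho/2$; compare volumes.\<close>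
lemma packing_Rn:
 assumes Z: "finite Z" "Z <= Rn k" "!!z. z \<in> Z ==> norm z <= r"
  and sep: "!!z z'. z \<in> Z ==> z' \<in> Z ==> z ~= z' ==> norm (z - z') >= rho" and rho: "rho > 0" and r: "r >= 0"
 shows "real (card Z) <= (1 + 2 * r / rho) ^ k"
proof -
 let ?B = "{x::fsvec. norm x < 1}"
 define U where "U z = {x. (1 / (rho / 2)) *\<^sub>R (x - z) \<in> ?B}" for z
 define S where "S = {x. (1 / (r + rho / 2)) *\<^sub>R (x - 0) \<in> ?B}"
 have sc: "norm ((1 / t) *\<^sub>R v) < 1 \<longleftrightarrow> norm v < t" if "t > 0" for t and v :: fsvec
  using that by (simp add: field_simps)
 have U_eq: "U z = {x. norm (x - z) < rho / 2}" for z
  unfolding U_def mem_Collect_eq using rho by (subst sc) auto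
 have S_eq: "S = {x. norm x < r + rho / 2}"
  unfolding S_def mem_Collect_eq using rho r by (subst sc) auto
 have volU: "cms k (U z)" "cvol k (U z) = (rho / 2) ^ k * cvol k ?B" if "z \<in> Z" for z
  unfolding U_def using cvol_scale[OF cms_ball(1), of z k "rho / 2" 1] Z(2) that rho by auto
 have volS: "cms k S" "cvol k S = (r + rho / 2) ^ k * cvol k ?B"
  unfolding S_def using cvol_scale[OF cms_ball(1), of 0 k "r + rho / 2" 1] rho r by auto
 have "(\<Sum>z\<in>Z. cvol k (U z)) <= cvol k S"
 proof (rule cvol_UN_disjoint)
  show "bounded (U z)" for z
  proof (rule boundedI)
   fix x assume "x \<in> U z"
   then show "norm x <= rho / 2 + norm z"
    using norm_triangle_sub[of x z] by (simp add: U_eq)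
  qed
  show "bounded S" unfolding S_eq by (rule bounded_norm_ball)
  show "U z \<inter> U z' = {}" if "z \<in> Z" "z' \<in> Z" "z ~= z'" for z z'
  proof (rule ccontr)
   assume "U z \<inter> U z' ~= {}"
   then obtain x where "norm (x - z) < rho / 2" "norm (x - z') < rho / 2" by (auto simp: U_eq)
   then have "norm (z - z') < rho"
    using norm_triangle_ineq4[of "x - z'" "x - z"] by simp
   then show False using sep[OF that] by simp
  qed
  show "U z <= S" if "z \<in> Z" for z
  proof
   fix x assume "x \<in> U z"
   then show "x \<in> S" using Z(3)[OF that] norm_triangle_sub[of x z] by (simp add: U_eq S_eq)
  qed
 qed (use Z volU volS in auto)
 then have "real (card Z) * (rho / 2) ^ k * cvol k ?B <= (r + rho / 2) ^ k * cvol k ?B"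
  using volS(2) sum.cong[OF refl volU(2), of Z] by (simp only: sum_constant mult.assoc refl)
 then have "real (card Z) * (rho / 2) ^ k <= (r + rho / 2) ^ k"
  using cvol_ball_pos[of 1 k] by (metis mult_le_cancel_right_pos zero_less_one)
 then have "real (card Z) <= (r + rho / 2) ^ k / (rho / 2) ^ k"
  using rho by (simp add: pos_le_divide_eq)
 also have "... = ((r + rho / 2) / (rho / 2)) ^ k" by (rule power_divide[symmetric])
 also have "(r + rho / 2) / (rho / 2) = 1 + 2 * r / rho"
  using rho by (simp add: field_simps)
 finally show ?thesis .
qed

section \<open>Orthonormal systems\<close>

definition orthon :: "(nat => 'a::real_inner) => nat => bool" where
 "orthon q m \<longleftrightarrow> (\<forall>i<m. \<forall>j<m. q i \<bullet> q j = (if i = j then 1 else 0))"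

definition proj :: "(nat => 'a::real_inner) => nat => 'a => 'a" where
 "proj q m x = (\<Sum>l<m. (x \<bullet> q l) *\<^sub>R q l)"

lemma linear_proj: "linear (proj q m)"
 by (rule linearI) (simp_all add: proj_def inner_add_left scaleR_left_distrib sum.distrib scaleR_right.sum)

lemma proj_in_span: "proj q m x \<in> span (q ` {..<m})"
 unfolding proj_def by (intro span_sum span_scale span_base) auto

lemma proj_inner:
 assumes "orthon q m" "l < m"
 shows "proj q m x \<bullet> q l = x \<bullet> q l"
proof -
 have "proj q m x \<bullet> q l = (\<Sum>j<m. (x \<bullet> q j) * (if j = l then 1 else 0))"
  unfolding proj_def inner_sum_left using assms by (intro sum.cong) (auto simp: orthon_def)
 then show ?thesis using assms by (simp add: if_distrib[of "%x. _ * x"] cong: if_cong)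
qed

lemma proj_orth:
 assumes "orthon q m" "y \<in> span (q ` {..<m})"
 shows "(x - proj q m x) \<bullet> y = 0"
 using assms(2)
proof (induction rule: span_induct_alt)
 case (step c z y)
 then show ?case using proj_inner[OF assms(1)] by (auto simp: inner_add_right inner_diff_left)
qed simp

lemma proj_id:
 assumes "orthon q m" "y \<in> span (q ` {..<m})"
 shows "proj q m y = y"
proof -
 have "y - proj q m y \<in> span (q ` {..<m})" using assms(2) proj_in_span by (rule span_diff)
 then have "(y - proj q m y) \<bullet> (y - proj q m y) = 0" by (rule proj_orth[OF assms(1)])
 then show ?thesis by simp
qed

lemma proj_pythagoras:
 assumes "orthon q m"
 shows "(norm x)^2 = (norm (proj q m x))^2 + (norm (x - proj q m x))^2"
proof -
 have "(x - proj q m x) \<bullet> proj q m x = 0" by (rule proj_orth[OF assms proj_in_span])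
 then show ?thesis by (simp add: power2_norm_eq_inner inner_diff_left inner_diff_right inner_commute)
qed

lemma norm_proj_sq:
 assumes "orthon q m"
 shows "(norm (proj q m x))^2 = (\<Sum>l<m. (x \<bullet> q l)^2)"
proof -
 have "proj q m x \<bullet> proj q m x = (\<Sum>l<m. (x \<bullet> q l) * (q l \<bullet> proj q m x))"
  by (subst (1) proj_def) (simp add: inner_sum_left)
 also have "... = (\<Sum>l<m. (x \<bullet> q l)^2)"
  using proj_inner[OF assms, of _ x] by (intro sum.cong) (auto simp: inner_commute power2_eq_square)
 finally show ?thesis by (simp add: power2_norm_eq_inner)
qed

lemma norm_proj_le: "orthon q m ==> norm (proj q m x) <= norm x"
 using proj_pythagoras[of q m x] by (simp add: power2_le_imp_le)

lemma norm_proj_compl_le: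
 assumes "orthon q m" "y \<in> span (q ` {..<m})"
 shows "norm (x - proj q m x) <= norm (x - y)"
proof -
 have "proj q m (x - y) = proj q m x - y"
  using proj_id[OF assms] linear_diff[OF linear_proj, of q m x y] by simp
 then have "x - proj q m x = (x - y) - proj q m (x - y)" by (simp only:) simp
 also have "norm ... <= norm (x - y)"
  using proj_pythagoras[OF assms(1), of "x - y"] by (simp add: power2_le_imp_le del: diff_diff_eq)
 finally show ?thesis .
qed

lemma gram_schmidt:
 fixes y :: "nat => 'a::real_inner"
 shows "\<exists>q m. m <= k \<and> orthon q m \<and> span (q ` {..<m}) = span (y ` {..<k})"
proof (induction k)
 case 0
 then show ?case by (intro exI[of _ "%_. 0"] exI[of _ 0]) (auto simp: orthon_def)
next
 case (Suc k)
 then obtain q m where q: "m <= k" "orthon q m" "span (q ` {..<m}) = span (y ` {..<k})" by blast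
 have yS: "y ` {..<Suc k} = insert (y k) (y ` {..<k})" by (auto simp: lessThan_Suc)
 define z where "z = y k - proj q m (y k)"
 show ?case
 proof (cases "z = 0")
  case True
  then have "y k \<in> span (y ` {..<k})" using proj_in_span[of q m "y k"] q(3) by (simp add: z_def)
  then have "span (y ` {..<Suc k}) = span (y ` {..<k})" unfolding yS by (rule span_redundant)
  then show ?thesis using q by (intro exI[of _ q] exI[of _ m]) auto
 next
  case False
  define q' where "q' = q(m := sgn z)"
  have zq: "z \<bullet> q l = 0" if "l < m" for l
   unfolding z_def using that by (intro proj_orth[OF q(2)] span_base) auto
  have sg: "sgn z \<bullet> sgn z = 1" using False by (simp add: dot_square_norm norm_sgn)
  have sq: "sgn z \<bullet> q l = 0" if "l < m" for l using zq[OF that] by (simp add: sgn_div_norm)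
  have "orthon q' (Suc m)"
   unfolding orthon_def
  proof (intro allI impI)
   fix i j assume "i < Suc m" "j < Suc m"
   then show "q' i \<bullet> q' j = (if i = j then 1 else 0)"
    using q(2) sg sq sq[THEN trans[OF inner_commute]]
    by (auto simp: q'_def orthon_def less_Suc_eq)
  qed
  moreover have "span (q' ` {..<Suc m}) = span (y ` {..<Suc k})"
  proof -
   have q'S: "q' ` {..<Suc m} = insert (sgn z) (q ` {..<m})"
    by (auto simp: q'_def lessThan_Suc)
   have "span (insert (sgn z) (q ` {..<m})) = span (insert (y k) (q ` {..<m}))"
   proof (rule span_eq[THEN iffD2], intro conjI subsetI)
    fix x assume "x \<in> insert (sgn z) (q ` {..<m})"
    moreover have "z \<in> span (insert (y k) (q ` {..<m}))"
     unfolding z_def using proj_in_span[of q m "y k"] span_mono[of "q ` {..<m}" "insert (y k) (q ` {..<m})"]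
     by (intro span_diff) (auto intro: span_base)
    ultimately show "x \<in> span (insert (y k) (q ` {..<m}))"
     by (auto simp: sgn_div_norm intro: span_scale span_base)
   next
    fix x assume "x \<in> insert (y k) (q ` {..<m})"
    moreover have "y k = norm z *\<^sub>R sgn z + proj q m (y k)"
     using False by (simp add: sgn_div_norm z_def)
    then have "y k \<in> span (insert (sgn z) (q ` {..<m}))"
     using proj_in_span[of q m "y k"] span_mono[of "q ` {..<m}" "insert (sgn z) (q ` {..<m})"]
     by (metis (no_types, lifting) insertI1 span_add span_base span_scale subsetD subset_insertI)
    ultimately show "x \<in> span (insert (sgn z) (q ` {..<m}))" by (auto intro: span_base)
   qed
   also have "... = span (insert (y k) (y ` {..<k}))"
    using q(3) by (simp add: span_insert)
   finally show ?thesis by (simp add: q'S yS)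
  qed
  ultimately show ?thesis using q(1) by (intro exI[of _ q'] exI[of _ "Suc m"]) auto
 qed
qed

text \<open>An orthonormal basis of the span carries the points to $\mathbb R^m$ with $m \le k$.\<close>
lemma packing_span:
 fixes y :: "nat => 'a::real_inner"
 assumes Z: "finite Z" "Z <= span (y ` {..<k})" "!!z. z \<in> Z ==> norm z <= r"
  and sep: "!!z z'. z \<in> Z ==> z' \<in> Z ==> z ~= z' ==> norm (z - z') >= rho" and rho: "rho > 0" and r: "r >= 0"
 shows "real (card Z) <= (1 + 2 * r / rho) ^ k"
proof -
 obtain q m where q: "m <= k" "orthon q m" "span (q ` {..<m}) = span (y ` {..<k})"
  using gram_schmidt[of k y] by blast
 define phi where "phi z = cvec m (%l. z \<bullet> q l)" for z
 have nrm: "norm (phi z) = norm z" if "z \<in> span (y ` {..<k})" for z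
 proof -
  have "proj q m z = z" using that by (intro proj_id[OF q(2)]) (simp only: q(3))
  then have "(norm (phi z))^2 = (norm z)^2"
   using norm_proj_sq[OF q(2), of z] norm_cvec[of m "%l. z \<bullet> q l"] by (simp only: phi_def)
  then show ?thesis by (rule power2_eq_imp_eq) auto
 qed
 have diff: "phi (z - z') = phi z - phi z'" for z z'
  by (simp add: phi_def cvec_def inner_diff_left scaleR_left_diff_distrib sum_subtractf)
 have nd: "norm (phi z - phi z') = norm (z - z')" if "z \<in> Z" "z' \<in> Z" for z z'
  using that Z(2) diff[of z z'] by (metis span_diff subsetD nrm)
 have inj: "inj_on phi Z"
 proof (rule inj_onI)
  fix z z' assume "z \<in> Z" "z' \<in> Z" "phi z = phi z'"
  then show "z = z'" using nd[of z z'] by simp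
 qed
 have "real (card (phi ` Z)) <= (1 + 2 * r / rho) ^ m"
 proof (rule packing_Rn)
  show "norm z <= r" if "z \<in> phi ` Z" for z
   using that Z(2,3) nrm by (metis image_iff subsetD)
  show "norm (z - z') >= rho" if "z \<in> phi ` Z" "z' \<in> phi ` Z" "z ~= z'" for z z'
   using that nd sep by (metis image_iff)
 qed (use Z rho r in \<open>auto simp: phi_def\<close>)
 also have "... <= (1 + 2 * r / rho) ^ k"
  using q(1) rho r by (intro power_increasing) auto
 finally show ?thesis using inj by (simp add: card_image)
qed

section \<open>Sudakov's inequalities\<close>

text \<open>Nets come from packing bounds: a separated set of largest size cannot be enlarged.\<close>
lemma maximal_separated:
 fixes far :: "'a => 'a => bool" and b :: real
 assumes bound: "!!Z. finite Z ==> Z <= S ==> pairwise far Z ==> real (card Z) <= b"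
  and sym: "!!x y. far x y ==> far y x"
 shows "\<exists>Z. finite Z \<and> Z <= S \<and> pairwise far Z \<and> real (card Z) <= b \<and> (\<forall>x\<in>S. \<exists>z\<in>Z. x = z \<or> \<not> far x z)"
proof -
 let ?P = "%Z. finite Z \<and> Z <= S \<and> pairwise far Z"
 have "\<exists>Z. ?P Z \<and> (\<forall>Y. ?P Y --> card Y <= card Z)"
  using bound by (intro ex_has_greatest_nat[where k="{}" and b="Suc (nat \<lfloor>b\<rfloor>)"]) (auto intro: le_nat_floor simp: less_Suc_eq_le)
 then obtain Z where Z: "?P Z" and max: "!!Y. ?P Y ==> card Y <= card Z" by blast
 have "\<exists>z\<in>Z. x = z \<or> \<not> far x z" if x: "x \<in> S" for x
 proof (rule ccontr)
  assume c: "\<not> (\<exists>z\<in>Z. x = z \<or> \<not> far x z)"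
  then have "?P (insert x Z)" "x \<notin> Z"
   using Z x sym by (auto simp: pairwise_insert)
  then show False using max[of "insert x Z"] Z by simp
 qed
 then show ?thesis using Z bound by blast
qed

text \<open>Chebyshev's inequality for $h^2$ at the level $4w^2$.\<close>
lemma gs_chebyshev:
 fixes h :: "fsvec => real"
 assumes h: "continuous_on UNIV h" and int: "gsquare n h"
  and w: "gmean n h <= w\<^sup>2" "w > 0" and nn: "!!x. h x >= 0"
 shows "measure (gs n) (cset n {x. h x <= 2 * w}) >= 3 / 4"
proof -
 interpret prob_space "gs n" by (rule prob_gs)
 have S: "cset n {x. h x <= 2 * w} \<in> sets (gs n)"
  using cms_le(1)[OF h] by (simp add: cms_def sets_gs)
 have mh: "(%a. (h (cvec n a))^2) \<in> borel_measurable (gs n)" using int by simp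
 have "prob {a \<in> space (gs n). (h (cvec n a))^2 >= 4 * w\<^sup>2} <= (gmean n h) / (4 * w\<^sup>2)"
  using int w(2) by (intro integral_Markov_inequality_measure[where A="{}"]) auto
 also have "... <= 1 / 4" using w by (simp add: divide_simps)
 finally have 1: "prob {a \<in> space (gs n). (h (cvec n a))^2 >= 4 * w\<^sup>2} <= 1 / 4" .
 have "prob (space (gs n) - cset n {x. h x <= 2 * w}) <= prob {a \<in> space (gs n). (h (cvec n a))^2 >= 4 * w\<^sup>2}"
 proof (rule finite_measure_mono)
  show "space (gs n) - cset n {x. h x <= 2 * w} <= {a \<in> space (gs n). (h (cvec n a))^2 >= 4 * w\<^sup>2}"
  proof
   fix a assume "a \<in> space (gs n) - cset n {x. h x <= 2 * w}"
   then have a: "a \<in> space (gs n)" "h (cvec n a) > 2 * w" by (auto simp: cset_def)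
   then have "(2 * w)^2 <= (h (cvec n a))^2" using w(2) by (intro power_mono) auto
   then show "a \<in> {a \<in> space (gs n). (h (cvec n a))^2 >= 4 * w\<^sup>2}" using a by (simp add: power_mult_distrib)
  qed
  show "{a \<in> space (gs n). (h (cvec n a))^2 >= 4 * w\<^sup>2} \<in> sets (gs n)"
   using mh by measurable
 qed
 then show ?thesis using 1 prob_compl[OF S] by simp
qed

text \<open>The translates of $A$ by $Y$ are disjoint, and each has Gaussian measure at least $\frac34 e^{-R^2/2}$.\<close>
lemma gs_translate_packing:
 assumes A: "cms n A" "!!x. x \<in> A ==> - x \<in> A" "measure (gs n) (cset n A) >= 3 / 4"
  and Y: "finite Y" "Y <= Rn n" "!!y. y \<in> Y ==> norm y <= R"
  and dis: "!!y y' a a'. y \<in> Y ==> y' \<in> Y ==> y ~= y' ==> a \<in> A ==> a' \<in> A ==> a - a' ~= y - y'"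
 shows "real (card Y) <= 4 / 3 * exp (R\<^sup>2 / 2)"
proof (cases "Y = {}")
 case True
 then show ?thesis by simp
next
 case False
 then have R: "R >= 0" using Y(3) norm_ge_zero order_trans by blast
 interpret prob_space "gs n" by (rule prob_gs)
 define T where "T y = cset n {x. x + y \<in> A}" for y
 have T: "T y \<in> sets (gs n)" if "y \<in> Y" for y
 proof -
  have "{x. x + y \<in> A} \<inter> Rn n = {x. y + 1 *\<^sub>R x \<in> A} \<inter> Rn n" by (auto simp: add.commute)
  then have "cset n {x. x + y \<in> A} = cset n {x. y + 1 *\<^sub>R x \<in> A}" by (auto simp: cset_def add.commute)
  moreover have "(%a. \<lambda>i\<in>{..<n}. cf y i + a i) \<in> measurable (PiM {..<n} (%_. borel)) (PiM {..<n} (%_. borel))"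
   by (intro measurable_restrict) measurable
  moreover have "cvec n (\<lambda>i\<in>{..<n}. cf y i + a i) = y + cvec n a" for a
  proof -
   have "cvec n (\<lambda>i\<in>{..<n}. cf y i + a i) = cvec n (%i. cf y i + a i)"
    by (rule cvec_cong) simp
   also have "... = y + cvec n a"
    using cvec_cf[of y n] Y(2) that by (auto simp: cvec_add[symmetric])
   finally show ?thesis .
  qed
  then have "cset n {x. y + 1 *\<^sub>R x \<in> A} = (%a. \<lambda>i\<in>{..<n}. cf y i + a i) -` cset n A \<inter> coord_space n"
   by (auto simp: cset_def coord_space_def)
  ultimately show ?thesis using A(1) measurable_sets[of "%a. \<lambda>i\<in>{..<n}. cf y i + a i" "PiM {..<n} (%_. borel)" "PiM {..<n} (%_. borel)" "cset n A"]
   by (simp add: T_def cms_def sets_gs)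
 qed
 have lower: "3 / 4 * exp (- R\<^sup>2 / 2) <= prob (T y)" if "y \<in> Y" for y
 proof -
  have "exp (- R\<^sup>2 / 2) <= exp (- (norm y)\<^sup>2 / 2)"
   using Y(3)[OF that] power_mono[of "norm y" R 2] by simp
  then have "exp (- R\<^sup>2 / 2) * (3 / 4) <= exp (- (norm y)\<^sup>2 / 2) * prob (cset n A)"
   using A(3) by (intro mult_mono) auto
  also have "... <= prob (T y)"
   unfolding T_def using A(1,2) Y(2) that by (intro gs_shift_lower) auto
  finally show ?thesis by simp
 qed
 have "real (card Y) * (3 / 4 * exp (- R\<^sup>2 / 2)) = (\<Sum>y\<in>Y. 3 / 4 * exp (- R\<^sup>2 / 2))" by simp
 also have "... <= (\<Sum>y\<in>Y. prob (T y))" by (intro sum_mono lower)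
 also have "... = prob (\<Union>y\<in>Y. T y)"
 proof (rule finite_measure_finite_Union[symmetric])
  show "disjoint_family_on T Y"
   unfolding disjoint_family_on_def
  proof (intro ballI impI)
   fix y y' assume y: "y \<in> Y" "y' \<in> Y" "y ~= y'"
   show "T y \<inter> T y' = {}"
   proof (rule ccontr)
    assume "T y \<inter> T y' ~= {}"
    then obtain a where "cvec n a + y \<in> A" "cvec n a + y' \<in> A" by (auto simp: T_def cset_def)
    from dis[OF y this] show False by simp
   qed
  qed
 qed (use Y T in auto)
 also have "... <= 1" by simp
 finally have "real (card Y) * (3 / 4 * exp (- R\<^sup>2 / 2)) <= 1" .
 then have "real (card Y) * (3 / 4 * exp (- R\<^sup>2 / 2)) * (4 / 3 * exp (R\<^sup>2 / 2)) <= 1 * (4 / 3 * exp (R\<^sup>2 / 2))"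
  by (intro mult_right_mono) auto
 moreover have "exp (- R\<^sup>2 / 2) * exp (R\<^sup>2 / 2) = 1" by (simp flip: exp_add)
 moreover have "real (card Y) * (3 / 4 * exp (- R\<^sup>2 / 2)) * (4 / 3 * exp (R\<^sup>2 / 2))
  = real (card Y) * (exp (- R\<^sup>2 / 2) * exp (R\<^sup>2 / 2))" by simp
 ultimately show ?thesis by (simp only: mult_1 mult_1_right)
qed

lemma exp_card_bound:
 assumes "real c <= 4 / 3 * exp x" "x >= 0"
 shows "real c <= exp (2 * x)"
proof (cases "exp x < 3 / 2")
 case True
 then have "real c < 2" using assms(1) by simp
 then have "real c <= 1" by simp
 also have "1 <= exp (2 * x)" using assms(2) by simp
 finally show ?thesis .
next
 case False
 then have "4 / 3 * exp x <= exp x * exp x" by (intro mult_right_mono) auto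
 then show ?thesis using assms(1) by (simp flip: exp_add)
qed

text \<open>After scaling by $5w/s$ the points of $Z$ are $5w$-separated for $h$. The set $\{h \le 2w\}$ has differences of size at most $4w$ only, so its
translates by these points are disjoint, and it has measure at least $3/4$.\<close>
lemma dual_sudakov:
 assumes h: "continuous_on UNIV h" and int: "gsquare n h"
  and w: "gmean n h <= w\<^sup>2" "w > 0" and nn: "!!x. h x >= 0"
  and tri: "!!x y. h (x - y) <= h x + h y" and sym: "!!x. h (- x) = h x"
  and hom: "!!x c. c > 0 ==> h (c *\<^sub>R x) = c * h x"
  and Z: "finite Z" "Z <= Rn n" "!!z. z \<in> Z ==> norm z <= R" and s: "s > 0"
  and sep: "!!z z'. z \<in> Z ==> z' \<in> Z ==> z ~= z' ==> h (z - z') >= s"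
 shows "real (card Z) <= exp (25 * (w * R / s)^2)"
proof -
 define l where "l = 5 * w / s"
 have l: "l > 0" using w s by (simp add: l_def)
 have "real (card ((*\<^sub>R) l ` Z)) <= 4 / 3 * exp ((l * R)^2 / 2)"
 proof (rule gs_translate_packing[where A="{x. h x <= 2 * w}"])
  show "cms n {x. h x <= 2 * w}" by (rule cms_le[OF h])
  show "3 / 4 <= measure (gs n) (cset n {x. h x <= 2 * w})" by (rule gs_chebyshev[OF h int w nn])
  show "norm y <= l * R" if "y \<in> (*\<^sub>R) l ` Z" for y using that Z(3) l by auto
  fix y y' a a' assume y: "y \<in> (*\<^sub>R) l ` Z" "y' \<in> (*\<^sub>R) l ` Z" "y ~= y'"
   and a: "a \<in> {x. h x <= 2 * w}" "a' \<in> {x. h x <= 2 * w}"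
  from y obtain z z' where z: "z \<in> Z" "z' \<in> Z" "z ~= z'" "y - y' = l *\<^sub>R (z - z')"
   by (auto simp: scaleR_diff_right)
  have "l * s <= h (y - y')" using sep[OF z(1-3)] l by (simp add: z(4) hom)
  moreover have "l * s = 5 * w" using s by (simp add: l_def)
  moreover have "h (a - a') <= 4 * w" using tri[of a a'] a by simp
  ultimately show "a - a' ~= y - y'" using w(2) by auto
 qed (use Z sym in auto)
 then have "real (card Z) <= 4 / 3 * exp ((l * R)^2 / 2)"
  using l by (subst (asm) card_image) (auto simp: inj_on_def)
 then have "real (card Z) <= exp (2 * ((l * R)^2 / 2))" by (rule exp_card_bound) simp
 then show ?thesis by (simp add: l_def power_mult_distrib power_divide mult.commute)
qed

text \<open>The same argument in duality. With the factor $9w/t^2$, two of the scaled points $y, y'$ satisfy $\langle z-z',y-y'\rangle \ge 9w$, whereas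
$\langle z-z',a-a'\rangle \le 8w$ for $a,a'$ in $\{h\le 2w\}$.\<close>
lemma sudakov_local:
 assumes h: "continuous_on UNIV h" and int: "gsquare n h"
  and w: "gmean n h <= w\<^sup>2" "w > 0" and nn: "!!x. h x >= 0"
  and sym: "!!x. h (- x) = h x"
  and K: "K <= Rn n" "!!x z. x \<in> K ==> \<bar>x \<bullet> z\<bar> <= h z"
  and t: "t > 0" and Z: "finite Z" "Z <= K" "!!z. z \<in> Z ==> norm (z - c) <= 2 * t" and c: "c \<in> Rn n"
  and sep: "!!z z'. z \<in> Z ==> z' \<in> Z ==> z ~= z' ==> norm (z - z') >= t"
 shows "real (card Z) <= exp (324 * (w / t)^2)"
proof -
 define l where "l = 9 * w / t\<^sup>2"
 have l: "l > 0" using w t by (simp add: l_def)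
 let ?f = "%z. l *\<^sub>R (z - c)"
 have "real (card (?f ` Z)) <= 4 / 3 * exp ((l * (2 * t))^2 / 2)"
 proof (rule gs_translate_packing[where A="{x. h x <= 2 * w}"])
  show "cms n {x. h x <= 2 * w}" by (rule cms_le[OF h])
  show "3 / 4 <= measure (gs n) (cset n {x. h x <= 2 * w})" by (rule gs_chebyshev[OF h int w nn])
  show "norm y <= l * (2 * t)" if "y \<in> ?f ` Z" for y using that Z(3) l by auto
  show "?f ` Z <= Rn n" using Z(2) K(1) c by auto
  fix y y' a a' assume y: "y \<in> ?f ` Z" "y' \<in> ?f ` Z" "y ~= y'"
   and a: "a \<in> {x. h x <= 2 * w}" "a' \<in> {x. h x <= 2 * w}"
  from y obtain z z' where z: "z \<in> Z" "z' \<in> Z" "z ~= z'" and yz: "y - y' = l *\<^sub>R (z - z')"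
   by (auto simp: scaleR_diff_right)
  have zK: "z \<in> K" "z' \<in> K" using z Z(2) by auto
  have "(z - z') \<bullet> (a - a') = z \<bullet> a - z \<bullet> a' - z' \<bullet> a + z' \<bullet> a'"
   by (simp add: inner_diff_left inner_diff_right)
  then have up: "(z - z') \<bullet> (a - a') <= 8 * w"
   using K(2)[OF zK(1), of a] K(2)[OF zK(1), of a'] K(2)[OF zK(2), of a] K(2)[OF zK(2), of a'] a by simp
  have "t\<^sup>2 <= (norm (z - z'))^2" using sep[OF z] t by (intro power_mono) auto
  then have "l * t\<^sup>2 <= l * ((z - z') \<bullet> (z - z'))" using l by (simp add: power2_norm_eq_inner)
  moreover have "l * t\<^sup>2 = 9 * w" using t by (simp add: l_def)
  ultimately have "(z - z') \<bullet> (y - y') >= 9 * w" by (simp add: yz)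
  then show "a - a' ~= y - y'" using up w(2) by auto
 qed (use Z sym in auto)
 then have "real (card Z) <= 4 / 3 * exp ((l * (2 * t))^2 / 2)"
  using l by (subst (asm) card_image) (auto simp: inj_on_def)
 then have "real (card Z) <= exp (2 * ((l * (2 * t))^2 / 2))" by (rule exp_card_bound) simp
 also have "2 * ((l * (2 * t))^2 / 2) = 324 * (w / t)^2"
  using t by (simp add: l_def power2_eq_square field_simps)
 finally show ?thesis .
qed

text \<open>Sudakov's inequality. Halving the radius multiplies the size of the net by the bound of \<open>sudakov_local\<close>, which is $e^{1296\cdot 4^j}$ at
scale $w/2^{j+1}$; the exponents add up to a geometric series.\<close>
lemma sudakov:
 assumes h: "continuous_on UNIV h" and int: "gsquare n h"
  and w: "gmean n h <= w\<^sup>2" "w > 0" and nn: "!!x. h x >= 0"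
  and sym: "!!x. h (- x) = h x"
  and K: "K <= Rn n" "!!x z. x \<in> K ==> \<bar>x \<bullet> z\<bar> <= h z" and K0: "0 \<in> K"
 shows "\<exists>Z. finite Z \<and> Z <= K \<and> real (card Z) <= exp (432 * 4 ^ j) \<and> (\<forall>x\<in>K. \<exists>z\<in>Z. norm (x - z) <= w / 2 ^ j)"
proof (induction j)
 case 0
 have "norm x <= w" if "x \<in> K" for x
 proof -
  have "(norm x)^2 = (\<integral>a. (cvec n a \<bullet> x) * (cvec n a \<bullet> x) \<partial>gs n)"
   using K(1) that inner_Rn[of x n x] by (simp add: gs_inner_moment power2_norm_eq_inner subset_iff)
  also have "... <= gmean n h"
  proof (intro integral_mono gs_inner_moment int)
   fix a
   have "\<bar>cvec n a \<bullet> x\<bar> <= h (cvec n a)" using K(2)[OF that, of "cvec n a"] by (simp add: inner_commute)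
   then have "\<bar>cvec n a \<bullet> x\<bar>\<^sup>2 <= (h (cvec n a))^2" by (intro power_mono) auto
   then show "(cvec n a \<bullet> x) * (cvec n a \<bullet> x) <= (h (cvec n a))^2" by (simp add: power2_eq_square)
  qed
  also have "... <= w\<^sup>2" by (rule w)
  finally have "(norm x)^2 <= w\<^sup>2" .
  then show ?thesis by (rule power2_le_imp_le) (use w(2) in auto)
 qed
 then show ?case using K0 by (intro exI[of _ "{0}"]) auto
next
 case (Suc j)
 then obtain Z where Z: "finite Z" "Z <= K" "real (card Z) <= exp (432 * 4 ^ j)"
  "!!x. x \<in> K ==> \<exists>z\<in>Z. norm (x - z) <= w / 2 ^ j" by blast
 define t where "t = w / 2 ^ Suc j"
 have t: "t > 0" using w(2) by (simp add: t_def)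
 have wt: "(w / t)^2 = 4 * 4 ^ j"
 proof -
  have "w / t = 2 * 2 ^ j" using w(2) by (simp add: t_def)
  then have "(w / t)^2 = 4 * (2 ^ j * 2 ^ j)" by (simp add: power2_eq_square)
  also have "(2 ^ j * 2 ^ j :: real) = (2 * 2) ^ j" by (rule power_mult_distrib[symmetric])
  finally show ?thesis by simp
 qed
 define S where "S z = {x\<in>K. norm (x - z) <= 2 * t}" for z
 have ex: "\<exists>Y. finite Y \<and> Y <= S z \<and> real (card Y) <= exp (324 * (w / t)^2) \<and> (\<forall>x\<in>S z. \<exists>y\<in>Y. norm (x - y) <= t)"
  if z: "z \<in> Z" for z
 proof -
  have "\<exists>Y. finite Y \<and> Y <= S z \<and> pairwise (%x y. norm (x - y) >= t) Y \<and> real (card Y) <= exp (324 * (w / t)^2)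
   \<and> (\<forall>x\<in>S z. \<exists>y\<in>Y. x = y \<or> \<not> norm (x - y) >= t)"
  proof (rule maximal_separated)
   fix Y assume Y: "finite Y" "Y <= S z" "pairwise (%x y. t <= norm (x - y)) Y"
   show "real (card Y) <= exp (324 * (w / t)^2)"
   proof (rule sudakov_local[OF h int w nn sym K t Y(1), of z])
    show "Y <= K" using Y(2) by (auto simp: S_def)
    show "norm (y - z) <= 2 * t" if "y \<in> Y" for y using Y(2) that by (auto simp: S_def)
    show "z \<in> Rn n" using z Z(2) K(1) by auto
    show "t <= norm (y - y')" if "y \<in> Y" "y' \<in> Y" "y ~= y'" for y y'
     using Y(3) that by (auto simp: pairwise_def)
   qed
  qed (simp add: norm_minus_commute)
  then show ?thesis using t
   by (metis cancel_comm_monoid_add_class.diff_cancel linorder_not_le norm_zero order_less_imp_le)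
 qed
 then obtain Y where Y: "!!z. z \<in> Z ==> finite (Y z)" "!!z. z \<in> Z ==> Y z <= S z"
  "!!z. z \<in> Z ==> real (card (Y z)) <= exp (324 * (w / t)^2)"
  "!!z x. z \<in> Z ==> x \<in> S z ==> \<exists>y\<in>Y z. norm (x - y) <= t" by metis
 have "real (card (\<Union>z\<in>Z. Y z)) <= (\<Sum>z\<in>Z. real (card (Y z)))"
  using card_UN_le[OF Z(1), of Y] by (metis of_nat_le_iff of_nat_sum)
 also have "... <= (\<Sum>z\<in>Z. exp (324 * (w / t)^2))" by (intro sum_mono Y)
 also have "... <= exp (432 * 4 ^ j) * exp (324 * (w / t)^2)"
  using Z(3) by (simp add: mult_right_mono)
 also have "... = exp (432 * 4 ^ Suc j)"
  unfolding wt by (simp flip: exp_add)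
 finally have c: "real (card (\<Union>z\<in>Z. Y z)) <= exp (432 * 4 ^ Suc j)" .
 have cov: "\<exists>y\<in>(\<Union>z\<in>Z. Y z). norm (x - y) <= w / 2 ^ Suc j" if x: "x \<in> K" for x
 proof -
  obtain z where z: "z \<in> Z" "norm (x - z) <= w / 2 ^ j" using Z(4)[OF x] by blast
  then have "x \<in> S z" using x by (simp add: S_def t_def)
  then show ?thesis using Y(4)[OF z(1)] z(1) unfolding t_def by blast
 qed
 show ?case
  using c cov Z(1) Y(1,2) by (intro exI[of _ "\<Union>z\<in>Z. Y z"]) (auto simp: S_def)
qed

section \<open>Ellipsoids and triangular matrices\<close>

lemma gram_schmidt_flag:
 fixes y :: "nat => 'a::real_inner"
 assumes "!!i. i < k ==> y i \<notin> span (y ` {..<i})"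
 shows "\<exists>q. orthon q k \<and> (\<forall>j\<le>k. span (q ` {..<j}) = span (y ` {..<j})) \<and> (\<forall>i<k. y i \<bullet> q i > 0)"
 using assms
proof (induction k)
 case 0
 then show ?case by (intro exI[of _ "%_. 0"]) (auto simp: orthon_def)
next
 case (Suc k)
 then obtain q where q: "orthon q k" "!!j. j <= k ==> span (q ` {..<j}) = span (y ` {..<j})"
  "!!i. i < k ==> y i \<bullet> q i > 0" by auto
 define z where "z = y k - proj q k (y k)"
 have z0: "z ~= 0"
 proof
  assume "z = 0"
  then have "y k \<in> span (q ` {..<k})" using proj_in_span[of q k "y k"] by (simp add: z_def)
  then show False using Suc.prems[of k] q(2)[of k] by simp
 qed
 define q' where "q' = q(k := sgn z)"
 have zq: "z \<bullet> q l = 0" if "l < k" for l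
  unfolding z_def using that by (intro proj_orth[OF q(1)] span_base) auto
 have sg: "sgn z \<bullet> sgn z = 1" using z0 by (simp add: dot_square_norm norm_sgn)
 have sq: "sgn z \<bullet> q l = 0" if "l < k" for l using zq[OF that] by (simp add: sgn_div_norm)
 have o: "orthon q' (Suc k)"
  unfolding orthon_def
 proof (intro allI impI)
  fix i j assume "i < Suc k" "j < Suc k"
  then show "q' i \<bullet> q' j = (if i = j then 1 else 0)"
   using q(1) sg sq sq[THEN trans[OF inner_commute]]
   by (auto simp: q'_def orthon_def less_Suc_eq)
 qed
 have img: "q' ` {..<j} = q ` {..<j}" if "j <= k" for j
  using that by (auto simp: q'_def)
 have top: "span (q' ` {..<Suc k}) = span (y ` {..<Suc k})"
 proof -
  have q'S: "q' ` {..<Suc k} = insert (sgn z) (q ` {..<k})"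
   by (auto simp: q'_def lessThan_Suc)
  have yS: "y ` {..<Suc k} = insert (y k) (y ` {..<k})" by (auto simp: lessThan_Suc)
  have "span (insert (sgn z) (q ` {..<k})) = span (insert (y k) (q ` {..<k}))"
  proof (rule span_eq[THEN iffD2], intro conjI subsetI)
   fix x assume "x \<in> insert (sgn z) (q ` {..<k})"
   moreover have "z \<in> span (insert (y k) (q ` {..<k}))"
    unfolding z_def using proj_in_span[of q k "y k"] span_mono[of "q ` {..<k}" "insert (y k) (q ` {..<k})"]
    by (intro span_diff) (auto intro: span_base)
   ultimately show "x \<in> span (insert (y k) (q ` {..<k}))"
    by (auto simp: sgn_div_norm intro: span_scale span_base)
  next
   fix x assume "x \<in> insert (y k) (q ` {..<k})"
   moreover have "y k = norm z *\<^sub>R sgn z + proj q k (y k)"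
    using z0 by (simp add: sgn_div_norm z_def)
   then have "y k \<in> span (insert (sgn z) (q ` {..<k}))"
    using proj_in_span[of q k "y k"] span_mono[of "q ` {..<k}" "insert (sgn z) (q ` {..<k})"]
    by (metis (no_types, lifting) insertI1 span_add span_base span_scale subsetD subset_insertI)
   ultimately show "x \<in> span (insert (sgn z) (q ` {..<k}))" by (auto intro: span_base)
  qed
  also have "... = span (insert (y k) (y ` {..<k}))"
   using q(2)[of k] by (simp add: span_insert)
  finally show ?thesis by (simp add: q'S yS)
 qed
 have "y k \<bullet> z = z \<bullet> z"
 proof -
  have "z \<bullet> proj q k (y k) = 0" unfolding z_def by (rule proj_orth[OF q(1) proj_in_span])
  then show ?thesis by (simp add: z_def inner_diff_left inner_diff_right inner_commute)
 qed
 then have pos: "y k \<bullet> sgn z > 0" using z0 by (simp add: sgn_div_norm)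
 show ?case
 proof (intro exI[of _ q'] conjI allI impI)
  show "orthon q' (Suc k)" by (rule o)
  fix j assume "j <= Suc k"
  then show "span (q' ` {..<j}) = span (y ` {..<j})"
   using top img[of j] q(2)[of j] by (cases "j = Suc k") auto
 next
  fix i assume "i < Suc k"
  then show "y i \<bullet> q' i > 0" using pos q(3) by (auto simp: q'_def less_Suc_eq)
 qed
qed

definition rows :: "nat => (nat => fsvec) => fsvec => fsvec" where
 "rows n v x = cvec n (%k. v k \<bullet> x)"

lemma linear_rows: "linear (rows n v)"
 by (rule linearI) (simp_all add: rows_def inner_add_right cvec_add[symmetric] cvec_scaleR[symmetric])

lemma rows_in [simp]: "rows n v x \<in> Rn n"
 by (simp add: rows_def)

lemma cf_rows: "cf (rows n v x) k = (if k < n then v k \<bullet> x else 0)"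
 by (simp add: rows_def cf_cvec)

lemma norm_rows: "(norm (rows n v x))^2 = (\<Sum>k<n. (v k \<bullet> x)^2)"
 by (simp add: rows_def norm_cvec)

text \<open>A matrix is given by its rows. Every ellipsoid is the preimage of a Euclidean ball under an upper triangular matrix with
positive diagonal, and its volume can be read off from the diagonal.\<close>
definition uppertri :: "nat => (nat => fsvec) => bool" where
 "uppertri n v \<longleftrightarrow> (\<forall>k<n. v k \<in> Rn n \<and> cf (v k) k > 0 \<and> (\<forall>i<k. cf (v k) i = 0))"

definition triell :: "nat => (nat => fsvec) => fsvec => fsvec set" where
 "triell n v d = {x \<in> Rn n. norm (rows n v x - d) <= 1}"

text \<open>Fubini's theorem: each variable in turn is substituted by an affine function whose slope is a diagonal entry.\<close>
lemma tri_integral: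
 fixes v :: "nat => nat => real"
 assumes v: "!!k. k < n ==> v k k > 0" "!!k i. k < n ==> i < k ==> v k i = 0"
  and f: "f \<in> borel_measurable (PiM {..<n} (%_. borel))"
 shows "(\<integral>\<^sup>+a. f a \<partial>PiM {..<n} (%_. lborel)) = ennreal (\<Prod>k<n. v k k) *
  (\<integral>\<^sup>+a. f (\<lambda>k\<in>{..<n}. (\<Sum>i<n. v k i * a i) - d k) \<partial>PiM {..<n} (%_. lborel))"
 using v f
proof (induction n arbitrary: d f)
 case 0
 have e: "(\<lambda>k\<in>{..<0}. (\<Sum>i<0. v k i * a i) - d k) = (%_. undefined)" for a by auto
 interpret S: product_sigma_finite "%_::nat. lborel :: real measure" ..
 show ?case unfolding e
  by (simp add: PiM_empty nn_integral_count_space_finite)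
next
 case (Suc n)
 interpret S: product_sigma_finite "%_::nat. lborel :: real measure" ..
 let ?L = "PiM {..<n} (%_. lborel :: real measure)"
 have SucI: "{..<Suc n} = insert n {..<n}" by (auto simp: lessThan_Suc)
 have f[measurable]: "f \<in> borel_measurable (PiM (insert n {..<n}) (%_. lborel))"
  using Suc.prems(3) measurable_cong_sets[OF sets_lborel_PiM[of "Suc n"] refl] unfolding SucI by blast
 have vn: "v n n > 0" using Suc.prems(1) by simp
 define T where "T a = (\<lambda>k\<in>{..<Suc n}. (\<Sum>i<Suc n. v k i * a i) - d k)" for a
 have mT: "T \<in> measurable (PiM (insert n {..<n}) (%_. lborel)) (PiM (insert n {..<n}) (%_. lborel))"
  unfolding T_def SucI by (intro measurable_restrict) measurable
 have fT[measurable]: "(%a. f (T a)) \<in> borel_measurable (PiM (insert n {..<n}) (%_. lborel))"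
  by (rule measurable_compose[OF mT f])
 have upd: "(%x. f (x(n := y))) \<in> borel_measurable (PiM {..<n} (%_. borel))" for y
 proof -
  have "(%x. x(n := y)) \<in> measurable (PiM {..<n} (%_. lborel)) (PiM (insert n {..<n}) (%_. lborel :: real measure))"
   by (rule measurable_fun_upd[where J="{..<n}"]) auto
  from measurable_compose[OF this f] show ?thesis
   using measurable_cong_sets[OF sets_lborel_PiM[of n] refl] by blast
 qed
 have mF: "(%y. \<integral>\<^sup>+x. f (x(n := y)) \<partial>?L) \<in> borel_measurable borel"
 proof -
  have "(%(y, x). f (x(n := y))) \<in> borel_measurable (lborel \<Otimes>\<^sub>M ?L)"
   by measurable
  then show ?thesis using S.sigma_finite_measures
   by (intro sigma_finite_measure.borel_measurable_nn_integral[where M="?L"])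
     (auto intro: S.sigma_finite simp: case_prod_beta')
 qed
 have "(\<integral>\<^sup>+a. f a \<partial>PiM (insert n {..<n}) (%_. lborel)) = (\<integral>\<^sup>+y. (\<integral>\<^sup>+x. f (x(n := y)) \<partial>?L) \<partial>lborel)"
  by (rule S.product_nn_integral_insert_rev) auto
 also have "... = ennreal (v n n) * (\<integral>\<^sup>+t. (\<integral>\<^sup>+x. f (x(n := - d n + v n n * t)) \<partial>?L) \<partial>lborel)"
  using vn nn_integral_real_affine[OF mF, of "v n n" "- d n"] by simp
 also have "... = ennreal (v n n) * (\<integral>\<^sup>+t. ennreal (\<Prod>k<n. v k k) * (\<integral>\<^sup>+x. f (T (x(n := t))) \<partial>?L) \<partial>lborel)"
 proof (intro arg_cong[where f="%x. ennreal (v n n) * x"] nn_integral_cong)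
  fix t :: real
  have "(\<integral>\<^sup>+x. f (x(n := - d n + v n n * t)) \<partial>?L) = ennreal (\<Prod>k<n. v k k) *
   (\<integral>\<^sup>+x. f ((\<lambda>k\<in>{..<n}. (\<Sum>i<n. v k i * x i) - (d k - v k n * t))(n := - d n + v n n * t)) \<partial>?L)"
   using Suc.prems(1,2) by (intro Suc.IH[of "%x. f (x(n := - d n + v n n * t))" "%k. d k - v k n * t"] upd) auto
  also have "(\<integral>\<^sup>+x. f ((\<lambda>k\<in>{..<n}. (\<Sum>i<n. v k i * x i) - (d k - v k n * t))(n := - d n + v n n * t)) \<partial>?L)
   = (\<integral>\<^sup>+x. f (T (x(n := t))) \<partial>?L)"
  proof (intro nn_integral_cong arg_cong[where f=f] ext)
   fix x k
   have "(\<Sum>i<n. v k i * (x(n := t)) i) = (\<Sum>i<n. v k i * x i)" by (intro sum.cong) auto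
   moreover have "(\<Sum>i<n. v n i * x i) = 0" using Suc.prems(2)[of n] by (intro sum.neutral) auto
   ultimately show "((\<lambda>k\<in>{..<n}. (\<Sum>i<n. v k i * x i) - (d k - v k n * t))(n := - d n + v n n * t)) k = T (x(n := t)) k"
    by (auto simp: T_def)
  qed
  finally show "(\<integral>\<^sup>+x. f (x(n := - d n + v n n * t)) \<partial>?L) = ennreal (\<Prod>k<n. v k k) * (\<integral>\<^sup>+x. f (T (x(n := t))) \<partial>?L)" .
 qed
 also have "... = ennreal (v n n) * (ennreal (\<Prod>k<n. v k k) * (\<integral>\<^sup>+t. (\<integral>\<^sup>+x. f (T (x(n := t))) \<partial>?L) \<partial>lborel))"
 proof -
  have "(%(y, x). f (T (x(n := y)))) \<in> borel_measurable (lborel \<Otimes>\<^sub>M ?L)"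
   by measurable
  then have "(%y. \<integral>\<^sup>+x. f (T (x(n := y))) \<partial>?L) \<in> borel_measurable lborel"
   by (intro sigma_finite_measure.borel_measurable_nn_integral[where M="?L"])
     (auto intro: S.sigma_finite simp: case_prod_beta')
  then show ?thesis by (subst nn_integral_cmult) auto
 qed
 also have "(\<integral>\<^sup>+t. (\<integral>\<^sup>+x. f (T (x(n := t))) \<partial>?L) \<partial>lborel) = (\<integral>\<^sup>+a. f (T a) \<partial>PiM (insert n {..<n}) (%_. lborel))"
  by (rule S.product_nn_integral_insert_rev[symmetric]) auto
 finally have F: "(\<integral>\<^sup>+a. f a \<partial>PiM (insert n {..<n}) (%_. lborel)) = ennreal (v n n) *
  (ennreal (\<Prod>k<n. v k k) * (\<integral>\<^sup>+a. f (T a) \<partial>PiM (insert n {..<n}) (%_. lborel)))" .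
 have P: "ennreal (\<Prod>k<Suc n. v k k) = ennreal (v n n) * ennreal (\<Prod>k<n. v k k)"
  unfolding prod.lessThan_Suc using Suc.prems(1)
  by (subst mult.commute, intro ennreal_mult prod_nonneg less_imp_le) auto
 show ?case
  unfolding T_def[symmetric] P unfolding SucI F by (rule mult.assoc[symmetric])
qed

lemma cvol_triell:
 assumes v: "uppertri n v" and d: "d \<in> Rn n"
 shows "cvol n (triell n v d) = cvol n {x. norm x <= 1} / (\<Prod>k<n. cf (v k) k)"
  and "cms n (triell n v d)"
proof -
 let ?L = "PiM {..<n} (%_. lborel :: real measure)"
 let ?B = "cset n {x. norm x <= 1}"
 define T where "T a = (\<lambda>k\<in>{..<n}. (\<Sum>i<n. cf (v k) i * a i) - cf d k)" for a :: "nat => real"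
 have B: "?B \<in> sets (PiM {..<n} (%_. borel))" using cms_ball(2)[of n 1] by (simp add: cms_def)
 have cT: "cvec n (T a) = rows n v (cvec n a) - d" if "a \<in> coord_space n" for a
 proof (rule fsvec_eqI)
  fix i
  show "cf (cvec n (T a)) i = cf (rows n v (cvec n a) - d) i"
   using d by (auto simp: T_def cf_cvec cf_rows inner_commute[of "v i"] inner_cvec Rn_def mult.commute)
 qed
 have eq: "cset n (triell n v d) = T -` ?B \<inter> coord_space n"
 proof (intro set_eqI iffI)
  fix a assume a: "a \<in> cset n (triell n v d)"
  then have "a \<in> coord_space n" "norm (rows n v (cvec n a) - d) <= 1" by (auto simp: cset_def triell_def)
  moreover have "T a \<in> coord_space n" by (simp add: T_def coord_space_def)
  ultimately show "a \<in> T -` ?B \<inter> coord_space n" using cT[of a] by (simp add: cset_def)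
 next
  fix a assume "a \<in> T -` ?B \<inter> coord_space n"
  then show "a \<in> cset n (triell n v d)" using cT[of a] by (simp add: cset_def triell_def)
 qed
 have mT: "T \<in> measurable (PiM {..<n} (%_. borel)) (PiM {..<n} (%_. borel))"
  unfolding T_def by (intro measurable_restrict) measurable
 show "cms n (triell n v d)"
  unfolding cms_def eq using measurable_sets[OF mT B] by simp
 then have E: "T -` ?B \<inter> coord_space n \<in> sets ?L" by (simp add: cms_def eq sets_lborel_PiM)
 have pos: "(\<Prod>k<n. cf (v k) k) > 0" using v by (intro prod_pos) (auto simp: uppertri_def)
 have "emeasure ?L ?B = (\<integral>\<^sup>+a. indicator ?B a \<partial>?L)"
  using B by (simp add: sets_lborel_PiM)
 also have "... = ennreal (\<Prod>k<n. cf (v k) k) * (\<integral>\<^sup>+a. indicator ?B (T a) \<partial>?L)"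
  unfolding T_def using v B by (intro tri_integral) (auto simp: uppertri_def)
 also have "(\<integral>\<^sup>+a. indicator ?B (T a) \<partial>?L) = (\<integral>\<^sup>+a. indicator (T -` ?B \<inter> coord_space n) a \<partial>?L)"
  by (intro nn_integral_cong) (auto split: split_indicator)
 also have "... = emeasure ?L (cset n (triell n v d))" using E by (simp add: eq)
 finally have "cvol n {x. norm x <= 1} = (\<Prod>k<n. cf (v k) k) * cvol n (triell n v d)"
  using pos by (simp add: cvol_def vol_def measure_def enn2real_mult)
 then show "cvol n (triell n v d) = cvol n {x. norm x <= 1} / (\<Prod>k<n. cf (v k) k)"
  using pos by (metis less_irrefl nonzero_mult_div_cancel_left)
qed

lemma uppertri_solve:
 assumes "uppertri n v"
 shows "\<exists>x\<in>Rn n. rows n v x = cvec n z"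
proof -
 have "\<exists>x\<in>Rn n. (\<forall>k<n. n - j <= k --> v k \<bullet> x = z k)" if "j <= n" for j
  using that
 proof (induction j)
  case 0
  then show ?case by (intro bexI[of _ 0]) auto
 next
  case (Suc j)
  then obtain x where x: "x \<in> Rn n" "!!k. k < n ==> n - j <= k ==> v k \<bullet> x = z k" by auto
  define k where "k = n - Suc j"
  have k: "k < n" "Suc k = n - j" using Suc.prems by (auto simp: k_def)
  define c where "c = (z k - v k \<bullet> x) / cf (v k) k"
  have vk: "cf (v k) k > 0" using assms k by (auto simp: uppertri_def)
  have "v l \<bullet> (x + c *\<^sub>R ax k) = z l" if "l < n" "k <= l" for l
  proof (cases "l = k")
   case True
   then show ?thesis using vk by (simp add: inner_add_right c_def)
  next
   case False
   then have "cf (v l) k = 0" using assms that by (auto simp: uppertri_def)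
   then show ?thesis using x(2)[of l] k that False by (simp add: inner_add_right)
  qed
  then show ?case using x(1) ax_in_Rn[OF k(1)] unfolding k_def
   by (intro bexI[of _ "x + c *\<^sub>R ax k"]) (auto simp: k_def)
 qed
 from this[of n] obtain x where "x \<in> Rn n" "!!k. k < n ==> v k \<bullet> x = z k" by auto
 then show ?thesis by (intro bexI[of _ x]) (auto simp: rows_def intro: cvec_cong)
qed

lemma uppertri_inj:
 assumes "uppertri n v" "x \<in> Rn n" "rows n v x = 0"
 shows "x = 0"
proof (rule ccontr)
 assume "x ~= 0"
 then obtain i where "cf x i ~= 0" using fsvec_eqI[of x 0] by auto
 then have ex: "\<exists>i. cf x i ~= 0" by blast
 have fin: "\<forall>i. cf x i ~= 0 --> i < n" using assms(2) by (auto simp: Rn_def not_less[symmetric])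
 obtain k where k: "cf x k ~= 0" "!!i. cf x i ~= 0 ==> i <= k"
  using ex_has_greatest_nat[of "%i. cf x i ~= 0" _ "%i. i" n] ex fin by blast
 have kn: "k < n" using fin k by auto
 have "v k \<bullet> x = (\<Sum>i<n. cf (v k) i * cf x i)"
  using assms(1) kn by (intro inner_Rn) (auto simp: uppertri_def)
 also have "... = (\<Sum>i\<in>{k}. cf (v k) i * cf x i)"
 proof (rule sum.mono_neutral_right)
  show "\<forall>i\<in>{..<n} - {k}. cf (v k) i * cf x i = 0"
  proof
   fix i assume "i \<in> {..<n} - {k}"
   then consider "i < k" | "i > k" by force
   then show "cf (v k) i * cf x i = 0"
    using assms(1) kn k(2)[of i] by cases (auto simp: uppertri_def)
  qed
 qed (use kn in auto)
 finally have "v k \<bullet> x ~= 0" using assms(1) kn k(1) by (auto simp: uppertri_def)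
 moreover have "v k \<bullet> x = 0" using arg_cong[OF assms(3), of "%x. cf x k"] kn by (simp add: cf_rows)
 ultimately show False by simp
qed

text \<open>The QR decomposition: express $M$ in the orthonormal basis that Gram--Schmidt makes out of the images of the axes.\<close>
lemma uppertri_of_linear:
 fixes M :: "fsvec => 'a::real_inner"
 assumes M: "linear M" and inj: "!!x. x \<in> Rn n ==> M x = 0 ==> x = 0"
 shows "\<exists>v. uppertri n v \<and> (\<forall>x\<in>Rn n. norm (rows n v x) = norm (M x))"
proof -
 define t where "t i = M (ax i)" for i
 have Mx: "M x = comb n t x" if "x \<in> Rn n" for x
 proof -
  have "M x = M (comb n ax x)" using cvec_cf[OF that] by (simp add: cvec_def)
  then show ?thesis by (simp add: linear_sum[OF M] linear_scale[OF M] t_def)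
 qed
 have ind: "t i \<notin> span (t ` {..<i})" if "i < n" for i
 proof
  assume "t i \<in> span (t ` {..<i})"
  also have "t ` {..<i} = M ` (ax ` {..<i})" by (auto simp: t_def)
  finally have "t i \<in> M ` span (ax ` {..<i})" by (simp add: linear_span_image[OF M])
  then obtain x where x: "x \<in> span (ax ` {..<i})" "t i = M x" by blast
  have "x \<in> Rn i" using x(1) by (rule span_induct) (auto simp: ax_in_Rn)
  then have "cf x i = 0" "x \<in> Rn n" using that by (auto simp: Rn_def)
  moreover have "M (ax i - x) = 0" using x(2) by (simp add: linear_diff[OF M] t_def)
  ultimately have "ax i - x = 0" using that by (intro inj) (auto simp: ax_in_Rn)
  then show False using `cf x i = 0` by (metis cf_ax eq_iff_diff_eq_0 zero_neq_one)
 qed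
 obtain q where q: "orthon q n" "!!j. j <= n ==> span (q ` {..<j}) = span (t ` {..<j})"
  "!!i. i < n ==> t i \<bullet> q i > 0" using gram_schmidt_flag[of n t] ind by blast
 define v where "v k = cvec n (%i. t i \<bullet> q k)" for k
 have tq: "t i \<bullet> q k = 0" if "i < k" "k < n" for i k
 proof -
  have "t i \<in> span (q ` {..<Suc i})" using that by (subst q(2)) (auto intro: span_base)
  then show ?thesis
  proof (induction rule: span_induct_alt)
   case (step c y z)
   then show ?case using q(1) that by (auto simp: orthon_def inner_add_left)
  qed simp
 qed
 have "uppertri n v" using q(3) tq by (auto simp: uppertri_def v_def cf_cvec)
 moreover have "norm (rows n v x) = norm (M x)" if x: "x \<in> Rn n" for x
 proof -
  have vk: "v k \<bullet> x = M x \<bullet> q k" for k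
   using x by (simp add: v_def inner_cvec Mx inner_sum_left mult.commute)
  have "M x \<in> span (t ` {..<n})" unfolding Mx[OF x] by (intro span_sum span_scale span_base) auto
  then have "proj q n (M x) = M x" by (intro proj_id[OF q(1)]) (simp only: q(2)[OF le_refl])
  then have "(norm (M x))^2 = (\<Sum>l<n. (M x \<bullet> q l)^2)" using norm_proj_sq[OF q(1), of "M x"] by simp
  then have "(norm (rows n v x))^2 = (norm (M x))^2" by (simp add: norm_rows vk)
  then show ?thesis by (rule power2_eq_imp_eq) auto
 qed
 ultimately show ?thesis by blast
qed

lemma cvec_inj: "a \<in> coord_space n ==> b \<in> coord_space n ==> cvec n a = cvec n b ==> a = b"
proof (rule ext)
 fix i assume a: "a \<in> coord_space n" "b \<in> coord_space n" "cvec n a = cvec n b"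
 show "a i = b i"
 proof (cases "i < n")
  case True
  then show ?thesis using arg_cong[OF a(3), of "%x. cf x i"] by (simp add: cf_cvec)
 next
  case False
  then show ?thesis using a(1,2) by (auto simp: coord_space_def PiE_def extensional_def)
 qed
qed

definition coords :: "nat => fsvec => nat => real" where
 "coords n x = (\<lambda>i\<in>{..<n}. cf x i)"

lemma coords_in [simp]: "coords n x \<in> coord_space n"
 by (simp add: coords_def coord_space_def)

lemma cvec_coords: "x \<in> Rn n ==> cvec n (coords n x) = x"
 using cvec_cf[of x n] cvec_cong[of n "coords n x" "cf x"] by (simp add: coords_def)

lemma affine_map_in [simp]: "affine_map n A c x \<in> coord_space n"
 by (simp add: affine_map_def coord_space_def)

lemma cvec_affine_map:
 "cvec n (affine_map n A c x) = cvec n c + (\<Sum>j<n. x j *\<^sub>R cvec n (%i. A i j))"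
 by (rule fsvec_eqI) (simp add: cf_cvec cf_sum affine_map_def mult.commute)

lemma sq_norm_cvec_le: "(\<Sum>i<n. (x i)^2) <= 1 \<longleftrightarrow> norm (cvec n x) <= 1"
 using norm_cvec[of n x] by (metis abs_norm_cancel abs_square_le_1)

lemma ellipsoid_imp_triell:
 assumes "ellipsoid n F"
 shows "\<exists>v d. uppertri n v \<and> d \<in> Rn n \<and> F = cset n (triell n v d)"
proof -
 obtain A c where bij: "bij_betw (affine_map n A c) (coord_space n) (coord_space n)"
  and F: "F = affine_map n A c ` {x \<in> coord_space n. (\<Sum>i<n. (x i)^2) <= 1}"
  using assms by (auto simp: ellipsoid_def)
 define L where "L z = (\<Sum>j<n. cf z j *\<^sub>R cvec n (%i. A i j))" for z
 have L: "linear L" by (rule linearI) (simp_all add: L_def scaleR_left_distrib sum.distrib scaleR_right.sum)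
 have LRn: "L z \<in> Rn n" for z unfolding L_def by (intro Rn_sum) auto
 have aff: "cvec n (affine_map n A c x) = cvec n c + L (cvec n x)" for x
  by (simp add: cvec_affine_map L_def cf_cvec)
 have surj: "\<exists>z\<in>Rn n. L z = y" if y: "y \<in> Rn n" for y
 proof -
  have "coords n (cvec n c + y) \<in> affine_map n A c ` coord_space n"
   using bij by (simp add: bij_betw_def)
  then obtain x where "x \<in> coord_space n" "coords n (cvec n c + y) = affine_map n A c x" by auto
  then have "cvec n c + y = cvec n c + L (cvec n x)"
   using aff[of x] cvec_coords[of "cvec n c + y" n] y by simp
  then show ?thesis by (intro bexI[of _ "cvec n x"]) auto
 qed
 have injL: "z = 0" if z: "z \<in> Rn n" "L z = 0" for z
 proof -
  have "cvec n (affine_map n A c (coords n z)) = cvec n (affine_map n A c (coords n 0))"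
   using z by (simp add: aff cvec_coords linear_0[OF L])
  then have "affine_map n A c (coords n z) = affine_map n A c (coords n 0)"
   by (intro cvec_inj[of _ n]) auto
  then have "coords n z = coords n 0" using bij by (auto simp: bij_betw_def inj_on_def)
  then show ?thesis using cvec_coords[OF z(1)] cvec_coords[of 0 n] by simp
 qed
 have "\<forall>i. \<exists>t. i < n --> t \<in> Rn n \<and> L t = ax i"
  using surj[OF ax_in_Rn] by blast
 then obtain t where t: "!!i. i < n ==> t i \<in> Rn n \<and> L (t i) = ax i" by metis
 define T where "T x = comb n t x" for x
 have T: "linear T" by (rule linearI) (simp_all add: T_def scaleR_left_distrib sum.distrib scaleR_right.sum)
 have TRn: "T x \<in> Rn n" for x unfolding T_def using t by (intro Rn_sum) auto
 have LT: "L (T x) = x" if "x \<in> Rn n" for x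
  using t cvec_cf[OF that] by (simp add: T_def linear_sum[OF L] linear_scale[OF L] cvec_def)
 have TL: "T (L z) = z" if "z \<in> Rn n" for z
 proof -
  have "L (T (L z) - z) = 0" using LT[OF LRn] by (simp add: linear_diff[OF L])
  then show ?thesis using injL[of "T (L z) - z"] TRn that by simp
 qed
 obtain v where v: "uppertri n v" "!!x. x \<in> Rn n ==> norm (rows n v x) = norm (T x)"
 proof -
  have "x = 0" if "x \<in> Rn n" "T x = 0" for x
   using LT[OF that(1)] linear_0[OF L] that(2) by simp
  then show ?thesis using uppertri_of_linear[OF T, of n] that by blast
 qed
 define d where "d = rows n v (cvec n c)"
 have nd: "norm (rows n v x - d) = norm (T (x - cvec n c))" if "x \<in> Rn n" for x
  using v(2)[of "x - cvec n c"] that by (simp add: d_def linear_diff[OF linear_rows])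
 have "F = cset n (triell n v d)"
 proof (intro set_eqI iffI)
  fix a assume "a \<in> F"
  then obtain x where x: "x \<in> coord_space n" "norm (cvec n x) <= 1" "a = affine_map n A c x"
   by (auto simp: F sq_norm_cvec_le)
  have "T (cvec n a - cvec n c) = cvec n x" using TL[of "cvec n x"] by (simp add: x(3) aff)
  then show "a \<in> cset n (triell n v d)" using x nd[of "cvec n a"] by (simp add: cset_def triell_def)
 next
  fix a assume "a \<in> cset n (triell n v d)"
  then have a: "a \<in> coord_space n" "norm (T (cvec n a - cvec n c)) <= 1"
   using nd[of "cvec n a"] by (auto simp: cset_def triell_def)
  define x where "x = coords n (T (cvec n a - cvec n c))"
  have cx: "cvec n x = T (cvec n a - cvec n c)" unfolding x_def by (rule cvec_coords[OF TRn])
  have "cvec n (affine_map n A c x) = cvec n a"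
   using LT[of "cvec n a - cvec n c"] by (simp add: aff cx)
  then have "affine_map n A c x = a" using a(1) by (intro cvec_inj[of _ n]) auto
  then show "a \<in> F" unfolding F using a(2) cx by (intro image_eqI[of _ _ x]) (auto simp: sq_norm_cvec_le x_def)
 qed
 then show ?thesis using v(1) by (intro exI[of _ v] exI[of _ d]) (auto simp: d_def)
qed

lemma triell_ellipsoid:
 assumes v: "uppertri n v" and d: "d \<in> Rn n"
 shows "ellipsoid n (cset n (triell n v d))"
proof -
 have "\<exists>x\<in>Rn n. rows n v x = ax j" if "j < n" for j
  using uppertri_solve[OF v, of "cf (ax j)"] cvec_cf[OF ax_in_Rn[OF that]] by simp
 then have "\<forall>j. \<exists>x. j < n --> x \<in> Rn n \<and> rows n v x = ax j" by blast
 then obtain s where s: "!!j. j < n ==> s j \<in> Rn n \<and> rows n v (s j) = ax j" by metis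
 obtain c where c: "c \<in> Rn n" "rows n v c = d"
  using uppertri_solve[OF v, of "cf d"] cvec_cf[OF d] by auto
 define A where "A i j = cf (s j) i" for i j
 define phi where "phi = affine_map n A (cf c)"
 have cphi: "cvec n (phi x) = c + (\<Sum>j<n. x j *\<^sub>R s j)" for x
  using s cvec_cf[OF c(1)] cvec_cf by (simp add: phi_def cvec_affine_map A_def)
 have rphi: "rows n v (cvec n (phi x)) = d + cvec n x" for x
 proof -
  have "rows n v (cvec n (phi x)) = d + (\<Sum>j<n. x j *\<^sub>R rows n v (s j))"
   by (simp only: cphi linear_add[OF linear_rows] linear_sum[OF linear_rows] linear_scale[OF linear_rows] c(2))
  also have "(\<Sum>j<n. x j *\<^sub>R rows n v (s j)) = cvec n x"
   unfolding cvec_def using s by (intro sum.cong) auto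
  finally show ?thesis .
 qed
 have rinj: "x = y" if "x \<in> Rn n" "y \<in> Rn n" "rows n v x = rows n v y" for x y
  using uppertri_inj[OF v, of "x - y"] that by (simp add: linear_diff[OF linear_rows])
 have inv: "phi (coords n (rows n v (cvec n a) - d)) = a" if "a \<in> coord_space n" for a
 proof (rule cvec_inj[of _ n])
  show "cvec n (phi (coords n (rows n v (cvec n a) - d))) = cvec n a"
  proof (rule rinj)
   have "cvec n (coords n (rows n v (cvec n a) - d)) = rows n v (cvec n a) - d"
    using d by (intro cvec_coords) simp
   then show "rows n v (cvec n (phi (coords n (rows n v (cvec n a) - d)))) = rows n v (cvec n a)"
    by (simp only: rphi) simp
  qed auto
 qed (use that in \<open>auto simp: phi_def\<close>)
 have "bij_betw phi (coord_space n) (coord_space n)"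
  unfolding bij_betw_def
 proof (intro conjI inj_onI)
  fix x y assume xy: "x \<in> coord_space n" "y \<in> coord_space n" "phi x = phi y"
  then have "d + cvec n x = d + cvec n y" by (metis rphi)
  then show "x = y" using xy by (intro cvec_inj[of _ n]) auto
 next
  show "phi ` coord_space n = coord_space n"
  proof (intro equalityI subsetI)
   fix a assume "a \<in> coord_space n"
   then show "a \<in> phi ` coord_space n" by (intro image_eqI[of a phi, OF inv[symmetric]]) auto
  qed (auto simp: phi_def)
 qed
 moreover have "cset n (triell n v d) = phi ` {x \<in> coord_space n. (\<Sum>i<n. (x i)^2) <= 1}"
 proof (intro set_eqI iffI)
  fix a assume "a \<in> cset n (triell n v d)"
  then have a: "a \<in> coord_space n" "norm (rows n v (cvec n a) - d) <= 1" by (auto simp: cset_def triell_def)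
  then show "a \<in> phi ` {x \<in> coord_space n. (\<Sum>i<n. (x i)^2) <= 1}"
   using d by (intro image_eqI[of a phi, OF inv[OF a(1), symmetric]]) (auto simp: sq_norm_cvec_le cvec_coords)
 next
  fix a assume "a \<in> phi ` {x \<in> coord_space n. (\<Sum>i<n. (x i)^2) <= 1}"
  then show "a \<in> cset n (triell n v d)"
   by (auto simp: cset_def triell_def rphi sq_norm_cvec_le phi_def) (metis phi_def add_diff_cancel_left' rphi)
 qed
 ultimately show ?thesis unfolding ellipsoid_def phi_def by blast
qed

lemma sum_lessThan_add: "(\<Sum>l<a + b. g l) = (\<Sum>l<a. g l) + (\<Sum>i<b. g (a + i :: nat) :: real)"
 by (induction b) (auto simp: add_ac)

lemma sum_lessThan_mult: "(\<Sum>l<a * n. g l) = (\<Sum>k<a. \<Sum>i<n. g (k * n + i :: nat) :: real)"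
proof (induction a)
 case (Suc a)
 have "(\<Sum>l<Suc a * n. g l) = (\<Sum>l<a * n + n. g l)" by (simp add: add.commute)
 then show ?case using Suc by (simp only: sum_lessThan_add sum.lessThan_Suc)
qed simp

lemma ball_interior_norm:
 assumes "v \<in> Rn n" "rho > 0" "!!x. x \<in> Rn n ==> norm x <= rho ==> \<bar>v \<bullet> x\<bar> <= 1"
 shows "norm v <= 1 / rho"
proof -
 have "norm ((rho / norm v) *\<^sub>R v) <= rho" using assms(2) by simp
 then have "\<bar>v \<bullet> ((rho / norm v) *\<^sub>R v)\<bar> <= 1" using assms(1) by (intro assms(3)) auto
 moreover have "v \<bullet> ((rho / norm v) *\<^sub>R v) = rho * norm v"
  by (cases "v = 0") (simp_all add: dot_square_norm power2_eq_square)
 ultimately show ?thesis using assms(2) by (simp add: field_simps)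
qed

text \<open>Ellipsoids that contain $K$ correspond to triangular matrices and centres in a compact set, since the ball inside $K$ bounds the matrix. A
minimal volume is a maximal product of the diagonal.\<close>
lemma minimal_ellipsoid:
 assumes bdd: "bounded K" and rho: "rho > 0" "!!x. x \<in> Rn n ==> norm x <= rho ==> x \<in> K" and KR: "K <= Rn n"
 shows "\<exists>F. ellipsoid n F \<and> cset n K <= F \<and> (\<forall>G. ellipsoid n G \<and> cset n K <= G --> vol n F <= vol n G)"
proof -
 \<comment> \<open>a triangular matrix and a centre are coded by one vector\<close>
 define N where "N = n * n + n"
 define row where "row P k = cvec n (%i. cf P (k * n + i))" for P k
 define S where "S = {P. P \<in> Rn N \<inter> cball 0 (sqrt (real n / rho\<^sup>2 + 1)) \<and> (\<forall>k<n. cf P (k * n + k) >= 0) \<and>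
   (\<forall>k<n. \<forall>i<k. cf P (k * n + i) = 0) \<and> (\<forall>x\<in>K. norm (rows n (row P) x - row P n) <= 1)}"
 have cont_cf: "continuous_on UNIV (%P. cf P i)" for i
  using continuous_on_inner[OF continuous_on_id continuous_on_const, of UNIV "ax i"] by simp
 have cont_row: "continuous_on UNIV (%P. row P k)" for k
  unfolding row_def cvec_def by (intro continuous_intros cont_cf)
 have cont_rows: "continuous_on UNIV (%P. norm (rows n (row P) x - row P n))" for x
  unfolding rows_def cvec_def by (intro continuous_intros cont_row)
 have compS: "compact S"
 proof -
  have "S = (Rn N \<inter> cball 0 (sqrt (real n / rho\<^sup>2 + 1))) \<inter> ((\<Inter>k\<in>{..<n}. {P. 0 <= cf P (k * n + k)}) \<inter>
    (\<Inter>k\<in>{..<n}. \<Inter>i\<in>{..<k}. {P. cf P (k * n + i) = 0}) \<inter> (\<Inter>x\<in>K. {P. norm (rows n (row P) x - row P n) <= 1}))"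
   by (auto simp: S_def)
  also have "compact ..."
   by (intro compact_Int_closed compact_Rn_ball closed_Int closed_INT ballI closed_Collect_le closed_Collect_eq
     cont_cf cont_rows continuous_on_const)
  finally show ?thesis .
 qed
 have code: "\<exists>P\<in>S. (\<forall>k<n. cf P (k * n + k) = cf (v k) k)"
  if v: "uppertri n v" and d: "d \<in> Rn n" and sub: "cset n K <= cset n (triell n v d)" for v d
 proof -
  define P where "P = cvec N (%l. if l < n * n then cf (v (l div n)) (l mod n) else cf d (l - n * n))"
  have Kd: "norm (rows n v x - d) <= 1" if "x \<in> K" for x
  proof -
   have "coords n x \<in> cset n K" using that KR by (auto simp: cset_def cvec_coords subset_iff)
   then have "coords n x \<in> cset n (triell n v d)" using sub by blast
   then show ?thesis using that KR by (auto simp: cset_def triell_def cvec_coords subset_iff)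
  qed
  have cfP: "cf P (k * n + i) = cf (v k) i" if "k < n" "i < n" for k i
  proof -
   have "Suc k * n <= n * n" using that by (intro mult_right_mono) auto
   then have "k * n + i < n * n" using that by simp
   then show ?thesis using that by (simp add: P_def cf_cvec N_def)
  qed
  have cfPd: "cf P (n * n + i) = cf d i" if "i < n" for i
   using that by (simp add: P_def cf_cvec N_def)
  have rowP: "row P k = v k" if "k < n" for k
   using cvec_cong[of n "%i. cf P (k * n + i)" "cf (v k)"] cfP[OF that] v that
   by (auto simp: row_def uppertri_def cvec_cf)
  have rowd: "row P n = d"
   using cvec_cong[of n "%i. cf P (n * n + i)" "cf d"] cfPd d
   by (auto simp: row_def cvec_cf)
  have rP: "rows n (row P) x = rows n v x" for x
   unfolding rows_def by (intro cvec_cong) (simp add: rowP)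
  have two: "norm (rows n v x) <= 1" if x: "x \<in> Rn n" "norm x <= rho" for x
  proof -
   have "norm (rows n v x - d) <= 1" "norm (rows n v (- x) - d) <= 1"
    using x rho(2)[of x] rho(2)[of "- x"] Kd by auto
   then have "norm ((rows n v x - d) - (rows n v (- x) - d)) <= 2"
    using norm_triangle_ineq4[of "rows n v x - d" "rows n v (- x) - d"] by linarith
   also have "(rows n v x - d) - (rows n v (- x) - d) = 2 *\<^sub>R rows n v x"
    by (simp add: linear_neg[OF linear_rows] scaleR_2)
   finally show ?thesis by simp
  qed
  have nv: "norm (v k) <= 1 / rho" if "k < n" for k
  proof (rule ball_interior_norm[of _ n])
   show "v k \<in> Rn n" using v that by (auto simp: uppertri_def)
   fix x assume x: "x \<in> Rn n" "norm x <= rho"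
   have "\<bar>v k \<bullet> x\<bar> = \<bar>cf (rows n v x) k\<bar>" using that by (simp add: cf_rows)
   also have "... <= 1" using abs_cf_le_norm[of "rows n v x" k] two[OF x] by simp
   finally show "\<bar>v k \<bullet> x\<bar> <= 1" .
  qed (rule rho(1))
  have "norm d <= 1" using Kd[of 0] rho by (simp add: linear_0[OF linear_rows])
  have "(norm P)^2 = (\<Sum>l<N. (cf P l)^2)"
   using norm_cvec[of N "cf P"] cvec_cf[of P N] by (simp add: P_def)
  also have "... = (\<Sum>l<n*n. (cf P l)^2) + (\<Sum>i<n. (cf P (n * n + i))^2)"
   unfolding N_def by (rule sum_lessThan_add)
  also have "(\<Sum>i<n. (cf P (n * n + i))^2) = (norm d)^2"
   using norm_cvec[of n "cf d"] cvec_cf[OF d] cfPd by simp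
  also have "(\<Sum>l<n*n. (cf P l)^2) = (\<Sum>k<n. \<Sum>i<n. (cf P (k * n + i))^2)"
   by (rule sum_lessThan_mult)
  also have "... = (\<Sum>k<n. (norm (v k))^2)"
  proof (intro sum.cong refl)
   fix k assume "k \<in> {..<n}"
   then have k: "k < n" "cvec n (cf (v k)) = v k" using v cvec_cf[of "v k" n] by (auto simp: uppertri_def)
   have "(\<Sum>i<n. (cf P (k * n + i))^2) = (\<Sum>i<n. (cf (v k) i)^2)"
    using cfP[OF k(1)] by (intro sum.cong) auto
   then show "(\<Sum>i<n. (cf P (k * n + i))^2) = (norm (v k))^2"
    using norm_cvec[of n "cf (v k)"] k(2) by simp
  qed
  also have "... <= (\<Sum>k<n. (1 / rho)^2)" using nv by (intro sum_mono power_mono) auto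
  also have "(norm d)^2 <= 1" using `norm d <= 1` by (simp add: power_le_one)
  finally have "(norm P)^2 <= real n / rho\<^sup>2 + 1" by (simp add: power_divide)
  then have "norm P <= sqrt (real n / rho\<^sup>2 + 1)" by (rule real_le_rsqrt)
  then have "P \<in> S"
   using v Kd by (auto simp: S_def P_def[symmetric] rP rowd cfP uppertri_def) (auto simp: P_def)
  then show ?thesis using cfP by blast
 qed
 obtain R where R: "R > 0" "!!x. x \<in> K ==> norm x <= R" using bdd bounded_pos by metis
 have start: "uppertri n (%k. (1 / R) *\<^sub>R ax k) \<and> cset n K <= cset n (triell n (%k. (1 / R) *\<^sub>R ax k) 0)"
 proof
  show "uppertri n (%k. (1 / R) *\<^sub>R ax k)" using R by (auto simp: uppertri_def cf_ax ax_in_Rn)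
  have "rows n (%k. (1 / R) *\<^sub>R ax k) x = (1 / R) *\<^sub>R x" if "x \<in> Rn n" for x
   using that by (intro fsvec_eqI) (auto simp: cf_rows Rn_def)
  then show "cset n K <= cset n (triell n (%k. (1 / R) *\<^sub>R ax k) 0)"
   using R by (auto simp: cset_def triell_def field_simps)
 qed
 define f where "f P = (\<Prod>k<n. cf P (k * n + k))" for P
 have "S ~= {}" using code[of "%k. (1 / R) *\<^sub>R ax k" 0] start by auto
 moreover have "continuous_on S f" unfolding f_def
  by (intro continuous_intros continuous_on_subset[OF cont_cf]) auto
 ultimately obtain P where P: "P \<in> S" "!!Q. Q \<in> S ==> f Q <= f P"
  using continuous_attains_sup[OF compS] by metis
 have fpos: "f P > 0"
 proof -
  obtain Q where "Q \<in> S" "!!k. k < n ==> cf Q (k * n + k) = 1 / R"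
   using code[of "%k. (1 / R) *\<^sub>R ax k" 0] start by (auto simp: cf_ax)
  then have "f Q > 0" using R by (simp add: f_def)
  then show ?thesis using P(2)[OF `Q \<in> S`] by simp
 qed
 have nz: "cf P (k * n + k) > 0" if "k < n" for k
 proof -
  have "cf P (k * n + k) ~= 0" using fpos that unfolding f_def by (metis finite_lessThan lessThan_iff less_irrefl prod_zero_iff)
  then show ?thesis using P(1) that by (force simp: S_def)
 qed
 have tri: "uppertri n (row P)"
  using P(1) nz by (auto simp: uppertri_def row_def cf_cvec S_def)
 have dP: "row P n \<in> Rn n" by (simp add: row_def)
 have sub: "cset n K <= cset n (triell n (row P) (row P n))"
  using P(1) by (auto simp: cset_def triell_def S_def)
 have volP: "vol n (cset n (triell n (row P) (row P n))) = cvol n {x. norm x <= 1} / f P"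
  using cvol_triell(1)[OF tri dP] by (simp add: cvol_def f_def row_def cf_cvec)
 show ?thesis
 proof (intro exI[of _ "cset n (triell n (row P) (row P n))"] conjI allI impI)
  show "ellipsoid n (cset n (triell n (row P) (row P n)))" by (rule triell_ellipsoid[OF tri dP])
  show "cset n K <= cset n (triell n (row P) (row P n))" by (rule sub)
  fix G assume G: "ellipsoid n G \<and> cset n K <= G"
  then obtain v d where vd: "uppertri n v" "d \<in> Rn n" "G = cset n (triell n v d)"
   using ellipsoid_imp_triell by blast
  then obtain Q where Q: "Q \<in> S" "!!k. k < n ==> cf Q (k * n + k) = cf (v k) k"
   using code[OF vd(1,2)] G by auto
  have "f Q = (\<Prod>k<n. cf (v k) k)" using Q(2) by (simp add: f_def)
  moreover have "f Q > 0" using Q(2) vd(1) by (auto simp: f_def uppertri_def intro!: prod_pos)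
  ultimately show "vol n (cset n (triell n (row P) (row P n))) <= vol n G"
   using cvol_triell(1)[OF vd(1,2)] P(2)[OF Q(1)] volP
   by (auto simp: vd(3) cvol_def[symmetric] intro!: divide_left_mono mult_pos_pos)
 qed
qed

section \<open>Coordinates of an r-norm\<close>

lemma powr_le_imp_le: "a powr r <= b powr r ==> 0 < r ==> 0 <= a ==> 0 <= b ==> a <= (b::real)"
 by (metis linorder_not_le powr_less_mono2)

text \<open>An $r$-norm on $\mathbb R^n$, extended to all sequences by ignoring the coordinates from $n$ on.\<close>
definition crn :: "nat => real => (fsvec => real) => bool" where
 "crn n r nu \<longleftrightarrow> 0 < r \<and> r <= 1 \<and> (\<forall>x. 0 <= nu x) \<and> (\<forall>c x. nu (c *\<^sub>R x) = \<bar>c\<bar> * nu x)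
  \<and> (\<forall>x y. nu (x + y) powr r <= nu x powr r + nu y powr r)
  \<and> (\<forall>x\<in>Rn n. nu x = 0 --> x = 0) \<and> (\<forall>x. nu x = nu (cvec n (cf x)))"

lemma crnD:
 assumes "crn n r nu"
 shows "0 < r" "r <= 1" "0 <= nu x" "nu (c *\<^sub>R x) = \<bar>c\<bar> * nu x" "nu (x + y) powr r <= nu x powr r + nu y powr r"
  "x \<in> Rn n ==> nu x = 0 ==> x = 0" "nu x = nu (cvec n (cf x))"
 using assms unfolding crn_def by blast+

lemma crn_zero: "crn n r nu ==> nu 0 = 0"
 using crnD(4)[of n r nu 0 0] by simp

lemma crn_minus: "crn n r nu ==> nu (- x) = nu x"
 using crnD(4)[of n r nu "-1" x] by simp

lemma crn_sum:
 assumes "crn n r nu" "finite I"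
 shows "nu (\<Sum>i\<in>I. f i) powr r <= (\<Sum>i\<in>I. nu (f i) powr r)"
 using assms(2)
proof (induction I)
 case (insert i I)
 then show ?case using crnD(5)[OF assms(1), of "f i" "sum f I"] by simp
qed (simp add: crn_zero[OF assms(1)])

lemma crn_upper:
 assumes nu: "crn n r nu"
 shows "\<exists>C>0. \<forall>x. nu x <= C * norm x"
proof -
 note r = crnD(1,2)[OF nu]
 define D where "D = 1 + (\<Sum>i<n. nu (ax i) powr r)"
 have D: "D > 0" unfolding D_def by (intro add_pos_nonneg sum_nonneg) auto
 have "nu x <= D powr (1 / r) * norm x" for x
 proof (rule powr_le_imp_le[of _ r])
  have "nu x powr r = nu (comb n ax x) powr r"
   using crnD(7)[OF nu, of x] by (simp add: cvec_def)
  also have "... <= (\<Sum>i<n. nu (cf x i *\<^sub>R ax i) powr r)" by (rule crn_sum[OF nu]) simp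
  also have "... = (\<Sum>i<n. \<bar>cf x i\<bar> powr r * nu (ax i) powr r)"
   by (simp add: crnD(4)[OF nu] powr_mult crnD(3)[OF nu])
  also have "... <= (\<Sum>i<n. norm x powr r * nu (ax i) powr r)"
   using r abs_cf_le_norm by (intro sum_mono mult_right_mono powr_mono2) auto
  also have "... <= norm x powr r * D"
   by (simp add: D_def sum_distrib_left[symmetric] mult_left_mono)
  also have "... = (D powr (1 / r) * norm x) powr r"
   using r D by (simp add: powr_mult powr_powr mult.commute)
  finally show "nu x powr r <= (D powr (1 / r) * norm x) powr r" .
 qed (use r D crnD(3)[OF nu] in auto)
 moreover have "D powr (1 / r) > 0" using D by simp
 ultimately show ?thesis by blast
qed

lemma crn_continuous:
 assumes nu: "crn n r nu"
 shows "continuous_on UNIV nu"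
proof -
 note r = crnD(1,2)[OF nu]
 obtain C where C: "C > 0" "!!x. nu x <= C * norm x" using crn_upper[OF nu] by blast
 have diff: "\<bar>nu x powr r - nu y powr r\<bar> <= (C * norm (x - y)) powr r" for x y
 proof -
  have "nu x powr r <= nu (x - y) powr r + nu y powr r" using crnD(5)[OF nu, of "x - y" y] by simp
  moreover have "nu y powr r <= nu (x - y) powr r + nu x powr r"
   using crnD(5)[OF nu, of "y - x" x] crn_minus[OF nu, of "x - y"] by simp
  moreover have "nu (x - y) powr r <= (C * norm (x - y)) powr r"
   using C(2)[of "x - y"] r crnD(3)[OF nu] by (intro powr_mono2) auto
  ultimately show ?thesis by linarith
 qed
 have 1: "continuous_on UNIV (%x. nu x powr r)"
  unfolding continuous_on_def
 proof
  fix x :: fsvec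
  have "((%y. (C * norm (y - x)) powr r) \<longlongrightarrow> (C * norm (x - x)) powr r) (at x)"
   using r C(1) by (intro tendsto_powr' tendsto_intros) auto
  then have lim0: "((%y. (C * norm (y - x)) powr r) \<longlongrightarrow> 0) (at x)" using r by simp
  have "((%y. nu y powr r - nu x powr r) \<longlongrightarrow> 0) (at x)"
   by (rule Lim_null_comparison[OF _ lim0]) (simp add: diff)
  then show "((%x. nu x powr r) \<longlongrightarrow> nu x powr r) (at x within UNIV)"
   by (rule LIM_zero_cancel)
 qed
 have "continuous_on UNIV (%x. (nu x powr r) powr (1 / r))"
  using r by (intro continuous_on_powr' 1 continuous_on_const) auto
 moreover have "(nu x powr r) powr (1 / r) = nu x" for x
  using r crnD(3)[OF nu, of x] by (simp add: powr_powr)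
 ultimately show ?thesis by simp
qed

lemma crn_lower:
 assumes nu: "crn n r nu"
 shows "\<exists>c>0. \<forall>x\<in>Rn n. c * norm x <= nu x"
proof (cases "n = 0")
 case True
 then have "x = 0" if "x \<in> Rn n" for x using that by (intro fsvec_eqI) (simp add: Rn_def)
 then have "1 * norm x <= nu x" if "x \<in> Rn n" for x using that crn_zero[OF nu] by fastforce
 then show ?thesis by (intro exI[of _ 1]) auto
next
 case False
 let ?S = "(Rn n \<inter> cball 0 1) \<inter> {x. norm x = 1}"
 have "compact ?S"
  by (intro compact_Int_closed compact_Rn_ball closed_Collect_eq continuous_intros)
 moreover have "ax 0 \<in> ?S" using False by (auto simp: ax_in_Rn norm_eq_sqrt_inner cf_ax)
 then have "?S ~= {}" by blast
 moreover have "continuous_on ?S nu" using crn_continuous[OF nu] continuous_on_subset by blast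
 ultimately obtain x where x: "x \<in> ?S" "!!y. y \<in> ?S ==> nu x <= nu y"
  using continuous_attains_inf[of ?S nu] by blast
 have "nu x ~= 0" using x(1) crnD(6)[OF nu, of x] by auto
 then have pos: "nu x > 0" using crnD(3)[OF nu, of x] by linarith
 have "nu x * norm y <= nu y" if y: "y \<in> Rn n" for y
 proof (cases "y = 0")
  case False
  have "nu x <= nu ((1 / norm y) *\<^sub>R y)" using y False by (intro x(2)) auto
  also have "... = nu y / norm y" by (simp add: crnD(4)[OF nu])
  finally show ?thesis using False by (simp add: field_simps)
 qed (simp add: crn_zero[OF nu])
 then show ?thesis using pos by blast
qed

definition cball_of :: "nat => (fsvec => real) => fsvec set" where
 "cball_of n nu = {x \<in> Rn n. nu x <= 1}"

lemma cball_of_props: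
 assumes nu: "crn n r nu"
 shows "cms n (cball_of n nu)" "bounded (cball_of n nu)" "cball_of n nu <= Rn n"
  "\<exists>rho>0. \<forall>x\<in>Rn n. norm x <= rho --> x \<in> cball_of n nu"
proof -
 have "cset n (cball_of n nu) = cset n {x. nu x <= 1}" by (auto simp: cset_def cball_of_def)
 then show "cms n (cball_of n nu)" using cms_le(1)[OF crn_continuous[OF nu], of n 1] by (simp add: cms_def)
 obtain c where c: "c > 0" "!!x. x \<in> Rn n ==> c * norm x <= nu x" using crn_lower[OF nu] by blast
 show "bounded (cball_of n nu)"
 proof (rule boundedI)
  fix x assume "x \<in> cball_of n nu"
  then have "c * norm x <= 1" using c(2)[of x] by (simp add: cball_of_def)
  then show "norm x <= 1 / c" using c(1) by (simp add: field_simps)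
 qed
 show "cball_of n nu <= Rn n" by (auto simp: cball_of_def)
 obtain C where C: "C > 0" "!!x. nu x <= C * norm x" using crn_upper[OF nu] by blast
 have "nu x <= 1" if "norm x <= 1 / C" for x
 proof -
  have "C * norm x <= 1" using that C(1) by (simp add: field_simps)
  then show ?thesis using C(2)[of x] by linarith
 qed
 then show "\<exists>rho>0. \<forall>x\<in>Rn n. norm x <= rho --> x \<in> cball_of n nu"
  using C(1) by (intro exI[of _ "1 / C"]) (auto simp: cball_of_def)
qed

section \<open>Quotients\<close>

lemma r_normD:
 assumes "is_r_norm r p"
 shows "0 < r" "r <= 1" "0 <= p x" "p x = 0 \<longleftrightarrow> x = 0" "p (a *\<^sub>R x) = \<bar>a\<bar> * p x"
  "p (x + y) powr r <= p x powr r + p y powr r"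
 using assms unfolding is_r_norm_def by blast+

lemma quotient_lower:
 assumes "is_r_norm r p" "subspace N" "z \<in> N"
 shows "quotient_qnorm p N x <= p (x + z)"
 unfolding quotient_qnorm_def using assms r_normD(3)[OF assms(1)]
 by (intro cINF_lower bdd_belowI2[where m=0]) auto

lemma quotient_nonneg:
 assumes "is_r_norm r p" "subspace N"
 shows "0 <= quotient_qnorm p N x"
 unfolding quotient_qnorm_def using assms r_normD(3)[OF assms(1)] subspace_0[OF assms(2)]
 by (intro cINF_greatest) auto

lemma quotient_approx:
 assumes p: "is_r_norm r p" and N: "subspace N" and e: "e > 0"
 shows "\<exists>z\<in>N. p (x + z) < quotient_qnorm p N x + e"
proof (rule ccontr)
 assume "\<not> ?thesis"
 then have "quotient_qnorm p N x + e <= quotient_qnorm p N x"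
  unfolding quotient_qnorm_def[of p N x, symmetric]
  by (subst (2) quotient_qnorm_def, intro cINF_greatest) (use subspace_0[OF N] in \<open>auto simp: not_less\<close>)
 then show False using e by simp
qed

lemma quotient_scale:
 assumes p: "is_r_norm r p" and N: "subspace N"
 shows "quotient_qnorm p N (c *\<^sub>R x) = \<bar>c\<bar> * quotient_qnorm p N x"
proof (rule antisym)
 have le: "quotient_qnorm p N (c *\<^sub>R x) <= \<bar>c\<bar> * quotient_qnorm p N x" for c x
 proof (rule field_le_epsilon)
  fix e :: real assume e: "e > 0"
  define e' where "e' = e / (\<bar>c\<bar> + 1)"
  have e': "e' > 0" using e by (simp add: e'_def)
  obtain z where z: "z \<in> N" "p (x + z) < quotient_qnorm p N x + e'" using quotient_approx[OF p N e'] by blast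
  have "quotient_qnorm p N (c *\<^sub>R x) <= p (c *\<^sub>R x + c *\<^sub>R z)"
   using z(1) N by (intro quotient_lower[OF p N]) (auto intro: subspace_scale)
  also have "... = \<bar>c\<bar> * p (x + z)" using r_normD(5)[OF p, of c "x + z"] by (simp add: scaleR_right_distrib)
  also have "... <= \<bar>c\<bar> * (quotient_qnorm p N x + e')" using z(2) by (intro mult_left_mono) auto
  also have "\<bar>c\<bar> * e' <= e" using e by (simp add: e'_def field_simps)
  then have "\<bar>c\<bar> * (quotient_qnorm p N x + e') <= \<bar>c\<bar> * quotient_qnorm p N x + e" by (simp add: distrib_left)
  finally show "quotient_qnorm p N (c *\<^sub>R x) <= \<bar>c\<bar> * quotient_qnorm p N x + e" .
 qed
 show "quotient_qnorm p N (c *\<^sub>R x) <= \<bar>c\<bar> * quotient_qnorm p N x" by (rule le)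
 show "\<bar>c\<bar> * quotient_qnorm p N x <= quotient_qnorm p N (c *\<^sub>R x)"
 proof (cases "c = 0")
  case True
  then show ?thesis using quotient_nonneg[OF p N] by simp
 next
  case False
  have "quotient_qnorm p N x <= \<bar>inverse c\<bar> * quotient_qnorm p N (c *\<^sub>R x)"
   using le[of "inverse c" "c *\<^sub>R x"] False by simp
  then show ?thesis using False by (simp add: abs_inverse field_simps)
 qed
qed

lemma quotient_triangle:
 assumes p: "is_r_norm r p" and N: "subspace N"
 shows "quotient_qnorm p N (x + y) powr r <= quotient_qnorm p N x powr r + quotient_qnorm p N y powr r"
proof (rule tendsto_lowerbound)
 let ?q = "quotient_qnorm p N"
 note r = r_normD(1,2)[OF p]
 show "((%e. (?q x + e) powr r + (?q y + e) powr r) \<longlongrightarrow> ?q x powr r + ?q y powr r) (at_right 0)"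
 proof -
  have t: "((%e. c + e) \<longlongrightarrow> c) (at_right 0)" for c :: real
   using tendsto_add[OF tendsto_const[of c] tendsto_ident_at[of 0 "{0<..}"]] by simp
  have ev: "\<forall>\<^sub>F e in at_right 0. 0 <= ?q x + e" for x
   unfolding eventually_at_filter using quotient_nonneg[OF p N, of x] by (intro always_eventually) auto
  show ?thesis using r by (intro tendsto_add tendsto_powr' t tendsto_const conjI disjI2 impI ev) auto
 qed
 show "\<forall>\<^sub>F e in at_right 0. ?q (x + y) powr r <= (?q x + e) powr r + (?q y + e) powr r"
  unfolding eventually_at_filter
 proof (intro always_eventually allI impI)
  fix e :: real assume "e ~= 0" "e \<in> {0<..}"
  then have e: "e > 0" by simp
  obtain z w where z: "z \<in> N" "p (x + z) < ?q x + e" and w: "w \<in> N" "p (y + w) < ?q y + e"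
   using quotient_approx[OF p N e] by metis
  have "?q (x + y) <= p ((x + z) + (y + w))"
   using quotient_lower[OF p N subspace_add[OF N z(1) w(1)], of "x + y"] by (simp add: add_ac)
  then have "?q (x + y) powr r <= p ((x + z) + (y + w)) powr r"
   using r quotient_nonneg[OF p N] by (intro powr_mono2) auto
  also have "... <= p (x + z) powr r + p (y + w) powr r" by (rule r_normD(6)[OF p])
  also have "... <= (?q x + e) powr r + (?q y + e) powr r"
   using r z(2) w(2) r_normD(3)[OF p] by (intro add_mono powr_mono2) auto
  finally show "?q (x + y) powr r <= (?q x + e) powr r + (?q y + e) powr r" .
 qed
qed simp

lemma quotient_zero:
 assumes p: "is_r_norm r p" and eq: "equivalent_qnorm p" and N: "subspace N" "qclosed N" and x: "quotient_qnorm p N x = 0"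
 shows "x \<in> N"
proof -
 obtain c where c: "c > 0" "!!x. c * qnorm x <= p x" using eq by (auto simp: equivalent_qnorm_def)
 have "\<exists>z\<in>N. p (x + z) < 1 / real (Suc k)" for k
  using quotient_approx[OF p N(1), of "1 / real (Suc k)" x] x by simp
 then obtain z where z: "!!k. z k \<in> N" "!!k. p (x + z k) < 1 / real (Suc k)" by metis
 have b: "qnorm (- z k - x) <= (1 / c) * (1 / real (Suc k))" for k
 proof -
  have "c * qnorm (- z k - x) <= p (- z k - x)" by (rule c)
  also have "- z k - x = - (x + z k)" by simp
  also have "p ... = p (x + z k)" using r_normD(5)[OF p, of "-1" "x + z k"] by (simp del: minus_add_distrib)
  also have "... <= 1 / real (Suc k)" using z(2)[of k] by simp
  finally have "c * qnorm (- (x + z k)) <= 1 / real (Suc k)" .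
  moreover have "q <= (1 / c) * t" if "c * q <= t" for q t using c(1) that by (simp add: field_simps)
  ultimately have "qnorm (- (x + z k)) <= (1 / c) * (1 / real (Suc k))" by blast
  moreover have "- z k - x = - (x + z k)" by simp
  ultimately show ?thesis by (simp only:)
 qed
 have "(%k. (1 / c) * (1 / real (Suc k))) \<longlonglongrightarrow> (1 / c) * 0"
  by (intro tendsto_intros LIMSEQ_Suc[OF lim_1_over_n])
 then have "(%k. qnorm (- z k - x)) \<longlonglongrightarrow> 0"
  unfolding mult_zero_right using b qnorm_ge_zero
  by (intro tendsto_sandwich[OF _ _ tendsto_const[of 0], of "%k. qnorm (- z k - x)" _ "%k. (1 / c) * (1 / real (Suc k))"]
    always_eventually allI) blast+
 moreover have "- z k \<in> N" for k using z(1) N(1) by (rule subspace_neg[rotated])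
 ultimately show ?thesis using N(2)[unfolded qclosed_def, rule_format, of "%k. - z k" x] by simp
qed

lemma lin_map_add: "lin_map n b (%i. x i + y i) = lin_map n b x + lin_map n b y"
 by (simp add: lin_map_def scaleR_left_distrib sum.distrib)

lemma lin_map_scale: "lin_map n b (%i. c * x i) = c *\<^sub>R lin_map n b x"
 by (simp add: lin_map_def scaleR_right.sum)

lemma cf_plus_fun: "cf (x + y) = (%i. cf x i + cf y i)" and cf_scaleR_fun: "cf (c *\<^sub>R x) = (%i. c * cf x i)"
 by (simp_all add: fun_eq_iff)

lemma lin_map_cong: "(!!i. i < n ==> x i = y i) ==> lin_map n b x = lin_map n b y"
 by (simp add: lin_map_def)

definition coord_qnorm :: "('a::real_vector => real) => 'a set => nat => (nat => 'a) => fsvec => real" where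
 "coord_qnorm p N n b x = quotient_qnorm p N (lin_map n b (cf x))"

lemma crn_quotient:
 assumes p: "is_r_norm r p" and eq: "equivalent_qnorm p" and N: "subspace N" "qclosed N" and b: "quotient_basis N n b"
 shows "crn n r (coord_qnorm p N n b)"
 unfolding crn_def
proof (intro conjI allI ballI impI)
 fix x y :: fsvec and c :: real
 show "0 <= coord_qnorm p N n b x" by (simp add: coord_qnorm_def quotient_nonneg[OF p N(1)])
 show "coord_qnorm p N n b (c *\<^sub>R x) = \<bar>c\<bar> * coord_qnorm p N n b x"
  by (simp add: coord_qnorm_def cf_scaleR_fun lin_map_scale quotient_scale[OF p N(1)])
 show "coord_qnorm p N n b (x + y) powr r <= coord_qnorm p N n b x powr r + coord_qnorm p N n b y powr r"
  by (simp add: coord_qnorm_def cf_plus_fun lin_map_add quotient_triangle[OF p N(1)])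
 show "coord_qnorm p N n b x = coord_qnorm p N n b (cvec n (cf x))"
  by (auto simp: coord_qnorm_def cf_cvec intro!: arg_cong[of _ _ "quotient_qnorm p N"] lin_map_cong)
next
 fix x assume x: "x \<in> Rn n" "coord_qnorm p N n b x = 0"
 then have "lin_map n b (cf x) \<in> N" using quotient_zero[OF p eq N] by (simp add: coord_qnorm_def)
 then have "\<forall>i<n. cf x i = 0" using b by (auto simp: quotient_basis_def)
 then show "x = 0" using x(1) by (intro fsvec_eqI) (auto simp: Rn_def not_less[symmetric])
qed (use r_normD(1,2)[OF p] in auto)

lemma outer_volume_ratio_coord:
 "{a \<in> coord_space n. quotient_qnorm p N (lin_map n b a) <= 1} = cset n (cball_of n (coord_qnorm p N n b))"
proof -
 have "quotient_qnorm p N (lin_map n b a) = coord_qnorm p N n b (cvec n a)" for a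
  by (auto simp: coord_qnorm_def cf_cvec intro!: arg_cong[of _ _ "quotient_qnorm p N"] lin_map_cong)
 then show ?thesis by (auto simp: cset_def cball_of_def)
qed

section \<open>Approximation numbers and triangular systems\<close>

definition lmap :: "nat => (nat => 'z::real_vector) => fsvec => 'z" where
 "lmap n u x = lin_map n u (cf x)"

lemma linear_lmap: "linear (lmap n u)"
 by (rule linearI) (simp_all add: lmap_def cf_plus_fun cf_scaleR_fun lin_map_add lin_map_scale)

lemma lmap_cvec: "lmap n u (cvec n a) = lin_map n u a"
 by (auto simp: lmap_def cf_cvec intro!: lin_map_cong)

lemma qdual_apply_sum: "qdual_apply (\<Sum>i\<in>I. f i) x = (\<Sum>i\<in>I. qdual_apply (f i) x)"
 by (induction I rule: infinite_finite_induct) (auto simp: qdual_apply_zero qdual_apply_plus)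

lemma qdual_apply_lmap: "qdual_apply (lmap n u z) xi = z \<bullet> cvec n (%k. qdual_apply (u k) xi)"
 by (simp add: lmap_def lin_map_def qdual_apply_sum qdual_apply_scaleR inner_commute[of z] inner_cvec mult.commute)

lemma op_norm_bdd: "bdd_above ((%x. norm (lin_map n u x)) ` {x. (\<Sum>k<n. (x k)^2) <= 1})"
proof (rule bdd_aboveI2)
 fix x :: "nat => real" assume "x \<in> {x. (\<Sum>k<n. (x k)^2) <= 1}"
 then have x: "norm (cvec n x) <= 1" by (simp add: sq_norm_cvec_le)
 have "\<bar>x k\<bar> <= 1" if "k < n" for k
  using abs_cf_le_norm[of "cvec n x" k] x that by (simp add: cf_cvec)
 then have "norm (lin_map n u x) <= (\<Sum>k<n. 1 * norm (u k))"
  unfolding lin_map_def by (intro order_trans[OF norm_sum] sum_mono) (auto intro!: mult_left_le_one_le)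
 then show "norm (lin_map n u x) <= (\<Sum>k<n. norm (u k))" by simp
qed

lemma op_norm_nonneg: "op_norm n u >= 0"
 unfolding op_norm_def by (rule cSUP_upper2[OF op_norm_bdd, of "%_. 0"]) auto

lemma approx_number_le: "lin_rank n v < k ==> approx_number k n u <= op_norm n (%i. u i - v i)"
 unfolding approx_number_def by (intro cINF_lower bdd_belowI2[where m=0] op_norm_nonneg) auto

text \<open>Subtract from $u$ its restriction to the span of the $w_l$, composed with the orthogonal projection. The rank of the subtracted
part is less than $k$, so the rest still has norm above $\alpha$.\<close>
lemma approx_number_witness:
 fixes u :: "nat => 'z::real_normed_vector" and w :: "nat => fsvec"
 assumes a: "0 < alpha" "alpha < approx_number k n u" and w: "!!l. l < i ==> w l \<in> Rn n" and i: "i < k"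
 shows "\<exists>x\<in>Rn n. norm x = 1 \<and> (\<forall>l<i. x \<bullet> w l = 0) \<and> norm (lmap n u x) > alpha"
proof -
 obtain q m where q: "m <= i" "orthon q m" "span (q ` {..<m}) = span (w ` {..<i})"
  using gram_schmidt[of i w] by blast
 have sub: "span (q ` {..<m}) <= Rn n"
  unfolding q(3) using w by (intro span_minimal subspace_Rn) auto
 define v where "v j = lmap n u (proj q m (ax j))" for j
 have vx: "lin_map n v a = lmap n u (proj q m (cvec n a))" for a
 proof -
  have "lmap n u (proj q m (cvec n a)) = (\<Sum>j<n. a j *\<^sub>R lmap n u (proj q m (ax j)))"
   by (simp add: cvec_def linear_sum[OF linear_proj] linear_scale[OF linear_proj]
     linear_sum[OF linear_lmap] linear_scale[OF linear_lmap])
  then show ?thesis by (simp add: lin_map_def v_def)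
 qed
 have "range (lin_map n v) <= span (lmap n u ` (q ` {..<m}))"
 proof
  fix y assume "y \<in> range (lin_map n v)"
  then obtain b where "y = lmap n u (proj q m (cvec n b))" using vx by auto
  then show "y \<in> span (lmap n u ` (q ` {..<m}))"
   using proj_in_span[of q m "cvec n b"] by (auto simp: linear_span_image[OF linear_lmap])
 qed
 then have "lin_rank n v <= card (lmap n u ` (q ` {..<m}))"
  unfolding lin_rank_def by (rule dim_le_card) auto
 also have "... <= m" using card_image_le[of "{..<m}"] card_image_le[of "q ` {..<m}" "lmap n u"]
  by (metis card_lessThan finite_imageI finite_lessThan le_trans)
 finally have "lin_rank n v < k" using q(1) i by simp
 then have "alpha < op_norm n (%i. u i - v i)" using approx_number_le[of n v k u] a(2) by linarith
 then obtain b where b: "(\<Sum>k<n. (b k)^2) <= 1" "alpha < norm (lin_map n (%i. u i - v i) b)"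
  unfolding op_norm_def by (subst (asm) less_cSUP_iff[OF _ op_norm_bdd]) (auto intro: exI[of _ "%_. 0"])
 define x where "x = cvec n b - proj q m (cvec n b)"
 have "lin_map n (%i. u i - v i) b = lin_map n u b - lin_map n v b"
  by (simp add: lin_map_def scaleR_right_diff_distrib sum_subtractf)
 also have "... = lmap n u x" by (simp add: vx x_def linear_diff[OF linear_lmap] lmap_cvec)
 finally have ux: "norm (lmap n u x) > alpha" using b(2) by simp
 have x0: "x ~= 0" using ux a(1) by (auto simp: linear_0[OF linear_lmap])
 have "norm x <= norm (cvec n b)"
  using proj_pythagoras[OF q(2), of "cvec n b"] unfolding x_def by (simp add: power2_le_imp_le)
 then have nx: "norm x <= 1" using b(1) by (simp add: sq_norm_cvec_le)
 have xR: "x \<in> Rn n" unfolding x_def using sub proj_in_span[of q m "cvec n b"] by auto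
 have orth: "x \<bullet> w l = 0" if "l < i" for l
  unfolding x_def by (rule proj_orth[OF q(2)]) (use that in \<open>auto simp: q(3) intro: span_base\<close>)
 have "alpha < norm (lmap n u x) / norm x"
 proof -
  have "norm (lmap n u x) * norm x <= norm (lmap n u x)" using nx by (simp add: mult_left_le)
  then have "norm (lmap n u x) <= norm (lmap n u x) / norm x" using x0 by (simp add: field_simps)
  then show ?thesis using ux by simp
 qed
 then have "norm (lmap n u (sgn x)) > alpha"
  by (simp add: sgn_div_norm linear_scale[OF linear_lmap] divide_inverse mult.commute)
 moreover have "norm (sgn x) = 1" using x0 by (simp add: norm_sgn)
 moreover have "sgn x \<bullet> w l = 0" if "l < i" for l using orth[OF that] by (simp add: sgn_div_norm)
 ultimately show ?thesis using xR by (intro bexI[of _ "sgn x"]) (auto simp: sgn_div_norm)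
qed

lemma qdual_norm_attain:
 assumes "alpha < norm (f :: 'a::quasi_normed_vector qdual)"
 shows "\<exists>x. qnorm x <= 1 \<and> alpha < qdual_apply f x"
proof -
 have "\<not> (\<forall>x\<in>{x. qnorm x <= 1}. \<bar>qdual_apply f x\<bar> <= alpha)"
 proof
  assume "\<forall>x\<in>{x. qnorm x <= 1}. \<bar>qdual_apply f x\<bar> <= alpha"
  moreover have "{x::'a. qnorm x <= 1} ~= {}" using qnorm_eq_zero[of "0::'a"] by (auto intro!: exI[of _ 0])
  ultimately have "norm f <= alpha" unfolding norm_qdual_def by (intro cSUP_least) auto
  then show False using assms by simp
 qed
 then obtain x where x: "qnorm x <= 1" "alpha < \<bar>qdual_apply f x\<bar>" by auto
 show ?thesis
 proof (cases "qdual_apply f x >= 0")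
  case True
  then show ?thesis using x by auto
 next
  case False
  have "qnorm (- x) = qnorm x" using qnorm_scaleR[of "-1" x] by simp
  moreover have "qdual_apply f (- x) = - qdual_apply f x" by (rule linear_neg[OF linear_qdual])
  ultimately show ?thesis using x False by (intro exI[of _ "- x"]) auto
 qed
qed

text \<open>The next vector has to be orthogonal to the $i$ vectors already chosen and its image has to vanish at the $i$ points already chosen. These are
$2i$ linear conditions, and \<open>approx_number_witness\<close> allows up to $k-1$ of them.\<close>
lemma triangular_system:
 fixes u :: "nat => 'a::quasi_banach qdual"
 assumes p: "is_r_norm r p" and d: "d > 0" "!!x. p x <= d * qnorm x"
  and a: "0 < alpha" "alpha < approx_number k n u"
 shows "2 * i < k + 2 ==> \<exists>x e. orthon x i \<and> (\<forall>l<i. x l \<in> Rn n \<and> p (e l) <= 1 \<and> qdual_apply (lmap n u (x l)) (e l) >= alpha / d)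
  \<and> (\<forall>l<i. \<forall>j<l. qdual_apply (lmap n u (x l)) (e j) = 0)"
proof (induction i)
 case 0
 then show ?case by (auto simp: orthon_def)
next
 case (Suc i)
 then obtain x e where xe: "orthon x i" "!!l. l < i ==> x l \<in> Rn n \<and> p (e l) <= 1 \<and> qdual_apply (lmap n u (x l)) (e l) >= alpha / d"
  "!!l j. l < i ==> j < l ==> qdual_apply (lmap n u (x l)) (e j) = 0"
 proof -
  have "2 * i < k + 2" using Suc.prems by simp
  from Suc.IH[OF this] show ?thesis using that by blast
 qed
 define w where "w l = (if l < i then x l else cvec n (%k. qdual_apply (u k) (e (l - i))))" for l
 have "\<exists>y\<in>Rn n. norm y = 1 \<and> (\<forall>l<2*i. y \<bullet> w l = 0) \<and> norm (lmap n u y) > alpha"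
  using Suc.prems xe(2) by (intro approx_number_witness[OF a]) (auto simp: w_def)
 then obtain y where y: "y \<in> Rn n" "norm y = 1" "!!l. l < 2 * i ==> y \<bullet> w l = 0" "norm (lmap n u y) > alpha" by blast
 obtain z where z: "qnorm z <= 1" "alpha < qdual_apply (lmap n u y) z" using qdual_norm_attain[OF y(4)] by blast
 have yx: "y \<bullet> x l = 0" if "l < i" for l using y(3)[of l] that by (simp add: w_def)
 have ye: "qdual_apply (lmap n u y) (e l) = 0" if "l < i" for l
  using y(3)[of "i + l"] that by (simp add: w_def qdual_apply_lmap)
 have pz: "p ((1 / d) *\<^sub>R z) <= 1"
 proof -
  have "p z <= d * 1" using d z(1) by (intro order_trans[OF d(2)] mult_left_mono) auto
  then show ?thesis using d(1) by (simp add: r_normD(5)[OF p] field_simps)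
 qed
 have fz: "qdual_apply (lmap n u y) ((1 / d) *\<^sub>R z) >= alpha / d"
  using z(2) d(1) by (simp add: linear_scale[OF linear_qdual] divide_right_mono)
 show ?case
 proof (intro exI[of _ "x(i := y)"] exI[of _ "e(i := (1 / d) *\<^sub>R z)"] conjI allI impI)
  show "orthon (x(i := y)) (Suc i)"
   unfolding orthon_def
  proof (intro allI impI)
   fix k l assume "k < Suc i" "l < Suc i"
   moreover have "y \<bullet> y = 1" using y(2) by (simp add: dot_square_norm)
   ultimately show "(x(i := y)) k \<bullet> (x(i := y)) l = (if k = l then 1 else 0)"
    using xe(1) yx yx[THEN trans[OF inner_commute]] by (auto simp: orthon_def less_Suc_eq)
  qed
 next
  fix l assume l: "l < Suc i"
  then show "(x(i := y)) l \<in> Rn n" using xe(2) y(1) by (auto simp: less_Suc_eq)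
  show "p ((e(i := (1 / d) *\<^sub>R z)) l) <= 1" using l xe(2) pz by (auto simp: less_Suc_eq)
  show "alpha / d <= qdual_apply (lmap n u ((x(i := y)) l)) ((e(i := (1 / d) *\<^sub>R z)) l)"
   using l xe(2) fz by (auto simp: less_Suc_eq)
  fix j assume "j < l"
  then show "qdual_apply (lmap n u ((x(i := y)) l)) ((e(i := (1 / d) *\<^sub>R z)) j) = 0"
   using l xe(3) ye by (auto simp: less_Suc_eq)
 qed
qed

section \<open>Weak cotype 2 from bounded volume ratios\<close>

lemma pow4_between: "1 <= m ==> \<exists>j. real m <= 4 ^ j \<and> 4 ^ j <= 4 * real m"
proof -
 assume m: "1 <= m"
 define j where "j = (LEAST j. real m <= 4 ^ j)"
 have ex: "real m <= 4 ^ m" using of_nat_less_two_power[of m, where ?'a = real] power_mono[of "2::real" 4 m] by linarith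
 have 1: "real m <= 4 ^ j" unfolding j_def using ex by (rule LeastI)
 have "4 ^ j <= 4 * real m"
 proof (cases j)
  case 0
  then show ?thesis using m by simp
 next
  case (Suc i)
  then have "\<not> real m <= 4 ^ i" using not_less_Least[of i "%j. real m <= 4 ^ j"] by (simp add: j_def)
  then show ?thesis using Suc by simp
 qed
 then show ?thesis using 1 by blast
qed

lemma ell_norm_gs: "ell_norm n u = sqrt (\<integral>a. (norm (lmap n u (cvec n a)))^2 \<partial>gs n)"
 by (simp add: ell_norm_def gs_def lmap_cvec)

lemma lmap_bound: "\<exists>L\<ge>0. \<forall>x. norm (lmap n (u :: nat => 'z::real_normed_vector) x) <= L * norm x"
proof (intro exI[of _ "\<Sum>k<n. norm (u k)"] conjI allI)
 fix x
 have "norm (lmap n u x) <= (\<Sum>k<n. norm x * norm (u k))"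
  unfolding lmap_def lin_map_def
  by (intro order_trans[OF norm_sum] sum_mono) (auto intro!: mult_right_mono abs_cf_le_norm)
 then show "norm (lmap n u x) <= (\<Sum>k<n. norm (u k)) * norm x" by (simp add: sum_distrib_left mult.commute)
qed (auto intro: sum_nonneg)

lemma lmap_continuous: "continuous_on S (lmap n (u :: nat => 'z::real_normed_vector))"
proof -
 have "continuous_on S (%z. \<Sum>k<n. (z \<bullet> ax k) *\<^sub>R u k)" by (intro continuous_intros)
 then show ?thesis by (simp add: lmap_def[abs_def] lin_map_def)
qed

lemma gs_square_integrable:
 fixes h :: "fsvec => real"
 assumes h: "continuous_on UNIV h" "!!x. \<bar>h x\<bar> <= L * norm x"
 shows "gsquare n h"
proof (rule Bochner_Integration.integrable_bound)
 show "integrable (gs n) (%a. L\<^sup>2 * (norm (cvec n a))^2)" by (intro integrable_mult_right gs_norm_integrable)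
 show "(%a. (h (cvec n a))^2) \<in> borel_measurable (gs n)"
  using measurable_gs[of "%x. (h x)^2" n] h(1) by (auto intro!: continuous_intros)
 have "(h x)^2 <= L\<^sup>2 * (norm x)^2" for x
  using power_mono[OF h(2)[of x], of 2] by (simp add: power_mult_distrib)
 then show "AE a in gs n. norm ((h (cvec n a))^2) <= norm (L\<^sup>2 * (norm (cvec n a))^2)" by simp
qed

lemma vol_ratio_bound:
 assumes K: "cms n K" "bounded K" "K <= Rn n" and rho: "rho > 0" "!!x. x \<in> Rn n ==> norm x <= rho ==> x \<in> K"
 shows "cvol n K > 0" "cvol n K < \<infinity>"
proof -
 have "0 < cvol n {x. norm x < rho}" using rho(1) by (rule cvol_ball_pos)
 also have "... <= cvol n K" using rho(2) by (intro cvol_mono K) auto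
 finally show "cvol n K > 0" .
qed simp

lemma powr_root_le:
 assumes "0 <= x" "x powr (1 / real n) <= C" "n >= 1"
 shows "x <= C ^ n"
proof (cases "x = 0")
 case False
 then have "x = (x powr (1 / real n)) ^ n"
  using assms by (simp add: powr_realpow[symmetric] powr_powr)
 also have "... <= C ^ n" using assms by (intro power_mono) auto
 finally show ?thesis .
next
 case True
 have "0 <= C" using assms(2) powr_ge_zero[of x "1 / real n"] by linarith
 then show ?thesis using True by simp
qed

text \<open>Write the ellipsoid as $|Vx-d|\le1$ with $V$ upper triangular. As it contains $\pm A_i$, we have $|VA_i|\le1$. The $i$-th
coordinate of $VA_i$ is $V_{ii}(A_i)_i$, because $A_i$ vanishes beyond the coordinate $i$; hence $V_{ii}\le1/\beta$.\<close>
lemma ellipsoid_volume_lower: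
 assumes F: "ellipsoid m F" and A: "!!i. i < m ==> A i \<in> Rn m" "!!i. i < m ==> coords m (A i) \<in> F" "!!i. i < m ==> coords m (- A i) \<in> F"
  and tri: "!!i. i < m ==> cf (A i) i >= beta" "!!i j. i < m ==> j < m ==> j > i ==> cf (A i) j = 0" and beta: "beta > 0"
 shows "vol m F >= beta ^ m * cvol m {x. norm x <= 1}"
proof -
 obtain v d where v: "uppertri m v" "d \<in> Rn m" "F = cset m (triell m v d)"
  using ellipsoid_imp_triell[OF F] by blast
 have vii: "cf (v i) i * beta <= 1" and vpos: "cf (v i) i > 0" if i: "i < m" for i
 proof -
  show vp: "cf (v i) i > 0" using v(1) i by (auto simp: uppertri_def)
  have "norm (rows m v (A i) - d) <= 1" "norm (rows m v (- A i) - d) <= 1"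
   using A(1)[OF i] A(2)[OF i] A(3)[OF i] unfolding v(3) by (auto simp: cset_def triell_def cvec_coords)
  then have "norm ((rows m v (A i) - d) - (rows m v (- A i) - d)) <= 2"
   using norm_triangle_ineq4[of "rows m v (A i) - d" "rows m v (- A i) - d"] by linarith
  also have "(rows m v (A i) - d) - (rows m v (- A i) - d) = 2 *\<^sub>R rows m v (A i)"
   by (simp add: linear_neg[OF linear_rows] scaleR_2)
  finally have "\<bar>cf (rows m v (A i)) i\<bar> <= 1" using abs_cf_le_norm[of "rows m v (A i)" i] by simp
  then have "v i \<bullet> A i <= 1" using i by (simp add: cf_rows)
  moreover have "v i \<bullet> A i = (\<Sum>l<m. cf (v i) l * cf (A i) l)"
   using v(1) i by (intro inner_Rn) (auto simp: uppertri_def)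
  moreover have "... = (\<Sum>l\<in>{i}. cf (v i) l * cf (A i) l)"
  proof (rule sum.mono_neutral_right)
   show "\<forall>l\<in>{..<m} - {i}. cf (v i) l * cf (A i) l = 0"
   proof
    fix l assume "l \<in> {..<m} - {i}"
    then consider "l < i" | "l > i" "l < m" by force
    then show "cf (v i) l * cf (A i) l = 0"
     using v(1) i tri(2)[of i l] by cases (auto simp: uppertri_def)
   qed
  qed (use i in auto)
  ultimately have "cf (v i) i * cf (A i) i <= 1" by simp
  moreover have "cf (v i) i * beta <= cf (v i) i * cf (A i) i" using tri(1)[OF i] vp by (intro mult_left_mono) auto
  ultimately show "cf (v i) i * beta <= 1" by linarith
 qed
 have pos: "(\<Prod>k<m. cf (v k) k) > 0" using vpos by (intro prod_pos) auto
 have "(\<Prod>k<m. cf (v k) k) * beta ^ m = (\<Prod>k<m. cf (v k) k * beta)" by (simp add: prod.distrib)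
 also have "... <= 1" using vii vpos beta by (intro prod_le_1) (auto intro!: mult_nonneg_nonneg less_imp_le)
 finally have "beta ^ m <= 1 / (\<Prod>k<m. cf (v k) k)" using pos by (simp add: field_simps)
 then have "beta ^ m * cvol m {x. norm x <= 1} <= 1 / (\<Prod>k<m. cf (v k) k) * cvol m {x. norm x <= 1}"
  by (intro mult_right_mono) auto
 then show ?thesis using cvol_triell(1)[OF v(1,2)] by (simp add: v(3) cvol_def)
qed

text \<open>Take the net of Sudakov's inequality at a scale $2^j$ between $\sqrt m$ and $2\sqrt m$. Its projection is a net of the projected set with $e^{O(m)}$
points and mesh at most $w/\sqrt m$.\<close>
lemma urysohn_projection:
 fixes h :: "fsvec => real"
 assumes h: "continuous_on UNIV h" and int: "gsquare n h"
  and w: "gmean n h <= w\<^sup>2" "w > 0" and nn: "!!x. h x >= 0"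
  and sym: "!!x. h (- x) = h x"
  and K: "K <= Rn n" "!!x z. x \<in> K ==> \<bar>x \<bullet> z\<bar> <= h z" and K0: "0 \<in> K"
  and x: "orthon x m" "m >= 1"
  and L: "!!a. a \<in> Rn m ==> a \<in> L ==> \<exists>y\<in>K. a = 2 *\<^sub>R cvec m (%j. x j \<bullet> y)"
 shows "cvol m L <= (2 * exp 1728 * w / sqrt (real m)) ^ m * cvol m {x. norm x <= 1}"
proof -
 obtain j where j: "real m <= 4 ^ j" "4 ^ j <= 4 * real m" using pow4_between[OF x(2)] by blast
 define t where "t = w / 2 ^ j"
 have t: "t > 0" using w(2) by (simp add: t_def)
 have tw: "t <= w / sqrt (real m)"
 proof -
  have "sqrt (real m) <= sqrt (4 ^ j)" using j(1) by simp
  also have "(4::real) ^ j = (2 ^ j)^2" by (simp add: power2_eq_square flip: power_mult_distrib)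
  then have "sqrt (4 ^ j) = 2 ^ j" by simp
  finally show ?thesis unfolding t_def using w(2) x(2) by (intro divide_left_mono) auto
 qed
 obtain Z where Z: "finite Z" "Z <= K" "real (card Z) <= exp (432 * 4 ^ j)" "!!x. x \<in> K ==> \<exists>z\<in>Z. norm (x - z) <= t"
  using sudakov[OF h int w nn sym K K0, of j] unfolding t_def by blast
 define \<pi> where "\<pi> y = cvec m (%j. x j \<bullet> y)" for y
 have pid: "\<pi> y - \<pi> z = \<pi> (y - z)" for y z
  by (simp add: \<pi>_def cvec_def inner_diff_right scaleR_left_diff_distrib sum_subtractf)
 have pin: "norm (\<pi> y) <= norm y" for y
 proof (rule power2_le_imp_le)
  have "(norm (\<pi> y))^2 = (norm (proj x m y))^2"
   by (simp add: \<pi>_def norm_cvec norm_proj_sq[OF x(1)] inner_commute)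
  then show "(norm (\<pi> y))^2 <= (norm y)^2"
   using norm_proj_le[OF x(1), of y] by (simp add: power_mono)
 qed simp
 let ?B = "{x::fsvec. norm x <= 1}"
 define U where "U z = {x. (1 / (2 * t)) *\<^sub>R (x - 2 *\<^sub>R \<pi> z) \<in> ?B}" for z
 have U_eq: "U z = {x. norm (x - 2 *\<^sub>R \<pi> z) <= 2 * t}" for z
 proof -
  have "norm ((1 / (2 * t)) *\<^sub>R v) <= 1 \<longleftrightarrow> norm v <= 2 * t" for v :: fsvec
   using t by (simp add: field_simps)
  then show ?thesis unfolding U_def mem_Collect_eq by blast
 qed
 have U: "cms m (U z)" "cvol m (U z) = (2 * t) ^ m * cvol m ?B" for z
  unfolding U_def using cvol_scale[OF cms_ball(2), of "2 *\<^sub>R \<pi> z" m "2 * t" 1] t by (auto simp: \<pi>_def)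
 have "cvol m L <= (\<Sum>z\<in>Z. cvol m (U z))"
 proof (rule cvol_UN_le[OF Z(1)])
  show "bounded (U z)" for z
  proof (rule boundedI)
   fix x assume "x \<in> U z"
   then show "norm x <= 2 * t + norm (2 *\<^sub>R \<pi> z)"
    using norm_triangle_sub[of x "2 *\<^sub>R \<pi> z"] by (simp add: U_eq)
  qed
  fix a assume "a \<in> Rn m" "a \<in> L"
  then obtain y where y: "y \<in> K" "a = 2 *\<^sub>R \<pi> y" using L unfolding \<pi>_def by blast
  obtain z where z: "z \<in> Z" "norm (y - z) <= t" using Z(4)[OF y(1)] by blast
  have "norm (a - 2 *\<^sub>R \<pi> z) = 2 * norm (\<pi> (y - z))"
   by (simp add: y(2) pid[symmetric] scaleR_diff_right[symmetric] del: scaleR_diff_right)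
  also have "... <= 2 * t" using pin[of "y - z"] z(2) by simp
  finally show "\<exists>i\<in>Z. a \<in> U i" using z(1) by (auto simp: U_eq)
 qed (rule U)
 also have "... = real (card Z) * ((2 * t) ^ m * cvol m ?B)" by (simp add: U)
 also have "... <= exp 1728 ^ m * ((2 * t) ^ m * cvol m ?B)"
 proof (rule mult_right_mono)
  have "real (card Z) <= exp (432 * 4 ^ j)" by (rule Z(3))
  also have "... <= exp (real m * 1728)" using j(2) by simp
  also have "... = exp 1728 ^ m" by (rule exp_of_nat_mult)
  finally show "real (card Z) <= exp 1728 ^ m" .
 qed (use t in simp)
 also have "... = (exp 1728 * (2 * t)) ^ m * cvol m ?B" by (simp only: power_mult_distrib mult.assoc)
 also have "... <= (2 * exp 1728 * w / sqrt (real m)) ^ m * cvol m ?B"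
 proof (intro mult_right_mono power_mono)
  have "exp 1728 * 2 * t <= exp 1728 * 2 * (w / sqrt (real m))" using tw by (intro mult_left_mono) auto
  then show "exp 1728 * (2 * t) <= 2 * exp 1728 * w / sqrt (real m)" by (simp add: mult_ac)
 qed (use t in auto)
 finally show ?thesis .
qed

lemma triangular_functionals_onto:
 fixes f :: "nat => 'a::quasi_normed_vector qdual"
 assumes "!!i. i < m ==> qdual_apply (f i) (e i) > 0" "!!i j. i < m ==> j < i ==> qdual_apply (f i) (e j) = 0"
 shows "\<exists>xi. \<forall>i<m. qdual_apply (f i) xi = z i"
proof -
 have "\<exists>xi. \<forall>i<m. m - t <= i --> qdual_apply (f i) xi = z i" if "t <= m" for t
  using that
 proof (induction t)
  case (Suc t)
  then obtain xi where xi: "!!i. i < m ==> m - t <= i ==> qdual_apply (f i) xi = z i" by auto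
  define k where "k = m - Suc t"
  have k: "k < m" "Suc k = m - t" using Suc.prems by (auto simp: k_def)
  define c where "c = (z k - qdual_apply (f k) xi) / qdual_apply (f k) (e k)"
  have "qdual_apply (f i) (xi + c *\<^sub>R e k) = z i" if i: "i < m" "k <= i" for i
  proof (cases "i = k")
   case True
   then show ?thesis using assms(1)[OF k(1)]
    by (simp add: linear_add[OF linear_qdual] linear_scale[OF linear_qdual] c_def)
  next
   case False
   then show ?thesis using assms(2)[OF i(1), of k] xi[of i] i k
    by (simp add: linear_add[OF linear_qdual] linear_scale[OF linear_qdual])
  qed
  then show ?case unfolding k_def by blast
 qed auto
 from this[of m] show ?thesis by auto
qed

lemma qclosed_kernel: "qclosed {xi. \<forall>i<m. qdual_apply (f i) xi = 0}"
 unfolding qclosed_def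
proof (intro allI impI, elim conjE, simp only: mem_Collect_eq, intro allI impI)
 fix s and xi :: 'a and i
 assume s: "\<forall>n::nat. \<forall>i<m. qdual_apply (f i) (s n) = 0" and lim: "(%n. qnorm (s n - xi)) \<longlonglongrightarrow> 0" and i: "i < m"
 have "(%n. norm (f i) * qnorm (s n - xi)) \<longlonglongrightarrow> norm (f i) * 0" by (intro tendsto_intros lim)
 moreover have "\<bar>qdual_apply (f i) xi\<bar> <= norm (f i) * qnorm (s n - xi)" for n
  using qdual_le_norm[of "f i" "s n - xi"] s i by (simp add: linear_diff[OF linear_qdual])
 ultimately have "\<bar>qdual_apply (f i) xi\<bar> <= norm (f i) * 0"
  by (intro tendsto_lowerbound[where F=sequentially]) auto
 then show "qdual_apply (f i) xi = 0" by simp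
qed

text \<open>Compare the two volume estimates in the quotient by the common kernel of the functionals $u(x_l)$. These functionals are coordinates on the
quotient.\<close>
lemma weak_cotype_2_of_outer_volume_ratio:
 fixes p :: "'a::quasi_banach => real"
 assumes p: "is_r_norm r p" and eq: "equivalent_qnorm p"
  and C: "!!N n b. subspace N ==> qclosed N ==> quotient_basis N n b ==> quotient_outer_volume_ratio p N n b <= C"
 shows "weak_cotype_2 TYPE('a qdual)"
proof -
 obtain c d where c: "c > 0" "!!x. c * qnorm x <= p x" and d: "d > 0" "!!x. p x <= d * qnorm x"
  using eq by (auto simp: equivalent_qnorm_def)
 define M where "M = d * max C 1 * (2 * exp 1728) * sqrt 2"
 have M: "M > 0" using d by (simp add: M_def)
 have key: "alpha <= M * w / sqrt (real k)"
  if k: "1 <= k" "k <= n" and alpha: "0 < alpha" "alpha < approx_number k n u" and w: "w > ell_norm n u / c"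
  for n k alpha w and u :: "nat => 'a qdual"
 proof -
  \<comment> \<open>the largest length that \<open>triangular_system\<close> allows\<close>
  define m where "m = (k + 1) div 2"
  have m: "m >= 1" "2 * m < k + 2" "k <= 2 * m" using k by (auto simp: m_def)
  obtain x e where xe: "orthon x m" "!!l. l < m ==> x l \<in> Rn n" "!!l. l < m ==> p (e l) <= 1"
   "!!l. l < m ==> qdual_apply (lmap n u (x l)) (e l) >= alpha / d"
   "!!l j. l < m ==> j < l ==> qdual_apply (lmap n u (x l)) (e j) = 0"
   using triangular_system[OF p d alpha m(2)] by blast
  define f where "f l = lmap n u (x l)" for l
  have fpos: "qdual_apply (f l) (e l) > 0" if "l < m" for l
   using xe(4)[OF that] alpha(1) d(1) unfolding f_def by (meson divide_pos_pos less_le_trans)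
  define N where "N = {xi. \<forall>i<m. qdual_apply (f i) xi = 0}"
  have N: "subspace N"
   by (auto simp: N_def subspace_def linear_0[OF linear_qdual] linear_add[OF linear_qdual] linear_scale[OF linear_qdual])
  have Nc: "qclosed N" unfolding N_def by (rule qclosed_kernel)
  have "\<exists>xi. \<forall>i<m. qdual_apply (f i) xi = (if i = j then 1 else 0)" for j
   by (rule triangular_functionals_onto[where e=e]) (use fpos xe(5) in \<open>auto simp: f_def\<close>)
  then obtain b where b: "!!i j. i < m ==> qdual_apply (f i) (b j) = (if i = j then 1 else 0)" by metis
  have fb: "qdual_apply (f i) (lin_map m b a) = a i" if "i < m" for i a
   using that by (simp add: lin_map_def linear_sum[OF linear_qdual] linear_scale[OF linear_qdual] b
     if_distrib[of "%x. _ * x"] cong: if_cong)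
  have coset: "xi - lin_map m b (%i. qdual_apply (f i) xi) \<in> N" for xi
   by (simp add: N_def linear_diff[OF linear_qdual] fb)
  have qb: "quotient_basis N m b"
   unfolding quotient_basis_def
  proof (intro conjI allI impI)
   fix a i assume "lin_map m b a \<in> N" "i < m"
   then show "a i = 0" using fb[of i a] by (simp add: N_def)
  qed (use coset in blast)
  let ?nu = "coord_qnorm p N m b"
  define K where "K = cball_of m ?nu"
  have nu: "crn m r ?nu" by (rule crn_quotient[OF p eq N Nc qb])
  note Kp = cball_of_props[OF nu, folded K_def]
  obtain rho where rho: "rho > 0" "!!x. x \<in> Rn m ==> norm x <= rho ==> x \<in> K" using Kp(4) by blast
  define F where "F = arg_min (vol m) (%F. ellipsoid m F \<and> cset m K <= F)"
  have F: "ellipsoid m F \<and> cset m K <= F"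
  proof -
   let ?P = "%F. ellipsoid m F \<and> cset m K <= F"
   obtain G where G: "?P G" "!!H. ?P H ==> vol m G <= vol m H"
    using minimal_ellipsoid[OF Kp(2) rho Kp(3)] by blast
   show ?thesis unfolding F_def
   proof (rule arg_minI[where P="?P" and Q="?P" and x=G])
    show "?P G" by (rule G(1))
    show "\<not> vol m H < vol m G" if "?P H" for H using G(2)[OF that] by linarith
   qed
  qed
  have qv: "quotient_outer_volume_ratio p N m b = (vol m F / cvol m K) powr (1 / real m)"
   unfolding quotient_outer_volume_ratio_def outer_volume_ratio_def Let_def outer_volume_ratio_coord F_def K_def cvol_def ..
  have Kpos: "cvol m K > 0" by (rule vol_ratio_bound(1)[OF Kp(1-3) rho])
  have "vol m F / cvol m K <= max C 1 ^ m"
   using C[OF N Nc qb] m(1) Kpos unfolding qv by (intro powr_root_le) (auto simp: vol_def)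
  then have vF: "vol m F <= max C 1 ^ m * cvol m K" using Kpos by (simp add: divide_le_eq)
  \<comment> \<open>the points $e_i$ in the coordinates of the quotient\<close>
  define A where "A i = cvec m (%j. qdual_apply (f j) (e i))" for i
  have AK: "A i \<in> K" "- A i \<in> K" if "i < m" for i
  proof -
   have "?nu (A i) = quotient_qnorm p N (lin_map m b (%j. qdual_apply (f j) (e i)))"
    unfolding coord_qnorm_def A_def
    by (intro arg_cong[of _ _ "quotient_qnorm p N"] lin_map_cong) (simp add: cf_cvec)
   also have "... <= p (lin_map m b (%j. qdual_apply (f j) (e i)) + (e i - lin_map m b (%j. qdual_apply (f j) (e i))))"
    by (rule quotient_lower[OF p N coset])
   also have "... <= 1" using xe(3)[OF that] by simp
   finally show "A i \<in> K" "- A i \<in> K" by (auto simp: K_def cball_of_def A_def crn_minus[OF nu])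
  qed
  have "(alpha / d) ^ m * cvol m {x. norm x <= 1} <= vol m F"
  proof (rule ellipsoid_volume_lower[where A=A])
   show "coords m (A i) \<in> F" "coords m (- A i) \<in> F" if "i < m" for i
   proof -
    have "cvec m (coords m (A i)) = A i" "cvec m (coords m (- A i)) = - A i"
     using AK[OF that] Kp(3) by (auto intro: cvec_coords)
    then have "coords m (A i) \<in> cset m K" "coords m (- A i) \<in> cset m K"
     using AK[OF that] by (simp_all add: cset_def)
    then show "coords m (A i) \<in> F" "coords m (- A i) \<in> F" using F by blast+
   qed
  qed (use F xe(4,5) alpha d in \<open>auto simp: A_def cf_cvec f_def\<close>)
  also note vF
  also have "cvol m K <= (2 * exp 1728 * w / sqrt (real m)) ^ m * cvol m {x. norm x <= 1}"
  proof (rule urysohn_projection[where h="%z. norm (lmap n u z) / c" and n=n and K="{cvec n (%k. qdual_apply (u k) xi) |xi. p xi <= 1}" and x=x])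
   obtain L where L: "L >= 0" "!!z. norm (lmap n u z) <= L * norm z" using lmap_bound[of n u] by blast
   show cont: "continuous_on UNIV (%z. norm (lmap n u z) / c)"
    using c(1) by (intro continuous_intros lmap_continuous) auto
   show "integrable (gs n) (%a. (norm (lmap n u (cvec n a)) / c)^2)"
    using L c(1) by (intro gs_square_integrable[OF cont, of "L / c"]) (simp add: divide_right_mono)
   have ell0: "ell_norm n u >= 0" by (simp add: ell_norm_gs)
   show w0: "w > 0" using w ell0 c(1) by (meson divide_nonneg_pos le_less_trans)
   have "(\<integral>a. (norm (lmap n u (cvec n a)) / c)^2 \<partial>gs n) = (ell_norm n u / c)^2"
    by (simp add: ell_norm_gs power_divide)
   also have "... <= w\<^sup>2" using w ell0 c(1) by (intro power_mono) auto
   finally show "(\<integral>a. (norm (lmap n u (cvec n a)) / c)^2 \<partial>gs n) <= w\<^sup>2" .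
   show "\<bar>y \<bullet> z\<bar> <= norm (lmap n u z) / c" if yK: "y \<in> {cvec n (%k. qdual_apply (u k) xi) |xi. p xi <= 1}" for y z
   proof -
    obtain xi where xi: "y = cvec n (%k. qdual_apply (u k) xi)" "p xi <= 1" using yK by blast
    have "c * qnorm xi <= 1" using c(2)[of xi] xi(2) by linarith
    then have q: "qnorm xi <= 1 / c" using c(1) by (simp add: field_simps)
    have "\<bar>y \<bullet> z\<bar> = \<bar>qdual_apply (lmap n u z) xi\<bar>" by (simp add: xi(1) qdual_apply_lmap inner_commute)
    also have "... <= norm (lmap n u z) * qnorm xi" by (rule qdual_le_norm)
    also have "... <= norm (lmap n u z) * (1 / c)" using q by (intro mult_left_mono) auto
    finally show ?thesis by simp
   qed
   show "0 \<in> {cvec n (%k. qdual_apply (u k) xi) |xi. p xi <= 1}"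
    using r_normD(4)[OF p, of 0] by (auto simp: linear_0[OF linear_qdual] cvec_def intro!: exI[of _ 0])
   fix a assume "a \<in> Rn m" "a \<in> K"
   then have aR: "a \<in> Rn m" and na: "quotient_qnorm p N (lin_map m b (cf a)) <= 1"
    by (auto simp: K_def cball_of_def coord_qnorm_def)
   obtain z where z: "z \<in> N" "p (lin_map m b (cf a) + z) < quotient_qnorm p N (lin_map m b (cf a)) + 1"
    using quotient_approx[OF p N, of 1] by auto
   define xi where "xi = (1 / 2) *\<^sub>R (lin_map m b (cf a) + z)"
   have "p xi <= 1" using z(2) na unfolding xi_def r_normD(5)[OF p] by simp
   moreover have "a = 2 *\<^sub>R cvec m (%j. x j \<bullet> cvec n (%k. qdual_apply (u k) xi))"
   proof (rule fsvec_eqI)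
    fix j
    have "2 * qdual_apply (f j) xi = cf a j" if "j < m"
     using z(1) that by (simp add: xi_def linear_scale[OF linear_qdual] linear_add[OF linear_qdual] fb N_def)
    then show "cf a j = cf (2 *\<^sub>R cvec m (%j. x j \<bullet> cvec n (%k. qdual_apply (u k) xi))) j"
     using aR by (auto simp: cf_cvec qdual_apply_lmap[symmetric] f_def[symmetric] Rn_def)
   qed
   ultimately show "\<exists>y\<in>{cvec n (%k. qdual_apply (u k) xi) |xi. p xi <= 1}. a = 2 *\<^sub>R cvec m (%j. x j \<bullet> y)" by blast
  qed (use xe m(1) c(1) in \<open>auto simp: linear_neg[OF linear_lmap]\<close>)
  finally have "(alpha / d) ^ m * cvol m {x. norm x <= 1}
   <= max C 1 ^ m * ((2 * exp 1728 * w / sqrt (real m)) ^ m * cvol m {x. norm x <= 1})"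
   by (simp add: mult_left_mono)
  moreover have "cvol m {x. norm x <= 1} > 0"
   using cvol_ball_pos[of 1 m] cvol_mono[OF cms_ball(2)[of m 1] bounded_norm_ball(2), of "{x. norm x < 1}"] by force
  ultimately have "(alpha / d) ^ m <= (max C 1 * (2 * exp 1728 * w / sqrt (real m))) ^ m"
   unfolding power_mult_distrib[of "max C 1"] by (simp add: mult.assoc[symmetric])
  moreover have w0: "w >= 0"
  proof -
   have "ell_norm n u / c >= 0" using c(1) by (simp add: ell_norm_gs)
   then show ?thesis using w by linarith
  qed
  ultimately have "alpha / d <= max C 1 * (2 * exp 1728 * w / sqrt (real m))"
   using m(1) by (intro power_le_imp_le_base[of "alpha / d" "m - 1"]) auto
  then have "alpha <= d * (max C 1 * (2 * exp 1728 * w / sqrt (real m)))"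
   using d(1) by (simp add: divide_le_eq mult.commute)
  also have "... = d * max C 1 * (2 * exp 1728) * w * (1 / sqrt (real m))" by simp
  also have "1 / sqrt (real m) <= sqrt 2 / sqrt (real k)"
  proof -
   have "sqrt (real k) <= sqrt (2 * real m)" using m(3) by (simp flip: of_nat_mult)
   then show ?thesis using k(1) m(1) by (simp add: real_sqrt_mult field_simps)
  qed
  then have "d * max C 1 * (2 * exp 1728) * w * (1 / sqrt (real m)) <= d * max C 1 * (2 * exp 1728) * w * (sqrt 2 / sqrt (real k))"
   using d w0 by (intro mult_left_mono) auto
  finally show ?thesis by (simp add: M_def mult_ac)
 qed
 have "approx_number k n u <= (M / c) * real k powr (- 1 / 2) * ell_norm n u"
  if k: "1 <= k \<and> k <= n" for n k and u :: "nat => 'a qdual"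
 proof -
  have kp: "real k powr (- 1 / 2) = 1 / sqrt (real k)"
   using k by (simp add: powr_minus_divide powr_half_sqrt)
  have ell0: "ell_norm n u >= 0" by (simp add: ell_norm_gs)
  have *: "alpha <= (M / c) * real k powr (- 1 / 2) * ell_norm n u" if alpha: "0 < alpha" "alpha < approx_number k n u" for alpha
  proof -
   have "alpha * sqrt (real k) / M <= w" if "ell_norm n u / c < w" for w
    using key[OF _ _ alpha that] k M by (simp add: field_simps)
   then have "alpha * sqrt (real k) / M <= ell_norm n u / c" by (rule dense_ge)
   then show ?thesis unfolding kp using M c(1) k by (simp add: field_simps)
  qed
  show ?thesis
  proof (rule dense_le)
   fix alpha assume a: "alpha < approx_number k n u"
   have "(M / c) * real k powr (- 1 / 2) * ell_norm n u >= 0"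
    by (rule mult_nonneg_nonneg[OF mult_nonneg_nonneg[OF divide_nonneg_nonneg[OF less_imp_le[OF M] less_imp_le[OF c(1)]] powr_ge_zero] ell0])
   then show "alpha <= (M / c) * real k powr (- 1 / 2) * ell_norm n u"
    using *[OF _ a] by linarith
  qed
 qed
 then show ?thesis unfolding weak_cotype_2_def by blast
qed

section \<open>Functions on the discrete cube\<close>

definition sg :: "'i => 'i set => real" where
 "sg j S = (if j \<in> S then -1 else 1)"

definition walsh :: "'i set => 'i set => real" where
 "walsh T S = (\<Prod>j\<in>T. sg j S)"

definition wcoeff :: "'i set => ('i set => 'v::real_vector) => 'i set => 'v" where
 "wcoeff J Phi T = (\<Sum>S\<in>Pow J. (walsh T S / 2 ^ card J) *\<^sub>R Phi S)"

definition multiplier :: "'i set => ('i set => real) => ('i set => 'v::real_vector) => 'i set => 'v" where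
 "multiplier J theta Phi S = (\<Sum>T\<in>Pow J. (theta T * walsh T S) *\<^sub>R wcoeff J Phi T)"

lemma prod_one_plus: "finite J ==> (\<Prod>j\<in>J. 1 + f j) = (\<Sum>T\<in>Pow J. \<Prod>j\<in>T. f j :: real)"
 using prod_add[of J "%_. 1" f]
 by (simp add: prod.neutral_const) (metis (no_types, lifting) add.commute prod.cong prod_add sum.cong mult.right_neutral prod.neutral_const)

lemma walsh_kernel:
 assumes "finite J"
 shows "(\<Sum>T\<in>Pow J. rho ^ card T * walsh T S * walsh T S') = (\<Prod>j\<in>J. 1 + rho * sg j S * sg j S')"
proof -
 have "(\<Prod>j\<in>J. 1 + rho * sg j S * sg j S') = (\<Sum>T\<in>Pow J. \<Prod>j\<in>T. rho * sg j S * sg j S')"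
  by (rule prod_one_plus[OF assms])
 also have "... = (\<Sum>T\<in>Pow J. rho ^ card T * walsh T S * walsh T S')"
  by (simp add: prod.distrib walsh_def)
 finally show ?thesis by simp
qed

lemma sg_sq: "sg j S * sg j S = 1"
 by (simp add: sg_def)

lemma walsh_complete:
 assumes J: "finite J" and S: "S <= J" "S' <= J"
 shows "(\<Sum>T\<in>Pow J. walsh T S * walsh T S') = (if S = S' then 2 ^ card J else 0)"
proof (cases "S = S'")
 case True
 then show ?thesis using walsh_kernel[OF J, of 1 S S'] by (simp add: sg_sq)
next
 case False
 then obtain j where j: "(j \<in> S) ~= (j \<in> S')" by blast
 then have "j \<in> J" "sg j S * sg j S' = -1" using S by (auto simp: sg_def)
 then have "(\<Prod>j\<in>J. 1 + 1 * sg j S * sg j S') = 0" using J by (intro prod_zero bexI[of _ j]) auto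
 then show ?thesis using walsh_kernel[OF J, of 1 S S'] False by simp
qed

lemma walsh_empty: "walsh {} S = 1"
 by (simp add: walsh_def)

lemma walsh_sym: "finite T ==> finite S ==> walsh T S = walsh S T"
proof -
 have "walsh T S = (-1) ^ card (T \<inter> S)" if "finite T" for T S :: "'a set"
 proof -
  have "walsh T S = (\<Prod>j\<in>T. if j \<in> S then -1 else 1)" by (simp add: walsh_def sg_def)
  also have "... = (\<Prod>j\<in>T \<inter> S. -1)" by (rule prod.inter_restrict[OF that, symmetric])
  finally show ?thesis by simp
 qed
 then show "finite T ==> finite S ==> walsh T S = walsh S T" by (metis Int_commute)
qed

lemma walsh_orth:
 assumes J: "finite J" and T: "T <= J" "T' <= J"
 shows "(\<Sum>S\<in>Pow J. walsh T S * walsh T' S) = (if T = T' then 2 ^ card J else 0)"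
proof -
 have "(\<Sum>S\<in>Pow J. walsh T S * walsh T' S) = (\<Sum>S\<in>Pow J. walsh S T * walsh S T')"
  using J T by (intro sum.cong) (auto simp: walsh_sym finite_subset)
 then show ?thesis using walsh_complete[OF J T] by simp
qed

lemma multiplier_id:
 assumes J: "finite J" and S: "S <= J"
 shows "multiplier J (%_. 1) Phi S = Phi S"
proof -
 have "multiplier J (%_. 1) Phi S = (\<Sum>T\<in>Pow J. \<Sum>S'\<in>Pow J. (walsh T S * walsh T S' / 2 ^ card J) *\<^sub>R Phi S')"
  by (simp add: multiplier_def wcoeff_def scaleR_sum_right)
 also have "... = (\<Sum>S'\<in>Pow J. \<Sum>T\<in>Pow J. (walsh T S * walsh T S' / 2 ^ card J) *\<^sub>R Phi S')"
  by (rule sum.swap)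
 also have "... = (\<Sum>S'\<in>Pow J. ((\<Sum>T\<in>Pow J. walsh T S * walsh T S') / 2 ^ card J) *\<^sub>R Phi S')"
  by (simp add: scaleR_sum_left sum_divide_distrib)
 also have "... = (\<Sum>S'\<in>Pow J. (if S' = S then Phi S' else 0))"
  using S by (intro sum.cong) (auto simp: walsh_complete[OF J])
 also have "... = Phi S" using J S by (simp add: sum.delta)
 finally show ?thesis .
qed

lemma multiplier_parseval:
 fixes Phi :: "'i set => 'v::real_inner"
 assumes J: "finite J"
 shows "(\<Sum>S\<in>Pow J. (norm (multiplier J theta Phi S))^2) = 2 ^ card J * (\<Sum>T\<in>Pow J. (theta T)^2 * (norm (wcoeff J Phi T))^2)"
proof -
 let ?c = "%T. theta T *\<^sub>R wcoeff J Phi T"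
 have m: "multiplier J theta Phi S = (\<Sum>T\<in>Pow J. walsh T S *\<^sub>R ?c T)" for S
  by (simp add: multiplier_def mult.commute)
 have "(\<Sum>S\<in>Pow J. (norm (multiplier J theta Phi S))^2)
  = (\<Sum>S\<in>Pow J. \<Sum>T\<in>Pow J. \<Sum>T'\<in>Pow J. (walsh T S * walsh T' S) * (?c T \<bullet> ?c T'))"
  unfolding m power2_norm_eq_inner inner_sum_left inner_sum_right
  by (intro sum.cong refl) (simp add: inner_commute)
 also have "... = (\<Sum>T\<in>Pow J. \<Sum>S\<in>Pow J. \<Sum>T'\<in>Pow J. (walsh T S * walsh T' S) * (?c T \<bullet> ?c T'))"
  by (rule sum.swap)
 also have "... = (\<Sum>T\<in>Pow J. \<Sum>T'\<in>Pow J. \<Sum>S\<in>Pow J. (walsh T S * walsh T' S) * (?c T \<bullet> ?c T'))"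
  by (intro sum.cong refl sum.swap)
 also have "... = (\<Sum>T\<in>Pow J. \<Sum>T'\<in>Pow J. (if T = T' then 2 ^ card J else 0) * (?c T \<bullet> ?c T'))"
  by (intro sum.cong refl) (simp add: sum_distrib_right[symmetric] walsh_orth[OF J])
 also have "... = (\<Sum>T\<in>Pow J. 2 ^ card J * (?c T \<bullet> ?c T))"
  using J by (intro sum.cong refl) (simp add: if_distrib[of "%x. x * _"] sum.delta cong: if_cong)
 also have "... = 2 ^ card J * (\<Sum>T\<in>Pow J. (theta T)^2 * (norm (wcoeff J Phi T))^2)"
  unfolding sum_distrib_left power2_norm_eq_inner by (intro sum.cong refl) (simp add: power2_eq_square mult_ac)
 finally show ?thesis .
qed

lemma multiplier_hilbert:
 fixes Phi :: "'i set => 'v::real_inner"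
 assumes J: "finite J" and theta: "!!T. T <= J ==> \<bar>theta T\<bar> <= e" and e: "e >= 0"
 shows "L2_set (%S. norm (multiplier J theta Phi S)) (Pow J) <= e * L2_set (%S. norm (Phi S)) (Pow J)"
proof -
 have "(\<Sum>S\<in>Pow J. (norm (multiplier J theta Phi S))^2) <= 2 ^ card J * (\<Sum>T\<in>Pow J. e\<^sup>2 * (norm (wcoeff J Phi T))^2)"
  unfolding multiplier_parseval[OF J]
 proof (intro mult_left_mono sum_mono mult_right_mono)
  fix T assume "T \<in> Pow J"
  then show "(theta T)^2 <= e\<^sup>2" using power_mono[OF theta[of T], of 2] by simp
 qed auto
 also have "... = e\<^sup>2 * (\<Sum>S\<in>Pow J. (norm (multiplier J (%_. 1) Phi S))^2)"
  unfolding multiplier_parseval[OF J] by (simp add: sum_distrib_left mult_ac)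
 also have "... = e\<^sup>2 * (\<Sum>S\<in>Pow J. (norm (Phi S))^2)"
  by (simp add: multiplier_id[OF J])
 finally have "L2_set (%S. norm (multiplier J theta Phi S)) (Pow J) <= sqrt (e\<^sup>2 * (\<Sum>S\<in>Pow J. (norm (Phi S))^2))"
  unfolding L2_set_def by (rule real_sqrt_le_mono)
 then show ?thesis using e by (simp add: L2_set_def real_sqrt_mult)
qed

definition seminorm :: "('v::real_vector => real) => bool" where
 "seminorm N \<longleftrightarrow> (\<forall>x y. N (x + y) <= N x + N y) \<and> (\<forall>c x. N (c *\<^sub>R x) = \<bar>c\<bar> * N x)"

lemma seminormD:
 assumes "seminorm N"
 shows "N (x + y) <= N x + N y" "N (c *\<^sub>R x) = \<bar>c\<bar> * N x"
 using assms by (auto simp: seminorm_def)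

lemma seminorm_zero [simp]: "seminorm N ==> N 0 = 0"
 using seminormD(2)[of N 0 0] by simp

lemma seminorm_minus: "seminorm N ==> N (- x) = N x"
 using seminormD(2)[of N "-1" x] by simp

lemma seminorm_nonneg: "seminorm N ==> 0 <= N x"
 using seminormD(1)[of N x "- x"] seminorm_minus[of N x] by simp

lemma seminorm_diff: "seminorm N ==> N (x - y) <= N x + N y"
 using seminormD(1)[of N x "- y"] seminorm_minus[of N y] by simp

lemma seminorm_sum: "seminorm N ==> N (\<Sum>i\<in>I. f i) <= (\<Sum>i\<in>I. N (f i))"
proof (induction I rule: infinite_finite_induct)
 case (insert i I)
 then show ?case using seminormD(1)[of N "f i" "sum f I"] by simp
qed auto

lemma L2_set_seminorm_sum:
 assumes "seminorm N" "finite I"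
 shows "L2_set (%S. N (\<Sum>i\<in>I. f i S)) A <= (\<Sum>i\<in>I. L2_set (%S. N (f i S)) A)"
 using assms(2)
proof (induction I)
 case (insert i I)
 have "L2_set (%S. N (\<Sum>i\<in>insert i I. f i S)) A <= L2_set (%S. N (f i S) + N (\<Sum>i\<in>I. f i S)) A"
  using insert seminormD(1)[OF assms(1)] seminorm_nonneg[OF assms(1)] by (intro L2_set_mono) auto
 also have "... <= L2_set (%S. N (f i S)) A + L2_set (%S. N (\<Sum>i\<in>I. f i S)) A"
  by (rule L2_set_triangle_ineq)
 finally show ?case using insert by simp
qed (simp add: assms(1) L2_set_def)

text \<open>For $|\rho|\le1$ the multiplier $\rho^{|T|}$ has the nonnegative symmetric kernel $\prod_j(1+\rho\,\varepsilon_j\varepsilon_j')$ of mean 1. It is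
an averaging operator, hence a contraction in mean square for every seminorm.\<close>
lemma noise_contraction:
 fixes N :: "'v::real_vector => real"
 assumes J: "finite J" and N: "seminorm N" and rho: "\<bar>rho\<bar> <= 1"
 shows "L2_set (%S. N (multiplier J (%T. rho ^ card T) Phi S)) (Pow J) <= L2_set (%S. N (Phi S)) (Pow J)"
proof -
 define kappa where "kappa S S' = (\<Prod>j\<in>J. 1 + rho * sg j S * sg j S') / 2 ^ card J" for S S'
 have kappa0: "kappa S S' >= 0" for S S'
  unfolding kappa_def using rho by (intro divide_nonneg_pos prod_nonneg) (auto simp: sg_def abs_le_iff)
 have kappasym: "kappa S S' = kappa S' S" for S S' by (simp add: kappa_def mult_ac)
 have kappa1: "(\<Sum>S'\<in>Pow J. kappa S S') = 1" for S
 proof -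
  have "(\<Sum>S'\<in>Pow J. kappa S S') = (\<Sum>S'\<in>Pow J. \<Sum>T\<in>Pow J. rho ^ card T * walsh T S * walsh T S') / 2 ^ card J"
   by (simp add: kappa_def walsh_kernel[OF J] sum_divide_distrib)
  also have "(\<Sum>S'\<in>Pow J. \<Sum>T\<in>Pow J. rho ^ card T * walsh T S * walsh T S')
   = (\<Sum>T\<in>Pow J. rho ^ card T * walsh T S * (\<Sum>S'\<in>Pow J. walsh T S' * walsh {} S'))"
   by (subst sum.swap) (simp add: sum_distrib_left walsh_empty)
  also have "... = (\<Sum>T\<in>Pow J. if T = {} then 2 ^ card J else 0)"
  proof (intro sum.cong refl)
   fix T assume "T \<in> Pow J"
   then show "rho ^ card T * walsh T S * (\<Sum>S'\<in>Pow J. walsh T S' * walsh {} S') = (if T = {} then 2 ^ card J else 0)"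
    using walsh_orth[OF J, of T "{}"] by (cases "T = {}") (simp_all only: if_True if_False walsh_empty card.empty power_0 mult_1 mult_zero_right Pow_iff empty_subsetI refl)
  qed
  also have "... = 2 ^ card J" using J by (simp add: sum.delta)
  finally show ?thesis by simp
 qed
 have rep: "multiplier J (%T. rho ^ card T) Phi S = (\<Sum>S'\<in>Pow J. kappa S S' *\<^sub>R Phi S')" for S
 proof -
  have "multiplier J (%T. rho ^ card T) Phi S = (\<Sum>T\<in>Pow J. \<Sum>S'\<in>Pow J. (rho ^ card T * walsh T S * walsh T S' / 2 ^ card J) *\<^sub>R Phi S')"
   by (simp add: multiplier_def wcoeff_def scaleR_sum_right)
  also have "... = (\<Sum>S'\<in>Pow J. \<Sum>T\<in>Pow J. (rho ^ card T * walsh T S * walsh T S' / 2 ^ card J) *\<^sub>R Phi S')"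
   by (rule sum.swap)
  also have "... = (\<Sum>S'\<in>Pow J. kappa S S' *\<^sub>R Phi S')"
   unfolding kappa_def walsh_kernel[OF J, symmetric] by (simp add: scaleR_sum_left sum_divide_distrib)
  finally show ?thesis .
 qed
 have sq: "(N (\<Sum>S'\<in>Pow J. kappa S S' *\<^sub>R Phi S'))^2 <= (\<Sum>S'\<in>Pow J. kappa S S' * (N (Phi S'))^2)" for S
 proof -
  have "N (\<Sum>S'\<in>Pow J. kappa S S' *\<^sub>R Phi S') <= (\<Sum>S'\<in>Pow J. kappa S S' * N (Phi S'))"
   using seminorm_sum[OF N, of "%S'. kappa S S' *\<^sub>R Phi S'" "Pow J"] by (simp add: seminormD(2)[OF N] kappa0)
  then have "(N (\<Sum>S'\<in>Pow J. kappa S S' *\<^sub>R Phi S'))^2 <= (\<Sum>S'\<in>Pow J. kappa S S' * N (Phi S'))^2"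
   by (intro power_mono seminorm_nonneg[OF N])
  also have "... = (\<Sum>S'\<in>Pow J. sqrt (kappa S S') * (sqrt (kappa S S') * N (Phi S')))^2"
   by (simp add: kappa0 mult.assoc[symmetric])
  also have "... <= (\<Sum>S'\<in>Pow J. (sqrt (kappa S S'))^2) * (\<Sum>S'\<in>Pow J. (sqrt (kappa S S') * N (Phi S'))^2)"
   by (rule Cauchy_Schwarz_ineq_sum)
  also have "... = (\<Sum>S'\<in>Pow J. kappa S S' * (N (Phi S'))^2)"
   by (simp add: kappa0 kappa1 power_mult_distrib)
  finally show ?thesis .
 qed
 have "(\<Sum>S\<in>Pow J. (N (\<Sum>S'\<in>Pow J. kappa S S' *\<^sub>R Phi S'))^2) <= (\<Sum>S\<in>Pow J. \<Sum>S'\<in>Pow J. kappa S S' * (N (Phi S'))^2)"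
  by (intro sum_mono sq)
 also have "... = (\<Sum>S'\<in>Pow J. (\<Sum>S\<in>Pow J. kappa S' S) * (N (Phi S'))^2)"
  by (subst sum.swap) (simp add: sum_distrib_right kappasym)
 also have "... = (\<Sum>S'\<in>Pow J. (N (Phi S'))^2)" by (simp add: kappa1)
 finally show ?thesis by (simp add: rep L2_set_def)
qed

text \<open>Induction on the degree: the weights for the nodes $t_l$ and $t_l/2$ are combined so that the power \<open>Suc (Suc m)\<close> drops out while the
first power keeps its value.\<close>
lemma interpolation_weights:
 "\<exists>L (c :: nat => real) t. (\<forall>l<L. \<bar>t l\<bar> <= 1) \<and> (\<forall>j\<le>Suc m. (\<Sum>l<L. c l * t l ^ j) = (if j = 1 then 1 else 0))"
proof (induction m)
 case 0
 show ?case
  by (rule exI[of _ "2::nat"], rule exI[of _ "%l. if l = 0 then 1/2 else - 1/2"], rule exI[of _ "%l. if l = 0 then 1 else - 1"])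
    (auto simp: numeral_2_eq_2 le_Suc_eq)
next
 case (Suc m)
 then obtain L and c t :: "nat => real" where L: "!!l. l < L ==> \<bar>t l\<bar> <= 1" "!!j. j <= Suc m ==> (\<Sum>l<L. c l * t l ^ j) = (if j = 1 then 1 else 0)"
  by blast
 define q :: real where "q = (1 / 2) ^ Suc (Suc m)"
 have q: "q < 1 / 2"
  using power_strict_decreasing[of 1 "Suc (Suc m)" "1/2::real"] by (simp add: q_def)
 define beta where "beta = 1 / (1 / 2 - q)"
 define alpha where "alpha = 1 - beta / 2"
 have ab: "alpha + beta * q = 0"
  using q by (simp add: alpha_def beta_def field_simps)
 define c' where "c' l = (if l < L then alpha * c l else beta * c (l - L))" for l
 define t' where "t' l = (if l < L then t l else t (l - L) / 2)" for l
 have s: "(\<Sum>l<L + L. c' l * t' l ^ j) = (alpha + beta * (1 / 2) ^ j) * (\<Sum>l<L. c l * t l ^ j)" for j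
 proof -
  have "(\<Sum>l<L + L. c' l * t' l ^ j) = (\<Sum>l<L. alpha * (c l * t l ^ j)) + (\<Sum>l<L. beta * (1 / 2) ^ j * (c l * t l ^ j))"
   unfolding sum_lessThan_add by (simp add: c'_def t'_def power_divide mult_ac)
  then show ?thesis by (simp add: sum_distrib_left[symmetric] distrib_right)
 qed
 show ?case
 proof (rule exI[of _ "L + L"], rule exI[of _ c'], rule exI[of _ t'], intro conjI allI impI)
  fix l assume l: "l < L + L"
  show "\<bar>t' l\<bar> <= 1"
  proof (cases "l < L")
   case False
   then have "l - L < L" using l by linarith
   then show ?thesis using L(1)[of "l - L"] False by (simp add: t'_def)
  qed (use L(1) in \<open>simp add: t'_def\<close>)
 next
  fix j assume j: "j <= Suc (Suc m)"
  show "(\<Sum>l<L + L. c' l * t' l ^ j) = (if j = 1 then 1 else 0)"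
  proof (cases "j = Suc (Suc m)")
   case True
   then show ?thesis unfolding s using ab by (simp add: q_def)
  next
   case False
   then show ?thesis unfolding s using j L(2)[of j] by (simp add: alpha_def)
  qed
 qed
qed

definition level1 :: "'i set => ('i set => 'v::real_vector) => 'i set => 'v" where
 "level1 J Phi S = (\<Sum>j\<in>J. sg j S *\<^sub>R wcoeff J Phi {j})"

lemma level1_multiplier:
 assumes "finite J"
 shows "level1 J Phi S = multiplier J (%T. if card T = 1 then 1 else 0) Phi S"
proof -
 have "multiplier J (%T. if card T = 1 then 1 else 0) Phi S
  = (\<Sum>T\<in>{T\<in>Pow J. card T = 1}. walsh T S *\<^sub>R wcoeff J Phi T)"
  unfolding multiplier_def using assms by (intro sum.mono_neutral_cong_right) auto
 also have "{T\<in>Pow J. card T = 1} = (%j. {j}) ` J" by (auto simp: card_1_singleton_iff)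
 also have "(\<Sum>T\<in>(%j. {j}) ` J. walsh T S *\<^sub>R wcoeff J Phi T) = level1 J Phi S"
  by (subst sum.reindex) (auto simp: level1_def walsh_def inj_on_def)
 finally show ?thesis by simp
qed

lemma multiplier_linear_sum:
 "(\<Sum>l\<in>L. c l *\<^sub>R multiplier J (theta l) Phi S) = multiplier J (%T. \<Sum>l\<in>L. c l * theta l T) Phi S"
proof -
 have "(\<Sum>l\<in>L. c l *\<^sub>R multiplier J (theta l) Phi S) = (\<Sum>l\<in>L. \<Sum>T\<in>Pow J. (c l * theta l T * walsh T S) *\<^sub>R wcoeff J Phi T)"
  by (simp add: multiplier_def scaleR_sum_right mult.assoc)
 also have "... = multiplier J (%T. \<Sum>l\<in>L. c l * theta l T) Phi S"
  unfolding multiplier_def by (subst sum.swap) (simp add: scaleR_sum_left sum_distrib_right)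
 finally show ?thesis .
qed

lemma multiplier_comp_linear:
 assumes "linear M"
 shows "M (multiplier J theta Phi S) = multiplier J theta (%S. M (Phi S)) S"
 by (simp add: multiplier_def wcoeff_def linear_sum[OF assms] linear_scale[OF assms])

text \<open>Weights as in \<open>interpolation_weights\<close> express $\eta$ times the projection to level one as a combination of noise operators and a
multiplier bounded by a multiple of $\eta^{m+1}$. The noise operators are contractions for $N$; the multiplier is estimated in the Hilbertian norm, which costs a factor of $A$.
With $\eta=A^{-1/(m+1)}$ both parts are bounded, and dividing by $\eta$ gives the power of $A$.\<close>
lemma level1_bound:
 assumes m: "m >= 1"
 shows "\<exists>W>0. \<forall>(J :: 'i set) (N :: 'v::real_vector => real) (M :: 'v => 'w::real_inner) A Phi.
  finite J --> seminorm N --> linear M --> A >= 1 --> (\<forall>x. norm (M x) <= N x \<and> N x <= A * norm (M x)) -->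
  L2_set (%S. N (level1 J Phi S)) (Pow J) <= W * A powr (1 / real (m + 1)) * L2_set (%S. N (Phi S)) (Pow J)"
proof -
 obtain k where k: "m = Suc k" using m by (cases m) auto
 obtain L and c t :: "nat => real" where L: "!!l. l < L ==> \<bar>t l\<bar> <= 1"
  "!!j. j <= m ==> (\<Sum>l<L. c l * t l ^ j) = (if j = 1 then 1 else 0)"
  using interpolation_weights[of k] unfolding k by blast
 define W where "W = (\<Sum>l<L. \<bar>c l\<bar>) + 1"
 have W: "W > 0" unfolding W_def by (intro add_nonneg_pos sum_nonneg) auto
 have "L2_set (%S. N (level1 J Phi S)) (Pow J) <= 2 * W * A powr (1 / real (m + 1)) * L2_set (%S. N (Phi S)) (Pow J)"
  if J: "finite J" and N: "seminorm N" and M: "linear M" and A: "A >= 1"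
   and cmp: "!!x. norm (M x) <= N x" "!!x. N x <= A * norm (M x)"
  for J :: "'i set" and N :: "'v => real" and M :: "'v => 'w" and A Phi
 proof -
  define eta where "eta = A powr (- 1 / real (m + 1))"
  have eta: "0 < eta" "eta <= 1" "A * eta ^ (m + 1) = 1"
  proof -
   show "0 < eta" using A by (simp add: eta_def)
   have "A powr (- 1 / real (m + 1)) <= A powr 0" using A by (intro powr_mono) (auto simp: divide_le_0_iff)
   then show "eta <= 1" using A by (simp add: eta_def)
   have "eta ^ (m + 1) = A powr (- 1)"
    using A by (simp add: eta_def powr_realpow[symmetric] powr_powr del: power_Suc)
   then show "A * eta ^ (m + 1) = 1" using A by (simp add: powr_minus)
  qed
  define n2 where "n2 = L2_set (%S. N (Phi S)) (Pow J)"
  have n2: "n2 >= 0" by (simp add: n2_def L2_set_nonneg)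
  define theta where "theta T = eta * (if card T = 1 then 1 else 0) - (\<Sum>l<L. c l * (eta * t l) ^ card T)" for T :: "'i set"
  have theta: "\<bar>theta T\<bar> <= eta ^ (m + 1) * W" for T
  proof (cases "card T <= m")
   case True
   have "(\<Sum>l<L. c l * (eta * t l) ^ card T) = eta ^ card T * (\<Sum>l<L. c l * t l ^ card T)"
    by (simp add: sum_distrib_left power_mult_distrib mult_ac)
   then have "theta T = 0" using L(2)[OF True] by (simp add: theta_def)
   then show ?thesis using W eta by simp
  next
   case False
   then have "card T ~= 1" using m by auto
   then have "\<bar>theta T\<bar> <= (\<Sum>l<L. \<bar>c l\<bar> * \<bar>eta * t l\<bar> ^ card T)"
    unfolding theta_def by (simp add: abs_mult power_abs) (intro order_trans[OF sum_abs] sum_mono, simp add: abs_mult power_abs)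
   also have "... <= (\<Sum>l<L. \<bar>c l\<bar> * eta ^ (m + 1))"
   proof (intro sum_mono mult_left_mono)
    fix l assume "l \<in> {..<L}"
    then have "\<bar>eta * t l\<bar> <= eta" using L(1)[of l] eta by (simp add: abs_mult mult_left_le)
    then have "\<bar>eta * t l\<bar> ^ card T <= eta ^ card T" by (intro power_mono) auto
    also have "... <= eta ^ (m + 1)" using False eta by (intro power_decreasing) auto
    finally show "\<bar>eta * t l\<bar> ^ card T <= eta ^ (m + 1)" .
   qed auto
   also have "... <= eta ^ (m + 1) * W"
    using eta by (simp add: W_def sum_distrib_right[symmetric] mult.commute mult_left_mono)
   finally show ?thesis .
  qed
  have split: "eta *\<^sub>R level1 J Phi S = (\<Sum>l<L. c l *\<^sub>R multiplier J (%T. (eta * t l) ^ card T) Phi S) + multiplier J theta Phi S" for S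
  proof -
   have "multiplier J theta Phi S + multiplier J (%T. \<Sum>l<L. c l * (eta * t l) ^ card T) Phi S
    = multiplier J (%T. eta * (if card T = 1 then 1 else 0)) Phi S"
    unfolding multiplier_def sum.distrib[symmetric] theta_def
    by (intro sum.cong refl) (simp add: scaleR_left_distrib[symmetric] distrib_right[symmetric])
   also have "... = eta *\<^sub>R level1 J Phi S"
    unfolding level1_multiplier[OF J] multiplier_def scaleR_sum_right by (intro sum.cong refl) simp
   finally show ?thesis by (simp add: multiplier_linear_sum add.commute)
  qed
  have "eta * L2_set (%S. N (level1 J Phi S)) (Pow J) = L2_set (%S. N (eta *\<^sub>R level1 J Phi S)) (Pow J)"
   using eta by (simp add: seminormD(2)[OF N] L2_set_right_distrib)
  also have "... <= L2_set (%S. N (\<Sum>l<L. c l *\<^sub>R multiplier J (%T. (eta * t l) ^ card T) Phi S) + N (multiplier J theta Phi S)) (Pow J)"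
   unfolding split using seminormD(1)[OF N] seminorm_nonneg[OF N] by (intro L2_set_mono) auto
  also have "... <= L2_set (%S. N (\<Sum>l<L. c l *\<^sub>R multiplier J (%T. (eta * t l) ^ card T) Phi S)) (Pow J)
    + L2_set (%S. N (multiplier J theta Phi S)) (Pow J)"
   by (rule L2_set_triangle_ineq)
  also have "L2_set (%S. N (\<Sum>l<L. c l *\<^sub>R multiplier J (%T. (eta * t l) ^ card T) Phi S)) (Pow J)
   <= (\<Sum>l<L. L2_set (%S. N (c l *\<^sub>R multiplier J (%T. (eta * t l) ^ card T) Phi S)) (Pow J))"
   by (rule L2_set_seminorm_sum[OF N]) simp
  also have "... <= (\<Sum>l<L. \<bar>c l\<bar> * n2)"
  proof (rule sum_mono)
   fix l assume l: "l \<in> {..<L}"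
   have "\<bar>eta * t l\<bar> <= 1" using L(1)[of l] l eta by (simp add: abs_mult mult_le_one)
   from noise_contraction[OF J N this, of Phi]
   show "L2_set (%S. N (c l *\<^sub>R multiplier J (%T. (eta * t l) ^ card T) Phi S)) (Pow J) <= \<bar>c l\<bar> * n2"
    by (simp add: seminormD(2)[OF N] L2_set_right_distrib[symmetric] n2_def mult_left_mono)
  qed
  also have "... <= W * n2" using n2 by (simp add: W_def sum_distrib_right[symmetric] mult_right_mono)
  also have "L2_set (%S. N (multiplier J theta Phi S)) (Pow J) <= L2_set (%S. A * norm (multiplier J theta (%S. M (Phi S)) S)) (Pow J)"
   using cmp(2) seminorm_nonneg[OF N] by (intro L2_set_mono) (auto simp: multiplier_comp_linear[OF M, symmetric])
  also have "... = A * L2_set (%S. norm (multiplier J theta (%S. M (Phi S)) S)) (Pow J)"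
   using A by (simp add: L2_set_right_distrib)
  also have "... <= A * (eta ^ (m + 1) * W * L2_set (%S. norm (M (Phi S))) (Pow J))"
   using theta W eta A by (intro mult_left_mono multiplier_hilbert[OF J]) auto
  also have "... = W * L2_set (%S. norm (M (Phi S))) (Pow J)"
   using eta(3) by (simp add: mult.assoc[symmetric])
  also have "... <= W * n2"
   unfolding n2_def using W cmp(1) by (intro mult_left_mono L2_set_mono) auto
  finally have "eta * L2_set (%S. N (level1 J Phi S)) (Pow J) <= 2 * W * n2" by simp
  then have "L2_set (%S. N (level1 J Phi S)) (Pow J) <= 2 * W * n2 / eta" using eta by (simp add: pos_le_divide_eq mult.commute)
  also have "... = 2 * W * A powr (1 / real (m + 1)) * n2"
   using A by (simp add: eta_def powr_minus divide_inverse mult_ac)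
  finally show ?thesis by (simp add: n2_def)
 qed
 then show ?thesis using W by (intro exI[of _ "2 * W"]) auto
qed

lemma L2_integral_triangle:
 fixes f g :: "'a => real"
 assumes f: "integrable M (%x. (f x)^2)" "f \<in> borel_measurable M" and g: "integrable M (%x. (g x)^2)" "g \<in> borel_measurable M"
 shows "integrable M (%x. (f x + g x)^2)"
  and "sqrt (\<integral>x. (f x + g x)^2 \<partial>M) <= sqrt (\<integral>x. (f x)^2 \<partial>M) + sqrt (\<integral>x. (g x)^2 \<partial>M)"
proof -
 have pw: "(x + y)^2 <= (1 + t) * x\<^sup>2 + (1 + 1 / t) * y\<^sup>2" if "t > 0" for x y t :: real
 proof -
  have "0 <= (sqrt t * x - y / sqrt t)^2" by simp
  also have "... = t * x\<^sup>2 - 2 * x * y + y\<^sup>2 / t"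
   using that by (simp add: power2_diff power_mult_distrib power_divide)
  finally show ?thesis by (simp add: power2_sum algebra_simps)
 qed
 show int: "integrable M (%x. (f x + g x)^2)"
 proof (rule Bochner_Integration.integrable_bound)
  show "integrable M (%x. 2 * (f x)^2 + 2 * (g x)^2)" using f g by auto
  show "(%x. (f x + g x)^2) \<in> borel_measurable M" using f(2) g(2) by measurable
  have "(f x + g x)^2 <= 2 * (f x)^2 + 2 * (g x)^2" for x using pw[of 1 "f x" "g x"] by simp
  then show "AE x in M. norm ((f x + g x)^2) <= norm (2 * (f x)^2 + 2 * (g x)^2)" by simp
 qed
 define a b where "a = sqrt (\<integral>x. (f x)^2 \<partial>M)" and "b = sqrt (\<integral>x. (g x)^2 \<partial>M)"
 have ab: "a >= 0" "b >= 0" "a\<^sup>2 = (\<integral>x. (f x)^2 \<partial>M)" "b\<^sup>2 = (\<integral>x. (g x)^2 \<partial>M)"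
  by (simp_all add: a_def b_def)
 have "sqrt (\<integral>x. (f x + g x)^2 \<partial>M) <= a + b"
 proof (rule field_le_epsilon)
  fix e0 :: real assume "e0 > 0"
  define e where "e = e0 / 2"
  have e: "e > 0" using `e0 > 0` by (simp add: e_def)
  define t where "t = (b + e) / (a + e)"
  have t: "t > 0" using ab e by (simp add: t_def add_nonneg_pos)
  have "(\<integral>x. (f x + g x)^2 \<partial>M) <= (\<integral>x. (1 + t) * (f x)^2 + (1 + 1 / t) * (g x)^2 \<partial>M)"
   using f g int pw[OF t] by (intro integral_mono) auto
  also have "... = (1 + t) * a\<^sup>2 + (1 + 1 / t) * b\<^sup>2"
   using f g by (simp add: ab)
  also have "... <= (1 + t) * (a + e)^2 + (1 + 1 / t) * (b + e)^2"
   using ab e t by (intro add_mono mult_left_mono power_mono) auto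
  also have "... = ((a + e) + (b + e))^2"
  proof -
   define x y where "x = a + e" and "y = b + e"
   have "x > 0" "y > 0" using ab e by (simp_all add: x_def y_def add_nonneg_pos)
   then have "(1 + y / x) * x\<^sup>2 + (1 + 1 / (y / x)) * y\<^sup>2 = (x + y)^2"
    by (simp add: power2_eq_square field_simps)
   then show ?thesis unfolding t_def x_def y_def .
  qed
  also have "(a + e) + (b + e) = a + b + e0" by (simp add: e_def)
  finally have "sqrt (\<integral>x. (f x + g x)^2 \<partial>M) <= sqrt ((a + b + e0)^2)" by (rule real_sqrt_le_mono)
  then show "sqrt (\<integral>x. (f x + g x)^2 \<partial>M) <= a + b + e0" using ab `e0 > 0` by simp
 qed
 then show "sqrt (\<integral>x. (f x + g x)^2 \<partial>M) <= sqrt (\<integral>x. (f x)^2 \<partial>M) + sqrt (\<integral>x. (g x)^2 \<partial>M)"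
  by (simp add: a_def b_def)
qed

section \<open>Normalised sums of signs\<close>

definition signsum :: "nat => nat set => real" where
 "signsum M T = (\<Sum>k<M. sg k T) / sqrt (real M)"

definition sign_law :: "nat => real measure" where
 "sign_law M = distr (measure_pmf (pmf_of_set (Pow {..<M}))) borel (signsum M)"

lemma real_distribution_sign_law: "real_distribution (sign_law M)"
 unfolding sign_law_def by (intro prob_space.real_distribution_distr measure_pmf.prob_space_axioms) auto

lemma finite_set_cube: "finite J ==> finite (set_pmf (pmf_of_set (Pow J)))"
 by (subst set_pmf_of_set) auto

lemma integral_cube: "finite J ==> (\<integral>T. f T \<partial>measure_pmf (pmf_of_set (Pow J))) = (\<Sum>T\<in>Pow J. f T) / 2 ^ card J"
 for f :: "'i set => real"
 by (subst integral_pmf_of_set) (auto simp: card_Pow)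

lemma integral_sign_law:
 assumes "f \<in> borel_measurable borel"
 shows "(\<integral>x. f x \<partial>sign_law M) = (\<Sum>T\<in>Pow {..<M}. f (signsum M T)) / (2 ^ M :: real)"
 unfolding sign_law_def using assms
 by (subst integral_distr) (auto simp: integral_cube)

lemma integrable_sign_law: "f \<in> borel_measurable borel ==> integrable (sign_law M) (f :: real => real)"
 unfolding sign_law_def
 by (subst integrable_distr_eq) (auto intro!: integrable_measure_pmf_finite finite_set_cube)

lemma char_sign_law: "char (sign_law M) t = complex_of_real (cos (t / sqrt (real M)) ^ M)"
proof -
 let ?s = "t / sqrt (real M)"
 have "char (sign_law M) t = (\<integral>T. iexp (t * signsum M T) \<partial>measure_pmf (pmf_of_set (Pow {..<M})))"
  unfolding char_def sign_law_def by (subst integral_distr) auto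
 also have "... = (\<Sum>T\<in>Pow {..<M}. iexp (t * signsum M T)) / 2 ^ M"
  by (subst integral_measure_pmf[where A="Pow {..<M}"])
   (use pmf_of_set[of "Pow {..<M}"] set_pmf_of_set[of "Pow {..<M}"] Pow_not_empty[of "{..<M}"] in
    \<open>auto simp: card_Pow scaleR_conv_of_real sum_divide_distrib indicator_def intro!: sum.cong\<close>)
 also have "(\<Sum>T\<in>Pow {..<M}. iexp (t * signsum M T)) = (\<Sum>T\<in>Pow {..<M}. (\<Prod>k\<in>T. iexp (- ?s)) * (\<Prod>k\<in>{..<M} - T. iexp ?s))"
 proof (intro sum.cong refl)
  fix T assume T: "T \<in> Pow {..<M}"
  have "t * signsum M T = (\<Sum>k<M. ?s * sg k T)" by (simp add: signsum_def sum_distrib_left sum_divide_distrib)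
  then have "iexp (t * signsum M T) = (\<Prod>k<M. iexp (?s * sg k T))"
   by (simp add: exp_sum sum_distrib_left)
  also have "... = (\<Prod>k\<in>T. iexp (?s * sg k T)) * (\<Prod>k\<in>{..<M} - T. iexp (?s * sg k T))"
   using T prod.subset_diff[of T "{..<M}" "%k. iexp (?s * sg k T)"] by (simp add: mult.commute)
  also have "(\<Prod>k\<in>T. iexp (?s * sg k T)) = (\<Prod>k\<in>T. iexp (- ?s))"
   by (intro prod.cong) (auto simp: sg_def)
  also have "(\<Prod>k\<in>{..<M} - T. iexp (?s * sg k T)) = (\<Prod>k\<in>{..<M} - T. iexp ?s)"
   by (intro prod.cong) (auto simp: sg_def)
  finally show "iexp (t * signsum M T) = (\<Prod>k\<in>T. iexp (- ?s)) * (\<Prod>k\<in>{..<M} - T. iexp ?s)" .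
 qed
 also have "... = (\<Prod>k<M. iexp (- ?s) + iexp ?s)" by (rule prod_add[symmetric]) simp
 also have "iexp (- ?s) + iexp ?s = 2 * complex_of_real (cos ?s)"
  by (simp add: cos_of_real[symmetric] cos_exp_eq)
 finally show ?thesis by (simp add: power_mult_distrib)
qed

lemma cos_power_limit: "(%M. cos (t / sqrt (real M)) ^ M) \<longlonglongrightarrow> exp (- (t\<^sup>2) / 2)"
proof -
 have *: "(%M. cos (s / sqrt (real M)) ^ M) \<longlonglongrightarrow> exp (- (s * s) / 2)" if "s > 0" for s
  using that by real_asymp
 show ?thesis
 proof (cases "t = 0")
  case False
  have "cos (\<bar>t\<bar> / sqrt (real M)) = cos (t / sqrt (real M))" for M
   by (cases "t >= 0") auto
  then show ?thesis using *[of "\<bar>t\<bar>"] False by (simp add: power2_eq_square)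
 qed simp
qed

text \<open>By Levy's and Skorohod's theorems the normalised sums can be realised so as to converge almost surely to a Gaussian variable. As all second
moments are 1, Fatou's lemma for $2Y^2+2Z^2-(Y-Z)^2\ge0$ yields convergence in mean square.\<close>
lemma clt_coupling:
 assumes delta: "delta > 0"
 shows "\<exists>M\<ge>1. \<exists>(Omega :: real measure) Y Z. prob_space Omega \<and> Y \<in> borel_measurable Omega \<and> Z \<in> borel_measurable Omega \<and>
  distr Omega borel Y = sign_law M \<and> distr Omega borel Z = std_normal_distribution \<and>
  integrable Omega (%x. (Y x - Z x)^2) \<and> (\<integral>x. (Y x - Z x)^2 \<partial>Omega) <= delta"
proof -
 have conv: "weak_conv_m sign_law std_normal_distribution"
 proof (rule levy_continuity)
  show "(%M. char (sign_law M) t) \<longlonglongrightarrow> char std_normal_distribution t" for t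
   unfolding char_sign_law char_std_normal_distribution by (intro tendsto_of_real cos_power_limit)
 qed (auto intro: real_distribution_sign_law real_dist_normal_dist)
 obtain Omega :: "real measure" and Y Z where Omega: "prob_space Omega" "!!M. Y M \<in> borel_measurable Omega" "!!M. distr Omega borel (Y M) = sign_law M"
  "Z \<in> borel_measurable Omega" "distr Omega borel Z = std_normal_distribution" "!!x. x \<in> space Omega ==> (%M. Y M x) \<longlonglongrightarrow> Z x"
 proof -
  have "\<exists>(Omega :: real measure) (Y_seq :: nat => real => real) (Y :: real => real).
   prob_space Omega \<and> (\<forall>n. Y_seq n \<in> measurable Omega borel) \<and> (\<forall>n. distr Omega borel (Y_seq n) = sign_law n) \<and>
   Y \<in> measurable Omega lborel \<and> distr Omega borel Y = std_normal_distribution \<and>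
   (\<forall>x \<in> space Omega. (%n. Y_seq n x) \<longlonglongrightarrow> Y x)"
   by (intro Skorohod real_distribution_sign_law real_dist_normal_dist conv)
  then obtain Omega :: "real measure" and Y_seq Y where "prob_space Omega" "\<forall>n. Y_seq n \<in> measurable Omega borel"
   "\<forall>n. distr Omega borel (Y_seq n) = sign_law n" "Y \<in> measurable Omega lborel"
   "distr Omega borel Y = std_normal_distribution" "\<forall>x \<in> space Omega. (%n. Y_seq n x) \<longlonglongrightarrow> Y x" by blast
  then show ?thesis by (intro that[of Omega Y_seq Y]) auto
 qed
 interpret prob_space Omega by (rule Omega(1))
 note [measurable] = Omega(2,4)
 have iY: "integrable Omega (%x. (Y M x)^2)" for M
  using integrable_sign_law[of "%x. x\<^sup>2" M] integrable_distr_eq[OF Omega(2), of "%x. x\<^sup>2" M] Omega(3) by simp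
 have iZ: "integrable Omega (%x. (Z x)^2)"
  using integrable_std_normal_distribution_moment[of 2] integrable_distr_eq[OF Omega(4), of "%x. x\<^sup>2"] Omega(5) by simp
 have vZ: "(\<integral>x. (Z x)^2 \<partial>Omega) = 1"
 proof -
  have "(\<integral>x. (Z x)^2 \<partial>Omega) = (\<integral>x. x\<^sup>2 \<partial>std_normal_distribution)"
   unfolding Omega(5)[symmetric] by (subst integral_distr) auto
  then show ?thesis using std_normal_distribution_even_moments(1)[of 1] by (simp add: fact_numeral)
 qed
 have vY: "(\<integral>x. (Y M x)^2 \<partial>Omega) = 1" if "M >= 1" for M
 proof -
  have "(\<integral>x. (Y M x)^2 \<partial>Omega) = (\<integral>x. x\<^sup>2 \<partial>sign_law M)"
   unfolding Omega(3)[symmetric] by (subst integral_distr) auto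
  also have "... = (\<Sum>T\<in>Pow {..<M}. (signsum M T)^2) / 2 ^ M"
   by (rule integral_sign_law) auto
  also have "(\<Sum>T\<in>Pow {..<M}. (signsum M T)^2) = (\<Sum>T\<in>Pow {..<M}. \<Sum>i<M. \<Sum>j<M. walsh {i} T * walsh {j} T) / real M"
   by (simp add: signsum_def power_divide walsh_def sum_divide_distrib) (simp add: power2_eq_square sum_product)
  also have "(\<Sum>T\<in>Pow {..<M}. \<Sum>i<M. \<Sum>j<M. walsh {i} T * walsh {j} T) = (\<Sum>i<M. \<Sum>T\<in>Pow {..<M}. \<Sum>j<M. walsh {i} T * walsh {j} T)"
   by (rule sum.swap)
  also have "... = (\<Sum>i<M. \<Sum>j<M. \<Sum>T\<in>Pow {..<M}. walsh {i} T * walsh {j} T)"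
   by (intro sum.cong refl sum.swap)
  also have "... = (\<Sum>i<M. \<Sum>j<M. if i = j then 2 ^ M else 0)"
   by (intro sum.cong refl) (simp add: walsh_orth)
  also have "... = real M * 2 ^ M" by simp
  finally show ?thesis using that by simp
 qed
 have "\<exists>M\<ge>1. (\<integral>x. (Y M x - Z x)^2 \<partial>Omega) <= delta"
 proof (rule ccontr)
  assume "\<not> ?thesis"
  then have c: "delta <= (\<integral>x. (Y M x - Z x)^2 \<partial>Omega)" if "M >= 1" for M using that by force
  have imn: "integrable Omega (%x. (Y M x - Z x)^2)" for M
   using L2_integral_triangle(1)[OF iY[of M] Omega(2), of "%x. - Z x"] iZ by simp
  have ipl: "integrable Omega (%x. (Y M x + Z x)^2)" for M
   using L2_integral_triangle(1)[OF iY[of M] Omega(2) iZ] by simp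
  have par: "(\<integral>x. (Y M x + Z x)^2 \<partial>Omega) + (\<integral>x. (Y M x - Z x)^2 \<partial>Omega) = 2 * (\<integral>x. (Y M x)^2 \<partial>Omega) + 2 * (\<integral>x. (Z x)^2 \<partial>Omega)" for M
  proof -
   have "(\<integral>x. (Y M x + Z x)^2 \<partial>Omega) + (\<integral>x. (Y M x - Z x)^2 \<partial>Omega) = (\<integral>x. (Y M x + Z x)^2 + (Y M x - Z x)^2 \<partial>Omega)"
    using ipl imn by simp
   also have "... = (\<integral>x. 2 * (Y M x)^2 + 2 * (Z x)^2 \<partial>Omega)"
    by (intro Bochner_Integration.integral_cong refl) (simp add: power2_eq_square algebra_simps)
   finally show ?thesis using iY iZ by simp
  qed
  have up0: "(\<integral>x. (Y M x + Z x)^2 \<partial>Omega) <= 4 - delta" if "M >= 1" for M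
   using par[of M] c[OF that] vY[OF that] vZ by linarith
  have up: "(\<integral>\<^sup>+x. ennreal ((Y (Suc M) x + Z x)^2) \<partial>Omega) <= ennreal (4 - delta)" for M
   using nn_integral_eq_integral[OF ipl[of "Suc M"]] up0[of "Suc M"] by (simp add: ennreal_leI)
  have "ennreal 4 = (\<integral>\<^sup>+x. ennreal (4 * (Z x)^2) \<partial>Omega)"
   using nn_integral_eq_integral[of Omega "%x. 4 * (Z x)^2"] iZ vZ by simp
  also have "... = (\<integral>\<^sup>+x. liminf (%M. ennreal ((Y (Suc M) x + Z x)^2)) \<partial>Omega)"
  proof (intro nn_integral_cong)
   fix x assume "x \<in> space Omega"
   then have "(%M. (Y (Suc M) x + Z x)^2) \<longlonglongrightarrow> (Z x + Z x)\<^sup>2"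
    by (intro tendsto_intros LIMSEQ_Suc Omega(6))
   then have "(%M. ennreal ((Y (Suc M) x + Z x)^2)) \<longlonglongrightarrow> ennreal ((Z x + Z x)^2)" by (rule tendsto_ennrealI)
   then show "ennreal (4 * (Z x)^2) = liminf (%M. ennreal ((Y (Suc M) x + Z x)^2))"
    by (subst lim_imp_Liminf[OF sequentially_bot]) (simp_all add: power2_eq_square algebra_simps)
  qed
  also have "... <= liminf (%M. \<integral>\<^sup>+x. ennreal ((Y (Suc M) x + Z x)^2) \<partial>Omega)"
   by (intro nn_integral_liminf) auto
  also have "... <= ennreal (4 - delta)"
   using up by (intro Liminf_le always_eventually allI) auto
  finally show False using delta by (auto simp: ennreal_le_iff2)
 qed
 then obtain M where M: "M >= 1" "(\<integral>x. (Y M x - Z x)^2 \<partial>Omega) <= delta" by blast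
 have "integrable Omega (%x. (Y M x - Z x)^2)"
  using L2_integral_triangle(1)[OF iY[of M] Omega(2), of "%x. - Z x"] iZ by simp
 then show ?thesis using M Omega by (intro exI[of _ M] conjI exI[of _ Omega] exI[of _ "Y M"] exI[of _ Z]) auto
qed

section \<open>The vector of sign sums\<close>

text \<open>For large $M$ the law of this vector under random signs is close to the standard Gaussian law.\<close>
definition cubevec :: "nat => nat => (nat \<times> nat) set => fsvec" where
 "cubevec n M S = cvec n (%i. (\<Sum>k<M. sg (i, k) S) / sqrt (real M))"

abbreviation grid :: "nat => nat => (nat \<times> nat) set" where
 "grid n M == {..<n} \<times> {..<M}"

lemma signsum_slice: "signsum M {k. (i, k) \<in> S} = (\<Sum>k<M. sg (i, k) S) / sqrt (real M)"
 by (simp add: signsum_def sg_def)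

lemma PiM_sign_law:
 "distr (measure_pmf (pmf_of_set (Pow (grid n M)))) (PiM {..<n} (%_. borel)) (%S. \<lambda>i\<in>{..<n}. signsum M {k. (i, k) \<in> S})
  = PiM {..<n} (%_. sign_law M)" (is "distr ?P _ ?T = _")
proof -
 interpret S: product_prob_space "%_::nat. sign_law M" UNIV
  by (intro product_prob_spaceI) (use real_distribution_sign_law real_distribution_def in blast)
 have sets_s: "sets (sign_law M) = sets borel" by (simp add: sign_law_def)
 have mT: "?T \<in> measurable ?P (PiM {..<n} (%_. borel))"
  by (simp add: space_PiM)
 show ?thesis
 proof (rule S.PiM_eqI)
  show "sets (distr ?P (PiM {..<n} (%_. borel)) ?T) = sets (PiM {..<n} (%_. sign_law M))"
   by (simp add: sets_s cong: sets_PiM_cong)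
  fix A assume A: "!!i. i \<in> {..<n} ==> A i \<in> sets (sign_law M)"
  then have A': "!!i. i < n ==> A i \<in> sets borel" by (simp add: sets_s)
  define B where "B i = {T\<in>Pow {..<M}. signsum M T \<in> A i}" for i
  have eB: "emeasure (sign_law M) (A i) = ennreal (real (card (B i)) / 2 ^ M)" if "i < n" for i
  proof -
   have "emeasure (sign_law M) (A i) = emeasure (measure_pmf (pmf_of_set (Pow {..<M}))) (signsum M -` A i)"
    unfolding sign_law_def using A'[OF that] by (subst emeasure_distr) auto
   also have "... = ennreal (real (card (Pow {..<M} \<inter> signsum M -` A i)) / real (card (Pow {..<M})))"
    by (subst emeasure_pmf_of_set) auto
   also have "Pow {..<M} \<inter> signsum M -` A i = B i" by (auto simp: B_def)
   finally show ?thesis by (simp add: card_Pow)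
  qed
  have bij: "bij_betw (%S. \<lambda>i\<in>{..<n}. {k. (i, k) \<in> S}) (Pow (grid n M) \<inter> ?T -` PiE {..<n} A) (PiE {..<n} B)"
  proof (rule bij_betw_byWitness[where f'="%F. {(i, k). i < n \<and> k \<in> F i}"])
   show "\<forall>S\<in>Pow (grid n M) \<inter> ?T -` PiE {..<n} A. {(i, k). i < n \<and> k \<in> (\<lambda>i\<in>{..<n}. {k. (i, k) \<in> S}) i} = S" by auto
   show "\<forall>F\<in>PiE {..<n} B. (\<lambda>i\<in>{..<n}. {k. (i, k) \<in> {(i, k). i < n \<and> k \<in> F i}}) = F"
    by (auto simp: PiE_def extensional_def fun_eq_iff)
   show "(%S. \<lambda>i\<in>{..<n}. {k. (i, k) \<in> S}) ` (Pow (grid n M) \<inter> ?T -` PiE {..<n} A) <= PiE {..<n} B"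
    by (auto simp: B_def PiE_def Pi_def)
   show "(%F. {(i, k). i < n \<and> k \<in> F i}) ` PiE {..<n} B <= Pow (grid n M) \<inter> ?T -` PiE {..<n} A"
   proof
    fix S assume "S \<in> (%F. {(i, k). i < n \<and> k \<in> F i}) ` PiE {..<n} B"
    then obtain F where F: "F \<in> PiE {..<n} B" "S = {(i, k). i < n \<and> k \<in> F i}" by auto
    have FB: "F i <= {..<M}" "signsum M (F i) \<in> A i" if "i < n" for i
     using F(1) that by (auto simp: B_def PiE_def Pi_def)
    have "{k. (i, k) \<in> S} = F i" if "i < n" for i using F(2) that by auto
    then show "S \<in> Pow (grid n M) \<inter> ?T -` PiE {..<n} A"
     using FB F(2) by (auto simp: PiE_def Pi_def)
   qed
  qed
  have "emeasure (distr ?P (PiM {..<n} (%_. borel)) ?T) (PiE {..<n} A) = emeasure ?P (?T -` PiE {..<n} A)"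
   using A' by (subst emeasure_distr[OF mT]) (auto intro!: sets_PiM_I_finite)
  also have "... = ennreal (real (card (Pow (grid n M) \<inter> ?T -` PiE {..<n} A)) / real (card (Pow (grid n M))))"
   by (subst emeasure_pmf_of_set) auto
  also have "card (Pow (grid n M) \<inter> ?T -` PiE {..<n} A) = card (PiE {..<n} B)"
   by (rule bij_betw_same_card[OF bij])
  also have "... = (\<Prod>i<n. card (B i))" by (simp add: card_PiE)
  also have "real (\<Prod>i<n. card (B i)) / real (card (Pow (grid n M))) = (\<Prod>i<n. real (card (B i)) / 2 ^ M)"
   by (simp add: card_Pow card_cartesian_product prod_dividef power_mult[symmetric] mult.commute)
  also have "ennreal ... = (\<Prod>i<n. emeasure (sign_law M) (A i))"
   by (subst prod_ennreal[symmetric]) (auto simp: eB)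
  finally show "emeasure (distr ?P (PiM {..<n} (%_. borel)) ?T) (PiE {..<n} A) = (\<Prod>i<n. emeasure (sign_law M) (A i))" .
 qed simp
qed

definition cubeL2 :: "nat => nat => (fsvec => real) => real" where
 "cubeL2 n M f = sqrt ((\<Sum>S\<in>Pow (grid n M). (f (cubevec n M S))^2) / 2 ^ (n * M))"

definition gaussL2 :: "nat => (fsvec => real) => real" where
 "gaussL2 n f = sqrt (gmean n f)"

lemma cubeL2_integral:
 assumes f: "continuous_on UNIV f"
 shows "cubeL2 n M f = sqrt (\<integral>a. (f (cvec n a))^2 \<partial>PiM {..<n} (%_. sign_law M))"
proof -
 have m: "(%a. (f (cvec n a))^2) \<in> borel_measurable (PiM {..<n} (%_. borel))"
  using f by (intro measurable_cvec[of "%x. (f x)^2"] continuous_intros)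
 have mT: "(%S. \<lambda>i\<in>{..<n}. signsum M {k. (i, k) \<in> S}) \<in> measurable (measure_pmf (pmf_of_set (Pow (grid n M)))) (PiM {..<n} (%_. borel))"
  by (simp add: space_PiM)
 have "(\<integral>a. (f (cvec n a))^2 \<partial>PiM {..<n} (%_. sign_law M))
  = (\<integral>S. (f (cvec n (\<lambda>i\<in>{..<n}. signsum M {k. (i, k) \<in> S})))^2 \<partial>measure_pmf (pmf_of_set (Pow (grid n M))))"
  unfolding PiM_sign_law[symmetric] by (rule integral_distr[OF mT m])
 also have "... = (\<Sum>S\<in>Pow (grid n M). (f (cvec n (\<lambda>i\<in>{..<n}. signsum M {k. (i, k) \<in> S})))^2) / 2 ^ card (grid n M)"
  by (rule integral_cube) simp
 also have "... = (\<Sum>S\<in>Pow (grid n M). (f (cubevec n M S))^2) / 2 ^ (n * M)"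
  by (simp add: card_cartesian_product cubevec_def signsum_slice cvec_cong[of n "\<lambda>i\<in>{..<n}. _ i"])
 finally show ?thesis by (simp add: cubeL2_def)
qed

lemma cube_inner_moment:
 assumes "M >= 1" "psi \<in> Rn n"
 shows "(\<Sum>S\<in>Pow (grid n M). (psi \<bullet> cubevec n M S)^2) / 2 ^ (n * M) = (norm psi)^2"
proof -
 have e: "psi \<bullet> cubevec n M S = (\<Sum>(i, k)\<in>grid n M. cf psi i * walsh {(i, k)} S) / sqrt (real M)" for S
  by (simp add: cubevec_def inner_commute[of psi] inner_cvec walsh_def sum.cartesian_product[symmetric]
    sum_divide_distrib sum_distrib_left sum_distrib_right mult.commute)
 have "(\<Sum>S\<in>Pow (grid n M). (psi \<bullet> cubevec n M S)^2)
  = (\<Sum>S\<in>Pow (grid n M). \<Sum>a\<in>grid n M. \<Sum>b\<in>grid n M. cf psi (fst a) * cf psi (fst b) * (walsh {a} S * walsh {b} S)) / real M"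
  unfolding e by (simp add: power_divide sum_divide_distrib[symmetric] case_prod_beta') (simp add: power2_eq_square sum_product mult_ac)
 also have "(\<Sum>S\<in>Pow (grid n M). \<Sum>a\<in>grid n M. \<Sum>b\<in>grid n M. cf psi (fst a) * cf psi (fst b) * (walsh {a} S * walsh {b} S))
  = (\<Sum>a\<in>grid n M. \<Sum>S\<in>Pow (grid n M). \<Sum>b\<in>grid n M. cf psi (fst a) * cf psi (fst b) * (walsh {a} S * walsh {b} S))"
  by (rule sum.swap)
 also have "... = (\<Sum>a\<in>grid n M. \<Sum>b\<in>grid n M. \<Sum>S\<in>Pow (grid n M). cf psi (fst a) * cf psi (fst b) * (walsh {a} S * walsh {b} S))"
  by (intro sum.cong refl sum.swap)
 also have "... = (\<Sum>a\<in>grid n M. \<Sum>b\<in>grid n M. cf psi (fst a) * cf psi (fst b) * (if a = b then 2 ^ (n * M) else 0))"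
  by (intro sum.cong refl) (simp add: sum_distrib_left[symmetric] walsh_orth card_cartesian_product)
 also have "... = (\<Sum>a\<in>grid n M. (cf psi (fst a))^2 * 2 ^ (n * M))"
  by (intro sum.cong refl) (simp add: if_distrib[of "%x. _ * x"] power2_eq_square cong: if_cong)
 also have "... = real M * (norm psi)^2 * 2 ^ (n * M)"
 proof -
  have "(\<Sum>a\<in>grid n M. (cf psi (fst a))^2) = (\<Sum>i<n. \<Sum>k<M. (cf psi i)^2)"
   by (subst sum.cartesian_product) (simp add: case_prod_beta')
  then show ?thesis
   using norm_cvec[of n "cf psi"] cvec_cf[OF assms(2)]
   by (simp add: sum_distrib_right[symmetric] sum_distrib_left[symmetric])
 qed
 finally show ?thesis using assms(1) by simp
qed

text \<open>A bounded seminorm that is a supremum of functionals; the factor 2 makes room for suprema that are not attained.\<close>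
definition nearly_normed :: "nat => (fsvec => real) => bool" where
 "nearly_normed n f \<longleftrightarrow> seminorm f \<and> (\<exists>L\<ge>0. \<forall>x. f x <= L * norm x) \<and>
   (\<forall>theta\<in>Rn n. \<exists>psi\<in>Rn n. (\<forall>x\<in>Rn n. \<bar>psi \<bullet> x\<bar> <= f x) \<and> f theta <= 2 * (psi \<bullet> theta))"

lemma seminorm_continuous:
 fixes f :: "'a::real_normed_vector => real"
 assumes f: "seminorm f" and L: "L >= 0" "!!x. f x <= L * norm x"
 shows "continuous_on S f"
proof -
 have "\<bar>f x - f y\<bar> <= L * norm (x - y)" for x y
  using seminormD(1)[OF f, of "x - y" y] seminormD(1)[OF f, of "y - x" x] L(2)[of "x - y"] L(2)[of "y - x"]
  by (simp add: norm_minus_commute)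
 then have "L-lipschitz_on S f" using L(1) by (intro lipschitz_onI) (simp_all add: dist_norm)
 then show ?thesis by (rule lipschitz_on_continuous_on)
qed

text \<open>One $M$ serves all seminorms of the dimension. A functional $\psi$ below $f$ satisfies $|\psi| \le \|f\|_2$ for either law, because both laws are isotropic. So
$f$ changes by at most $2\|f\|_2|Y-Z|$ under the coupling, and the mean square of $|Y-Z|$ is at most $1/4$.\<close>
lemma gauss_cube_compare:
 "\<exists>M\<ge>1. \<forall>f. nearly_normed n f --> gaussL2 n f <= 2 * cubeL2 n M f \<and> cubeL2 n M f <= 2 * gaussL2 n f"
proof -
 define delta where "delta = 1 / (4 * (real n + 1))"
 have delta: "delta > 0" by (simp add: delta_def)
 obtain M and Omega :: "real measure" and Y Z where M: "M >= 1" and Omega: "prob_space Omega" "Y \<in> borel_measurable Omega" "Z \<in> borel_measurable Omega"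
  "distr Omega borel Y = sign_law M" "distr Omega borel Z = std_normal_distribution"
  "integrable Omega (%x. (Y x - Z x)^2)" "(\<integral>x. (Y x - Z x)^2 \<partial>Omega) <= delta"
  using clt_coupling[OF delta] by blast
 interpret PP: product_prob_space "%_::nat. Omega" UNIV by (intro product_prob_spaceI Omega)
 note [measurable] = Omega(2,3)
 define P where "P = PiM {..<n} (%_. Omega)"
 have law: "(\<integral>a. (f (cvec n a))^2 \<partial>PiM {..<n} (%_. distr Omega borel X)) = (\<integral>omega. (f (cvec n (%i. X (omega i))))^2 \<partial>P)"
  and lawi: "integrable (PiM {..<n} (%_. distr Omega borel X)) (%a. (f (cvec n a))^2) ==> integrable P (%omega. (f (cvec n (%i. X (omega i))))^2)"
  and lawm: "(%omega. f (cvec n (%i. X (omega i)))) \<in> borel_measurable P"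
  if X[measurable]: "X \<in> borel_measurable Omega" and f: "continuous_on UNIV f" for X :: "real => real" and f :: "fsvec => real"
 proof -
  have m: "(%a. (f (cvec n a))^2) \<in> borel_measurable (PiM {..<n} (%_. borel))"
   using f by (intro measurable_cvec[of "%x. (f x)^2"] continuous_intros)
  have mX: "compose {..<n} X \<in> measurable P (PiM {..<n} (%_. borel))"
   unfolding P_def compose_def by (intro measurable_restrict) measurable
  have d: "PiM {..<n} (%_. distr Omega borel X) = distr P (PiM {..<n} (%_. borel)) (compose {..<n} X)"
  proof -
   have pr: "prob_space (distr Omega borel X)" using Omega(1) X by (rule prob_space.prob_space_distr)
   have "distr P (PiM {..<n} (%_. distr Omega borel X)) (compose {..<n} X)
    = PiM {..<n} (%_. distr Omega (distr Omega borel X) X)"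
    unfolding P_def by (intro distr_PiM_finite_prob_space') (use pr Omega(1) in auto)
   moreover have "distr Omega (distr Omega borel X) X = distr Omega borel X" by (intro distr_cong) auto
   moreover have "distr P (PiM {..<n} (%_. distr Omega borel X)) (compose {..<n} X) = distr P (PiM {..<n} (%_. borel)) (compose {..<n} X)"
    by (intro distr_cong sets_PiM_cong) auto
   ultimately show ?thesis by simp
  qed
  have cc: "cvec n (compose {..<n} X omega) = cvec n (%i. X (omega i))" for omega
   by (intro cvec_cong) (simp add: compose_def)
  show "(\<integral>a. (f (cvec n a))^2 \<partial>PiM {..<n} (%_. distr Omega borel X)) = (\<integral>omega. (f (cvec n (%i. X (omega i))))^2 \<partial>P)"
   unfolding d by (subst integral_distr[OF mX m]) (simp add: cc)
  show "integrable (PiM {..<n} (%_. distr Omega borel X)) (%a. (f (cvec n a))^2) ==> integrable P (%omega. (f (cvec n (%i. X (omega i))))^2)"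
   unfolding d by (subst (asm) integrable_distr_eq[OF mX m]) (simp add: cc)
  show "(%omega. f (cvec n (%i. X (omega i)))) \<in> borel_measurable P"
   using measurable_compose[OF mX measurable_cvec[OF f]] by (simp add: cc)
 qed
 have dist: "integrable P (%omega. (norm (cvec n (%i. Y (omega i) - Z (omega i))))^2)"
  "(\<integral>omega. (norm (cvec n (%i. Y (omega i) - Z (omega i))))^2 \<partial>P) <= 1 / 4"
 proof -
  have comp: "integrable P (%omega. (Y (omega i) - Z (omega i))^2)" "(\<integral>omega. (Y (omega i) - Z (omega i))^2 \<partial>P) <= delta" if "i < n" for i
  proof -
   interpret F: product_prob_space "%_::nat. Omega" "{..<n}" by (intro product_prob_spaceI Omega)
   have c: "distr P Omega (%omega. omega i) = Omega" unfolding P_def using that by (intro F.PiM_component) auto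
   have mc: "(%omega. omega i) \<in> measurable P Omega" unfolding P_def using that by (intro measurable_component_singleton) auto
   have "integrable (distr P Omega (%omega. omega i)) (%x. (Y x - Z x)^2)" using Omega(6) by (simp add: c)
   then show "integrable P (%omega. (Y (omega i) - Z (omega i))^2)" by (subst (asm) integrable_distr_eq[OF mc]) auto
   have "(\<integral>omega. (Y (omega i) - Z (omega i))^2 \<partial>P) = (\<integral>x. (Y x - Z x)^2 \<partial>distr P Omega (%omega. omega i))"
    by (rule integral_distr[OF mc, symmetric]) auto
   then show "(\<integral>omega. (Y (omega i) - Z (omega i))^2 \<partial>P) <= delta" using Omega(7) by (simp add: c)
  qed
  show "integrable P (%omega. (norm (cvec n (%i. Y (omega i) - Z (omega i))))^2)"
   unfolding norm_cvec using comp(1) by (intro Bochner_Integration.integrable_sum) auto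
  have "(\<integral>omega. (norm (cvec n (%i. Y (omega i) - Z (omega i))))^2 \<partial>P) = (\<Sum>i<n. \<integral>omega. (Y (omega i) - Z (omega i))^2 \<partial>P)"
   unfolding norm_cvec using comp(1) by (intro Bochner_Integration.integral_sum) auto
  also have "... <= (\<Sum>i<n. delta)" using comp(2) by (intro sum_mono) auto
  also have "... <= 1 / 4" by (simp add: delta_def field_simps)
  finally show "(\<integral>omega. (norm (cvec n (%i. Y (omega i) - Z (omega i))))^2 \<partial>P) <= 1 / 4" .
 qed
 have "gaussL2 n f <= 2 * cubeL2 n M f \<and> cubeL2 n M f <= 2 * gaussL2 n f" if nn: "nearly_normed n f" for f
 proof -
  obtain L where f: "seminorm f" and L: "L >= 0" "!!x. f x <= L * norm x"
   and at: "!!theta. theta \<in> Rn n ==> \<exists>psi\<in>Rn n. (\<forall>x\<in>Rn n. \<bar>psi \<bullet> x\<bar> <= f x) \<and> f theta <= 2 * (psi \<bullet> theta)"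
   using nn unfolding nearly_normed_def by blast
  have cont: "continuous_on UNIV f" by (rule seminorm_continuous[OF f L])
  have f0: "f x >= 0" for x by (rule seminorm_nonneg[OF f])
  define G where "G = gaussL2 n f"
  define Q where "Q = cubeL2 n M f"
  have igs: "gsquare n f"
   using L f0 by (intro gs_square_integrable[OF cont, of L]) simp
  have G0: "G >= 0" by (simp add: G_def gaussL2_def)
  have Q0: "Q >= 0" by (simp add: Q_def cubeL2_def sum_nonneg)
  have GQ: "f theta <= 2 * G * norm theta" "f theta <= 2 * Q * norm theta" if theta: "theta \<in> Rn n" for theta
  proof -
   obtain psi where psi: "psi \<in> Rn n" "!!x. x \<in> Rn n ==> \<bar>psi \<bullet> x\<bar> <= f x" "f theta <= 2 * (psi \<bullet> theta)" using at[OF theta] by blast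
   have sq: "(psi \<bullet> x)^2 <= (f x)^2" if "x \<in> Rn n" for x
    using power_mono[OF psi(2)[OF that], of 2] by simp
   have "(norm psi)^2 = (\<integral>a. (cvec n a \<bullet> psi) * (cvec n a \<bullet> psi) \<partial>gs n)"
    using inner_Rn[OF psi(1), of psi] by (simp add: gs_inner_moment power2_norm_eq_inner)
   also have "... <= gmean n f"
    using sq[OF cvec_in_Rn] by (intro integral_mono gs_inner_moment igs) (simp add: power2_eq_square inner_commute)
   finally have 1: "norm psi <= G" unfolding G_def gaussL2_def by (simp add: real_le_rsqrt)
   have "(norm psi)^2 <= (\<Sum>S\<in>Pow (grid n M). (f (cubevec n M S))^2) / 2 ^ (n * M)"
    unfolding cube_inner_moment[OF M psi(1), symmetric]
    by (intro divide_right_mono sum_mono sq) (auto simp: cubevec_def)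
   then have 2: "norm psi <= Q" unfolding Q_def cubeL2_def by (simp add: real_le_rsqrt)
   have "f theta <= 2 * (norm psi * norm theta)" using psi(3) norm_cauchy_schwarz[of psi theta] by linarith
   moreover have "norm psi * norm theta <= G * norm theta" "norm psi * norm theta <= Q * norm theta"
    using 1 2 by (auto intro: mult_right_mono)
   ultimately show "f theta <= 2 * G * norm theta" "f theta <= 2 * Q * norm theta" by linarith+
  qed
  let ?fY = "%omega. f (cvec n (%i. Y (omega i)))" and ?fZ = "%omega. f (cvec n (%i. Z (omega i)))"
  let ?D = "%omega. norm (cvec n (%i. Y (omega i) - Z (omega i)))"
  have eZ: "G = sqrt (\<integral>omega. (?fZ omega)^2 \<partial>P)"
   unfolding G_def gaussL2_def gs_def using law[OF Omega(3) cont] by (simp add: Omega(5))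
  have eY: "Q = sqrt (\<integral>omega. (?fY omega)^2 \<partial>P)"
   unfolding Q_def cubeL2_integral[OF cont] using law[OF Omega(2) cont] by (simp add: Omega(4))
  have iZ: "integrable P (%omega. (?fZ omega)^2)"
   using lawi[OF Omega(3) cont] igs by (simp add: Omega(5) gs_def)
  have sdiff: "cvec n a - cvec n b = cvec n (%i. a i - b i)" for a b
   by (simp add: cvec_def scaleR_left_diff_distrib sum_subtractf)
  have fsplit: "f x <= f (x - y) + f y" for x y
   using seminormD(1)[OF f, of "x - y" y] by simp
  have mD: "?D \<in> borel_measurable P"
  proof -
   have "?D = (%omega. sqrt (\<Sum>i<n. (Y (omega i) - Z (omega i))^2))"
    by (simp add: norm_cvec[symmetric])
   moreover have "(%omega. sqrt (\<Sum>i<n. (Y (omega i) - Z (omega i))^2)) \<in> borel_measurable P"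
    unfolding P_def by measurable
   ultimately show ?thesis by simp
  qed
  have iY: "integrable P (%omega. (?fY omega)^2)"
  proof (rule Bochner_Integration.integrable_bound)
   show "integrable P (%omega. (?fZ omega + L * ?D omega)^2)"
    using dist(1) mD by (intro L2_integral_triangle(1) iZ lawm[OF Omega(3) cont]) (auto simp: power_mult_distrib)
   show "(%omega. (?fY omega)^2) \<in> borel_measurable P" using lawm[OF Omega(2) cont] by measurable
   have "?fY omega <= ?fZ omega + L * ?D omega" for omega
    using fsplit[of "cvec n (%i. Y (omega i))" "cvec n (%i. Z (omega i))"]
     L(2)[of "cvec n (%i. Y (omega i)) - cvec n (%i. Z (omega i))"] by (simp add: sdiff)
   then show "AE omega in P. norm ((?fY omega)^2) <= norm ((?fZ omega + L * ?D omega)^2)"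
    using f0 by (auto intro!: power_mono)
  qed
  have cmp: "sqrt (\<integral>omega. (f1 omega)^2 \<partial>P) <= 2 * B"
   if f1: "integrable P (%omega. (f1 omega)^2)" "f1 \<in> borel_measurable P" "!!omega. f1 omega >= 0"
    and f2: "integrable P (%omega. (f2 omega)^2)" "f2 \<in> borel_measurable P" "!!omega. f2 omega >= 0"
    and B: "B = sqrt (\<integral>omega. (f2 omega)^2 \<partial>P)" and le: "!!omega. f1 omega <= f2 omega + 2 * B * ?D omega" for f1 f2 B
  proof -
   have B0: "B >= 0" by (simp add: B)
   have iD: "integrable P (%omega. (2 * B * ?D omega)^2)" using dist(1) by (simp add: power_mult_distrib)
   have "(\<integral>omega. (f1 omega)^2 \<partial>P) <= (\<integral>omega. (f2 omega + 2 * B * ?D omega)^2 \<partial>P)"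
    using f1 f2 iD mD le by (intro integral_mono L2_integral_triangle(1) power_mono) auto
   then have "sqrt (\<integral>omega. (f1 omega)^2 \<partial>P) <= sqrt (\<integral>omega. (f2 omega + 2 * B * ?D omega)^2 \<partial>P)" by (rule real_sqrt_le_mono)
   also have "... <= B + sqrt (\<integral>omega. (2 * B * ?D omega)^2 \<partial>P)"
    unfolding B[symmetric] using f2 iD mD L2_integral_triangle(2)[OF f2(1,2) iD] by (simp add: B[symmetric])
   also have "sqrt (\<integral>omega. (2 * B * ?D omega)^2 \<partial>P) = 2 * B * sqrt (\<integral>omega. (?D omega)^2 \<partial>P)"
    using B0 by (simp add: power_mult_distrib real_sqrt_mult)
   also have "... <= 2 * B * sqrt (1 / 4)" using B0 dist(2) by (intro mult_left_mono real_sqrt_le_mono) auto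
   also have "sqrt (1 / 4 :: real) = 1 / 2" by (simp add: real_sqrt_divide)
   finally show ?thesis by simp
  qed
  have "G <= 2 * Q"
   unfolding eZ
  proof (rule cmp[OF iZ lawm[OF Omega(3) cont] f0 iY lawm[OF Omega(2) cont] f0 eY])
   fix omega
   show "?fZ omega <= ?fY omega + 2 * Q * ?D omega"
    using fsplit[of "cvec n (%i. Z (omega i))" "cvec n (%i. Y (omega i))"]
     GQ(2)[of "cvec n (%i. Z (omega i)) - cvec n (%i. Y (omega i))"] norm_minus_commute[of "cvec n (%i. Z (omega i))" "cvec n (%i. Y (omega i))"]
    by (simp add: sdiff)
  qed
  moreover have "Q <= 2 * G"
   unfolding eY
  proof (rule cmp[OF iY lawm[OF Omega(2) cont] f0 iZ lawm[OF Omega(3) cont] f0 eZ])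
   fix omega
   show "?fY omega <= ?fZ omega + 2 * G * ?D omega"
    using fsplit[of "cvec n (%i. Y (omega i))" "cvec n (%i. Z (omega i))"]
     GQ(1)[of "cvec n (%i. Y (omega i)) - cvec n (%i. Z (omega i))"]
    by (simp add: sdiff)
  qed
  ultimately show ?thesis by (simp add: G_def Q_def)
 qed
 then show ?thesis using M by blast
qed

section \<open>K-convexity\<close>

definition gauss_coeff :: "nat => nat => ((nat \<times> nat) set => 'v::real_vector) => nat => 'v" where
 "gauss_coeff n M Phi i = (\<Sum>S\<in>Pow (grid n M). (cf (cubevec n M S) i / 2 ^ (n * M)) *\<^sub>R Phi S)"

text \<open>The projection onto the sums of signs is the average of the projection to level one over these shifts, which permute the signs within
each of the $n$ blocks.\<close>
definition cyclic_shift :: "nat => nat => nat => (nat \<times> nat) set => (nat \<times> nat) set" where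
 "cyclic_shift n M d S = {(i, k). i < n \<and> k < M \<and> (i, (k + d) mod M) \<in> S}"

lemma bij_cyclic_shift:
 assumes "M >= 1"
 shows "bij_betw (cyclic_shift n M d) (Pow (grid n M)) (Pow (grid n M))"
proof -
 have inj: "S <= S'" if S: "S <= grid n M" and eq: "cyclic_shift n M d S = cyclic_shift n M d S'" for S S'
 proof
  fix p assume p: "p \<in> S"
  obtain i k where ik: "p = (i, k)" "i < n" "k < M" using p S by (cases p) auto
  define k' where "k' = (k + (M - d mod M)) mod M"
  have "(k' + d) mod M = (k + (M - d mod M) + d mod M) mod M" unfolding k'_def by (simp add: mod_simps)
  also have "k + (M - d mod M) + d mod M = k + M" using assms mod_less_divisor[of M d] by linarith
  finally have e: "(k' + d) mod M = k" using ik by simp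
  have "(i, k') \<in> cyclic_shift n M d S" using ik p e assms by (simp add: cyclic_shift_def k'_def)
  then show "p \<in> S'" using ik e unfolding eq by (simp add: cyclic_shift_def)
 qed
 have "inj_on (cyclic_shift n M d) (Pow (grid n M))"
  using inj by (intro inj_onI) (metis PowD subset_antisym)
 moreover have "cyclic_shift n M d ` Pow (grid n M) <= Pow (grid n M)" by (auto simp: cyclic_shift_def)
 ultimately show ?thesis
  by (simp add: bij_betw_def endo_inj_surj)
qed

lemma gauss_coeff_wcoeff:
 assumes "i < n"
 shows "gauss_coeff n M Phi i = (1 / sqrt (real M)) *\<^sub>R (\<Sum>k<M. wcoeff (grid n M) Phi {(i, k)})"
proof -
 have "(\<Sum>k<M. wcoeff (grid n M) Phi {(i, k)}) = (\<Sum>S\<in>Pow (grid n M). \<Sum>k<M. (sg (i, k) S / 2 ^ (n * M)) *\<^sub>R Phi S)"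
  unfolding wcoeff_def by (subst sum.swap) (simp add: walsh_def card_cartesian_product)
 then show ?thesis
  using assms by (simp add: gauss_coeff_def cubevec_def cf_cvec scaleR_sum_right scaleR_sum_left sum_divide_distrib mult.commute)
qed

lemma gauss_projection_average:
 assumes M: "M >= 1"
 shows "(\<Sum>i<n. cf (cubevec n M S) i *\<^sub>R gauss_coeff n M Phi i)
  = (\<Sum>d<M. (1 / real M) *\<^sub>R level1 (grid n M) Phi (cyclic_shift n M d S))"
proof -
 let ?w = "%i k. wcoeff (grid n M) Phi {(i, k)}"
 have sg: "sg (i, k) (cyclic_shift n M d S) = sg (i, (k + d) mod M) S" if "i < n" "k < M" for i k d
  using that by (simp add: sg_def cyclic_shift_def)
 have rot: "(\<Sum>d<M. sg (i, (k + d) mod M) S) = (\<Sum>k<M. sg (i, k) S)" if "k < M" for i k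
 proof (rule sum.reindex_bij_betw)
  have "inj_on (%d. (k + d) mod M) {..<M}"
  proof (rule linorder_inj_onI)
   fix d e assume de: "d < e" "d \<in> {..<M}" "e \<in> {..<M}"
   have "\<not> M dvd (k + e) - (k + d)" using de by (auto dest: dvd_imp_le)
   then show "(k + d) mod M ~= (k + e) mod M"
    using de mod_eq_dvd_iff_nat[of "k + d" "k + e" M] by auto
  qed auto
  moreover have "(%d. (k + d) mod M) ` {..<M} <= {..<M}" using M by auto
  ultimately show "bij_betw (%d. (k + d) mod M) {..<M} {..<M}" by (simp add: bij_betw_def endo_inj_surj)
 qed
 have "(\<Sum>d<M. (1 / real M) *\<^sub>R level1 (grid n M) Phi (cyclic_shift n M d S))
  = (\<Sum>d<M. \<Sum>i<n. \<Sum>k<M. (sg (i, (k + d) mod M) S / real M) *\<^sub>R ?w i k)"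
  by (intro sum.cong refl, subst sum.cartesian_product)
   (auto simp: level1_def scaleR_sum_right sg intro!: sum.cong)
 also have "... = (\<Sum>i<n. \<Sum>d<M. \<Sum>k<M. (sg (i, (k + d) mod M) S / real M) *\<^sub>R ?w i k)"
  by (rule sum.swap)
 also have "... = (\<Sum>i<n. \<Sum>k<M. \<Sum>d<M. (sg (i, (k + d) mod M) S / real M) *\<^sub>R ?w i k)"
  by (intro sum.cong refl sum.swap)
 also have "... = (\<Sum>i<n. \<Sum>k<M. ((\<Sum>d<M. sg (i, (k + d) mod M) S) / real M) *\<^sub>R ?w i k)"
  by (simp add: scaleR_sum_left sum_divide_distrib)
 also have "... = (\<Sum>i<n. \<Sum>k<M. ((\<Sum>k<M. sg (i, k) S) / real M) *\<^sub>R ?w i k)"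
  by (intro sum.cong refl) (simp add: rot)
 also have "... = (\<Sum>i<n. cf (cubevec n M S) i *\<^sub>R gauss_coeff n M Phi i)"
  by (intro sum.cong refl) (simp add: gauss_coeff_wcoeff cubevec_def cf_cvec scaleR_sum_right)
 finally show ?thesis by simp
qed

lemma gauss_projection_bound:
 assumes M: "M >= 1" and h: "seminorm h"
 shows "L2_set (%S. h (\<Sum>i<n. cf (cubevec n M S) i *\<^sub>R gauss_coeff n M Phi i)) (Pow (grid n M))
  <= L2_set (%S. h (level1 (grid n M) Phi S)) (Pow (grid n M))"
proof -
 have shift: "L2_set (%S. h (level1 (grid n M) Phi (cyclic_shift n M d S))) (Pow (grid n M))
  = L2_set (%S. h (level1 (grid n M) Phi S)) (Pow (grid n M))" for d
  unfolding L2_set_def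
  by (subst sum.reindex_bij_betw[OF bij_cyclic_shift[OF M], of "%S. (h (level1 (grid n M) Phi S))^2" n d, symmetric]) simp
 have "L2_set (%S. h (\<Sum>i<n. cf (cubevec n M S) i *\<^sub>R gauss_coeff n M Phi i)) (Pow (grid n M))
  <= (\<Sum>d<M. L2_set (%S. h ((1 / real M) *\<^sub>R level1 (grid n M) Phi (cyclic_shift n M d S))) (Pow (grid n M)))"
  unfolding gauss_projection_average[OF M] by (rule L2_set_seminorm_sum[OF h]) simp
 also have "... = (\<Sum>d<M. (1 / real M) * L2_set (%S. h (level1 (grid n M) Phi S)) (Pow (grid n M)))"
 proof (intro sum.cong refl)
  fix d
  show "L2_set (%S. h ((1 / real M) *\<^sub>R level1 (grid n M) Phi (cyclic_shift n M d S))) (Pow (grid n M))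
   = (1 / real M) * L2_set (%S. h (level1 (grid n M) Phi S)) (Pow (grid n M))"
   unfolding seminormD(2)[OF h] shift[of d, symmetric] by (subst L2_set_right_distrib) auto
 qed
 finally show ?thesis using M by simp
qed

definition supp :: "fsvec set => fsvec => real" where
 "supp K x = (SUP y\<in>K. x \<bullet> y)"

definition polar :: "nat => fsvec set => fsvec set" where
 "polar n K = {phi\<in>Rn n. \<forall>y\<in>K. phi \<bullet> y <= 1}"

definition sym_body :: "nat => fsvec set => bool" where
 "sym_body n K \<longleftrightarrow> K <= Rn n \<and> bounded K \<and> (\<forall>x\<in>K. - x \<in> K) \<and> (\<exists>rho>0. \<forall>x\<in>Rn n. norm x <= rho --> x \<in> K)"

lemma sym_bodyD:
 assumes "sym_body n K"
 shows "K <= Rn n" "bounded K" "!!x. x \<in> K ==> - x \<in> K" "0 \<in> K"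
 using assms by (auto simp: sym_body_def)

lemma supp_bdd:
 assumes "sym_body n K"
 shows "bdd_above ((%y. x \<bullet> y) ` K)"
proof -
 obtain R where R: "!!y. y \<in> K ==> norm y <= R" using sym_bodyD(2)[OF assms] by (auto simp: bounded_iff)
 have "x \<bullet> y <= norm x * R" if "y \<in> K" for y
  using norm_cauchy_schwarz[of x y] mult_left_mono[OF R[OF that], of "norm x"] by simp
 then show ?thesis by (intro bdd_aboveI2[where M="norm x * R"])
qed

lemma supp_upper: "sym_body n K ==> y \<in> K ==> x \<bullet> y <= supp K x"
 unfolding supp_def by (rule cSUP_upper[OF _ supp_bdd])

lemma supp_least: "sym_body n K ==> (!!y. y \<in> K ==> x \<bullet> y <= b) ==> supp K x <= b"
 unfolding supp_def using sym_bodyD(4) by (intro cSUP_least) auto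

lemma seminorm_supp:
 assumes K: "sym_body n K"
 shows "seminorm (supp K)"
proof -
 have pos: "supp K (c *\<^sub>R x) <= c * supp K x" if "c >= 0" for c x
  using that supp_upper[OF K, of _ x] by (intro supp_least[OF K]) (simp add: mult_left_mono)
 have neg: "supp K (- x) <= supp K x" for x
  using supp_upper[OF K, of "- _" x] sym_bodyD(3)[OF K] by (intro supp_least[OF K]) simp
 have abs: "supp K (c *\<^sub>R x) <= \<bar>c\<bar> * supp K x" for c x
  using pos[of "\<bar>c\<bar>" x] neg[of "\<bar>c\<bar> *\<^sub>R x"] by (cases "c >= 0") auto
 have "supp K (c *\<^sub>R x) = \<bar>c\<bar> * supp K x" for c x
 proof (cases "c = 0")
  case True
  then show ?thesis using abs[of c x] supp_upper[OF K sym_bodyD(4)[OF K], of "c *\<^sub>R x"] by simp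
 next
  case False
  have "supp K x <= \<bar>1 / c\<bar> * supp K (c *\<^sub>R x)" using abs[of "1 / c" "c *\<^sub>R x"] False by simp
  then show ?thesis using abs[of c x] False by (simp add: field_simps)
 qed
 moreover have "supp K (x + y) <= supp K x + supp K y" for x y
  using supp_upper[OF K, of _ x] supp_upper[OF K, of _ y]
  by (intro supp_least[OF K]) (simp add: inner_add_left add_mono)
 ultimately show ?thesis by (simp add: seminorm_def)
qed

lemma supp_abs_upper: "sym_body n K ==> y \<in> K ==> \<bar>x \<bullet> y\<bar> <= supp K x"
 using supp_upper[of n K y x] supp_upper[of n K "- y" x] sym_bodyD(3)[of n K y] by (simp add: abs_le_iff)

lemma supp_near_attained:
 assumes K: "sym_body n K"
 shows "\<exists>y\<in>K. supp K x <= 2 * (x \<bullet> y)"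
proof (cases "supp K x <= 0")
 case True
 then show ?thesis using sym_bodyD(4)[OF K] by (intro bexI[of _ 0]) auto
next
 case False
 then have "supp K x / 2 < supp K x" by simp
 then obtain y where "y \<in> K" "supp K x / 2 < x \<bullet> y"
  unfolding supp_def using less_cSUP_iff[OF _ supp_bdd[OF K]] sym_bodyD(4)[OF K] by blast
 then show ?thesis by (intro bexI[of _ y]) auto
qed

lemma supp_lipschitz:
 assumes K: "sym_body n K"
 shows "\<exists>L\<ge>0. \<forall>x. supp K x <= L * norm x"
proof -
 obtain R where R: "!!y. y \<in> K ==> norm y <= R" using sym_bodyD(2)[OF K] by (auto simp: bounded_iff)
 have "R >= 0" using R[OF sym_bodyD(4)[OF K]] by simp
 moreover have "supp K x <= R * norm x" for x
  using norm_cauchy_schwarz[of x] mult_left_mono[OF R, of _ "norm x"]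
  by (intro supp_least[OF K]) (metis mult.commute norm_ge_zero order_trans)
 ultimately show ?thesis by blast
qed

lemma nearly_normed_supp:
 assumes K: "sym_body n K"
 shows "nearly_normed n (supp K)"
 unfolding nearly_normed_def
proof (intro conjI ballI seminorm_supp[OF K] supp_lipschitz[OF K])
 fix theta
 show "\<exists>psi\<in>Rn n. (\<forall>x\<in>Rn n. \<bar>psi \<bullet> x\<bar> <= supp K x) \<and> supp K theta <= 2 * (psi \<bullet> theta)"
  using supp_near_attained[OF K, of theta] supp_abs_upper[OF K] sym_bodyD(1)[OF K] by (auto simp: inner_commute)
qed

lemma nearly_normed_supp_linear:
 assumes K: "sym_body n K"
 shows "nearly_normed n (%x. supp K (comb n W x))"
proof -
 let ?L = "%x. \<Sum>i<n. cf x i *\<^sub>R W i"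
 have add: "?L (x + y) = ?L x + ?L y" and sc: "?L (c *\<^sub>R x) = c *\<^sub>R ?L x" for x y c
  by (simp_all add: scaleR_left_distrib sum.distrib scaleR_right.sum)
 have semi: "seminorm (%x. supp K (?L x))"
  unfolding seminorm_def add sc using seminormD[OF seminorm_supp[OF K]] by simp
 obtain L where L: "L >= 0" "!!x. supp K x <= L * norm x" using supp_lipschitz[OF K] by blast
 have nL: "norm (?L x) <= (\<Sum>i<n. norm (W i)) * norm x" for x
 proof -
  have "norm (?L x) <= (\<Sum>i<n. \<bar>cf x i\<bar> * norm (W i))" by (rule norm_sum[THEN order_trans]) simp
  also have "... <= (\<Sum>i<n. norm x * norm (W i))" by (intro sum_mono mult_right_mono abs_cf_le_norm) auto
  finally show ?thesis by (simp add: sum_distrib_left mult.commute)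
 qed
 have "supp K (?L x) <= (L * (\<Sum>i<n. norm (W i))) * norm x" for x
  using L(2)[of "?L x"] mult_left_mono[OF nL[of x] L(1)] by (simp add: mult.assoc)
 then have bd: "\<exists>L\<ge>0. \<forall>x. supp K (?L x) <= L * norm x"
  using L(1) by (intro exI[of _ "L * (\<Sum>i<n. norm (W i))"]) (auto intro!: mult_nonneg_nonneg sum_nonneg)
 have "\<exists>psi\<in>Rn n. (\<forall>x\<in>Rn n. \<bar>psi \<bullet> x\<bar> <= supp K (?L x)) \<and> supp K (?L theta) <= 2 * (psi \<bullet> theta)" for theta
 proof -
  obtain y where y: "y \<in> K" "supp K (?L theta) <= 2 * (?L theta \<bullet> y)" using supp_near_attained[OF K] by blast
  have e: "cvec n (%i. W i \<bullet> y) \<bullet> x = ?L x \<bullet> y" for x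
   by (simp add: inner_cvec inner_sum_left mult.commute)
  show ?thesis using y supp_abs_upper[OF K y(1)] by (intro bexI[of _ "cvec n (%i. W i \<bullet> y)"]) (auto simp: e)
 qed
 then show ?thesis unfolding nearly_normed_def using semi bd by blast
qed

lemma polar_sym_body:
 assumes K: "sym_body n K"
 shows "sym_body n (polar n K)"
proof -
 obtain R where R: "!!y. y \<in> K ==> norm y <= R" "R > 0"
  using sym_bodyD(2)[OF K] by (auto simp: bounded_pos)
 obtain rho where rho: "rho > 0" "!!x. x \<in> Rn n ==> norm x <= rho ==> x \<in> K" using K by (auto simp: sym_body_def)
 have "norm phi <= 1 / rho" if "phi \<in> polar n K" for phi
 proof (cases "phi = 0")
  case False
  have "(rho / norm phi) *\<^sub>R phi \<in> K" using that rho False by (intro rho(2)) (auto simp: polar_def)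
  then have "phi \<bullet> ((rho / norm phi) *\<^sub>R phi) <= 1" using that by (auto simp: polar_def)
  then have "rho * norm phi <= 1" using False by (simp add: power2_norm_eq_inner[symmetric] power2_eq_square)
  then show ?thesis using rho(1) by (simp add: field_simps)
 qed (use rho in auto)
 then have "bounded (polar n K)" by (auto simp: bounded_iff)
 moreover have "- phi \<in> polar n K" if "phi \<in> polar n K" for phi
  using that sym_bodyD(3)[OF K] by (force simp: polar_def)
 moreover have "phi \<in> polar n K" if "phi \<in> Rn n" "norm phi <= 1 / R" for phi
 proof -
  have "phi \<bullet> y <= 1" if "y \<in> K" for y
  proof -
   have "norm phi * norm y <= (1 / R) * R" using R `norm phi <= 1 / R` that by (intro mult_mono) auto
   then show ?thesis using norm_cauchy_schwarz[of phi y] R(2) by simp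
  qed
  then show ?thesis using that by (simp add: polar_def)
 qed
 ultimately show ?thesis using R(2) by (auto simp: sym_body_def polar_def intro!: exI[of _ "1 / R"])
qed

lemma polar_supp:
 assumes K: "sym_body n K" and "phi \<in> Rn n"
 shows "phi \<in> polar n K \<longleftrightarrow> supp K phi <= 1"
proof
 show "phi \<in> polar n K ==> supp K phi <= 1" by (intro supp_least[OF K]) (auto simp: polar_def)
 show "supp K phi <= 1 ==> phi \<in> polar n K" using assms supp_upper[OF K, of _ phi] by (force simp: polar_def)
qed

lemma L2_set_scale: "c >= 0 ==> sqrt ((\<Sum>S\<in>A. (f S)^2) / c) = L2_set f A / sqrt c"
 by (simp add: L2_set_def real_sqrt_divide)

text \<open>The trace inequality says that the identity has norm at most $\sqrt n$ for the norm dual to the $\ell$-norm of $K$. The bound asserts that the Gaussian norm of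
the polar of $K$ is then at most $\sqrt n$ too, up to a power of the distance $A$ to a Hilbertian norm.\<close>
definition K_convex_bound :: "nat => real => bool" where
 "K_convex_bound m W \<longleftrightarrow> W > 0 \<and> (\<forall>n K A (M :: fsvec => fsvec). sym_body n K --> linear M --> A >= 1 -->
  (\<forall>x. norm (M x) <= supp K x \<and> supp K x <= A * norm (M x)) -->
  (\<forall>w. (\<Sum>i<n. cf (w i) i) <= sqrt (real n) * gaussL2 n (%x. supp K (comb n w x))) -->
  gaussL2 n (supp (polar n K)) <= W * A powr (1 / real (m + 1)) * sqrt (real n))"

text \<open>Replace Gaussian vectors by sums of signs $X$. Let $\psi(S)$ be a point of the polar that nearly norms $X(S)$, let $N$ be the support function of the polar and
$\Phi=N(X)\psi$. Then $\mathbb E\langle X,\Phi\rangle$ is at least half the square of the norm $p$ to be estimated, and it is the trace of the matrix $w$ of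
the coefficients of $\Phi$. By assumption the trace is at most $\sqrt n\,\ell(w)$. Here $\ell(w)$ is the norm of the projection of $\Phi$ onto the
sums of signs, so \<open>level1_bound\<close> bounds it by a multiple of $A^{1/(m+1)}p$.\<close>
lemma K_convexity:
 assumes m: "m >= 1"
 shows "\<exists>W. K_convex_bound m W"
proof -
 obtain W0 where W0: "W0 > 0" "!!(J :: (nat \<times> nat) set) (N :: fsvec => real) (M :: fsvec => fsvec) A Phi.
  finite J ==> seminorm N ==> linear M ==> A >= 1 ==> (!!x. norm (M x) <= N x \<and> N x <= A * norm (M x)) ==>
  L2_set (%S. N (level1 J Phi S)) (Pow J) <= W0 * A powr (1 / real (m + 1)) * L2_set (%S. N (Phi S)) (Pow J)"
  using level1_bound[OF m] by metis
 have main: "gaussL2 n (supp (polar n K)) <= (8 * W0) * A powr (1 / real (m + 1)) * sqrt (real n)"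
  if K: "sym_body n K" and lin: "linear D" and A: "A >= 1" and sand: "!!x. norm (D x) <= supp K x \<and> supp K x <= A * norm (D x)"
   and tr: "!!w. (\<Sum>i<n. cf (w i) i) <= sqrt (real n) * gaussL2 n (%x. supp K (comb n w x))"
  for n K A and D :: "fsvec => fsvec"
 proof -
  define N where "N = supp (polar n K)"
  define h where "h = supp K"
  have P: "sym_body n (polar n K)" by (rule polar_sym_body[OF K])
  have h: "seminorm h" and N: "seminorm N" unfolding h_def N_def using seminorm_supp K P by blast+
  obtain M where M: "M >= 1" and cmp: "!!f. nearly_normed n f ==> gaussL2 n f <= 2 * cubeL2 n M f"
   "!!f. nearly_normed n f ==> cubeL2 n M f <= 2 * gaussL2 n f"
   using gauss_cube_compare[of n] by blast
  define J where "J = Pow (grid n M)"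
  define c where "c = (2::real) ^ (n * M)"
  have c: "c > 0" by (simp add: c_def)
  define X where "X = cubevec n M"
  have "\<exists>psi\<in>polar n K. N (X S) <= 2 * (X S \<bullet> psi)" for S
   unfolding N_def by (rule supp_near_attained[OF P])
  then obtain psi where psi: "!!S. psi S \<in> polar n K" "!!S. N (X S) <= 2 * (X S \<bullet> psi S)" by metis
  define Phi where "Phi S = N (X S) *\<^sub>R psi S" for S
  have hPhi: "h (Phi S) <= N (X S)" for S
  proof -
   have "h (psi S) <= 1" unfolding h_def using polar_supp[OF K, of "psi S"] psi(1)[of S] by (auto simp: polar_def)
   then show ?thesis
    unfolding Phi_def seminormD(2)[OF h] using seminorm_nonneg[OF N, of "X S"] by (simp add: mult_left_le)
  qed
  define w where "w = gauss_coeff n M Phi"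
  define p where "p = cubeL2 n M N"
  have p0: "p >= 0" by (simp add: p_def cubeL2_def sum_nonneg)
  have p2: "p\<^sup>2 = (\<Sum>S\<in>J. (N (X S))^2) / c"
   by (simp add: p_def cubeL2_def sum_nonneg J_def c_def X_def)
  have pL: "L2_set (%S. N (X S)) J = p * sqrt c"
   unfolding p_def cubeL2_def using c by (simp add: L2_set_scale J_def[symmetric] X_def[symmetric] c_def[symmetric])
  have trw: "(\<Sum>i<n. cf (w i) i) = (\<Sum>S\<in>J. X S \<bullet> Phi S) / c"
  proof -
   have "(\<Sum>i<n. cf (w i) i) = (\<Sum>i<n. \<Sum>S\<in>J. cf (X S) i * cf (Phi S) i / c)"
    by (simp add: w_def gauss_coeff_def cf_sum J_def X_def c_def)
   also have "... = (\<Sum>S\<in>J. \<Sum>i<n. cf (X S) i * cf (Phi S) i / c)" by (rule sum.swap)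
   also have "... = (\<Sum>S\<in>J. X S \<bullet> Phi S) / c"
   proof -
    have "X S \<in> Rn n" for S by (simp add: X_def cubevec_def)
    then show ?thesis by (simp add: inner_Rn[of "X _" n] sum_divide_distrib)
   qed
   finally show ?thesis .
  qed
  have "p\<^sup>2 / 2 = (\<Sum>S\<in>J. (N (X S))^2 / 2) / c" unfolding p2 by (simp add: sum_divide_distrib[symmetric])
  also have "... <= (\<Sum>S\<in>J. X S \<bullet> Phi S) / c"
  proof (intro divide_right_mono sum_mono)
   fix S
   have "N (X S) * (N (X S) / 2) <= N (X S) * (X S \<bullet> psi S)"
    using psi(2)[of S] seminorm_nonneg[OF N, of "X S"] by (intro mult_left_mono) auto
   then show "(N (X S))^2 / 2 <= X S \<bullet> Phi S" by (simp add: Phi_def power2_eq_square)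
  qed (use c in auto)
  also have "... <= sqrt (real n) * gaussL2 n (%x. h (comb n w x))"
   unfolding trw[symmetric] h_def by (rule tr)
  also have "... <= sqrt (real n) * (2 * cubeL2 n M (%x. h (comb n w x)))"
   unfolding h_def by (intro mult_left_mono cmp nearly_normed_supp_linear K) auto
  also have "cubeL2 n M (%x. h (comb n w x)) = L2_set (%S. h (comb n w (X S))) J / sqrt c"
   unfolding cubeL2_def using c by (simp add: L2_set_scale J_def[symmetric] X_def[symmetric] c_def[symmetric])
  also have "L2_set (%S. h (comb n w (X S))) J <= L2_set (%S. h (level1 (grid n M) Phi S)) J"
   unfolding X_def w_def J_def by (rule gauss_projection_bound[OF M h])
  also have "... <= W0 * A powr (1 / real (m + 1)) * L2_set (%S. h (Phi S)) J"
   unfolding J_def using sand by (intro W0(2)[OF _ h lin A]) (auto simp: h_def)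
  also have "L2_set (%S. h (Phi S)) J <= p * sqrt c"
   unfolding pL[symmetric] using hPhi seminorm_nonneg[OF h] by (intro L2_set_mono) auto
  finally have "p\<^sup>2 / 2 <= sqrt (real n) * (2 * (W0 * A powr (1 / real (m + 1)) * (p * sqrt c) / sqrt c))"
   using c W0(1) by (simp add: mult_left_mono divide_right_mono)
  then have "p * p <= p * (4 * W0 * A powr (1 / real (m + 1)) * sqrt (real n))"
   using c by (simp add: power2_eq_square field_simps)
  then have "p <= 4 * W0 * A powr (1 / real (m + 1)) * sqrt (real n)"
   using p0 W0(1) by (cases "p = 0") (auto simp: mult_le_cancel_left)
  moreover have "gaussL2 n N <= 2 * p" unfolding p_def N_def by (intro cmp nearly_normed_supp P)
  ultimately show ?thesis unfolding N_def by (simp add: mult.assoc)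
 qed
 show ?thesis
  unfolding K_convex_bound_def by (rule exI[of _ "8 * W0"], intro conjI allI impI) (use W0(1) in simp, rule main, auto)
qed

lemma exchange_Rn:
 assumes B: "independent B" "B <= Rn n" "finite B" "card B = n"
 shows "Rn n <= span B"
proof -
 have sp: "Rn n <= span (ax ` {..<n})"
 proof
  fix x assume "x \<in> Rn n"
  then have "x = comb n ax x" using cvec_cf[of x n] by (simp add: cvec_def)
  moreover have "(comb n ax x) \<in> span (ax ` {..<n})" by (intro span_sum span_scale span_base) auto
  ultimately show "x \<in> span (ax ` {..<n})" by metis
 qed
 have cn: "card (ax ` {..<n}) <= n" using card_image_le[of "{..<n}" ax] by simp
 show ?thesis
 proof (rule ccontr)
  assume "\<not> ?thesis"
  then obtain x where x: "x \<in> Rn n" "x \<notin> span B" by blast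
  then have "independent (insert x B)" "x \<notin> B" using B(1) span_base by (auto simp: independent_insert)
  moreover have "insert x B <= span (ax ` {..<n})" using x B(2) sp by auto
  ultimately have "card (insert x B) <= card (ax ` {..<n})" by (intro independent_span_bound[THEN conjunct2]) auto
  then show False using cn `x \<notin> B` B by simp
 qed
qed

lemma linear_inj_onto_Rn:
 assumes T: "linear T" "!!x. x \<in> Rn n ==> T x \<in> Rn n" and inj: "!!x. x \<in> Rn n ==> T x = 0 ==> x = 0"
 shows "\<exists>sig. \<forall>j<n. sig j \<in> Rn n \<and> T (sig j) = ax j"
proof -
 have spR: "span (ax ` {..<n}) <= Rn n" by (rule span_minimal) (auto simp: ax_in_Rn)
 have injR: "inj_on T (Rn n)"
 proof (rule inj_onI)
  fix x y assume "x \<in> Rn n" "y \<in> Rn n" "T x = T y"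
  then show "x = y" using inj[of "x - y"] by (simp add: linear_diff[OF T(1)])
 qed
 have ax_eq: "k = i" if "ax k = ax i" for k i
  using arg_cong[OF that, of "%x. cf x i"] by (simp add: cf_ax split: if_splits)
 then have ax_inj: "inj_on ax {..<n}" by (intro inj_onI) blast
 have "independent (ax ` {..<n})"
  unfolding independent_explicit_module
 proof (intro allI impI)
  fix t u v assume t: "finite t" "t <= ax ` {..<n}" "(\<Sum>v\<in>t. u v *\<^sub>R v) = 0" "v \<in> t"
  obtain i where i: "v = ax i" using t by auto
  have "0 = cf (\<Sum>v\<in>t. u v *\<^sub>R v) i" using t by simp
  also have "... = (\<Sum>w\<in>t. if w = v then u v else 0)"
   unfolding cf_sum
  proof (intro sum.cong refl)
   fix w assume "w \<in> t"
   then obtain k where "w = ax k" using t by auto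
   then show "cf (u w *\<^sub>R w) i = (if w = v then u v else 0)" using i ax_eq[of k i] by (auto simp: cf_ax)
  qed
  also have "... = u v" using t by simp
  finally show "u v = 0" by simp
 qed
 then have ind: "independent (T ` (ax ` {..<n}))"
  using inj_on_subset[OF injR spR] by (rule linear_independent_injective_image[OF T(1)])
 have "card (T ` (ax ` {..<n})) = n"
  using inj_on_subset[OF injR, of "ax ` {..<n}"] ax_in_Rn ax_inj by (subst card_image) (auto simp: card_image)
 then have "Rn n <= span (T ` (ax ` {..<n}))" using ind T(2) ax_in_Rn by (intro exchange_Rn) auto
 then have "Rn n <= T ` span (ax ` {..<n})" by (simp add: linear_span_image[OF T(1)])
 then have sub: "Rn n <= T ` Rn n" using spR by blast
 have "\<exists>s\<in>Rn n. T s = ax j" if "j < n" for j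
 proof -
  have "ax j \<in> T ` Rn n" using ax_in_Rn[OF that] sub by blast
  then show ?thesis by (metis imageE)
 qed
 then show ?thesis by metis
qed

section \<open>Determinants\<close>

text \<open>Leibniz's formula for the determinant as a function of the rows, in any number of them.\<close>
definition ldet :: "nat => (nat => fsvec) => real" where
 "ldet n tau = (\<Sum>p\<in>{p. p permutes {..<n}}. of_int (sign p) * (\<Prod>i<n. cf (tau i) (p i)))"

lemma prod_fun_upd:
 assumes "i < (n::nat)"
 shows "(\<Prod>k<n. f ((tau(i := x)) k) k :: real) = f x i * (\<Prod>k\<in>{..<n} - {i}. f (tau k) k)"
proof -
 have "(\<Prod>k<n. f ((tau(i := x)) k) k) = f x i * (\<Prod>k\<in>{..<n} - {i}. f ((tau(i := x)) k) k)"
  using assms by (subst prod.remove[of _ i]) auto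
 also have "(\<Prod>k\<in>{..<n} - {i}. f ((tau(i := x)) k) k) = (\<Prod>k\<in>{..<n} - {i}. f (tau k) k)"
  by (intro prod.cong) auto
 finally show ?thesis .
qed

lemma ldet_row:
 assumes "i < n"
 shows "ldet n (tau(i := x)) = (\<Sum>p\<in>{p. p permutes {..<n}}. of_int (sign p) * (cf x (p i) * (\<Prod>k\<in>{..<n} - {i}. cf (tau k) (p k))))"
 unfolding ldet_def using prod_fun_upd[OF assms, of "%x k. cf x (_ k)"] by simp

lemma ldet_row_linear:
 assumes "i < n"
 shows "linear (%x. ldet n (tau(i := x)))"
 unfolding ldet_row[OF assms]
 by (rule linearI) (simp_all add: distrib_right distrib_left sum.distrib sum_distrib_left mult_ac)

lemma ldet_equal_rows:
 assumes ij: "i < n" "j < n" "i ~= j" and eq: "tau i = tau j"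
 shows "ldet n tau = 0"
proof -
 let ?t = "Transposition.transpose i j"
 have t: "?t permutes {..<n}" using ij by (intro permutes_swap_id) auto
 have taut: "tau (?t k) = tau k" for k using eq by (auto simp: Transposition.transpose_def)
 have "ldet n tau = (\<Sum>p\<in>{p. p permutes {..<n}}. of_int (sign (p \<circ> ?t)) * (\<Prod>k<n. cf (tau k) ((p \<circ> ?t) k)))"
  unfolding ldet_def by (rule sum_permutations_compose_right[OF t])
 also have "... = (\<Sum>p\<in>{p. p permutes {..<n}}. - (of_int (sign p) * (\<Prod>k<n. cf (tau k) (p k))))"
 proof (intro sum.cong refl)
  fix p assume p: "p \<in> {p. p permutes {..<n}}"
  have "sign (p \<circ> ?t) = - sign p"
  proof -
   have "permutation p" using p by (auto simp: permutation_permutes)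
   then show ?thesis using ij by (simp add: sign_compose permutation_swap_id sign_swap_id)
  qed
  moreover have "(\<Prod>k<n. cf (tau k) ((p \<circ> ?t) k)) = (\<Prod>k<n. cf (tau k) (p k))"
   using prod.permute[OF t, of "%k. cf (tau k) (p k)"] taut by (simp add: o_def)
  ultimately show "of_int (sign (p \<circ> ?t)) * (\<Prod>k<n. cf (tau k) ((p \<circ> ?t) k)) = - (of_int (sign p) * (\<Prod>k<n. cf (tau k) (p k)))"
   by simp
 qed
 also have "... = - ldet n tau" by (simp add: ldet_def sum_negf)
 finally show ?thesis by simp
qed

lemma ldet_derivative:
 "((%e. ldet n (%i. tau i + e *\<^sub>R sig i)) has_field_derivative (\<Sum>i<n. ldet n (tau(i := sig i)))) (at 0)"
proof -
 have 1: "((%e. \<Prod>i<n. cf (tau i + e *\<^sub>R sig i) (p i)) has_field_derivative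
  (\<Sum>i<n. cf (sig i) (p i) * (\<Prod>k\<in>{..<n} - {i}. cf (tau k + 0 *\<^sub>R sig k) (p k)))) (at 0)" for p
  by (rule has_field_derivative_prod) (auto intro!: derivative_eq_intros)
 have "((%e. ldet n (%i. tau i + e *\<^sub>R sig i)) has_field_derivative
  (\<Sum>p\<in>{p. p permutes {..<n}}. of_int (sign p) * (\<Sum>i<n. cf (sig i) (p i) * (\<Prod>k\<in>{..<n} - {i}. cf (tau k + 0 *\<^sub>R sig k) (p k))))) (at 0)"
  unfolding ldet_def by (intro DERIV_sum DERIV_cmult 1)
 also have "(\<Sum>p\<in>{p. p permutes {..<n}}. of_int (sign p) * (\<Sum>i<n. cf (sig i) (p i) * (\<Prod>k\<in>{..<n} - {i}. cf (tau k + 0 *\<^sub>R sig k) (p k))))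
  = (\<Sum>i<n. ldet n (tau(i := sig i)))"
  unfolding sum_distrib_left by (subst sum.swap) (simp add: ldet_row)
 finally show ?thesis .
qed

lemma ldet_scale: "ldet n (%i. c *\<^sub>R tau i) = c ^ n * ldet n tau"
 by (simp add: ldet_def prod.distrib sum_distrib_left mult_ac)

lemma ldet_ax: "ldet n ax = 1"
proof -
 have "ldet n ax = (\<Sum>p\<in>{p. p permutes {..<n}}. if p = id then 1 else 0)"
  unfolding ldet_def
 proof (intro sum.cong refl)
  fix p assume p: "p \<in> {p. p permutes {..<n}}"
  show "of_int (sign p) * (\<Prod>i<n. cf (ax i) (p i)) = (if p = id then 1 else 0 :: real)"
  proof (cases "p = id")
   case False
   then obtain i where i: "p i ~= i" by (auto simp: fun_eq_iff)
   then have "i < n" using p by (auto simp: permutes_def)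
   then show ?thesis using i False by (auto simp: cf_ax intro!: prod_zero bexI[of _ i])
  qed (simp add: cf_ax)
 qed
 then show ?thesis by (simp add: finite_permutations permutes_id)
qed

lemma ldet_nonzero_inj:
 assumes tau: "!!i. i < n ==> tau i \<in> Rn n" and d: "ldet n tau ~= 0" and x: "x \<in> Rn n" "rows n tau x = 0"
 shows "x = 0"
proof -
 have inj: "inj_on tau {..<n}" using d ldet_equal_rows by (intro inj_onI) (metis lessThan_iff)
 have "independent (tau ` {..<n})"
  unfolding dependent_def
 proof clarify
  fix i assume i: "i < n" "tau i \<in> span (tau ` {..<n} - {tau i})"
  have lin: "linear (%x. ldet n (tau(i := x)))" by (rule ldet_row_linear[OF i(1)])
  define g where "g x = ldet n (tau(i := x))" for x
  have "g y = 0" if "y \<in> span (tau ` {..<n} - {tau i})" for y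
   using that
  proof (induction rule: span_induct_alt)
   case base
   then show ?case using linear_0[OF lin] by (simp add: g_def)
  next
   case (step c z y)
   then obtain j where j: "z = tau j" "j < n" "j ~= i" by auto
   then have "g z = 0" unfolding g_def using i by (intro ldet_equal_rows[of i n j]) auto
   then show ?case using step linear_add[OF lin, of "c *\<^sub>R z" y] linear_scale[OF lin, of c z] by (simp add: g_def[symmetric])
  qed
  then have "g (tau i) = 0" using i by blast
  then have "ldet n (tau(i := tau i)) = 0" by (simp add: g_def)
  then show False using d by simp
 qed
 then have "Rn n <= span (tau ` {..<n})" using tau inj by (intro exchange_Rn) (auto simp: card_image)
 then have "x \<in> span (tau ` {..<n})" using x by blast
 moreover have "y \<bullet> x = 0" if "y \<in> span (tau ` {..<n})" for y
  using that
 proof (induction rule: span_induct_alt)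
  case (step c z y)
  then obtain j where "z = tau j" "j < n" by auto
  then show ?case using step x(2) cf_rows[of n tau x j] by (simp add: inner_add_left)
 qed simp
 ultimately show ?thesis by (metis inner_eq_zero_iff)
qed

section \<open>The Gaussian norm of a matrix\<close>

definition ell :: "nat => fsvec set => (nat => fsvec) => real" where
 "ell n K tau = gaussL2 n (%x. supp K (comb n tau x))"

lemma nearly_normed_square_integrable:
 assumes "nearly_normed n f"
 shows "gsquare n f" "(%a. f (cvec n a)) \<in> borel_measurable (gs n)"
proof -
 obtain L where f: "seminorm f" and L: "L >= 0" "!!x. f x <= L * norm x" using assms by (auto simp: nearly_normed_def)
 have c: "continuous_on UNIV f" by (rule seminorm_continuous[OF f L])
 show "gsquare n f"
  using L seminorm_nonneg[OF f] by (intro gs_square_integrable[OF c, of L]) simp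
 show "(%a. f (cvec n a)) \<in> borel_measurable (gs n)" by (rule measurable_gs[OF c])
qed

lemma ell_nonneg: "ell n K tau >= 0"
 by (simp add: ell_def gaussL2_def)

lemma ell_scale:
 assumes "sym_body n K"
 shows "ell n K (%i. c *\<^sub>R tau i) = \<bar>c\<bar> * ell n K tau"
proof -
 have e: "(\<Sum>i<n. cf x i *\<^sub>R c *\<^sub>R tau i) = c *\<^sub>R (comb n tau x)" for x
  by (simp add: scaleR_sum_right mult.commute)
 show ?thesis
  unfolding ell_def gaussL2_def e seminormD(2)[OF seminorm_supp[OF assms]]
  by (simp add: power_mult_distrib real_sqrt_mult)
qed

lemma ell_add:
 assumes K: "sym_body n K"
 shows "ell n K (%i. sig i + tau i) <= ell n K sig + ell n K tau"
proof -
 let ?f = "%tau x. supp K (comb n tau x)"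
 note nn = nearly_normed_square_integrable[OF nearly_normed_supp_linear[OF K]]
 have le: "?f (%i. sig i + tau i) x <= ?f sig x + ?f tau x" for x
  using seminormD(1)[OF seminorm_supp[OF K]] by (simp add: scaleR_right_distrib sum.distrib)
 have "(\<integral>a. (?f (%i. sig i + tau i) (cvec n a))^2 \<partial>gs n) <= (\<integral>a. (?f sig (cvec n a) + ?f tau (cvec n a))^2 \<partial>gs n)"
  using le seminorm_nonneg[OF seminorm_supp[OF K]] by (intro integral_mono nn L2_integral_triangle(1) power_mono) auto
 then have "ell n K (%i. sig i + tau i) <= sqrt (\<integral>a. (?f sig (cvec n a) + ?f tau (cvec n a))^2 \<partial>gs n)"
  unfolding ell_def gaussL2_def by (rule real_sqrt_le_mono)
 also have "... <= ell n K sig + ell n K tau"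
  unfolding ell_def gaussL2_def by (intro L2_integral_triangle(2) nn)
 finally show ?thesis .
qed

lemma gs_matrix_moment:
 "integrable (gs n) (%a. (norm (comb n tau (cvec n a)))^2)"
 "(\<integral>a. (norm (comb n tau (cvec n a)))^2 \<partial>gs n) = (\<Sum>i<n. (norm (tau i :: 'v::real_inner))^2)"
proof -
 have e: "(norm (comb n tau (cvec n a)))^2
  = (\<Sum>i<n. \<Sum>j<n. (tau i \<bullet> tau j) * ((cvec n a \<bullet> ax i) * (cvec n a \<bullet> ax j)))" for a
  unfolding power2_norm_eq_inner inner_sum_left inner_sum_right
  by (subst sum.swap) (simp add: mult_ac inner_commute)
 show "integrable (gs n) (%a. (norm (comb n tau (cvec n a)))^2)"
  unfolding e by (intro Bochner_Integration.integrable_sum integrable_mult_right gs_inner_moment(1))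
 have "(\<integral>a. (norm (comb n tau (cvec n a)))^2 \<partial>gs n)
  = (\<Sum>i<n. \<Sum>j<n. (tau i \<bullet> tau j) * (\<Sum>k<n. cf (ax i) k * cf (ax j) k))"
  unfolding e
  by (simp add: Bochner_Integration.integral_sum Bochner_Integration.integrable_sum integrable_mult_right gs_inner_moment del: inner_ax)
 also have "... = (\<Sum>i<n. \<Sum>j<n. if i = j then (norm (tau i))\<^sup>2 else 0)"
  by (intro sum.cong refl) (auto simp: cf_ax power2_norm_eq_inner if_distrib[of "%x. x * _"] if_distrib[of "%x. _ * x"] cong: if_cong)
 finally show "(\<integral>a. (norm (comb n tau (cvec n a)))^2 \<partial>gs n) = (\<Sum>i<n. (norm (tau i))^2)"
  by simp
qed

lemma ell_upper:
 assumes K: "sym_body n K" and L: "!!x. supp K x <= L * norm x" "L >= 0"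
 shows "ell n K tau <= L * sqrt (\<Sum>i<n. (norm (tau i))^2)"
proof -
 have "(\<integral>a. (supp K (comb n tau (cvec n a)))^2 \<partial>gs n)
  <= (\<integral>a. L\<^sup>2 * (norm (comb n tau (cvec n a)))^2 \<partial>gs n)"
 proof (rule integral_mono)
  show "integrable (gs n) (%a. L\<^sup>2 * (norm (comb n tau (cvec n a)))^2)"
   by (intro integrable_mult_right gs_matrix_moment(1))
  show "(supp K (comb n tau (cvec n a)))^2 <= L\<^sup>2 * (norm (comb n tau (cvec n a)))^2" for a
   unfolding power_mult_distrib[symmetric] using L seminorm_nonneg[OF seminorm_supp[OF K]] by (intro power_mono) auto
 qed (rule nearly_normed_square_integrable(1)[OF nearly_normed_supp_linear[OF K]])
 also have "... = L\<^sup>2 * (\<Sum>i<n. (norm (tau i))^2)" by (simp add: gs_matrix_moment)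
 finally have "ell n K tau <= sqrt (L\<^sup>2 * (\<Sum>i<n. (norm (tau i))^2))" unfolding ell_def gaussL2_def by (rule real_sqrt_le_mono)
 then show ?thesis using L(2) by (simp add: real_sqrt_mult)
qed

lemma supp_lower:
 assumes K: "sym_body n K"
 shows "\<exists>rho>0. \<forall>x\<in>Rn n. rho * norm x <= supp K x"
proof -
 obtain rho where rho: "rho > 0" "!!x. x \<in> Rn n ==> norm x <= rho ==> x \<in> K" using K by (auto simp: sym_body_def)
 have "rho * norm x <= supp K x" if "x \<in> Rn n" for x
 proof (cases "x = 0")
  case False
  then have "(rho / norm x) *\<^sub>R x \<in> K" using that rho by (intro rho(2)) auto
  then have "x \<bullet> ((rho / norm x) *\<^sub>R x) <= supp K x" by (rule supp_upper[OF K])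
  then show ?thesis using False by (simp add: power2_norm_eq_inner[symmetric] power2_eq_square)
 qed (simp add: seminorm_nonneg[OF seminorm_supp[OF K]])
 then show ?thesis using rho(1) by blast
qed

lemma ell_lower:
 assumes K: "sym_body n K" and rho: "!!x. x \<in> Rn n ==> rho * norm x <= supp K x" "rho >= 0"
  and tau: "!!i. i < n ==> tau i \<in> Rn n"
 shows "rho * sqrt (\<Sum>i<n. (norm (tau i))^2) <= ell n K tau"
proof -
 have r: "(\<Sum>i<n. c i *\<^sub>R tau i) \<in> Rn n" for c using tau by (intro Rn_sum Rn_simps) auto
 have "rho\<^sup>2 * (\<Sum>i<n. (norm (tau i))^2) = (\<integral>a. rho\<^sup>2 * (norm (comb n tau (cvec n a)))^2 \<partial>gs n)"
  by (simp add: gs_matrix_moment)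
 also have "... <= (\<integral>a. (supp K (comb n tau (cvec n a)))^2 \<partial>gs n)"
 proof (rule integral_mono)
  show "integrable (gs n) (%a. rho\<^sup>2 * (norm (comb n tau (cvec n a)))^2)"
   by (intro integrable_mult_right gs_matrix_moment(1))
  fix a
  show "rho\<^sup>2 * (norm (comb n tau (cvec n a)))^2 <= (supp K (comb n tau (cvec n a)))^2"
   unfolding power_mult_distrib[symmetric] using rho r by (intro power_mono) auto
 qed (rule nearly_normed_square_integrable(1)[OF nearly_normed_supp_linear[OF K]])
 finally have "sqrt (rho\<^sup>2 * (\<Sum>i<n. (norm (tau i))^2)) <= ell n K tau" unfolding ell_def gaussL2_def by (rule real_sqrt_le_mono)
 then show ?thesis using rho(2) by (simp add: real_sqrt_mult)
qed

text \<open>Lewis' argument. Let $\tau$ maximise $|\det|$ among the matrices with $\ell(\tau)\le\sqrt n$. For $\sigma=w\tau$ the maximality gives $|\det(\tau+e\sigma)| \le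
(1+e\,\ell(\sigma)/\sqrt n)^n|\det\tau|$ for $e>0$, and the derivatives at $e=0$ are the two sides of the trace inequality.\<close>
lemma extremal_position:
 assumes K: "sym_body n K"
 shows "\<exists>tau. (\<forall>i<n. tau i \<in> Rn n) \<and> (\<forall>x\<in>Rn n. rows n tau x = 0 --> x = 0) \<and> ell n K tau <= sqrt (real n) \<and>
  (\<forall>w. (\<Sum>i<n. cf (w i) i) <= sqrt (real n) * ell n K (%i. \<Sum>j<n. cf (w i) j *\<^sub>R tau j))"
proof (cases "n = 0")
 case True
 then show ?thesis
  using seminorm_zero[OF seminorm_supp[OF K]] by (auto simp: ell_def gaussL2_def Rn_def intro!: fsvec_eqI)
next
 case False
 then have n: "n > 0" by simp
 obtain L where L: "!!x. supp K x <= L * norm x" "L >= 0" using supp_lipschitz[OF K] by blast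
 obtain rho where rho: "rho > 0" "!!x. x \<in> Rn n ==> rho * norm x <= supp K x" using supp_lower[OF K] by blast
 define row where "row P k = cvec n (%i. cf P (k * n + i))" for P k
 have row_add: "row (P + Q) = (%k. row P k + row Q k)" and row_sc: "row (c *\<^sub>R P) = (%k. c *\<^sub>R row P k)" for P Q c
  by (simp_all add: row_def fun_eq_iff cvec_add cvec_scaleR)
 have rowR: "row P k \<in> Rn n" for P k by (simp add: row_def)
 have row_norm: "(\<Sum>k<n. (norm (row P k))^2) = (norm (cvec (n * n) (cf P)))^2" for P
  unfolding row_def norm_cvec by (simp add: sum_lessThan_mult)
 have cvn: "norm (cvec N (cf P)) <= norm P" for N P
 proof -
  have "(norm (cvec N (cf P)))^2 = cvec N (cf P) \<bullet> P" unfolding norm_cvec inner_cvec by (simp add: power2_eq_square)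
  also have "... <= norm (cvec N (cf P)) * norm P" by (rule norm_cauchy_schwarz)
  finally show ?thesis by (cases "norm (cvec N (cf P)) = 0") (auto simp: power2_eq_square)
 qed
 define f where "f P = ell n K (row P)" for P
 have f: "seminorm f" unfolding f_def seminorm_def row_add row_sc using ell_add[OF K] ell_scale[OF K] by simp
 have fL: "f P <= L * norm P" for P
  using ell_upper[OF K L, of "row P"] mult_left_mono[OF cvn[of "n * n" P] L(2)] by (simp add: f_def row_norm)
 have fc: "continuous_on UNIV f" by (rule seminorm_continuous[OF f L(2) fL])
 define S where "S = {P\<in>Rn (n * n). f P <= sqrt (real n)}"
 have "S = (Rn (n * n) \<inter> cball 0 (sqrt (real n) / rho)) \<inter> f -` {..sqrt (real n)}"
 proof -
  have "norm P <= sqrt (real n) / rho" if "P \<in> S" for P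
   using ell_lower[OF K rho(2) less_imp_le[OF rho(1)], of "row P"] rowR[of P] that rho(1) cvec_cf[of P "n * n"]
   by (simp add: S_def row_norm f_def rowR field_simps)
  then show ?thesis by (auto simp: S_def)
 qed
 then have "compact S"
  using compact_Int_closed[OF compact_Rn_ball[of "n * n" "sqrt (real n) / rho"], of "f -` {..sqrt (real n)}"]
   continuous_closed_vimage[of "{..sqrt (real n)}" f] fc by (simp add: continuous_on_eq_continuous_at)
 moreover have "continuous_on S (%P. \<bar>ldet n (row P)\<bar>)"
 proof -
  have cc: "continuous_on S (%P. cf P l)" for l unfolding inner_ax'[symmetric] by (intro continuous_intros)
  have "continuous_on S (%P. cf (row P k) l)" for k l
   unfolding row_def cf_cvec using cc by (cases "l < n") auto
  then show ?thesis unfolding ldet_def by (intro continuous_intros)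
 qed
 moreover define code where "code tau = cvec (n * n) (%l. cf (tau (l div n)) (l mod n))" for tau :: "nat => fsvec"
 have code: "row (code tau) k = tau k" if "k < n" "!!i. i < n ==> tau i \<in> Rn n" for tau k
 proof -
  have "k * n + i < n * n" if "i < n" for i
  proof -
   have "k * n + i < (k + 1) * n" using that by simp
   also have "... <= n * n" using `k < n` by (intro mult_right_mono) auto
   finally show ?thesis .
  qed
  then have "row (code tau) k = cvec n (cf (tau k))" unfolding row_def code_def using n by (intro cvec_cong) (simp add: cf_cvec)
  then show ?thesis using cvec_cf that by simp
 qed
 have ell_cong: "ell n K tau = ell n K tau'" if "!!i. i < n ==> tau i = tau' i" for tau tau' using that by (simp add: ell_def)
 have ldet_cong: "ldet n tau = ldet n tau'" if "!!i. i < n ==> tau i = tau' i" for tau tau' using that by (simp add: ldet_def)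
 have codeS: "code tau \<in> S" "ldet n (row (code tau)) = ldet n tau"
  if "!!i. i < n ==> tau i \<in> Rn n" "ell n K tau <= sqrt (real n)" for tau
 proof -
  have rk: "row (code tau) k = tau k" if "k < n" for k using code `!!i. i < n ==> tau i \<in> Rn n` that by blast
  show "ldet n (row (code tau)) = ldet n tau" by (rule ldet_cong[OF rk])
  have "code tau \<in> Rn (n * n)" by (simp add: code_def)
  then show "code tau \<in> S" using ell_cong[OF rk] \<open>ell n K tau <= sqrt (real n)\<close> by (simp add: S_def f_def)
 qed
 define c where "c = sqrt (real n) / (ell n K ax + 1)"
 have c: "c > 0" using n ell_nonneg[of n K ax] by (simp add: c_def)
 have "ell n K (%i. c *\<^sub>R ax i) <= sqrt (real n)"
  using ell_nonneg[of n K ax] by (simp add: ell_scale[OF K] c_def field_simps)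
 then have c1: "code (%i. c *\<^sub>R ax i) \<in> S" "ldet n (row (code (%i. c *\<^sub>R ax i))) > 0"
  using codeS[of "%i. c *\<^sub>R ax i"] ax_in_Rn c by (auto simp: ldet_scale ldet_ax)
 ultimately obtain P where P: "P \<in> S" "!!Q. Q \<in> S ==> \<bar>ldet n (row Q)\<bar> <= \<bar>ldet n (row P)\<bar>"
  using continuous_attains_sup[of S "%P. \<bar>ldet n (row P)\<bar>"] by blast
 define tau where "tau = row P"
 have tauR: "tau i \<in> Rn n" for i by (simp add: tau_def row_def)
 have d: "ldet n tau ~= 0" using P(2)[OF c1(1)] c1(2) by (auto simp: tau_def)
 have taun: "ell n K tau <= sqrt (real n)" using P(1) by (simp add: S_def f_def tau_def)
 have max: "\<bar>ldet n tau'\<bar> <= \<bar>ldet n tau\<bar>" if "!!i. i < n ==> tau' i \<in> Rn n" "ell n K tau' <= sqrt (real n)" for tau'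
  using P(2)[OF codeS(1)[OF that]] codeS(2)[OF that] by (simp add: tau_def)
 have "(\<Sum>i<n. cf (w i) i) <= sqrt (real n) * ell n K (%i. \<Sum>j<n. cf (w i) j *\<^sub>R tau j)" for w
 proof -
  define sig where "sig i = comb n tau (w i)" for i
  have sigR: "sig i \<in> Rn n" for i unfolding sig_def using tauR by (intro Rn_sum Rn_simps) auto
  define b where "b = ell n K sig / sqrt (real n)"
  have b: "b >= 0" by (simp add: b_def ell_nonneg)
  have row_det: "ldet n (tau(i := sig i)) = cf (w i) i * ldet n tau" if "i < n" for i
  proof -
   have lin: "linear (%x. ldet n (tau(i := x)))" by (rule ldet_row_linear[OF that])
   have "ldet n (tau(i := sig i)) = (\<Sum>j<n. cf (w i) j * ldet n (tau(i := tau j)))"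
    unfolding sig_def using linear_sum[OF lin, of "%j. cf (w i) j *\<^sub>R tau j" "{..<n}"] linear_scale[OF lin] by simp
   also have "... = (\<Sum>j<n. if j = i then cf (w i) i * ldet n tau else 0)"
   proof (intro sum.cong refl)
    fix j assume "j \<in> {..<n}"
    then show "cf (w i) j * ldet n (tau(i := tau j)) = (if j = i then cf (w i) i * ldet n tau else 0)"
     using that ldet_equal_rows[of i n j "tau(i := tau j)"] by auto
   qed
   finally show ?thesis using that by simp
  qed
  define F where "F e = ldet n (%i. tau i + e *\<^sub>R sig i) / ldet n tau - (1 + e * b) ^ n" for e
  have "(F has_field_derivative (\<Sum>i<n. cf (w i) i * ldet n tau) / ldet n tau - real n * b) (at 0)"
   unfolding F_def using ldet_derivative[of n tau sig] row_det d
   by (auto intro!: derivative_eq_intros)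
  then have DF: "DERIV F 0 :> (\<Sum>i<n. cf (w i) i) - real n * b" using d by (simp add: sum_distrib_right[symmetric])
  have F0: "F 0 = 0" using d by (simp add: F_def)
  have Fle: "F e <= 0" if e: "e > 0" for e
  proof -
   define s where "s = 1 / (1 + e * b)"
   have pos: "1 + e * b > 0" using b e by (intro add_pos_nonneg) auto
   then have s: "s > 0" "s * (1 + e * b) = 1" by (simp_all add: s_def)
   define tau' where "tau' i = s *\<^sub>R (tau i + e *\<^sub>R sig i)" for i
   have "ell n K (%i. tau i + e *\<^sub>R sig i) <= sqrt (real n) + e * ell n K sig"
    using ell_add[OF K, of tau "%i. e *\<^sub>R sig i"] ell_scale[OF K, of e sig] e taun by simp
   also have "... = (1 + e * b) * sqrt (real n)" using n by (simp add: b_def field_simps)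
   finally have "ell n K tau' <= s * ((1 + e * b) * sqrt (real n))"
    unfolding tau'_def ell_scale[OF K] using s by (simp add: mult_left_mono)
   then have "ell n K tau' <= sqrt (real n)" using s(2) by (simp add: mult.assoc[symmetric])
   then have "\<bar>ldet n tau'\<bar> <= \<bar>ldet n tau\<bar>" using tauR sigR by (intro max) (auto simp: tau'_def)
   then have "s ^ n * \<bar>ldet n (%i. tau i + e *\<^sub>R sig i)\<bar> <= \<bar>ldet n tau\<bar>"
    unfolding tau'_def ldet_scale using s by (simp add: abs_mult)
   then have "\<bar>ldet n (%i. tau i + e *\<^sub>R sig i)\<bar> <= (1 + e * b) ^ n * \<bar>ldet n tau\<bar>"
    using pos by (simp add: s_def power_divide field_simps)
   then have "\<bar>ldet n (%i. tau i + e *\<^sub>R sig i) / ldet n tau\<bar> <= (1 + e * b) ^ n" using d by (simp add: field_simps)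
   then show ?thesis unfolding F_def by linarith
  qed
  have "\<not> (\<Sum>i<n. cf (w i) i) - real n * b > 0"
  proof
   assume "(\<Sum>i<n. cf (w i) i) - real n * b > 0"
   then obtain delta where delta: "delta > 0" "!!h. h > 0 ==> h < delta ==> F 0 < F (0 + h)" using DERIV_pos_inc_right[OF DF] by blast
   show False using delta(2)[of "delta / 2"] delta(1) Fle[of "delta / 2"] F0 by simp
  qed
  moreover have "real n * b = sqrt (real n) * ell n K sig" using n by (simp add: b_def field_simps)
  ultimately show ?thesis by (simp add: sig_def[abs_def])
 qed
 then show ?thesis using tauR taun ldet_nonzero_inj[OF tauR d] by blast
qed

section \<open>A good position for a body\<close>

lemma rows_sum_adjoint: "(comb n tau phi) \<bullet> y = phi \<bullet> rows n tau y"
 by (simp add: rows_def inner_commute[of phi] inner_cvec inner_sum_left mult.commute)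

lemma supp_image_rows:
 assumes K: "sym_body n K"
 shows "supp (rows n tau ` K) phi = supp K (comb n tau phi)"
 by (simp add: supp_def image_image rows_sum_adjoint)

lemma rows_dual_basis:
 assumes inj: "!!x. x \<in> Rn n ==> rows n tau x = 0 ==> x = 0"
 shows "\<exists>sig. (\<forall>j<n. sig j \<in> Rn n \<and> rows n tau (sig j) = ax j) \<and>
  (\<forall>x\<in>Rn n. x = comb n sig (rows n tau x)) \<and> (\<forall>z\<in>Rn n. rows n tau (comb n sig z) = z)"
proof -
 obtain sig where sig: "!!j. j < n ==> sig j \<in> Rn n \<and> rows n tau (sig j) = ax j"
  using linear_inj_onto_Rn[OF linear_rows _ inj] by (metis rows_in)
 have inv: "rows n tau (comb n sig z) = z" if "z \<in> Rn n" for z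
 proof -
  have "rows n tau (comb n sig z) = comb n ax z"
   using sig by (simp add: linear_sum[OF linear_rows] linear_scale[OF linear_rows])
  then show ?thesis using cvec_cf[OF that] by (simp add: cvec_def)
 qed
 have "x = comb n sig (rows n tau x)" if "x \<in> Rn n" for x
 proof -
  let ?y = "\<Sum>j<n. cf (rows n tau x) j *\<^sub>R sig j"
  have "?y \<in> Rn n" using sig by (intro Rn_sum Rn_simps) auto
  then have "x - ?y \<in> Rn n" using that by simp
  moreover have "rows n tau (x - ?y) = 0" using inv[OF rows_in, of tau x] by (simp add: linear_diff[OF linear_rows])
  ultimately show ?thesis using inj by fastforce
 qed
 then show ?thesis using sig inv by blast
qed

lemma linear_norm_bound_Rn:
 assumes "linear (f :: fsvec => 'b::real_normed_vector)"
 shows "\<exists>B>0. \<forall>x\<in>Rn n. norm (f x) <= B * norm x"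
proof -
 have *: "norm (f x) <= (\<Sum>i<n. norm (f (ax i)) + 1) * norm x" if "x \<in> Rn n" for x
 proof -
  have "f x = f (comb n ax x)" using cvec_cf[OF that] by (simp add: cvec_def)
  also have "... = (\<Sum>i<n. cf x i *\<^sub>R f (ax i))" by (simp add: linear_sum[OF assms] linear_scale[OF assms])
  also have "norm ... <= (\<Sum>i<n. norm x * (norm (f (ax i)) + 1))"
   by (rule norm_sum[THEN order_trans], intro sum_mono) (auto intro!: mult_mono abs_cf_le_norm)
  finally show ?thesis by (simp add: sum_distrib_left mult.commute)
 qed
 have "norm (f x) <= ((\<Sum>i<n. norm (f (ax i)) + 1) + 1) * norm x" if "x \<in> Rn n" for x
  using *[OF that] norm_ge_zero[of x] unfolding distrib_right by linarith
 moreover have "(\<Sum>i<n. norm (f (ax i)) + 1) + 1 > 0" by (intro add_nonneg_pos sum_nonneg) auto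
 ultimately show ?thesis by blast
qed

lemma sym_body_image_rows:
 assumes K: "sym_body n K" and inj: "!!x. x \<in> Rn n ==> rows n tau x = 0 ==> x = 0"
 shows "sym_body n (rows n tau ` K)"
proof -
 obtain sig where sig: "!!j. j < n ==> sig j \<in> Rn n" "!!z. z \<in> Rn n ==> rows n tau (comb n sig z) = z"
  using rows_dual_basis[OF inj] by metis
 obtain rho where rho: "rho > 0" "!!x. x \<in> Rn n ==> norm x <= rho ==> x \<in> K" using K by (auto simp: sym_body_def)
 have ls: "linear (%z. \<Sum>j<n. cf z j *\<^sub>R sig j)"
  by (rule linearI) (simp_all add: scaleR_left_distrib sum.distrib scaleR_right.sum)
 obtain B where B: "B > 0" "!!z. z \<in> Rn n ==> norm (comb n sig z) <= B * norm z"
  using linear_norm_bound_Rn[OF ls, of n] by blast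
 obtain C where C: "C > 0" "!!x. x \<in> Rn n ==> norm (rows n tau x) <= C * norm x"
  using linear_norm_bound_Rn[OF linear_rows, of n n tau] by blast
 obtain R where R: "!!x. x \<in> K ==> norm x <= R" using sym_bodyD(2)[OF K] by (auto simp: bounded_iff)
 have "norm y <= C * R" if y: "y \<in> rows n tau ` K" for y
 proof -
  obtain x where x: "x \<in> K" "y = rows n tau x" using y by blast
  have "norm y <= C * norm x" using C(2)[of x] x sym_bodyD(1)[OF K] by blast
  also have "... <= C * R" using R[OF x(1)] C(1) by simp
  finally show ?thesis .
 qed
 then have "bounded (rows n tau ` K)" by (intro boundedI)
 moreover have "- y \<in> rows n tau ` K" if y: "y \<in> rows n tau ` K" for y
 proof -
  obtain x where x: "x \<in> K" "y = rows n tau x" using y by blast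
  then show ?thesis
   using sym_bodyD(3)[OF K x(1)] linear_neg[OF linear_rows, of n tau x] by (intro image_eqI[of _ _ "- x"]) auto
 qed
 moreover have "z \<in> rows n tau ` K" if z: "z \<in> Rn n" "norm z <= rho / B" for z
 proof -
  have "norm (comb n sig z) <= B * norm z" by (rule B(2)[OF z(1)])
  also have "... <= rho" using z(2) B(1) by (simp add: field_simps)
  finally have "(comb n sig z) \<in> K" using sig(1) by (intro rho(2) Rn_sum Rn_simps) auto
  then show ?thesis using sig(2)[OF z(1)] by (intro image_eqI) auto
 qed
 ultimately show ?thesis using rho(1) B(1) unfolding sym_body_def by (auto intro!: exI[of _ "rho / B"])
qed

lemma polar_duality:
 assumes K: "sym_body n K" and phi: "phi \<in> Rn n" and N: "supp (polar n K) z <= 1"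
 shows "phi \<bullet> z <= supp K phi"
proof (cases "phi = 0")
 case False
 obtain rho where rho: "rho > 0" "!!x. x \<in> Rn n ==> rho * norm x <= supp K x" using supp_lower[OF K] by blast
 have "0 < rho * norm phi" using rho(1) False by simp
 also have "... <= supp K phi" by (rule rho(2)[OF phi])
 finally have pos: "supp K phi > 0" .
 have "(1 / supp K phi) *\<^sub>R phi \<in> polar n K"
  using polar_supp[OF K, of "(1 / supp K phi) *\<^sub>R phi"] phi pos by (simp add: seminormD(2)[OF seminorm_supp[OF K]])
 then have "z \<bullet> ((1 / supp K phi) *\<^sub>R phi) <= supp (polar n K) z" by (rule supp_upper[OF polar_sym_body[OF K]])
 then have "z \<bullet> phi / supp K phi <= 1" using N by simp
 then show ?thesis using pos by (simp add: inner_commute field_simps)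
qed (simp add: seminorm_nonneg[OF seminorm_supp[OF K]])

lemma supp_polar_le_1:
 assumes K: "sym_body n K" and "z \<in> K"
 shows "supp (polar n K) z <= 1"
 using assms(2) by (intro supp_least[OF polar_sym_body[OF K]]) (auto simp: polar_def inner_commute)

text \<open>In the position given by $\tau$ the seminorm $N$ is the gauge of the closed convex hull of $K$. That its unit ball is not larger than the closed convex hull is
expressed by separation: no linear functional is larger at a point of the ball than on all of $K$, up to $\eta$.\<close>
definition positioned :: "nat => fsvec set => real => (nat => fsvec) => (fsvec => real) => bool" where
 "positioned n K w tau N \<longleftrightarrow> (\<forall>i<n. tau i \<in> Rn n) \<and> (\<forall>x\<in>Rn n. rows n tau x = 0 --> x = 0) \<and> ell n K tau <= sqrt (real n) \<and>
  nearly_normed n N \<and> gaussL2 n N <= w \<and> (\<forall>x\<in>K. N (rows n tau x) <= 1) \<and>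
  (\<forall>psi x eta. linear psi --> x \<in> Rn n --> N (rows n tau x) <= 1 --> eta > 0 --> (\<exists>y\<in>K. psi x <= psi y + (eta::real)))"

lemma positionedD:
 assumes "positioned n K w tau N"
 shows "i < n ==> tau i \<in> Rn n" "x \<in> Rn n ==> rows n tau x = 0 ==> x = 0" "ell n K tau <= sqrt (real n)"
  "nearly_normed n N" "gaussL2 n N <= w" "x \<in> K ==> N (rows n tau x) <= 1"
  "linear psi ==> x \<in> Rn n ==> N (rows n tau x) <= 1 ==> eta > 0 ==> \<exists>y\<in>K. psi x <= psi y + (eta::real)"
 using assms by (simp_all add: positioned_def)

definition sandwich :: "nat => real => (fsvec => fsvec) => fsvec set => bool" where
 "sandwich n A M K \<longleftrightarrow> linear M \<and> (\<forall>x\<in>K. norm (M x) <= 1) \<and> (\<forall>x\<in>Rn n. norm (M x) <= 1 / A --> x \<in> K)"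

lemma sandwichD:
 assumes "sandwich n A M K"
 shows "linear M" "x \<in> K ==> norm (M x) <= 1" "x \<in> Rn n ==> norm (M x) <= 1 / A ==> x \<in> K"
 using assms by (simp_all add: sandwich_def)

lemma sandwich_inj:
 assumes K: "sym_body n K" and S: "sandwich n A M K" and A: "A >= 1" and x: "x \<in> Rn n" "M x = 0"
 shows "x = 0"
proof (rule ccontr)
 assume "x ~= 0"
 obtain R where R: "!!x. x \<in> K ==> norm x <= R" "R > 0" using sym_bodyD(2)[OF K] by (auto simp: bounded_pos)
 have "((R + 1) / norm x) *\<^sub>R x \<in> K" using x A by (intro sandwichD(3)[OF S]) (auto simp: linear_scale[OF sandwichD(1)[OF S]])
 then show False using R(1)[of "((R + 1) / norm x) *\<^sub>R x"] R(2) \<open>x ~= 0\<close> by simp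
qed

text \<open>In the extremal position the image of $K$ satisfies the assumptions of \<open>K_convex_bound\<close>; $N$ is the support function of the polar of the
image, and the bipolar theorem gives the separation property.\<close>
lemma good_position:
 assumes W: "K_convex_bound m W" and K: "sym_body n K" and S: "sandwich n A M K" and A: "A >= 1"
 shows "\<exists>tau N. positioned n K (W * A powr (1 / real (m + 1)) * sqrt (real n)) tau N"
proof -
 note M = sandwichD(1)[OF S] and KD = sandwichD(2)[OF S] and DK = sandwichD(3)[OF S] and Minj = sandwich_inj[OF K S A]
 obtain tau where tau0: "(\<forall>i<n. tau i \<in> Rn n) \<and> (\<forall>x\<in>Rn n. rows n tau x = 0 --> x = 0) \<and> ell n K tau <= sqrt (real n) \<and>
  (\<forall>w. (\<Sum>i<n. cf (w i) i) <= sqrt (real n) * ell n K (%i. \<Sum>j<n. cf (w i) j *\<^sub>R tau j))"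
  using extremal_position[OF K] by (rule exE)
 then have tau: "!!i. i < n ==> tau i \<in> Rn n" "!!x. x \<in> Rn n ==> rows n tau x = 0 ==> x = 0" "ell n K tau <= sqrt (real n)"
  "!!w. (\<Sum>i<n. cf (w i) i) <= sqrt (real n) * ell n K (%i. \<Sum>j<n. cf (w i) j *\<^sub>R tau j)"
  by blast+
 define T where "T = rows n tau"
 define K' where "K' = T ` K"
 have K': "sym_body n K'" unfolding K'_def T_def by (rule sym_body_image_rows[OF K tau(2)])
 have supK': "supp K' phi = supp K (comb n tau phi)" for phi
  unfolding K'_def T_def by (rule supp_image_rows[OF K])
 \<comment> \<open>a scaled adjoint of $TV^{-1}$, for which the sandwich passes to support functions\<close>
 obtain v where v: "uppertri n v" "!!x. x \<in> Rn n ==> norm (rows n v x) = norm (M x)" using uppertri_of_linear[OF M] Minj by blast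
 obtain s where s0: "(\<forall>j<n. s j \<in> Rn n \<and> rows n v (s j) = ax j) \<and>
  (\<forall>x\<in>Rn n. x = comb n s (rows n v x)) \<and> (\<forall>z\<in>Rn n. rows n v (comb n s z) = z)"
  using rows_dual_basis[OF uppertri_inj[OF v(1)]] by (rule exE)
 then have s: "!!j. j < n ==> s j \<in> Rn n" "!!x. x \<in> Rn n ==> x = comb n s (rows n v x)"
  "!!z. z \<in> Rn n ==> rows n v (comb n s z) = z"
  by blast+
 define u where "u phi = cvec n (%j. phi \<bullet> T (s j))" for phi
 have linT: "linear T" unfolding T_def by (rule linear_rows)
 have ul: "linear u" unfolding u_def by (rule linearI) (simp_all add: inner_add_left cvec_add cvec_scaleR)
 have phiT: "phi \<bullet> T (comb n s z) = z \<bullet> u phi" for phi z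
  by (simp add: linear_sum[OF linT] linear_scale[OF linT] inner_sum_right u_def inner_commute[of z] inner_cvec mult.commute)
 define M' where "M' phi = (1 / A) *\<^sub>R u phi" for phi
 have M': "linear M'" unfolding M'_def by (rule linear_compose_scale_right[OF ul])
 have up: "supp K' phi <= A * norm (M' phi)" for phi
 proof (rule supp_least[OF K'])
  fix y assume "y \<in> K'"
  then obtain x where x: "x \<in> K" "y = T x" by (auto simp: K'_def)
  have xR: "x \<in> Rn n" using x sym_bodyD(1)[OF K] by blast
  have "phi \<bullet> y = phi \<bullet> T (comb n s (rows n v x))" using s(2)[OF xR] x by simp
  also have "... = rows n v x \<bullet> u phi" by (rule phiT)
  also have "... <= norm (rows n v x) * norm (u phi)" by (rule norm_cauchy_schwarz)
  also have "... <= 1 * norm (u phi)" using KD[OF x(1)] v(2)[OF xR] by (intro mult_right_mono) auto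
  finally show "phi \<bullet> y <= A * norm (M' phi)" using A by (simp add: M'_def)
 qed
 have low: "norm (M' phi) <= supp K' phi" for phi
 proof (cases "u phi = 0")
  case True
  then show ?thesis by (simp add: M'_def seminorm_nonneg[OF seminorm_supp[OF K']])
 next
  case False
  define z where "z = (1 / (A * norm (u phi))) *\<^sub>R u phi"
  have z: "z \<in> Rn n" by (simp add: z_def u_def)
  have x: "(comb n s z) \<in> Rn n" using s(1) by (intro Rn_sum Rn_simps) auto
  have "(comb n s z) \<in> K"
   using DK[OF x] v(2)[OF x] s(3)[OF z] False A by (simp add: z_def)
  then have "phi \<bullet> T (comb n s z) <= supp K' phi" by (intro supp_upper[OF K']) (simp add: K'_def)
  then show ?thesis
   unfolding phiT using False A by (simp add: z_def M'_def power2_norm_eq_inner[symmetric] power2_eq_square)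
 qed
 define N where "N = supp (polar n K')"
 have gN: "gaussL2 n N <= W * A powr (1 / real (m + 1)) * sqrt (real n)"
  unfolding N_def
 proof (rule W[unfolded K_convex_bound_def, THEN conjunct2, rule_format, OF K' M' A])
  show "norm (M' x) <= supp K' x \<and> supp K' x <= A * norm (M' x)" for x using up low by blast
  fix w
  have e: "comb n tau (\<Sum>i<n. cf x i *\<^sub>R w i) = (\<Sum>i<n. cf x i *\<^sub>R (comb n tau (w i)))" for x
  proof -
   have "comb n tau (\<Sum>i<n. cf x i *\<^sub>R w i) = (\<Sum>j<n. \<Sum>i<n. (cf x i * cf (w i) j) *\<^sub>R tau j)"
    by (simp add: cf_sum scaleR_sum_left)
   also have "... = (\<Sum>i<n. \<Sum>j<n. (cf x i * cf (w i) j) *\<^sub>R tau j)" by (rule sum.swap)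
   finally show ?thesis by (simp add: scaleR_sum_right)
  qed
  show "(\<Sum>i<n. cf (w i) i) <= sqrt (real n) * gaussL2 n (%x. supp K' (comb n w x))"
   using tau(4)[of w] unfolding supK' e ell_def .
 qed
 have sep: "\<exists>y\<in>K. psi x <= psi y + eta" if psi: "linear psi" and x: "x \<in> Rn n" "N (T x) <= 1" and eta: "eta > 0" for psi :: "fsvec => real" and x eta
 proof -
  obtain sig where sig: "!!x. x \<in> Rn n ==> x = comb n sig (T x)"
   unfolding T_def using rows_dual_basis[OF tau(2)] by blast
  define phi where "phi = cvec n (%j. psi (sig j))"
  have phi: "phi \<bullet> T y = psi y" if "y \<in> Rn n" for y
  proof -
   have "psi y = psi (comb n sig (T y))" using sig[OF that] by simp
   then show ?thesis by (simp add: linear_sum[OF psi] linear_scale[OF psi] phi_def inner_cvec mult.commute)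
  qed
  have "psi x = phi \<bullet> T x" using phi[OF x(1)] by simp
  also have "... <= supp K' phi" using x(2) unfolding N_def by (intro polar_duality[OF K']) (simp_all add: phi_def)
  also have "... < supp K' phi + eta" using eta by simp
  finally have "psi x - eta < supp K' phi" by simp
  then obtain y where "y \<in> K'" "psi x - eta < phi \<bullet> y"
   unfolding supp_def using less_cSUP_iff[OF _ supp_bdd[OF K']] sym_bodyD(4)[OF K'] by blast
  then obtain y0 where "y0 \<in> K" "y = T y0" "psi x - eta < phi \<bullet> T y0" by (auto simp: K'_def)
  then show ?thesis using phi[of y0] sym_bodyD(1)[OF K] by (intro bexI[of _ y0]) auto
 qed
 have "nearly_normed n N" unfolding N_def by (intro nearly_normed_supp polar_sym_body K')
 moreover have "N (T x) <= 1" if "x \<in> K" for x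
  unfolding N_def using that by (intro supp_polar_le_1[OF K']) (simp add: K'_def)
 ultimately show ?thesis
  using tau(1-3) gN sep unfolding positioned_def T_def by (intro exI[of _ tau], intro exI[of _ N]) blast
qed

section \<open>Weak cotype 2 of a body\<close>

text \<open>Weak cotype 2 of the dual norm, in adjoint form: $\tau$ stands for an operator from a Hilbert space into the dual, and an approximation of rank less than
$k$ is one of its adjoint, in the norm of $K$, by an orthogonal projection of rank less than $k$.\<close>
definition wct :: "nat => real => fsvec set => bool" where
 "wct n c K \<longleftrightarrow> (\<forall>tau k. (\<forall>i<n. tau i \<in> Rn n) --> 1 <= k --> (\<exists>q m. m < k \<and> orthon q m \<and> (\<forall>l<m. q l \<in> Rn n) \<and>
   (\<forall>x\<in>K. norm (rows n tau x - proj q m (rows n tau x)) <= c * ell n K tau / sqrt (real k))))"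

text \<open>The image of a Euclidean ball of arbitrary dimension $d$. That $d$ may exceed $n$ keeps sums of ellipsoids within sets of this form.\<close>
definition Ell :: "nat => (nat => fsvec) => fsvec set" where
 "Ell d s = (%b. \<Sum>i<d. cf b i *\<^sub>R s i) ` (Rn d \<inter> cball 0 1)"

definition set_plus :: "fsvec set => fsvec set => fsvec set" where
 "set_plus K E = {x + y |x y. x \<in> K \<and> y \<in> E}"

lemma linear_comb: "linear (%b. \<Sum>i<d. cf b i *\<^sub>R (s i :: 'b::real_vector))"
 by (rule linearI) (simp_all add: scaleR_left_distrib sum.distrib scaleR_right.sum)

lemma bessel:
 assumes "orthon q m"
 shows "(\<Sum>l<m. (x \<bullet> q l)^2) <= (norm x)^2"
 using norm_proj_sq[OF assms, of x] norm_proj_le[OF assms, of x] by (metis norm_ge_zero power_mono)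

text \<open>Take a largest orthonormal system along which the quadratic form $\sum_i\langle t_i,\cdot\rangle^2$ exceeds $H^2/k$. It has fewer than $k$ members since the
trace of the form is at most $H^2$; on the orthogonal complement the form is at most $H^2/k$.\<close>
lemma hilbert_schmidt_approx:
 fixes t :: "nat => fsvec"
 assumes t: "!!i. i < d ==> t i \<in> Rn n" and H: "(\<Sum>i<d. (norm (t i))^2) <= H\<^sup>2" "H >= 0" and k: "k >= 1"
 shows "\<exists>q m. m < k \<and> orthon q m \<and> (\<forall>l<m. q l \<in> Rn n) \<and>
  (\<forall>b\<in>Rn d \<inter> cball 0 1. norm (comb d t b - proj q m (comb d t b)) <= H / sqrt (real k))"
proof -
 define Q where "Q phi = (\<Sum>i<d. (t i \<bullet> phi)^2)" for phi
 define P where "P m \<longleftrightarrow> (\<exists>q. orthon q m \<and> (\<forall>l<m. q l \<in> Rn n \<and> Q (q l) > H\<^sup>2 / real k))" for m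
 have P0: "P 0" by (simp add: P_def orthon_def)
 have bnd: "m < k" if Pm: "P m" for m
 proof (rule ccontr)
  assume "\<not> m < k"
  then have km: "k <= m" by simp
  obtain q where q: "orthon q m" "!!l. l < m ==> Q (q l) > H\<^sup>2 / real k" using Pm by (auto simp: P_def)
  have m0: "{..<m} ~= {}" using km k by (auto simp: lessThan_empty_iff)
  have "H\<^sup>2 <= real m * (H\<^sup>2 / real k)" using km k by (simp add: field_simps mult_right_mono)
  also have "... = (\<Sum>l<m. H\<^sup>2 / real k)" by simp
  also have "... < (\<Sum>l<m. Q (q l))" using q(2) m0 by (intro sum_strict_mono) auto
  also have "... = (\<Sum>i<d. \<Sum>l<m. (t i \<bullet> q l)^2)" unfolding Q_def by (rule sum.swap)
  also have "... <= (\<Sum>i<d. (norm (t i))^2)" by (intro sum_mono bessel q)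
  finally show False using H by simp
 qed
 obtain m where m: "P m" "!!m'. P m' ==> m' <= m"
  using ex_has_greatest_nat[of P 0 "%m. m" k] P0 bnd by (metis less_imp_le)
 then obtain q where q: "orthon q m" "!!l. l < m ==> q l \<in> Rn n" "!!l. l < m ==> Q (q l) > H\<^sup>2 / real k" by (auto simp: P_def)
 have small: "Q zeta <= H\<^sup>2 / real k * (norm zeta)^2" if zeta: "zeta \<in> Rn n" "!!l. l < m ==> zeta \<bullet> q l = 0" for zeta
 proof (cases "zeta = 0")
  case True
  then show ?thesis by (simp add: Q_def)
 next
  case False
  define e where "e = (1 / norm zeta) *\<^sub>R zeta"
  have e: "e \<bullet> e = 1" "e \<in> Rn n" "!!l. l < m ==> e \<bullet> q l = 0"
   using False zeta by (simp_all add: e_def power2_norm_eq_inner[symmetric] power2_eq_square)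
  have "\<not> Q e > H\<^sup>2 / real k"
  proof
   assume Qe: "Q e > H\<^sup>2 / real k"
   have "orthon (q(m := e)) (Suc m)"
    unfolding orthon_def using q(1) e by (auto simp: orthon_def less_Suc_eq inner_commute)
   then have "P (Suc m)" unfolding P_def using q e Qe by (intro exI[of _ "q(m := e)"]) (auto simp: less_Suc_eq)
   then show False using m(2)[of "Suc m"] by simp
  qed
  moreover have "Q zeta = (norm zeta)^2 * Q e"
   using False by (simp add: Q_def e_def sum_distrib_left power_divide)
  ultimately show ?thesis using mult_left_mono[of "Q e" "H\<^sup>2 / real k" "(norm zeta)^2"] by (simp add: mult.commute)
 qed
 have "norm (comb d t b - proj q m (comb d t b)) <= H / sqrt (real k)" if b: "b \<in> Rn d" "norm b <= 1" for b
 proof -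
  define y where "y = comb d t b"
  define zeta where "zeta = y - proj q m y"
  have yR: "y \<in> Rn n" unfolding y_def using t by (intro Rn_sum Rn_simps) auto
  have "proj q m y \<in> Rn n" unfolding proj_def using q(2) by (intro Rn_sum Rn_simps) auto
  then have zetaR: "zeta \<in> Rn n" using yR by (simp add: zeta_def)
  have orth: "zeta \<bullet> q l = 0" if "l < m" for l
   unfolding zeta_def using proj_inner[OF q(1) that, of y] by (simp add: inner_diff_left)
  have "(norm zeta)^2 = zeta \<bullet> y"
   using proj_orth[OF q(1) proj_in_span, of y y] by (simp add: power2_norm_eq_inner zeta_def inner_diff_right)
  also have "... = cvec d (%i. t i \<bullet> zeta) \<bullet> b" by (simp add: y_def inner_sum_right inner_cvec inner_commute[of zeta] mult.commute)
  also have "... <= norm (cvec d (%i. t i \<bullet> zeta)) * norm b" by (rule norm_cauchy_schwarz)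
  also have "... <= norm (cvec d (%i. t i \<bullet> zeta))" using b(2) by (simp add: mult_left_le)
  also have "... = sqrt (Q zeta)" using norm_cvec[of d "%i. t i \<bullet> zeta"] by (simp add: Q_def real_sqrt_unique)
  also have "... <= sqrt (H\<^sup>2 / real k * (norm zeta)^2)" using small[OF zetaR orth] by simp
  also have "... = H / sqrt (real k) * norm zeta" using H(2) by (simp add: real_sqrt_mult real_sqrt_divide)
  finally have "norm zeta * norm zeta <= (H / sqrt (real k)) * norm zeta" by (simp add: power2_eq_square)
  then have "norm zeta <= H / sqrt (real k)"
   using H(2) by (cases "norm zeta = 0") (simp, simp only: mult_le_cancel_right, simp)
  then show ?thesis by (simp add: zeta_def y_def)
 qed
 then show ?thesis using q bnd[OF m(1)] by (intro exI[of _ q] exI[of _ m]) auto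
qed

lemma zero_in_Ell: "0 \<in> Ell d s"
 unfolding Ell_def by (rule image_eqI[of _ _ 0]) auto

lemma ell_mono:
 assumes K: "sym_body n K" "sym_body n G" and sub: "K <= G"
 shows "ell n K tau <= ell n G tau"
proof -
 have "supp K x <= supp G x" for x using sub by (intro supp_least[OF K(1)] supp_upper[OF K(2)]) auto
 then show ?thesis
  unfolding ell_def gaussL2_def
  using nearly_normed_square_integrable(1)[OF nearly_normed_supp_linear[OF K(1), of tau]]
   nearly_normed_square_integrable(1)[OF nearly_normed_supp_linear[OF K(2), of tau]] seminorm_nonneg[OF seminorm_supp[OF K(1)]]
  by (intro real_sqrt_le_mono integral_mono power_mono) auto
qed

lemma ell_Ell_lower:
 assumes G: "sym_body n G" and sub: "Ell d s <= G"
 shows "(\<Sum>i<d. (norm (rows n tau (s i)))^2) <= (ell n G tau)^2"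
proof -
 have low: "(norm (cvec d (%i. s i \<bullet> x)))^2 <= (supp G x)^2" for x
 proof -
  let ?b = "cvec d (%i. s i \<bullet> x)"
  have "norm ?b <= supp G x"
  proof (cases "?b = 0")
   case False
   define b where "b = (1 / norm ?b) *\<^sub>R ?b"
   have "b \<in> Rn d \<inter> cball 0 1" using False by (simp add: b_def)
   then have "(comb d s b) \<in> G" using sub by (auto simp: Ell_def)
   then have "x \<bullet> comb d s b <= supp G x" by (rule supp_upper[OF G])
   also have "x \<bullet> comb d s b = ?b \<bullet> b"
    by (simp add: inner_sum_right inner_cvec inner_commute[of x] mult.commute)
   also have "... = norm ?b" using False by (simp add: b_def power2_norm_eq_inner[symmetric] power2_eq_square)
   finally show ?thesis .
  qed (simp add: seminorm_nonneg[OF seminorm_supp[OF G]])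
  then show ?thesis by (simp add: power_mono)
 qed
 have adj: "s i \<bullet> comb n tau x = x \<bullet> rows n tau (s i)" for x i
  using rows_sum_adjoint[where n=n and phi=x and tau=tau and y="s i"] by (simp add: inner_commute)
 have rr: "(\<Sum>j<n. cf (rows n tau y) j * cf (rows n tau y) j) = (norm (rows n tau y))^2" for y
  by (simp add: power2_norm_eq_inner inner_Rn[OF rows_in])
 have e: "(norm (cvec d (%i. s i \<bullet> comb n tau (cvec n a))))^2
  = (\<Sum>i<d. (cvec n a \<bullet> rows n tau (s i)) * (cvec n a \<bullet> rows n tau (s i)))" for a
  unfolding norm_cvec adj by (simp add: power2_eq_square)
 have "(\<Sum>i<d. (norm (rows n tau (s i)))^2)
  = (\<integral>a. (norm (cvec d (%i. s i \<bullet> comb n tau (cvec n a))))^2 \<partial>gs n)"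
  unfolding e by (subst Bochner_Integration.integral_sum) (auto simp: gs_inner_moment rr)
 also have "... <= (\<integral>a. (supp G (comb n tau (cvec n a)))^2 \<partial>gs n)"
 proof (rule integral_mono)
  show "integrable (gs n) (%a. (norm (cvec d (%i. s i \<bullet> comb n tau (cvec n a))))^2)"
   unfolding e by (intro Bochner_Integration.integrable_sum gs_inner_moment(1))
 qed (use low nearly_normed_square_integrable(1)[OF nearly_normed_supp_linear[OF G]] in auto)
 also have "... = (ell n G tau)^2" by (simp add: ell_def gaussL2_def)
 finally show ?thesis .
qed

text \<open>Approximate the image of $K$ and that of the ellipsoid separately, with half of the dimensions each. The Hilbert--Schmidt norm for the ellipsoid is at most
the $\ell$-norm for the sum, so one ellipsoid of any size does no harm.\<close>
lemma wct_sum: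
 assumes K: "sym_body n K" "wct n c K" and G: "sym_body n (set_plus K (Ell d s))" and s: "!!i. i < d ==> s i \<in> Rn n" and c: "c >= 0"
 shows "wct n (2 * (c + 1)) (set_plus K (Ell d s))"
 unfolding wct_def
proof (intro allI impI)
 fix tau and k :: nat assume tau: "\<forall>i<n. tau i \<in> Rn n" and k: "1 <= k"
 let ?T = "rows n tau" and ?G = "set_plus K (Ell d s)"
 define k1 where "k1 = (k + 1) div 2"
 have k1: "k1 >= 1" "k <= 2 * k1" "2 * k1 <= k + 1" using k by (auto simp: k1_def)
 have KG: "K <= ?G" using zero_in_Ell[of d s] by (force simp: set_plus_def)
 have EG: "Ell d s <= ?G" using sym_bodyD(4)[OF K(1)] by (force simp: set_plus_def)
 obtain q1 m1 where q1: "m1 < k1" "orthon q1 m1" "!!l. l < m1 ==> q1 l \<in> Rn n"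
  "!!x. x \<in> K ==> norm (?T x - proj q1 m1 (?T x)) <= c * ell n K tau / sqrt (real k1)"
  using K(2) tau k1(1) unfolding wct_def by metis
 have T: "?T (s i) \<in> Rn n" for i by simp
 obtain q2 m2 where q20: "m2 < k1 \<and> orthon q2 m2 \<and> (\<forall>l<m2. q2 l \<in> Rn n) \<and>
  (\<forall>b\<in>Rn d \<inter> cball 0 1. norm ((\<Sum>i<d. cf b i *\<^sub>R ?T (s i)) - proj q2 m2 (\<Sum>i<d. cf b i *\<^sub>R ?T (s i))) <= ell n ?G tau / sqrt (real k1))"
  using hilbert_schmidt_approx[OF T ell_Ell_lower[OF G EG] ell_nonneg k1(1)] by (elim exE)
 then have q2: "m2 < k1" "orthon q2 m2" "!!l. l < m2 ==> q2 l \<in> Rn n"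
  "!!b. b \<in> Rn d \<inter> cball 0 1 ==> norm ((\<Sum>i<d. cf b i *\<^sub>R ?T (s i)) - proj q2 m2 (\<Sum>i<d. cf b i *\<^sub>R ?T (s i))) <= ell n ?G tau / sqrt (real k1)"
  by blast+
 define y where "y l = (if l < m1 then q1 l else q2 (l - m1))" for l
 obtain q m where q: "m <= m1 + m2" "orthon q m" "span (q ` {..<m}) = span (y ` {..<m1 + m2})" using gram_schmidt by blast
 have yR: "y ` {..<m1 + m2} <= Rn n" using q1(3) q2(3) by (auto simp: y_def)
 have qR: "q l \<in> Rn n" if "l < m" for l
 proof -
  have "q l \<in> span (q ` {..<m})" using that by (intro span_base) auto
  then have "q l \<in> span (y ` {..<m1 + m2})" by (simp only: q(3))
  then show ?thesis using span_minimal[OF yR subspace_Rn] by blast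
 qed
 have sub1: "span (q1 ` {..<m1}) <= span (q ` {..<m})"
  unfolding q(3)
 proof (intro span_mono subsetI)
  fix x assume "x \<in> q1 ` {..<m1}"
  then obtain l where "l < m1" "x = q1 l" by auto
  then show "x \<in> y ` {..<m1 + m2}" by (intro image_eqI[of _ _ l]) (auto simp: y_def)
 qed
 have sub2: "span (q2 ` {..<m2}) <= span (q ` {..<m})"
  unfolding q(3)
 proof (intro span_mono subsetI)
  fix x assume "x \<in> q2 ` {..<m2}"
  then obtain l where "l < m2" "x = q2 l" by auto
  then show "x \<in> y ` {..<m1 + m2}" by (intro image_eqI[of _ _ "m1 + l"]) (auto simp: y_def)
 qed
 have d1: "norm (z - proj q m z) <= norm (z - proj q1 m1 z)" "norm (z - proj q m z) <= norm (z - proj q2 m2 z)" for z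
  using norm_proj_compl_le[OF q(2)] proj_in_span[of q1 m1 z] proj_in_span[of q2 m2 z] sub1 sub2 by blast+
 have "norm (?T x - proj q m (?T x)) <= 2 * (c + 1) * ell n ?G tau / sqrt (real k)" if xG: "x \<in> ?G" for x
 proof -
  obtain x1 b where x: "x1 \<in> K" "b \<in> Rn d \<inter> cball 0 1" "x = x1 + comb d s b"
   using xG by (auto simp: set_plus_def Ell_def)
  define z where "z = (\<Sum>i<d. cf b i *\<^sub>R ?T (s i))"
  have Tx: "?T x = ?T x1 + z"
   by (simp add: x z_def linear_add[OF linear_rows] linear_sum[OF linear_rows] linear_scale[OF linear_rows])
  have "?T x - proj q m (?T x) = (?T x1 - proj q m (?T x1)) + (z - proj q m z)"
   unfolding Tx linear_add[OF linear_proj] by simp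
  then have "norm (?T x - proj q m (?T x)) <= norm (?T x1 - proj q m (?T x1)) + norm (z - proj q m z)"
   using norm_triangle_ineq by metis
  also have "... <= c * ell n K tau / sqrt (real k1) + ell n ?G tau / sqrt (real k1)"
   using d1(1)[of "?T x1"] q1(4)[OF x(1)] d1(2)[of z] q2(4)[OF x(2)] unfolding z_def by linarith
  also have "... <= c * ell n ?G tau / sqrt (real k1) + ell n ?G tau / sqrt (real k1)"
   using ell_mono[OF K(1) G KG, of tau] c by (intro add_mono divide_right_mono mult_left_mono) auto
  also have "... = (c + 1) * ell n ?G tau * (1 / sqrt (real k1))"
   by (simp add: distrib_right distrib_left add_divide_distrib)
  also have "... <= (c + 1) * ell n ?G tau * (2 / sqrt (real k))"
  proof (rule mult_left_mono)
   have "sqrt (real k) <= sqrt (4 * real k1)" using k1 by (intro real_sqrt_le_mono) auto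
   then have "sqrt (real k) <= 2 * sqrt (real k1)" by (simp add: real_sqrt_mult)
   then show "1 / sqrt (real k1) <= 2 / sqrt (real k)" using k k1 by (simp add: field_simps)
  qed (use c ell_nonneg in auto)
  finally show ?thesis by (simp add: algebra_simps add_divide_distrib)
 qed
 moreover have "m < k" using q(1) q1(1) q2(1) k1 by linarith
 ultimately show "\<exists>q m. m < k \<and> orthon q m \<and> (\<forall>l<m. q l \<in> Rn n) \<and>
   (\<forall>x\<in>?G. norm (?T x - proj q m (?T x)) <= 2 * (c + 1) * ell n ?G tau / sqrt (real k))"
  using q(2) qR by (intro exI[of _ q] exI[of _ m]) auto
qed

lemma seminorm_nearly: "nearly_normed n N ==> seminorm N"
 by (simp add: nearly_normed_def)

section \<open>Covering a Hilbert ball by translates of a body\<close>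

text \<open>Group the points according to a net, for $N$, of their components orthogonal to the $q_l$; this net is small by the dual Sudakov inequality. Two points of one group
differ, up to $2s$, by an element of an $m$-dimensional space. There the comparison with the Hilbertian norm bounds their number by volume.\<close>
lemma packing_position:
 fixes M :: "fsvec => 'b::real_inner"
 assumes inj: "!!x. x \<in> Rn n ==> rows n tau x = 0 ==> x = 0"
  and N: "nearly_normed n N" "gaussL2 n N <= w" "w > 0"
  and M: "linear M" "!!x. x \<in> Rn n ==> norm (M x) <= N (rows n tau x)" "!!x. x \<in> Rn n ==> N (rows n tau x) <= A * norm (M x)" and A: "A >= 1"
  and q: "orthon q m" "!!l. l < m ==> q l \<in> Rn n" and s: "s >= 1"
  and Z: "finite Z" "Z <= Rn n" "!!z. z \<in> Z ==> norm (rows n tau z - proj q m (rows n tau z)) <= R" "!!z. z \<in> Z ==> N (rows n tau z) <= 2 * A"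
  and sep: "!!z z'. z \<in> Z ==> z' \<in> Z ==> z ~= z' ==> N (rows n tau z - rows n tau z') >= 3 * s"
 shows "real (card Z) <= exp (25 * (w * R / s)^2) * (20 * A\<^sup>2) ^ m"
proof -
 define T where "T = rows n tau"
 define P where "P z = proj q m (T z)" for z
 define Q where "Q z = T z - P z" for z
 have sN: "seminorm N" by (rule seminorm_nearly[OF N(1)])
 obtain L where L: "L >= 0" "!!x. N x <= L * norm x" using N(1) by (auto simp: nearly_normed_def)
 have PR: "P z \<in> Rn n" for z unfolding P_def proj_def using q(2) by (intro Rn_sum Rn_simps) auto
 have TR: "T z \<in> Rn n" for z by (simp add: T_def)
 have QR: "Q z \<in> Rn n" for z using PR TR by (simp add: Q_def)
 have "gmean n N = (gaussL2 n N)^2" by (simp add: gaussL2_def)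
 also have "... <= w\<^sup>2" using N(2) by (intro power_mono) (auto simp: gaussL2_def)
 finally have Nw: "gmean n N <= w\<^sup>2" .
 have "\<exists>Y. finite Y \<and> Y <= Q ` Z \<and> pairwise (%x y. N (x - y) >= s) Y \<and> real (card Y) <= exp (25 * (w * R / s)^2) \<and>
  (\<forall>x\<in>Q ` Z. \<exists>y\<in>Y. x = y \<or> \<not> N (x - y) >= s)"
 proof (rule maximal_separated)
  show "N (x - y) >= s ==> N (y - x) >= s" for x y using seminorm_minus[OF sN, of "x - y"] by simp
  fix Y assume Y: "finite Y" "Y <= Q ` Z" "pairwise (%x y. N (x - y) >= s) Y"
  show "real (card Y) <= exp (25 * (w * R / s)^2)"
  proof (rule dual_sudakov[OF seminorm_continuous[OF sN L] nearly_normed_square_integrable(1)[OF N(1)] Nw N(3) seminorm_nonneg[OF sN]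
     seminorm_diff[OF sN] seminorm_minus[OF sN] _ Y(1)])
   show "c > 0 ==> N (c *\<^sub>R x) = c * N x" for x c by (simp add: seminormD(2)[OF sN])
   show "Y <= Rn n" using Y(2) QR by auto
   show "z \<in> Y ==> norm z <= R" for z using Y(2) Z(3) by (auto simp: Q_def P_def T_def)
   show "0 < s" using s by simp
   show "z \<in> Y ==> z' \<in> Y ==> z ~= z' ==> s <= N (z - z')" for z z' using Y(3) by (auto simp: pairwise_def)
  qed
 qed
 then obtain Y where Y: "finite Y" "real (card Y) <= exp (25 * (w * R / s)^2)" "!!x. x \<in> Q ` Z ==> \<exists>y\<in>Y. x = y \<or> \<not> N (x - y) >= s"
  by blast
 have "\<exists>y\<in>Y. N (Q z - y) < s" if "z \<in> Z" for z
 proof -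
  obtain y where "y \<in> Y" "Q z = y \<or> \<not> N (Q z - y) >= s" using Y(3)[of "Q z"] \<open>z \<in> Z\<close> by blast
  then show ?thesis using s seminorm_zero[OF sN] by (intro bexI[of _ y]) auto
 qed
 then obtain f where f: "!!z. z \<in> Z ==> f z \<in> Y" "!!z. z \<in> Z ==> N (Q z - f z) < s" by metis
 obtain sig where sig0: "(\<forall>j<n. sig j \<in> Rn n \<and> rows n tau (sig j) = ax j) \<and>
  (\<forall>x\<in>Rn n. x = comb n sig (rows n tau x)) \<and> (\<forall>z\<in>Rn n. rows n tau (comb n sig z) = z)"
  using rows_dual_basis[OF inj] by (rule exE)
 define Ti where "Ti z = comb n sig z" for z
 have TTi: "T (Ti z) = z" if "z \<in> Rn n" for z using sig0 that by (simp add: T_def Ti_def)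
 have TiR: "Ti z \<in> Rn n" for z unfolding Ti_def using sig0 by (intro Rn_sum Rn_simps) auto
 have linTi: "linear Ti" unfolding Ti_def by (rule linear_comb)
 have linMTi: "linear (%z. M (Ti z))" using linear_compose[OF linTi M(1)] by (simp add: o_def)
 have group: "real (card {z\<in>Z. f z = y}) <= (20 * A\<^sup>2) ^ m" if "y \<in> Y" for y
 proof (cases "{z\<in>Z. f z = y} = {}")
  case True
  then show ?thesis by (simp only: card.empty) simp
 next
  case False
  define B where "B = {z\<in>Z. f z = y}"
  obtain z0 where z0: "z0 \<in> B" using False by (auto simp: B_def)
  define g where "g z = M (Ti (P z - P z0))" for z
  have QQ: "N (Q z - Q z') <= 2 * s" if "z \<in> B" "z' \<in> B" for z z'
   using seminorm_diff[OF sN, of "Q z - y" "Q z' - y"] f(2)[of z] f(2)[of z'] that by (auto simp: B_def)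
  have PP1: "N (P z - P z') >= s" if "z \<in> B" "z' \<in> B" "z ~= z'" for z z'
  proof -
   have "3 * s <= N (T z - T z')" unfolding T_def using that by (intro sep) (auto simp: B_def)
   also have "T z - T z' = (P z - P z') + (Q z - Q z')" by (simp add: Q_def)
   also have "N ... <= N (P z - P z') + N (Q z - Q z')" by (rule seminormD(1)[OF sN])
   finally show ?thesis using QQ[OF that(1,2)] by linarith
  qed
  have PP2: "N (P z - P z0) <= 4 * A + 2 * s" if "z \<in> B" for z
  proof -
   have "P z - P z0 = (T z - T z0) - (Q z - Q z0)" by (simp add: Q_def)
   then have "N (P z - P z0) <= N (T z - T z0) + N (Q z - Q z0)" using seminorm_diff[OF sN] by metis
   moreover have "N (T z - T z0) <= N (T z) + N (T z0)" by (rule seminorm_diff[OF sN])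
   moreover have "N (T z) <= 2 * A" "N (T z0) <= 2 * A" using Z(4) that z0 by (auto simp: B_def T_def)
   ultimately show ?thesis using QQ[OF that z0] by linarith
  qed
  have gsep: "norm (g z - g z') >= s / A" if "z \<in> B" "z' \<in> B" "z ~= z'" for z z'
  proof -
   have e: "g z - g z' = M (Ti (P z - P z'))"
    unfolding g_def linear_diff[OF linMTi, symmetric] by simp
   have "s <= N (T (Ti (P z - P z')))" using PP1[OF that] TTi[of "P z - P z'"] PR by simp
   also have "... <= A * norm (g z - g z')" unfolding e T_def by (rule M(3)[OF TiR])
   finally show ?thesis using A by (simp add: field_simps)
  qed
  have gle: "norm (g z) <= 4 * A + 2 * s" if "z \<in> B" for z
  proof -
   have "norm (g z) <= N (T (Ti (P z - P z0)))" unfolding g_def T_def by (rule M(2)[OF TiR])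
   then show ?thesis using PP2[OF that] TTi[of "P z - P z0"] PR by simp
  qed
  have gspan: "g z \<in> span ((%l. M (Ti (q l))) ` {..<m})" for z
  proof -
   have "P z - P z0 \<in> span (q ` {..<m})" unfolding P_def by (intro span_diff proj_in_span)
   then have "g z \<in> (%z. M (Ti z)) ` span (q ` {..<m})" by (simp add: g_def)
   then show ?thesis using linear_span_image[OF linMTi, of "q ` {..<m}"] by (simp add: image_image)
  qed
  have sA: "s / A > 0" using s A by simp
  have ginj: "inj_on g B" using gsep sA by (intro inj_onI) (metis diff_self norm_zero not_le)
  have finB: "finite B" using Z(1) by (simp add: B_def)
  have "real (card (g ` B)) <= (1 + 2 * (4 * A + 2 * s) / (s / A)) ^ m"
   using finB gspan gle gsep sA s A
   by (intro packing_span[of _ "%l. M (Ti (q l))" m]) auto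
  also have "... <= (20 * A\<^sup>2) ^ m"
  proof (rule power_mono)
   have "2 * (4 * A + 2 * s) / (s / A) = 8 * A\<^sup>2 / s + 4 * A" using s A by (simp add: field_simps power2_eq_square)
   also have "... <= 8 * A\<^sup>2 + 4 * A\<^sup>2"
   proof (rule add_mono)
    show "8 * A\<^sup>2 / s <= 8 * A\<^sup>2" using s mult_right_mono[of 1 s "A\<^sup>2"] by (simp add: field_simps)
    show "4 * A <= 4 * A\<^sup>2" using A by (simp add: power2_eq_square)
   qed
   finally show "1 + 2 * (4 * A + 2 * s) / (s / A) <= 20 * A\<^sup>2" using one_le_power[OF A, of 2] by linarith
   show "0 <= 1 + 2 * (4 * A + 2 * s) / (s / A)" using s A by (intro add_nonneg_nonneg divide_nonneg_pos) auto
  qed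
  finally show ?thesis using card_image[OF ginj] by (simp add: B_def)
 qed
 have "Z = (\<Union>y\<in>Y. {z\<in>Z. f z = y})" using f(1) by auto
 then have "card Z <= (\<Sum>y\<in>Y. card {z\<in>Z. f z = y})" using card_UN_le[OF Y(1), of "%y. {z\<in>Z. f z = y}"] by simp
 then have "real (card Z) <= (\<Sum>y\<in>Y. real (card {z\<in>Z. f z = y}))" by (metis of_nat_le_iff of_nat_sum)
 also have "... <= (\<Sum>y\<in>Y. (20 * A\<^sup>2) ^ m)" by (intro sum_mono group)
 also have "... <= exp (25 * (w * R / s)^2) * (20 * A\<^sup>2) ^ m" using Y(2) A by (simp add: mult_right_mono)
 finally show ?thesis .
qed

lemma separated_norm_le_1:
 fixes MF :: "'v::real_vector => 'b::real_inner"
 assumes MF: "linear MF" "!!y. y \<in> G ==> norm (MF y) <= 1"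
  and sep: "!!psi eta. linear psi ==> eta > 0 ==> \<exists>y\<in>G. psi x <= psi y + (eta::real)"
 shows "norm (MF x) <= 1"
proof (rule ccontr)
 define a where "a = norm (MF x)"
 assume "\<not> ?thesis"
 then have a: "a > 1" by (simp add: a_def)
 then have aa: "a < a * a" by simp
 have "linear (%z. MF x \<bullet> MF z)"
  by (rule linearI) (simp_all add: linear_add[OF MF(1)] linear_scale[OF MF(1)] inner_add_right)
 then obtain y where y: "y \<in> G" "MF x \<bullet> MF x <= MF x \<bullet> MF y + (a * a - a) / 2"
  using sep[of "%z. MF x \<bullet> MF z" "(a * a - a) / 2"] aa by auto
 have "MF x \<bullet> MF y <= a * 1"
  using norm_cauchy_schwarz[of "MF x" "MF y"] mult_left_mono[OF MF(2)[OF y(1)], of a] a by (simp add: a_def)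
 then have "a * a <= a + (a * a - a) / 2" using y(2) by (simp add: a_def power2_norm_eq_inner[symmetric] power2_eq_square)
 then show False using aa by argo
qed

text \<open>A deterministic form of Maurey's empirical method: the next $y_i$ is chosen by separation such that the inner product of the error so far with the new
summand is at most $1/2$. The squared error then grows by at most $1+4$.\<close>
lemma maurey:
 fixes MF :: "'v::real_vector => 'b::real_inner"
 assumes MF: "linear MF" "!!y. y \<in> G ==> norm (MF y) <= 1"
  and sep: "!!psi eta. linear psi ==> eta > 0 ==> \<exists>y\<in>G. psi x <= psi y + (eta::real)"
 shows "\<exists>y. (\<forall>i<mu. y i \<in> G) \<and> (norm (\<Sum>i<mu. MF x - MF (y i)))\<^sup>2 <= 5 * real mu"
proof -
 have lin: "linear (%z. e \<bullet> MF z)" for e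
  by (rule linearI) (simp_all add: linear_add[OF MF(1)] linear_scale[OF MF(1)] inner_add_right)
 have x1: "norm (MF x) <= 1" by (rule separated_norm_le_1[OF MF sep])
 show ?thesis
 proof (induction mu)
  case 0
  show ?case by simp
 next
  case (Suc mu)
  then obtain y where y: "!!i. i < mu ==> y i \<in> G" "(norm (\<Sum>i<mu. MF x - MF (y i)))^2 <= 5 * real mu" by blast
  define e where "e = (\<Sum>i<mu. MF x - MF (y i))"
  obtain z where z: "z \<in> G" "e \<bullet> MF x <= e \<bullet> MF z + 1 / 2" using sep[OF lin[of e], of "1 / 2"] by auto
  define d where "d = MF x - MF z"
  have "norm d <= 2" using norm_triangle_ineq4[of "MF x" "MF z"] x1 MF(2)[OF z(1)] by (simp add: d_def)
  then have d2: "(norm d)^2 <= 2\<^sup>2" by (intro power_mono) auto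
  have "(norm (e + d))^2 = (norm e)^2 + 2 * (e \<bullet> d) + (norm d)^2"
   by (simp add: power2_norm_eq_inner inner_add_left inner_add_right inner_commute)
  also have "... <= 5 * real mu + 1 + 4"
   using y(2) z(2) d2 by (simp add: e_def[symmetric] d_def inner_diff_right)
  finally have "(norm (e + d))^2 <= 5 * real (Suc mu)" by simp
  moreover have "(\<Sum>i<Suc mu. MF x - MF ((y(mu := z)) i)) = e + d" by (simp add: e_def d_def)
  ultimately show ?case using y(1) z(1) by (intro exI[of _ "y(mu := z)"]) (auto simp: less_Suc_eq)
 qed
qed

text \<open>The $r$-convexity of the unit ball of an $r$-norm.\<close>
definition rconv :: "real => 'v::real_vector set => bool" where
 "rconv r G \<longleftrightarrow> (\<forall>x\<in>G. \<forall>y\<in>G. \<forall>a\<ge>0. \<forall>b\<ge>0. a powr r + b powr r <= 1 --> a *\<^sub>R x + b *\<^sub>R y \<in> G)"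

lemma rconvD: "rconv r G ==> x \<in> G ==> y \<in> G ==> a >= 0 ==> b >= 0 ==> a powr r + b powr r <= 1 ==> a *\<^sub>R x + b *\<^sub>R y \<in> G"
 by (simp add: rconv_def)

lemma rconv_sum:
 assumes G: "rconv r G" "0 \<in> G" and r: "r > 0" and I: "finite I"
  and y: "!!i. i \<in> I ==> y i \<in> G" "!!i. i \<in> I ==> a i >= 0" "(\<Sum>i\<in>I. a i powr r) <= 1"
 shows "(\<Sum>i\<in>I. a i *\<^sub>R y i) \<in> G"
 using I y
proof (induction I arbitrary: a)
 case empty
 then show ?case using G by simp
next
 case (insert i I)
 define S where "S = (\<Sum>j\<in>I. a j powr r)"
 have S0: "S >= 0" by (simp add: S_def sum_nonneg)
 show ?case
 proof (cases "S = 0")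
  case True
  have "a j = 0" if "j \<in> I" for j
  proof -
   have "a j powr r = 0" using True insert.hyps(1) that by (simp add: S_def sum_nonneg_eq_0_iff)
   then show ?thesis by (simp add: powr_eq_0_iff)
  qed
  then have "(\<Sum>j\<in>insert i I. a j *\<^sub>R y j) = a i *\<^sub>R y i + 0 *\<^sub>R y i" using insert.hyps by simp
  also have "... \<in> G" using insert.prems insert.hyps True r by (intro rconvD[OF G(1)]) (auto simp: S_def)
  finally show ?thesis .
 next
  case False
  define b where "b = S powr (1 / r)"
  have b: "b > 0" "b powr r = S" using False S0 r by (simp_all add: b_def powr_powr)
  have "(\<Sum>j\<in>I. (a j / b) powr r) = 1"
   using b insert.prems False by (simp add: powr_divide sum_divide_distrib[symmetric] S_def)
  then have "(\<Sum>j\<in>I. (a j / b) *\<^sub>R y j) \<in> G" using insert.prems b by (intro insert.IH) auto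
  then have "a i *\<^sub>R y i + b *\<^sub>R (\<Sum>j\<in>I. (a j / b) *\<^sub>R y j) \<in> G"
   using insert.prems insert.hyps b by (intro rconvD[OF G(1)]) (auto simp: S_def)
  then show ?thesis using insert.hyps b by (simp add: scaleR_sum_right)
 qed
qed

text \<open>The Hilbertian norm whose ball is the $F$ of the introduction. It measures both the distance to the small subspace, at scale $R$, and $|Mx|$. The factor
$1/\sqrt2$ puts the body inside the ball.\<close>
definition flat_norm :: "nat => (nat => fsvec) => (nat => fsvec) => nat => real => (fsvec => fsvec) => fsvec => fsvec \<times> fsvec" where
 "flat_norm n tau q m R M x = (1 / sqrt 2) *\<^sub>R ((1 / R) *\<^sub>R (rows n tau x - proj q m (rows n tau x)), M x)"

lemma linear_flat_norm:
 assumes "linear M"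
 shows "linear (flat_norm n tau q m R M)"
 by (rule linearI) (simp_all add: flat_norm_def linear_add[OF assms] linear_scale[OF assms] linear_add[OF linear_rows] linear_scale[OF linear_rows]
   linear_add[OF linear_proj] linear_scale[OF linear_proj] scaleR_diff_right scaleR_add_right algebra_simps)

lemma norm_flat_norm:
 assumes "R > 0"
 shows "(norm (flat_norm n tau q m R M x))^2 = ((norm (rows n tau x - proj q m (rows n tau x)))^2 / R\<^sup>2 + (norm (M x))^2) / 2"
 unfolding flat_norm_def norm_scaleR norm_Pair power_mult_distrib
 using assms by (simp add: power_divide)

lemma flat_norm_le_1:
 assumes "R > 0" "norm (rows n tau x - proj q m (rows n tau x)) <= R" "norm (M x) <= 1"
 shows "norm (flat_norm n tau q m R M x) <= 1"
proof -
 have "(norm (rows n tau x - proj q m (rows n tau x)))^2 / R\<^sup>2 <= 1"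
  using power_mono[OF assms(2), of 2] assms(1) by (simp add: field_simps)
 moreover have "(norm (M x))^2 <= 1" using assms(3) by (simp add: power_le_one)
 ultimately have "(norm (flat_norm n tau q m R M x))^2 <= 1\<^sup>2" unfolding norm_flat_norm[OF assms(1)] by simp
 then show ?thesis by (rule power2_le_imp_le) simp
qed

lemma flat_norm_bounds:
 assumes R: "R > 0" and x: "norm (flat_norm n tau q m R M x) <= b" "b >= 0"
 shows "norm (rows n tau x - proj q m (rows n tau x)) <= sqrt 2 * b * R" "norm (M x) <= sqrt 2 * b"
proof -
 let ?d = "norm (rows n tau x - proj q m (rows n tau x))"
 have "(?d / R)^2 + (norm (M x))^2 <= 2 * b\<^sup>2"
  using norm_flat_norm[OF R, of n tau q m M x] power_mono[OF x(1), of 2] by (simp add: power_divide)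
 moreover have "(sqrt 2 * b)^2 = 2 * b\<^sup>2" by (simp add: power_mult_distrib)
 ultimately have "(?d / R)^2 <= (sqrt 2 * b)^2" "(norm (M x))^2 <= (sqrt 2 * b)^2"
  using zero_le_power2[of "?d / R"] zero_le_power2[of "norm (M x)"] by linarith+
 then have "?d / R <= sqrt 2 * b" "norm (M x) <= sqrt 2 * b"
  using x(2) by (auto intro: power2_le_imp_le)
 then show "?d <= sqrt 2 * b * R" "norm (M x) <= sqrt 2 * b" using R by (simp_all add: field_simps)
qed

text \<open>A maximal $3s$-separated subset of the Hilbert ball, for $N$, serves as the net. The difference of a point to the net is $3s$ times a point of the convex hull. Maurey's
method replaces this point by an average of $\mu$ points of $G$, and $r$-convexity puts their sum into $\mu^{1/r}G$. The error is at most
$3s\sqrt{5/\mu}\le1/2$.\<close>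
lemma one_step_cover:
 assumes G: "sym_body n G" "rconv r G" "r > 0" and S: "sandwich n A M G" and A: "A >= 1"
  and P: "positioned n G w tau N" and w: "w > 0"
  and q: "orthon q m" "!!l. l < m ==> q l \<in> Rn n" and s: "s >= 1" and R: "R > 0"
  and qG: "!!x. x \<in> G ==> norm (rows n tau x - proj q m (rows n tau x)) <= R"
  and mu: "mu >= 1" "real mu >= 180 * s\<^sup>2"
 shows "\<exists>Z. finite Z \<and> Z <= Rn n \<and> real (card Z) <= exp (50 * (w * R / s)^2) * (20 * A\<^sup>2) ^ m \<and>
  (\<forall>x\<in>Rn n. norm (flat_norm n tau q m R M x) <= 1 -->
   (\<exists>z\<in>Z. \<exists>y\<in>G. norm (flat_norm n tau q m R M (x - z - (3 * s * real mu powr (1 / r - 1)) *\<^sub>R y)) <= 1 / 2))"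
proof -
 let ?T = "rows n tau" and ?F = "flat_norm n tau q m R M"
 note M = sandwichD[OF S] and inj = positionedD(2)[OF P] and N = positionedD(4,5)[OF P] and NG = positionedD(6)[OF P] and sepG = positionedD(7)[OF P]
 have sN: "seminorm N" by (rule seminorm_nearly[OF N(1)])
 have linF: "linear ?F" by (rule linear_flat_norm[OF M(1)])
 have lT: "?T (c *\<^sub>R x) = c *\<^sub>R ?T x" "?T (x - y) = ?T x - ?T y" for c x y
  by (simp_all add: linear_scale[OF linear_rows] linear_diff[OF linear_rows])
 have up: "N (?T x) <= A * norm (M x)" if x: "x \<in> Rn n" for x
 proof (rule field_le_epsilon)
  fix e :: real assume e: "e > 0"
  define b where "b = A * norm (M x) + e"
  have b: "b > 0" using A e by (simp add: b_def add_nonneg_pos)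
  have "(1 / b) *\<^sub>R x \<in> G"
  proof (rule M(3))
   show "(1 / b) *\<^sub>R x \<in> Rn n" using x by simp
   have "A * norm (M x) <= b" using e by (simp add: b_def)
   then show "norm (M ((1 / b) *\<^sub>R x)) <= 1 / A" using A b by (simp add: linear_scale[OF M(1)] field_simps)
  qed
  then have "N (?T ((1 / b) *\<^sub>R x)) <= 1" by (rule NG)
  then have "N (?T x) <= b" using b by (simp add: lT seminormD(2)[OF sN] field_simps)
  then show "N (?T x) <= A * norm (M x) + e" by (simp add: b_def)
 qed
 have FG: "norm (?F y) <= 1" if "y \<in> G" for y
  by (rule flat_norm_le_1[where M=M, OF R qG[OF that] M(2)[OF that]])
 have low: "norm (M x) <= N (?T x)" if x: "x \<in> Rn n" for x
 proof (rule field_le_epsilon)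
  fix e :: real assume e: "e > 0"
  define b where "b = N (?T x) + e"
  have b: "b > 0" using seminorm_nonneg[OF sN, of "?T x"] e by (simp add: b_def add_nonneg_pos)
  have "N (?T ((1 / b) *\<^sub>R x)) <= 1" using b e by (simp add: lT seminormD(2)[OF sN] b_def)
  then have se: "\<exists>y\<in>G. psi ((1 / b) *\<^sub>R x) <= psi y + eta" if "linear psi" "eta > 0" for psi and eta :: real
   using x that by (intro sepG) auto
  have "norm (M ((1 / b) *\<^sub>R x)) <= 1" by (rule separated_norm_le_1[OF M(1,2) se])
  then have "norm (M x) <= b" using b by (simp add: linear_scale[OF M(1)])
  then show "norm (M x) <= N (?T x) + e" by (simp add: b_def)
 qed
 have "\<exists>Z. finite Z \<and> Z <= {x\<in>Rn n. norm (?F x) <= 1} \<and> pairwise (%x y. N (?T x - ?T y) >= 3 * s) Z \<and>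
   real (card Z) <= exp (25 * (w * (sqrt 2 * R) / s)^2) * (20 * A\<^sup>2) ^ m \<and>
  (\<forall>x\<in>{x\<in>Rn n. norm (?F x) <= 1}. \<exists>z\<in>Z. x = z \<or> \<not> N (?T x - ?T z) >= 3 * s)"
 proof (rule maximal_separated)
  show "N (?T x - ?T y) >= 3 * s ==> N (?T y - ?T x) >= 3 * s" for x y using seminorm_minus[OF sN, of "?T x - ?T y"] by simp
  fix Z assume Z: "finite Z" "Z <= {x\<in>Rn n. norm (?F x) <= 1}" "pairwise (%x y. N (?T x - ?T y) >= 3 * s) Z"
  show "real (card Z) <= exp (25 * (w * (sqrt 2 * R) / s)^2) * (20 * A\<^sup>2) ^ m"
  proof (rule packing_position[OF inj N w M(1) low up A q s Z(1)])
   show "Z <= Rn n" using Z(2) by auto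
   show "norm (?T z - proj q m (?T z)) <= sqrt 2 * R" if "z \<in> Z" for z
    using flat_norm_bounds(1)[OF R, of n tau q m M z 1] Z(2) that by auto
   show "N (?T z) <= 2 * A" if "z \<in> Z" for z
   proof -
    have z: "z \<in> Rn n" "norm (?F z) <= 1" using Z(2) that by auto
    have "norm (M z) <= sqrt 2" using flat_norm_bounds(2)[OF R z(2)] by simp
    also have "... <= 2" using real_sqrt_le_mono[of 2 4] by simp
    finally have "A * norm (M z) <= A * 2" using A by (intro mult_left_mono) auto
    then show ?thesis using up[OF z(1)] by linarith
   qed
   show "z \<in> Z ==> z' \<in> Z ==> z ~= z' ==> 3 * s <= N (?T z - ?T z')" for z z' using Z(3) by (auto simp: pairwise_def)
  qed
 qed
 then obtain Z where Z: "finite Z" "Z <= {x\<in>Rn n. norm (?F x) <= 1}"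
   "real (card Z) <= exp (25 * (w * (sqrt 2 * R) / s)^2) * (20 * A\<^sup>2) ^ m"
   "!!x. x \<in> {x\<in>Rn n. norm (?F x) <= 1} ==> \<exists>z\<in>Z. x = z \<or> \<not> N (?T x - ?T z) >= 3 * s"
  by blast
 have card: "real (card Z) <= exp (50 * (w * R / s)^2) * (20 * A\<^sup>2) ^ m"
  using Z(3) by (simp add: power_mult_distrib power_divide)
 have "\<exists>z\<in>Z. \<exists>y\<in>G. norm (?F (x - z - (3 * s * real mu powr (1 / r - 1)) *\<^sub>R y)) <= 1 / 2"
  if x: "x \<in> Rn n" "norm (?F x) <= 1" for x
 proof -
  obtain z where z: "z \<in> Z" "x = z \<or> \<not> N (?T x - ?T z) >= 3 * s" using Z(4) x by blast
  have zR: "z \<in> Rn n" using z(1) Z(2) by auto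
  have Nxz: "N (?T x - ?T z) <= 3 * s" using z(2) s sN by auto
  define u where "u = (1 / (3 * s)) *\<^sub>R (x - z)"
  have uR: "u \<in> Rn n" using x zR by (simp add: u_def)
  have Nu: "N (?T u) <= 1" using Nxz s by (simp add: u_def lT seminormD(2)[OF sN])
  obtain y where y: "!!i. i < mu ==> y i \<in> G" "(norm (\<Sum>i<mu. ?F u - ?F (y i)))^2 <= 5 * real mu"
   using maurey[OF linF FG sepG[OF _ uR Nu], of "mu"] by blast
  define c where "c = real mu powr (- 1 / r)"
  have mp: "real mu > 0" using mu(1) by simp
  have "c powr r = 1 / real mu" using G(3) mp unfolding c_def powr_powr by (simp add: powr_minus_divide)
  then have yG: "(\<Sum>i<mu. c *\<^sub>R y i) \<in> G"
   using y(1) mp by (intro rconv_sum[OF G(2) sym_bodyD(4)[OF G(1)] G(3)]) (auto simp: c_def)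
  have c1: "real mu powr (1 / r - 1) * c = 1 / real mu"
   unfolding c_def powr_add[symmetric] using mp by (simp add: powr_minus_divide)
  have e: "x - z - (3 * s * real mu powr (1 / r - 1)) *\<^sub>R (\<Sum>i<mu. c *\<^sub>R y i) = (3 * s / real mu) *\<^sub>R (\<Sum>i<mu. u - y i)"
  proof -
   have "(3 * s * real mu powr (1 / r - 1)) *\<^sub>R (\<Sum>i<mu. c *\<^sub>R y i) = (3 * s * (real mu powr (1 / r - 1) * c)) *\<^sub>R (\<Sum>i<mu. y i)"
    by (simp add: scaleR_sum_right mult.assoc)
   also have "... = (3 * s / real mu) *\<^sub>R (\<Sum>i<mu. y i)" unfolding c1 by simp
   moreover have "x - z = (3 * s / real mu) *\<^sub>R (real mu *\<^sub>R u)" using s mp by (simp add: u_def)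
   ultimately show ?thesis by (simp add: sum_subtractf scaleR_diff_right sum_constant_scaleR)
  qed
  have "norm (?F (x - z - (3 * s * real mu powr (1 / r - 1)) *\<^sub>R (\<Sum>i<mu. c *\<^sub>R y i)))
   = (3 * s / real mu) * norm (\<Sum>i<mu. ?F u - ?F (y i))"
   unfolding e using s mp by (simp add: linear_scale[OF linF] linear_sum[OF linF] linear_diff[OF linF])
  also have "... <= (3 * s / real mu) * sqrt (5 * real mu)"
   using y(2) s mp by (intro mult_left_mono real_le_rsqrt) auto
  also have "... <= 1 / 2"
  proof -
   have "((3 * s / real mu) * sqrt (5 * real mu))^2 = 45 * s\<^sup>2 / real mu"
   proof -
    have "((3 * s / real mu) * sqrt (5 * real mu))^2 = (3 * s / real mu)^2 * (5 * real mu)"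
     unfolding power_mult_distrib[of "3 * s / real mu"] by simp
    then show ?thesis using mp by (simp add: power2_eq_square field_simps)
   qed
   also have "... <= (1 / 2)^2" using mu(2) mp by (simp add: field_simps power2_eq_square)
   finally show ?thesis by (rule power2_le_imp_le) simp
  qed
  finally show ?thesis using z(1) yG by blast
 qed
 then show ?thesis using Z(1,2) card by (intro exI[of _ Z]) auto
qed

lemma cover_iterate:
 fixes MF :: "fsvec => 'b::real_inner"
 assumes MF: "linear MF" and G: "G <= Rn n"
  and Z: "finite Z" "Z <= Rn n" "real (card Z) <= B"
  and cov: "!!x. x \<in> Rn n ==> norm (MF x) <= 1 ==> \<exists>z\<in>Z. \<exists>y\<in>G. norm (MF (x - z - a *\<^sub>R y)) <= 1 / 2"
 shows "\<exists>Z'. finite Z' \<and> Z' <= Rn n \<and> real (card Z') <= B ^ t \<and> (\<forall>x\<in>Rn n. norm (MF x) <= 1 -->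
  (\<exists>z\<in>Z'. \<exists>y. (\<forall>i<t. y i \<in> G) \<and> norm (MF (x - z - (\<Sum>i<t. (a / 2 ^ i) *\<^sub>R y i))) <= 1 / 2 ^ t))"
proof (induction t)
 case 0
 show ?case by (intro exI[of _ "{0}"]) auto
next
 case (Suc t)
 then obtain Z1 where Z1: "finite Z1" "Z1 <= Rn n" "real (card Z1) <= B ^ t"
  "!!x. x \<in> Rn n ==> norm (MF x) <= 1 ==> \<exists>z\<in>Z1. \<exists>y. (\<forall>i<t. y i \<in> G) \<and> norm (MF (x - z - (\<Sum>i<t. (a / 2 ^ i) *\<^sub>R y i))) <= 1 / 2 ^ t"
  by blast
 define Z2 where "Z2 = (%(z, z'). z + (1 / 2 ^ t) *\<^sub>R z') ` (Z1 \<times> Z)"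
 have B: "B >= 0" using Z(3) of_nat_0_le_iff order_trans by blast
 have "finite Z2" using Z1 Z by (auto simp: Z2_def)
 moreover have "Z2 <= Rn n" using Z1(2) Z(2) by (auto simp: Z2_def intro!: Rn_simps(2,5))
 moreover have "real (card Z2) <= B ^ Suc t"
 proof -
  have "card Z2 <= card (Z1 \<times> Z)" unfolding Z2_def using Z1 Z by (intro card_image_le) auto
  then have "real (card Z2) <= real (card Z1) * real (card Z)" by (simp add: card_cartesian_product flip: of_nat_mult)
  also have "... <= B ^ t * B" using Z1(3) Z(3) B by (intro mult_mono) auto
  finally show ?thesis by (simp add: mult.commute)
 qed
 moreover have "\<exists>z\<in>Z2. \<exists>y. (\<forall>i<Suc t. y i \<in> G) \<and> norm (MF (x - z - (\<Sum>i<Suc t. (a / 2 ^ i) *\<^sub>R y i))) <= 1 / 2 ^ Suc t"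
  if x: "x \<in> Rn n" "norm (MF x) <= 1" for x
 proof -
  obtain z y where zy: "z \<in> Z1" "!!i. i < t ==> y i \<in> G" "norm (MF (x - z - (\<Sum>i<t. (a / 2 ^ i) *\<^sub>R y i))) <= 1 / 2 ^ t"
   using Z1(4)[OF x] by blast
  define v where "v = x - z - (\<Sum>i<t. (a / 2 ^ i) *\<^sub>R y i)"
  have vR: "v \<in> Rn n" unfolding v_def using x zy Z1(2) G by (intro Rn_simps Rn_sum) auto
  have "norm (MF ((2 ^ t) *\<^sub>R v)) <= 1" using zy(3) unfolding v_def[symmetric] linear_scale[OF MF] norm_scaleR by (simp add: field_simps)
  then obtain z' y' where z': "z' \<in> Z" "y' \<in> G" "norm (MF ((2 ^ t) *\<^sub>R v - z' - a *\<^sub>R y')) <= 1 / 2" using cov[of "(2 ^ t) *\<^sub>R v"] vR by auto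
  have e: "x - (z + (1 / 2 ^ t) *\<^sub>R z') - (\<Sum>i<Suc t. (a / 2 ^ i) *\<^sub>R (y(t := y')) i) = (1 / 2 ^ t) *\<^sub>R ((2 ^ t) *\<^sub>R v - z' - a *\<^sub>R y')"
   by (simp add: v_def scaleR_diff_right)
  have "norm (MF (x - (z + (1 / 2 ^ t) *\<^sub>R z') - (\<Sum>i<Suc t. (a / 2 ^ i) *\<^sub>R (y(t := y')) i))) <= 1 / 2 ^ Suc t"
   unfolding e linear_scale[OF MF] norm_scaleR using z'(3) by (simp add: field_simps)
  moreover have "z + (1 / 2 ^ t) *\<^sub>R z' \<in> Z2" using zy(1) z'(1) by (force simp: Z2_def)
  ultimately show ?thesis using zy(2) z'(2) by (intro bexI[of _ "z + (1 / 2 ^ t) *\<^sub>R z'"] exI[of _ "y(t := y')"]) (auto simp: less_Suc_eq)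
 qed
 ultimately show ?case by blast
qed

lemma geometric_bound: "0 <= x ==> x < 1 ==> (\<Sum>i<t. x ^ i) <= 1 / (1 - x)" for x :: real
 by (simp add: sum_gp_strict divide_right_mono)

text \<open>After $t$ rounds of \<open>one_step_cover\<close> the error lies in $G$ by itself. The points of $G$ are gathered by $r$-convexity; their coefficients
$a/2^i$ have a summable $r$-th power.\<close>
lemma cover_by_body:
 fixes MF :: "fsvec => 'b::real_inner"
 assumes MF: "linear MF" and G: "sym_body n G" "rconv r G" and r: "r > 0"
  and Z: "finite Z" "Z <= Rn n" "real (card Z) <= B" and a: "a >= 0"
  and cov: "!!x. x \<in> Rn n ==> norm (MF x) <= 1 ==> \<exists>z\<in>Z. \<exists>y\<in>G. norm (MF (x - z - a *\<^sub>R y)) <= 1 / 2"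
  and small: "!!x. x \<in> Rn n ==> norm (MF x) <= 1 / 2 ^ t ==> x \<in> G"
  and a': "a' > 0" "a powr r / (1 - 2 powr - r) + 1 <= a' powr r"
 shows "\<exists>Z'. finite Z' \<and> Z' <= Rn n \<and> real (card Z') <= B ^ t \<and> (\<forall>x\<in>Rn n. norm (MF x) <= 1 --> (\<exists>z\<in>Z'. \<exists>y\<in>G. x = z + a' *\<^sub>R y))"
proof -
 obtain Z' where Z': "finite Z'" "Z' <= Rn n" "real (card Z') <= B ^ t"
  "!!x. x \<in> Rn n ==> norm (MF x) <= 1 ==> \<exists>z\<in>Z'. \<exists>y. (\<forall>i<t. y i \<in> G) \<and> norm (MF (x - z - (\<Sum>i<t. (a / 2 ^ i) *\<^sub>R y i))) <= 1 / 2 ^ t"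
  using cover_iterate[OF MF sym_bodyD(1)[OF G(1)] Z cov, of t] by blast
 have "\<exists>z\<in>Z'. \<exists>y\<in>G. x = z + a' *\<^sub>R y" if x: "x \<in> Rn n" "norm (MF x) <= 1" for x
 proof -
  obtain z y where zy: "z \<in> Z'" "!!i. i < t ==> y i \<in> G" "norm (MF (x - z - (\<Sum>i<t. (a / 2 ^ i) *\<^sub>R y i))) <= 1 / 2 ^ t"
   using Z'(4)[OF x] by blast
  define v where "v = x - z - (\<Sum>i<t. (a / 2 ^ i) *\<^sub>R y i)"
  have "v \<in> Rn n" unfolding v_def using x zy Z'(2) sym_bodyD(1)[OF G(1)] by (intro Rn_simps Rn_sum) auto
  then have vG: "v \<in> G" using small zy(3) by (simp add: v_def)
  define Y where "Y = y(t := v)"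
  define c where "c i = (if i < t then a / 2 ^ i else 1) / a'" for i
  have r2: "2 powr - r < 1" using r by (simp add: powr_less_one)
  have "(\<Sum>i<t. (a / 2 ^ i) powr r) = (\<Sum>i<t. a powr r * (2 powr - r) ^ i)"
  proof (intro sum.cong refl)
   fix i
   have "(2 ^ i) powr r = (2 powr r) ^ i" by (simp add: powr_realpow[symmetric] powr_powr mult.commute)
   then show "(a / 2 ^ i) powr r = a powr r * (2 powr - r) ^ i"
    using a powr_divide[of a "2 ^ i" r] by (simp add: powr_minus_divide power_divide)
  qed
  also have "... <= a powr r * (1 / (1 - 2 powr - r))"
   unfolding sum_distrib_left[symmetric] using r2 by (intro mult_left_mono geometric_bound) auto
  finally have "(\<Sum>i<t. (a / 2 ^ i) powr r) + 1 <= a' powr r" using a'(2) by simp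
  moreover have "(\<Sum>i<Suc t. c i powr r) = ((\<Sum>i<t. (a / 2 ^ i) powr r) + 1) / a' powr r"
   using a a'(1) by (simp add: c_def powr_divide sum_divide_distrib add_divide_distrib)
  ultimately have c1: "(\<Sum>i<Suc t. c i powr r) <= 1" using a'(1) by simp
  have "(\<Sum>i<Suc t. c i *\<^sub>R Y i) \<in> G"
  proof (rule rconv_sum[OF G(2) sym_bodyD(4)[OF G(1)] r _ _ _ c1])
   show "Y i \<in> G" if "i \<in> {..<Suc t}" for i using that zy(2) vG by (auto simp: Y_def less_Suc_eq)
   show "c i >= 0" for i using a a'(1) by (simp add: c_def)
  qed simp
  moreover have "x = z + a' *\<^sub>R (\<Sum>i<Suc t. c i *\<^sub>R Y i)"
   using a'(1) by (simp add: c_def Y_def scaleR_sum_right scaleR_add_right v_def)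
  ultimately show ?thesis using zy(1) by blast
 qed
 then show ?thesis using Z'(1-3) by blast
qed

lemma cms_compact:
 assumes "compact K"
 shows "cms n K"
proof (cases "K = {}")
 case True
 then show ?thesis by (simp add: cms_def cset_def)
next
 case False
 have "K = {x. infdist x K <= 0}"
  using in_closed_iff_infdist_zero[OF compact_imp_closed[OF assms] False] infdist_nonneg[of _ K] by (auto intro: antisym)
 moreover have "cms n {x. infdist x K <= 0}" by (intro cms_le continuous_intros)
 ultimately show ?thesis by simp
qed

text \<open>By $r$-convexity $g+\kappa y$ lies in $(1+\kappa^r)^{1/r}G$.\<close>
lemma cvol_cover:
 assumes G: "compact G" "rconv r G" and r: "r > 0" and Z: "finite Z" "Z <= Rn n" and k: "kappa >= 0"
  and S: "!!x. x \<in> S ==> \<exists>g\<in>G. \<exists>z\<in>Z. \<exists>y\<in>G. x = g + z + kappa *\<^sub>R y"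
 shows "cvol n S <= real (card Z) * ((1 + kappa powr r) powr (real n / r) * cvol n G)"
proof -
 define beta where "beta = (1 + kappa powr r) powr (1 / r)"
 have p: "1 + kappa powr r > 0" by (simp add: add_pos_nonneg)
 then have beta: "beta > 0" "beta powr r = 1 + kappa powr r" using r by (simp_all add: beta_def powr_powr)
 have betan: "beta ^ n = (1 + kappa powr r) powr (real n / r)"
  using p by (simp add: beta_def powr_realpow[symmetric] powr_powr)
 let ?K = "%z. {x. (1 / beta) *\<^sub>R (x - z) \<in> G}"
 have GC: "cms n G" by (rule cms_compact[OF G(1)])
 obtain Rg where Rg: "!!x. x \<in> G ==> norm x <= Rg" using compact_imp_bounded[OF G(1)] by (auto simp: bounded_iff)
 have "cvol n S <= (\<Sum>z\<in>Z. cvol n (?K z))"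
 proof (rule cvol_UN_le[OF Z(1)])
  show "cms n (?K z)" if "z \<in> Z" for z using that Z(2) beta(1) by (intro cvol_scale(1)[OF GC]) auto
  show "bounded (?K z)" for z
  proof (rule boundedI)
   fix x assume "x \<in> ?K z"
   then have "norm ((1 / beta) *\<^sub>R (x - z)) <= Rg" by (intro Rg) simp
   then have "norm (x - z) / beta <= Rg" using beta(1) by simp
   then have "norm (x - z) <= beta * Rg" using beta(1) by (simp add: pos_divide_le_eq mult.commute)
   then show "norm x <= beta * Rg + norm z" using norm_triangle_sub[of x z] by linarith
  qed
  fix x assume "x \<in> S"
  then obtain g z y where gzy: "g \<in> G" "z \<in> Z" "y \<in> G" "x = g + z + kappa *\<^sub>R y" using S by blast
  have "(1 / beta) powr r + (kappa / beta) powr r <= 1"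
   using beta k p by (simp add: powr_divide add_divide_distrib[symmetric])
  then have "(1 / beta) *\<^sub>R g + (kappa / beta) *\<^sub>R y \<in> G" using gzy beta(1) k by (intro rconvD[OF G(2)]) auto
  moreover have "(1 / beta) *\<^sub>R (x - z) = (1 / beta) *\<^sub>R g + (kappa / beta) *\<^sub>R y"
   by (simp add: gzy(4) scaleR_add_right)
  ultimately show "\<exists>z\<in>Z. x \<in> ?K z" using gzy(2) by (intro bexI[of _ z]) simp_all
 qed
 also have "... = (\<Sum>z\<in>Z. beta ^ n * cvol n G)"
  using Z(2) beta(1) by (intro sum.cong refl cvol_scale(2)[OF GC]) auto
 finally show ?thesis by (simp add: betan)
qed

section \<open>Sums of a body and an ellipsoid\<close>

lemma Ell_subset:
 assumes "!!i. i < d ==> s i \<in> Rn n"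
 shows "Ell d s <= Rn n"
 unfolding Ell_def using assms by (auto intro!: Rn_sum Rn_simps(5))

lemma continuous_on_cf: "continuous_on S (%x. cf x i)"
 unfolding inner_ax'[symmetric] by (intro continuous_intros)

lemma compact_Ell: "compact (Ell d s)"
 unfolding Ell_def by (intro compact_continuous_image compact_Rn_ball continuous_intros continuous_on_cf)

lemma Ell_comb:
 assumes "u \<in> Ell d s" "v \<in> Ell d s" "\<bar>a\<bar> + \<bar>b\<bar> <= 1"
 shows "a *\<^sub>R u + b *\<^sub>R v \<in> Ell d s"
proof -
 obtain x y where xy: "x \<in> Rn d" "norm x <= 1" "u = comb d s x" "y \<in> Rn d" "norm y <= 1" "v = comb d s y"
  using assms by (auto simp: Ell_def)
 have "norm (a *\<^sub>R x + b *\<^sub>R y) <= \<bar>a\<bar> * norm x + \<bar>b\<bar> * norm y" by (rule norm_triangle_ineq[THEN order_trans]) simp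
 also have "... <= \<bar>a\<bar> * 1 + \<bar>b\<bar> * 1" using xy by (intro add_mono mult_left_mono) auto
 finally have "a *\<^sub>R x + b *\<^sub>R y \<in> Rn d \<inter> cball 0 1" using assms(3) xy by simp
 moreover have "a *\<^sub>R u + b *\<^sub>R v = comb d s (a *\<^sub>R x + b *\<^sub>R y)"
  unfolding xy by (simp add: scaleR_left_distrib sum.distrib scaleR_sum_right)
 ultimately show ?thesis unfolding Ell_def by blast
qed

lemma powr_sum_le_1:
 fixes a b :: real
 assumes "a >= 0" "b >= 0" "a powr r + b powr r <= 1" "0 < r" "r <= 1"
 shows "a + b <= 1"
proof -
 have le: "x <= x powr r" if "x >= 0" "x powr r <= 1" for x :: real
 proof (cases "x = 0")
  case False
  have "x <= 1"
  proof (rule ccontr)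
   assume "\<not> x <= 1"
   then have "1 powr r < x powr r" using assms(4) by (intro powr_less_mono2) auto
   then show False using that by simp
  qed
  then show ?thesis using powr_mono'[of r 1 x] that(1) assms(5) False by simp
 qed simp
 have "a powr r <= 1" "b powr r <= 1" using assms(3) powr_ge_zero[of a r] powr_ge_zero[of b r] by linarith+
 then show ?thesis using le[OF assms(1)] le[OF assms(2)] assms(3) by linarith
qed

lemma set_plus_body:
 assumes K: "sym_body n K" "compact K" "rconv r K" and r: "0 < r" "r <= 1" and s: "!!i. i < d ==> s i \<in> Rn n"
 shows "sym_body n (set_plus K (Ell d s))" "compact (set_plus K (Ell d s))" "rconv r (set_plus K (Ell d s))"
proof -
 let ?G = "set_plus K (Ell d s)"
 show c: "compact ?G" unfolding set_plus_def by (intro compact_sums K compact_Ell)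
 have KG: "K <= ?G" using zero_in_Ell[of d s] by (force simp: set_plus_def)
 have "?G <= Rn n" using sym_bodyD(1)[OF K(1)] Ell_subset[of d s n] s by (auto simp: set_plus_def intro!: Rn_simps(2))
 moreover have "- z \<in> ?G" if z: "z \<in> ?G" for z
 proof -
  obtain x y where xy: "x \<in> K" "y \<in> Ell d s" "z = x + y" using z by (auto simp: set_plus_def)
  have "- y \<in> Ell d s" using Ell_comb[OF xy(2,2), of "-1" 0] by simp
  moreover have "- z = - x + - y" by (simp add: xy)
  ultimately show ?thesis using sym_bodyD(3)[OF K(1) xy(1)] unfolding set_plus_def by blast
 qed
 moreover obtain rho where "rho > 0" "!!x. x \<in> Rn n ==> norm x <= rho ==> x \<in> K" using K(1) by (auto simp: sym_body_def)
 ultimately show "sym_body n ?G" unfolding sym_body_def using compact_imp_bounded[OF c] KG by blast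
 show "rconv r ?G"
  unfolding rconv_def
 proof (intro ballI allI impI)
  fix z w :: fsvec and a b :: real
  assume zw: "z \<in> ?G" "w \<in> ?G" and ab: "0 <= a" "0 <= b" "a powr r + b powr r <= 1"
  obtain x y x' y' where xy: "x \<in> K" "y \<in> Ell d s" "z = x + y" "x' \<in> K" "y' \<in> Ell d s" "w = x' + y'"
   using zw by (auto simp: set_plus_def)
  have "a *\<^sub>R x + b *\<^sub>R x' \<in> K" by (rule rconvD[OF K(3) xy(1,4) ab])
  moreover have "a *\<^sub>R y + b *\<^sub>R y' \<in> Ell d s" using powr_sum_le_1[OF ab r] ab by (intro Ell_comb xy) auto
  moreover have "a *\<^sub>R z + b *\<^sub>R w = (a *\<^sub>R x + b *\<^sub>R x') + (a *\<^sub>R y + b *\<^sub>R y')" by (simp add: xy scaleR_right_distrib)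
  ultimately show "a *\<^sub>R z + b *\<^sub>R w \<in> ?G" unfolding set_plus_def by blast
 qed
qed

lemma hilbert_ball_Ell:
 fixes M :: "fsvec => 'b::real_inner"
 assumes M: "linear M" "!!x. x \<in> Rn n ==> M x = 0 ==> x = 0"
 shows "\<exists>v s. uppertri n v \<and> (\<forall>x\<in>Rn n. norm (rows n v x) = norm (M x)) \<and> (\<forall>j<n. s j \<in> Rn n) \<and>
  (\<forall>b. norm (M (comb n s b)) = norm (cvec n (cf b))) \<and>
  (\<forall>x\<in>Rn n. x = comb n s (rows n v x))"
proof -
 obtain v where v: "uppertri n v" "!!x. x \<in> Rn n ==> norm (rows n v x) = norm (M x)" using uppertri_of_linear[OF M] by blast
 obtain s where s: "(\<forall>j<n. s j \<in> Rn n \<and> rows n v (s j) = ax j) \<and>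
   (\<forall>x\<in>Rn n. x = comb n s (rows n v x)) \<and> (\<forall>z\<in>Rn n. rows n v (comb n s z) = z)"
   using rows_dual_basis[OF uppertri_inj[OF v(1)]] by (rule exE)
 have "norm (M (comb n s b)) = norm (cvec n (cf b))" for b
 proof -
  have e: "comb n s b = comb n s (cvec n (cf b))" by (intro sum.cong) (auto simp: cf_cvec)
  have "(comb n s b) \<in> Rn n" using s by (intro Rn_sum Rn_simps) auto
  then have "norm (M (comb n s b)) = norm (rows n v (comb n s b))" using v(2) by simp
  also have "rows n v (comb n s b) = cvec n (cf b)" unfolding e using s by simp
  finally show ?thesis .
 qed
 moreover have "\<forall>x\<in>Rn n. norm (rows n v x) = norm (M x)" "\<forall>j<n. s j \<in> Rn n" "\<forall>x\<in>Rn n. x = comb n s (rows n v x)"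
  using v s by blast+
 ultimately show ?thesis using v(1) by blast
qed

lemma norm_cvec_cf_le: "norm (cvec n (%i. cf b (d + i))) <= norm b"
proof -
 have "(norm (cvec n (%i. cf b (d + i))))^2 = (\<Sum>i<n. cf b (d + i) * cf b (d + i))" unfolding norm_cvec by (simp add: power2_eq_square)
 also have "... <= (\<Sum>i<d + n. cf b i * cf b i)"
  by (subst sum_lessThan_add) (simp add: sum_nonneg)
 also have "... = cvec (d + n) (cf b) \<bullet> b" by (simp add: inner_cvec)
 also have "... <= norm (cvec (d + n) (cf b)) * norm b" by (rule norm_cauchy_schwarz)
 also have "norm (cvec (d + n) (cf b)) <= norm b"
 proof -
  have "(norm (cvec (d + n) (cf b)))^2 = cvec (d + n) (cf b) \<bullet> b" unfolding norm_cvec inner_cvec by (simp add: power2_eq_square)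
  also have "... <= norm (cvec (d + n) (cf b)) * norm b" by (rule norm_cauchy_schwarz)
  finally show ?thesis by (cases "norm (cvec (d + n) (cf b)) = 0") (auto simp: power2_eq_square)
 qed
 finally have "(norm (cvec n (%i. cf b (d + i))))^2 <= (norm b)^2" by (simp add: power2_eq_square mult_right_mono)
 then show ?thesis by (rule power2_le_imp_le) simp
qed

text \<open>Appends the axes of the ellipsoid $\{t\sum_j b_je_j : |b|\le1\}$. The new ellipsoid contains the two given ones and is contained in their sum.\<close>
definition append_axes :: "nat => (nat => fsvec) => real => (nat => fsvec) => nat => fsvec" where
 "append_axes d s t e i = (if i < d then s i else t *\<^sub>R e (i - d))"

lemma append_axes_sum:
 "(\<Sum>i<d + n. c i *\<^sub>R append_axes d s t e i) = (\<Sum>i<d. c i *\<^sub>R s i) + t *\<^sub>R (\<Sum>j<n. c (d + j) *\<^sub>R e j)"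
proof (induction n)
 case 0
 then show ?case by (simp add: append_axes_def)
next
 case (Suc n)
 then show ?case by (simp add: append_axes_def scaleR_right_distrib mult.commute)
qed

lemma Ell_append:
 assumes "z \<in> Ell (d + n) (append_axes d s t e)"
 shows "\<exists>y\<in>Ell d s. \<exists>b\<in>Rn n. norm b <= 1 \<and> z = y + t *\<^sub>R (comb n e b)"
proof -
 obtain b where b: "norm b <= 1" "z = (\<Sum>i<d + n. cf b i *\<^sub>R append_axes d s t e i)" using assms by (auto simp: Ell_def)
 define b1 where "b1 = cvec d (cf b)"
 define b2 where "b2 = cvec n (%j. cf b (d + j))"
 have "norm b1 <= 1" using norm_cvec_cf_le[of d b 0] b(1) by (simp add: b1_def)
 moreover have "norm b2 <= 1" using norm_cvec_cf_le[of n b d] b(1) by (simp add: b2_def)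
 moreover have "z = comb d s b1 + t *\<^sub>R (comb n e b2)"
  unfolding b append_axes_sum by (simp add: b1_def b2_def cf_cvec)
 ultimately show ?thesis by (intro bexI[of _ "\<Sum>i<d. cf b1 i *\<^sub>R s i"] bexI[of _ b2]) (auto simp: Ell_def b1_def b2_def)
qed

lemma Ell_append_left: "Ell d s <= Ell (d + n) (append_axes d s t e)"
proof
 fix z assume "z \<in> Ell d s"
 then obtain b where b: "b \<in> Rn d" "norm b <= 1" "z = comb d s b" by (auto simp: Ell_def)
 have "b \<in> Rn (d + n)" "!!j. cf b (d + j) = 0" using b(1) by (auto simp: Rn_def)
 then show "z \<in> Ell (d + n) (append_axes d s t e)"
  unfolding Ell_def using b by (intro image_eqI[of _ _ b]) (auto simp: append_axes_sum)
qed

lemma Ell_append_right: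
 assumes "b \<in> Rn n" "norm b <= 1"
 shows "t *\<^sub>R (comb n e b) \<in> Ell (d + n) (append_axes d s t e)"
proof -
 define b' where "b' = cvec (d + n) (%i. if i < d then 0 else cf b (i - d))"
 have "(norm b')^2 = (\<Sum>i<n. (cf b i)^2)" unfolding b'_def norm_cvec by (subst sum_lessThan_add) simp
 also have "... = (norm b)^2" using norm_cvec[of n "cf b"] cvec_cf[OF assms(1)] by simp
 finally have "norm b' <= 1" using assms(2) by simp
 moreover have "t *\<^sub>R (comb n e b) = (\<Sum>i<d + n. cf b' i *\<^sub>R append_axes d s t e i)"
  unfolding append_axes_sum by (simp add: b'_def cf_cvec)
 ultimately show ?thesis unfolding Ell_def by (intro image_eqI[of _ _ b']) (auto simp: b'_def)
qed

section \<open>One step of the iteration\<close>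

lemma iteration_constants:
 fixes Ca :: real
 assumes "0 < r" "Ca > 0"
 shows "\<exists>A0. \<forall>A\<ge>A0. A >= 1 \<and> ln A >= 2 \<and> 2 * Ca * ln A powr (10 / r) <= A powr (1 / 4)"
proof -
 have "10 / r > 0" using assms by simp
 then have "eventually (%A::real. 2 * Ca * ln A powr (10 / r) <= A powr (1 / 4)) at_top"
  using assms(2) by real_asymp
 moreover have "eventually (%A::real. ln A >= 2) at_top" by real_asymp
 moreover have "eventually (%A::real. A >= 1) at_top" by (rule eventually_ge_at_top)
 ultimately have "eventually (%A. A >= 1 \<and> ln A >= 2 \<and> 2 * Ca * ln A powr (10 / r) <= A powr (1 / 4)) at_top"
  by (intro eventually_conj)
 then show ?thesis by (simp add: eventually_at_top_linorder)
qed

definition rbody :: "nat => real => real => fsvec set => bool" where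
 "rbody n r c K \<longleftrightarrow> sym_body n K \<and> compact K \<and> rconv r K \<and> wct n c K"

definition improvable :: "nat => real => real => fsvec set => bool" where
 "improvable n A0 C K \<longleftrightarrow> (\<forall>d s A M. A >= A0 --> (\<forall>i<d. s i \<in> Rn n) --> sandwich n A M (set_plus K (Ell d s)) -->
  (\<exists>d' s' M'. (\<forall>i<d'. s' i \<in> Rn n) \<and> set_plus K (Ell d s) <= set_plus K (Ell d' s') \<and>
   sandwich n (sqrt A) M' (set_plus K (Ell d' s')) \<and>
   cvol n (set_plus K (Ell d' s')) <= exp (real n * (C / (ln A)^2)) * cvol n (set_plus K (Ell d s))))"

text \<open>With $L=\ln A$, the parameters are chosen such that each source of volume contributes at most a multiple of $n/L^2$ to the exponent, whereas $\theta$, the multiple of the Hilbert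
ball $F$ that is added, is at least $2/\sqrt A$. The new body lies in $(1+\theta)F$ and contains $\theta F$, so their ratio is at most $\sqrt A$.\<close>
lemma position_step:
 assumes r: "0 < r" "r <= 1" and c: "c >= 0"
 shows "\<exists>A0 C. A0 >= exp 2 \<and> C >= 0 \<and> (\<forall>n K. n >= 1 --> rbody n r c K --> improvable n A0 C K)"
proof -
 define c' where "c' = 2 * (c + 1)"
 have c': "c' > 0" using c by (simp add: c'_def)
 \<comment> \<open>the exponent $\delta=1/(p+1)$ is so small that even the power $2/r-1$ of $A^\delta$, which enters \<open>theta\<close>, is at most $A^{1/4}$\<close>
 define p where "p = nat \<lceil>8 / r\<rceil>"
 have ri: "1 / r >= 1" using r by simp
 then have r8: "8 / r >= 8" "2 / r >= 2" by simp_all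
 have p8: "real p >= 8 / r" using r8(1) by (simp add: p_def)
 then have p: "p >= 1" using r8(1) by linarith
 define delta where "delta = 1 / real (p + 1)"
 have delta: "delta > 0" "delta * (2 / r - 1) <= 1 / 4"
 proof -
  show "delta > 0" by (simp add: delta_def)
  have "2 / r - 1 <= (1 / 4) * real (p + 1)" using p8 by simp
  then show "delta * (2 / r - 1) <= 1 / 4" by (simp add: delta_def field_simps)
 qed
 obtain W where W: "K_convex_bound p W" using K_convexity[OF p] by blast
 then have W0: "W > 0" by (simp add: K_convex_bound_def)
 define D where "D = (3 * 181 powr (1 / r - 1)) powr r / (1 - 2 powr - r) + 1"
 have r2: "2 powr - r < 1" using r by (simp add: powr_less_one)
 have D: "D > 0" unfolding D_def using r2 by (intro add_nonneg_pos divide_nonneg_pos) auto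
 define Ca where "Ca = D powr (1 / r)"
 have Ca: "Ca > 0" "Ca powr r = D" using D r by (simp_all add: Ca_def powr_powr)
 obtain A1 where A1: "!!A. A >= A1 ==> A >= 1 \<and> ln A >= 2 \<and> 2 * Ca * ln A powr (10 / r) <= A powr (1 / 4)"
  using iteration_constants[OF r(1) Ca(1)] by blast
 define C where "C = 200 * W\<^sup>2 * c'\<^sup>2 + 20 + 1 / r"
 have C0: "C >= 0" using r by (simp add: C_def)
 have main: "\<exists>d' s' M'. (\<forall>i<d'. s' i \<in> Rn n) \<and> set_plus K (Ell d s) <= set_plus K (Ell d' s') \<and>
   sandwich n (sqrt A) M' (set_plus K (Ell d' s')) \<and>
   cvol n (set_plus K (Ell d' s')) <= exp (real n * (C / (ln A)^2)) * cvol n (set_plus K (Ell d s))"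
  if n: "n >= 1" and K0: "rbody n r c K" and s: "\<forall>i<d. s i \<in> Rn n" and AA: "A >= max A1 (exp 2)"
   and SG: "sandwich n A M (set_plus K (Ell d s))" for n K d s A M
 proof -
  have K: "sym_body n K" "compact K" "rconv r K" "wct n c K" using K0 by (simp_all add: rbody_def)
  define G where "G = set_plus K (Ell d s)"
  have S: "sandwich n A M G" using SG by (simp add: G_def)
  note M = sandwichD(1)[OF S] and GM = sandwichD(2)[OF S] and MG = sandwichD(3)[OF S]
  have s': "!!i. i < d ==> s i \<in> Rn n" using s by blast
  have G: "sym_body n G" "compact G" "rconv r G"
   unfolding G_def by (rule set_plus_body(1)[OF K(1-3) r s'] set_plus_body(2)[OF K(1-3) r s'] set_plus_body(3)[OF K(1-3) r s'], assumption)+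
  have Gw: "wct n c' G" unfolding G_def c'_def by (rule wct_sum[OF K(1,4) _ s' c]) (use G(1) in \<open>simp add: G_def\<close>)
  define L where "L = ln A"
  have A: "A >= 1" "L >= 2" "2 * Ca * L powr (10 / r) <= A powr (1 / 4)" using A1[of A] AA by (auto simp: L_def)
  have AL: "A powr x = exp (x * L)" for x using A(1) by (simp add: powr_def L_def)
  define w where "w = W * A powr delta * sqrt (real n)"
  have w: "w > 0" using W0 n A(1) by (simp add: w_def)
  obtain tau N where P: "positioned n G w tau N"
   using good_position[OF W G(1) S A(1)] unfolding w_def delta_def by blast
  \<comment> \<open>dimension of the subspace per $n$; each of the $t=O(L)$ rounds costs $m\ln(20A^2)=O(nL^{-3})$\<close>
  define eps where "eps = 1 / L ^ 4"
  have eps: "eps > 0" using A(2) by (simp add: eps_def)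
  define k where "k = nat \<lfloor>eps * real n\<rfloor> + 1"
  have en: "0 < eps * real n" using eps n by simp
  have k: "k >= 1" "real k >= eps * real n" "real k <= eps * real n + 1"
   using en unfolding k_def by linarith+
  define R where "R = c' * L\<^sup>2"
  have R: "R > 0" using c' A(2) by (simp add: R_def)
  have "\<exists>q m. m < k \<and> orthon q m \<and> (\<forall>l<m. q l \<in> Rn n) \<and>
   (\<forall>x\<in>G. norm (rows n tau x - proj q m (rows n tau x)) <= c' * ell n G tau / sqrt (real k))"
   by (rule Gw[unfolded wct_def, rule_format]) (use positionedD(1)[OF P] k(1) in auto)
  then obtain q m where q0: "m < k \<and> orthon q m \<and> (\<forall>l<m. q l \<in> Rn n) \<and>
   (\<forall>x\<in>G. norm (rows n tau x - proj q m (rows n tau x)) <= c' * ell n G tau / sqrt (real k))"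
   by (elim exE)
  then have q: "m < k" "orthon q m" "!!l. l < m ==> q l \<in> Rn n"
   "!!x. x \<in> G ==> norm (rows n tau x - proj q m (rows n tau x)) <= c' * ell n G tau / sqrt (real k)"
   by blast+
  have mk: "real m <= eps * real n" using q(1) k(3) by linarith
  have qG: "norm (rows n tau x - proj q m (rows n tau x)) <= R" if "x \<in> G" for x
  proof -
   have "c' * ell n G tau / sqrt (real k) <= c' * sqrt (real n) / sqrt (eps * real n)"
    using positionedD(3)[OF P] c' k(2) en by (intro frac_le mult_left_mono real_sqrt_le_mono) (auto simp: ell_nonneg)
   also have "... = R"
   proof -
    have "sqrt eps = 1 / L\<^sup>2" unfolding eps_def real_sqrt_divide using A(2) real_sqrt_unique[of "L\<^sup>2" "L ^ 4"] by (simp flip: power_mult)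
    then show ?thesis using n by (simp add: real_sqrt_mult R_def)
   qed
   finally show ?thesis using q(4)[OF that] by linarith
  qed
  \<comment> \<open>the scale of the net: $w R/h$ is then a multiple of $\sqrt n/L^2$, so that the dual Sudakov bound costs $O(nL^{-4})$ in each round\<close>
  define h where "h = A powr delta * L ^ 4"
  have S1: "h >= 1"
  proof -
   have "A powr delta >= 1" using A(1) delta(1) by (simp add: ge_one_powr_ge_zero)
   moreover have "L ^ 4 >= 1" using A(2) by (intro one_le_power) auto
   ultimately show ?thesis unfolding h_def using mult_mono[of 1 "A powr delta" 1 "L ^ 4"] by simp
  qed
  define mu where "mu = nat \<lceil>180 * h\<^sup>2\<rceil>"
  have h2: "h\<^sup>2 >= 1" using S1 by (simp add: one_le_power)
  have mu: "mu >= 1" "real mu >= 180 * h\<^sup>2" "real mu <= 181 * h\<^sup>2"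
   using h2 unfolding mu_def by linarith+
  define F where "F = flat_norm n tau q m R M"
  have linF: "linear F" unfolding F_def by (rule linear_flat_norm[OF M])
  define B where "B = exp (50 * (w * R / h)^2) * (20 * A\<^sup>2) ^ m"
  define a where "a = 3 * h * real mu powr (1 / r - 1)"
  obtain Z where Z: "finite Z" "Z <= Rn n" "real (card Z) <= B"
   "!!x. x \<in> Rn n ==> norm (F x) <= 1 ==> \<exists>z\<in>Z. \<exists>y\<in>G. norm (F (x - z - a *\<^sub>R y)) <= 1 / 2"
  proof -
   have "\<exists>Z. finite Z \<and> Z <= Rn n \<and> real (card Z) <= B \<and>
    (\<forall>x\<in>Rn n. norm (F x) <= 1 --> (\<exists>z\<in>Z. \<exists>y\<in>G. norm (F (x - z - a *\<^sub>R y)) <= 1 / 2))"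
    unfolding B_def F_def a_def by (rule one_step_cover[OF G(1,3) r(1) S A(1) P w q(2,3) S1 R qG mu(1,2)])
   then show thesis by (elim exE conjE) (rule that, auto)
  qed
  \<comment> \<open>so many halvings that what is left of the Hilbert ball lies in $G$\<close>
  define t where "t = nat \<lceil>log 2 (2 * A)\<rceil>"
  have lg: "log 2 (2 * A) >= 0" using A(1) by simp
  have t2: "2 * A <= 2 ^ t"
  proof -
   have "2 * A = 2 powr (log 2 (2 * A))" using A(1) by simp
   also have "... <= 2 powr real t" using lg by (intro powr_mono) (auto simp: t_def)
   finally show ?thesis by (simp add: powr_realpow)
  qed
  have t4: "real t <= 4 * L"
  proof -
   have "real t <= log 2 (2 * A) + 1" using lg by (simp add: t_def)
   also have "log 2 (2 * A) = 1 + L / ln 2" using A(1) by (simp add: log_def ln_mult L_def add_divide_distrib)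
   also have "L / ln 2 <= L / (1 / 2)"
    using A(2) ln2_ge_two_thirds by (intro divide_left_mono) auto
   finally show ?thesis using A(2) by simp
  qed
  have small: "x \<in> G" if "x \<in> Rn n" "norm (F x) <= 1 / 2 ^ t" for x
  proof -
   have "norm (M x) <= sqrt 2 * (1 / 2 ^ t)" using flat_norm_bounds(2)[OF R, of n tau q m M x "1 / 2 ^ t"] that by (simp add: F_def)
   also have "... <= 2 * (1 / (2 * A))"
    using t2 A(1) real_sqrt_le_mono[of 2 4] by (intro mult_mono divide_left_mono) auto
   finally show ?thesis by (intro MG that(1)) simp
  qed
  \<comment> \<open>the covering multiple \<open>a'\<close> grows like $h\mu^{1/r-1}$ with $\mu$ of order $h^2$\<close>
  define sig where "sig = h powr (2 / r - 1)"
  define a' where "a' = Ca * sig"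
  have sig1: "sig >= 1" unfolding sig_def using S1 r8(2) by (intro ge_one_powr_ge_zero) auto
  have a': "a' > 0" using Ca sig1 by (simp add: a'_def)
  have a0: "a >= 0" using S1 by (simp add: a_def)
  have a_le: "a <= 3 * 181 powr (1 / r - 1) * sig"
  proof -
   have "real mu powr (1 / r - 1) <= (181 * h\<^sup>2) powr (1 / r - 1)" using mu ri by (intro powr_mono2) auto
   also have "... = 181 powr (1 / r - 1) * h powr (2 * (1 / r - 1))"
   proof -
    have "h\<^sup>2 = h powr 2" using S1 by simp
    then have "(h\<^sup>2) powr (1 / r - 1) = h powr (2 * (1 / r - 1))" by (simp only: powr_powr)
    then show ?thesis by (simp only: powr_mult)
   qed
   finally have "a <= 3 * h * (181 powr (1 / r - 1) * h powr (2 * (1 / r - 1)))"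
    unfolding a_def using S1 by (intro mult_left_mono) auto
   also have "... = 3 * 181 powr (1 / r - 1) * (h powr 1 * h powr (2 * (1 / r - 1)))" using S1 by simp
   also have "h powr 1 * h powr (2 * (1 / r - 1)) = sig" unfolding powr_add[symmetric] sig_def by (simp add: algebra_simps)
   finally show ?thesis .
  qed
  have a'r: "a powr r / (1 - 2 powr - r) + 1 <= a' powr r"
  proof -
   have "a powr r <= (3 * 181 powr (1 / r - 1)) powr r * sig powr r"
    unfolding powr_mult[symmetric] using a0 a_le r by (intro powr_mono2) (auto simp: powr_mult)
   then have "a powr r / (1 - 2 powr - r) <= (3 * 181 powr (1 / r - 1)) powr r * sig powr r / (1 - 2 powr - r)"
    using r2 by (intro divide_right_mono) auto
   moreover have "1 <= sig powr r" using sig1 r by (simp add: ge_one_powr_ge_zero)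
   ultimately have "a powr r / (1 - 2 powr - r) + 1 <= D * sig powr r"
    by (simp add: D_def distrib_right)
   also have "... = a' powr r" using Ca sig1 by (simp add: a'_def powr_mult)
   finally show ?thesis .
  qed
  have "\<exists>Z'. finite Z' \<and> Z' <= Rn n \<and> real (card Z') <= B ^ t \<and>
   (\<forall>x\<in>Rn n. norm (F x) <= 1 --> (\<exists>z\<in>Z'. \<exists>y\<in>G. x = z + a' *\<^sub>R y))"
   by (rule cover_by_body[OF linF G(1,3) r(1) Z(1-3) a0 Z(4) small a' a'r])
  then obtain Z' where Z0: "finite Z' \<and> Z' <= Rn n \<and> real (card Z') <= B ^ t \<and>
   (\<forall>x\<in>Rn n. norm (F x) <= 1 --> (\<exists>z\<in>Z'. \<exists>y\<in>G. x = z + a' *\<^sub>R y))" by (rule exE)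
  then have Z': "finite Z'" "Z' <= Rn n" "real (card Z') <= B ^ t"
   "!!x. x \<in> Rn n ==> norm (F x) <= 1 ==> \<exists>z\<in>Z'. \<exists>y\<in>G. x = z + a' *\<^sub>R y"
   by blast+
  \<comment> \<open>$\theta a'=\kappa$ and $\kappa^r=L^{-2}$: the translates of $\kappa G$ that cover $\theta F$ enlarge $G$ by at most $(1+L^{-2})^{n/r}$\<close>
  define kappa where "kappa = L powr (- 2 / r)"
  have kappa: "kappa > 0" "kappa <= 1" "kappa powr r = 1 / L\<^sup>2"
  proof -
   show "kappa > 0" using A(2) by (simp add: kappa_def)
   show "kappa <= 1" unfolding kappa_def using A(2) r powr_mono[of "- 2 / r" 0 L] by simp
   show "kappa powr r = 1 / L\<^sup>2" unfolding kappa_def powr_powr using A(2) r by (simp add: powr_minus_divide)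
  qed
  define theta where "theta = kappa / a'"
  have Ca1: "Ca >= 1"
  proof -
   have "D >= 1" unfolding D_def using r2 by (simp add: divide_nonneg_pos)
   then show ?thesis unfolding Ca_def using r by (simp add: ge_one_powr_ge_zero)
  qed
  have a'1: "a' >= 1" using mult_mono[of 1 Ca 1 sig] Ca1 sig1 by (simp add: a'_def)
  have theta: "theta > 0" "theta <= 1" using kappa a'1 by (simp_all add: theta_def field_simps)
  have Finj: "x = 0" if "x \<in> Rn n" "F x = 0" for x
  proof -
   have "norm (M x) <= sqrt 2 * 0" using flat_norm_bounds(2)[OF R, of n tau q m M x 0] that by (simp add: F_def)
   then show ?thesis using sandwich_inj[OF G(1) S A(1) that(1)] by simp
  qed
  have "\<exists>v e. uppertri n v \<and> (\<forall>x\<in>Rn n. norm (rows n v x) = norm (F x)) \<and> (\<forall>j<n. e j \<in> Rn n) \<and>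
   (\<forall>b. norm (F (comb n e b)) = norm (cvec n (cf b))) \<and>
   (\<forall>x\<in>Rn n. x = comb n e (rows n v x))"
   by (rule hilbert_ball_Ell[OF linF Finj])
  then obtain v e where ve: "uppertri n v \<and> (\<forall>x\<in>Rn n. norm (rows n v x) = norm (F x)) \<and> (\<forall>j<n. e j \<in> Rn n) \<and>
   (\<forall>b. norm (F (comb n e b)) = norm (cvec n (cf b))) \<and>
   (\<forall>x\<in>Rn n. x = comb n e (rows n v x))"
   by (elim exE)
  have ve1: "norm (rows n v x) = norm (F x)" if "x \<in> Rn n" for x using ve that by blast
  have ve2: "e j \<in> Rn n" if "j < n" for j using ve that by blast
  have ve3: "norm (F (comb n e b)) = norm (cvec n (cf b))" for b using ve by blast
  have ve4: "x = comb n e (rows n v x)" if "x \<in> Rn n" for x using ve that by blast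
  define s1 where "s1 = append_axes d s theta e"
  define G1 where "G1 = set_plus K (Ell (d + n) s1)"
  define M1 where "M1 x = (1 / (1 + theta)) *\<^sub>R rows n v x" for x
  have s1R: "\<forall>i<d + n. s1 i \<in> Rn n" using s ve2 by (auto simp: s1_def append_axes_def)
  have lM1: "linear M1" unfolding M1_def by (rule linear_compose_scale_right[OF linear_rows])
  have GG1: "G <= G1" using Ell_append_left[of d s n theta e] unfolding G_def G1_def s1_def set_plus_def by blast
  have eR: "(comb n e b) \<in> Rn n" for b using ve2 by (intro Rn_sum Rn_simps) auto
  have dec: "\<exists>g\<in>G. \<exists>f\<in>Rn n. norm (F f) <= 1 \<and> x = g + theta *\<^sub>R f" if "x \<in> G1" for x
  proof -
   obtain x0 z where xz: "x0 \<in> K" "z \<in> Ell (d + n) s1" "x = x0 + z" using `x \<in> G1` by (auto simp: G1_def set_plus_def)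
   obtain y b where yb: "y \<in> Ell d s" "b \<in> Rn n" "norm b <= 1" "z = y + theta *\<^sub>R (comb n e b)"
    using Ell_append[of z d n s theta e] xz(2) by (auto simp: s1_def)
   have "x0 + y \<in> G" using xz(1) yb(1) by (auto simp: G_def set_plus_def)
   moreover have "norm (F (comb n e b)) <= 1" using yb cvec_cf[OF yb(2)] unfolding ve3 by simp
   moreover have "x = (x0 + y) + theta *\<^sub>R (comb n e b)" by (simp add: xz yb add.assoc)
   ultimately show ?thesis using eR by blast
  qed
  have FG: "norm (F g) <= 1" if "g \<in> G" for g
   unfolding F_def using qG[OF that] GM[OF that] by (rule flat_norm_le_1[where M=M, OF R])
  have GR: "g \<in> Rn n" if "g \<in> G" for g using that sym_bodyD(1)[OF G(1)] by blast
  have M1G: "norm (M1 x) <= 1" if xG1: "x \<in> G1" for x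
  proof -
   obtain g f where gf: "g \<in> G" "f \<in> Rn n" "norm (F f) <= 1" "x = g + theta *\<^sub>R f" using dec[OF xG1] by blast
   have xR: "x \<in> Rn n" using gf GR by simp
   have "norm (F x) <= norm (F g) + theta * norm (F f)"
    unfolding gf linear_add[OF linF] linear_scale[OF linF] using theta(1) by (intro norm_triangle_ineq[THEN order_trans]) simp
   also have "... <= 1 + theta * 1" using FG[OF gf(1)] gf(3) theta(1) by (intro add_mono mult_left_mono) auto
   finally show ?thesis using ve1[OF xR] theta(1) by (simp add: M1_def field_simps)
  qed
  have big: "(1 + theta) / sqrt A <= theta"
  proof -
   have Lp: "L powr (4 * (2 / r - 1)) * L powr (2 / r) <= L powr (10 / r)"
    unfolding powr_add[symmetric] using A(2) r by (intro powr_mono) (auto simp: field_simps)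
   have "sig = A powr (delta * (2 / r - 1)) * L powr (4 * (2 / r - 1))"
   proof -
    have "L ^ 4 = L powr 4" using A(2) powr_realpow[of L 4] by simp
    then show ?thesis unfolding sig_def h_def by (simp only: powr_mult powr_powr)
   qed
   also have "... <= A powr (1 / 4) * L powr (4 * (2 / r - 1))" using delta(2) A(1) by (intro mult_right_mono powr_mono) auto
   finally have s: "sig <= A powr (1 / 4) * L powr (4 * (2 / r - 1))" .
   have "2 / theta = 2 * Ca * sig * L powr (2 / r)"
    using A(2) by (simp add: theta_def a'_def kappa_def powr_minus_divide)
   also have "... <= 2 * Ca * (A powr (1 / 4) * L powr (4 * (2 / r - 1))) * L powr (2 / r)"
    using s Ca by (intro mult_right_mono mult_left_mono) auto
   also have "... = A powr (1 / 4) * (2 * Ca * (L powr (4 * (2 / r - 1)) * L powr (2 / r)))" by (simp add: mult_ac)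
   also have "... <= A powr (1 / 4) * (2 * Ca * L powr (10 / r))" using Lp Ca by (intro mult_left_mono) auto
   also have "... <= A powr (1 / 4) * A powr (1 / 4)" using A(3) by (intro mult_left_mono) auto
   also have "... = sqrt A" using A(1) by (simp add: powr_add[symmetric] powr_half_sqrt)
   finally have "2 / theta <= sqrt A" .
   then have "2 <= theta * sqrt A" using theta(1) by (simp add: field_simps)
   then show ?thesis using theta(2) A(1) by (simp add: field_simps)
  qed
  have M1s: "x \<in> G1" if x: "x \<in> Rn n" "norm (M1 x) <= 1 / sqrt A" for x
  proof -
   have "norm (rows n v x) <= (1 + theta) / sqrt A" using x(2) theta(1) by (simp add: M1_def field_simps)
   then have nb: "norm ((1 / theta) *\<^sub>R rows n v x) <= 1" using big theta(1) by (simp add: field_simps)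
   have "x = theta *\<^sub>R (comb n e ((1 / theta) *\<^sub>R rows n v x))"
   proof -
    have "theta *\<^sub>R (comb n e ((1 / theta) *\<^sub>R rows n v x)) = comb n e (rows n v x)"
     using theta(1) by (simp add: scaleR_sum_right)
    then show ?thesis using ve4[OF x(1)] by (rule trans[symmetric, OF _ sym])
   qed
   moreover have "theta *\<^sub>R (comb n e ((1 / theta) *\<^sub>R rows n v x)) \<in> Ell (d + n) s1"
    unfolding s1_def by (rule Ell_append_right[OF _ nb]) simp
   ultimately have "x \<in> Ell (d + n) s1" by metis
   then show ?thesis using sym_bodyD(4)[OF K(1)] unfolding G1_def set_plus_def by force
  qed
  have vol: "cvol n G1 <= exp (real n * (C / L\<^sup>2)) * cvol n G"
  proof -
   have "cvol n G1 <= real (card ((*\<^sub>R) theta ` Z')) * ((1 + kappa powr r) powr (real n / r) * cvol n G)"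
   proof (rule cvol_cover[OF G(2,3) r(1)])
    show "finite ((*\<^sub>R) theta ` Z')" "(*\<^sub>R) theta ` Z' <= Rn n" "0 <= kappa" using Z' kappa(1) by auto
    fix x assume "x \<in> G1"
    then obtain g f where gf: "g \<in> G" "f \<in> Rn n" "norm (F f) <= 1" "x = g + theta *\<^sub>R f" using dec by blast
    obtain z y where zy: "z \<in> Z'" "y \<in> G" "f = z + a' *\<^sub>R y" using Z'(4)[OF gf(2,3)] by blast
    have "x = g + theta *\<^sub>R z + kappa *\<^sub>R y" using a' by (simp add: gf zy scaleR_right_distrib theta_def)
    then show "\<exists>g\<in>G. \<exists>z\<in>(*\<^sub>R) theta ` Z'. \<exists>y\<in>G. x = g + z + kappa *\<^sub>R y" using gf(1) zy(1,2) by blast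
   qed
   also have "... <= exp (real n * ((200 * W\<^sup>2 * c'\<^sup>2 + 20) / L\<^sup>2)) * (exp (real n * (1 / r / L\<^sup>2)) * cvol n G)"
   proof (intro mult_mono mult_right_mono)
    have "real (card ((*\<^sub>R) theta ` Z')) <= B ^ t" using card_image_le[OF Z'(1), of "(*\<^sub>R) theta"] Z'(3) by linarith
    also have "B ^ t = exp (real t * (50 * (w * R / h)^2)) * exp (real t * real m * ln (20 * A\<^sup>2))"
    proof -
     have "20 * A\<^sup>2 = exp (ln (20 * A\<^sup>2))" using A(1) by simp
     then have "(20 * A\<^sup>2) ^ m = exp (real m * ln (20 * A\<^sup>2))" by (metis exp_of_nat_mult)
     then show ?thesis by (simp add: B_def power_mult_distrib exp_of_nat_mult[symmetric] mult.assoc)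
    qed
    also have "... <= exp (real n * (200 * W\<^sup>2 * c'\<^sup>2 / L\<^sup>2)) * exp (real n * (20 / L\<^sup>2))"
    proof (intro mult_mono)
     have "(w * R / h)^2 = W\<^sup>2 * c'\<^sup>2 * real n / L ^ 4"
      using A(1,2) by (simp add: w_def R_def h_def power_mult_distrib power_divide field_simps flip: power_mult power_add)
     then have "real t * (50 * (w * R / h)^2) <= 4 * L * (50 * (W\<^sup>2 * c'\<^sup>2 * real n / L ^ 4))"
      using t4 A(2) by (simp only:) (intro mult_right_mono, auto)
     also have "... = real n * (200 * W\<^sup>2 * c'\<^sup>2) * (1 / L ^ 3)" using A(2) by (simp add: field_simps power4_eq_xxxx power3_eq_cube)
     also have "... <= real n * (200 * W\<^sup>2 * c'\<^sup>2) * (1 / L\<^sup>2)"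
      using A(2) by (intro mult_left_mono divide_left_mono power_increasing) auto
     finally show "exp (real t * (50 * (w * R / h)^2)) <= exp (real n * (200 * W\<^sup>2 * c'\<^sup>2 / L\<^sup>2))" by simp
     have "ln (20 * A\<^sup>2) = ln 20 + 2 * L" using A(1) by (simp add: ln_mult ln_realpow L_def)
     also have "ln 20 <= (5::real)"
     proof -
      have "(20::real) <= 2 ^ 5" by simp
      also have "... <= exp 1 ^ 5" using exp_ge_add_one_self[of 1] by (intro power_mono) auto
      also have "... = exp (5::real)" by (simp flip: exp_of_nat_mult)
      finally have "ln 20 <= ln (exp (5::real))" by (subst ln_le_cancel_iff) auto
      then show ?thesis by simp
     qed
     finally have l20: "ln (20 * A\<^sup>2) <= 5 * L" using A(2) by linarith
     have A20: "1 <= 20 * A\<^sup>2" using one_le_power[OF A(1), of 2] by linarith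
     have "real t * real m * ln (20 * A\<^sup>2) <= (4 * L) * (eps * real n) * (5 * L)"
      using t4 mk l20 A(2) eps en A20 by (intro mult_mono) auto
     also have "... = real n * (20 / L\<^sup>2)" using A(2) by (simp add: eps_def field_simps power4_eq_xxxx power2_eq_square)
     finally show "exp (real t * real m * ln (20 * A\<^sup>2)) <= exp (real n * (20 / L\<^sup>2))" by simp
    qed auto
    also have "... = exp (real n * ((200 * W\<^sup>2 * c'\<^sup>2 + 20) / L\<^sup>2))"
     by (simp add: exp_add[symmetric] add_divide_distrib distrib_left)
    finally show "real (card ((*\<^sub>R) theta ` Z')) <= exp (real n * ((200 * W\<^sup>2 * c'\<^sup>2 + 20) / L\<^sup>2))" .
    have "(1 + kappa powr r) powr (real n / r) <= exp (1 / L\<^sup>2) powr (real n / r)"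
     unfolding kappa(3) using r exp_ge_add_one_self[of "1 / L\<^sup>2"] by (intro powr_mono2) auto
    also have "... = exp (real n * (1 / r / L\<^sup>2))" by (simp add: powr_def field_simps)
    finally show "(1 + kappa powr r) powr (real n / r) <= exp (real n * (1 / r / L\<^sup>2))" .
   qed auto
   also have "... = exp (real n * (C / L\<^sup>2)) * cvol n G"
    by (simp add: C_def mult.assoc[symmetric] exp_add[symmetric] add_divide_distrib distrib_left)
   finally show ?thesis .
  qed
  have "sandwich n (sqrt A) M1 G1" using lM1 M1G M1s by (simp add: sandwich_def)
  then show ?thesis
   by (intro exI[of _ "d + n"], intro exI[of _ s1], intro exI[of _ M1]) (use s1R GG1 vol in \<open>simp add: G_def G1_def L_def\<close>)
 qed
 show ?thesis
  by (rule exI[of _ "max A1 (exp 2)"], rule exI[of _ C]) (use C0 main in \<open>simp add: improvable_def\<close>)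
qed

section \<open>Summing up the steps\<close>

lemma cvol_hilbert_ball:
 assumes G: "compact G" and S: "sandwich n A M G" and A: "A > 0"
 shows "cvol n {x. norm (M x) <= 1} <= A ^ n * cvol n G"
proof -
 let ?K = "{x. (1 / A) *\<^sub>R (x - 0) \<in> G}"
 have GC: "cms n G" by (rule cms_compact[OF G])
 obtain Rg where Rg: "!!x. x \<in> G ==> norm x <= Rg" using compact_imp_bounded[OF G] by (auto simp: bounded_iff)
 have "cvol n {x. norm (M x) <= 1} <= cvol n ?K"
 proof (rule cvol_mono)
  show "cms n ?K" using A by (intro cvol_scale(1)[OF GC]) auto
  show "bounded ?K"
  proof (rule boundedI)
   fix x assume "x \<in> ?K"
   then have "norm ((1 / A) *\<^sub>R (x - 0)) <= Rg" by (intro Rg) simp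
   then show "norm x <= A * Rg" using A by (simp add: pos_divide_le_eq mult.commute)
  qed
  fix x assume "x \<in> Rn n" "x \<in> {x. norm (M x) <= 1}"
  then show "x \<in> ?K"
   using A sandwichD(3)[OF S, of "(1 / A) *\<^sub>R x"] by (simp add: linear_scale[OF sandwichD(1)[OF S]] divide_right_mono)
 qed
 also have "... = A ^ n * cvol n G" using A by (intro cvol_scale(2)[OF GC]) auto
 finally show ?thesis .
qed

definition outer_ball :: "nat => fsvec set => real => (fsvec => fsvec) => bool" where
 "outer_ball n K t M \<longleftrightarrow> linear M \<and> (\<forall>x\<in>Rn n. M x = 0 --> x = 0) \<and> (\<forall>x\<in>K. norm (M x) <= 1) \<and>
  cvol n {x. norm (M x) <= 1} <= exp (real n * t) * cvol n K"

lemma outer_ball_mono: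
 assumes "outer_ball n K' t M" "K <= K'" "cvol n K' <= exp (real n * s) * cvol n K" "t + s <= t'"
 shows "outer_ball n K t' M"
proof -
 have "exp (real n * t) * cvol n K' <= exp (real n * t) * (exp (real n * s) * cvol n K)" using assms(3) by (intro mult_left_mono) auto
 also have "... = exp (real n * (t + s)) * cvol n K" by (simp add: distrib_left exp_add)
 also have "... <= exp (real n * t') * cvol n K"
  using mult_left_mono[OF assms(4), of "real n"] by (intro mult_right_mono) auto
 finally have *: "exp (real n * t) * cvol n K' <= exp (real n * t') * cvol n K" .
 have "cvol n {x. norm (M x) <= 1} <= exp (real n * t) * cvol n K'" using assms(1) by (simp add: outer_ball_def)
 from order_trans[OF this *] show ?thesis using assms(1,2) by (auto simp: outer_ball_def)
qed

text \<open>Let $L_0$ be the logarithm of the threshold of the step. If $\ln A\le 2^jL_0$, then $j$ steps lead below the threshold, and the step from level $j$ costs at most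
$C/2^j$ in the exponent. The bound $C(2-2^{-j})$ carries the induction.\<close>
lemma small_hilbert_ball:
 assumes r: "0 < r" "r <= 1" and c: "c >= 0"
 shows "\<exists>Psi\<ge>0. \<forall>n K. n >= 1 --> rbody n r c K --> (\<exists>M. outer_ball n K Psi M)"
proof -
 obtain A0 C where A0e: "A0 >= exp 2" and C: "C >= 0" and step: "!!n K. n >= 1 ==> rbody n r c K ==> improvable n A0 C K"
  using position_step[OF r c] by blast
 define L0 where "L0 = ln A0"
 have A0: "A0 > 0" using A0e exp_gt_zero[of "2::real"] by linarith
 have "ln (exp 2) <= ln A0" using A0e A0 by (subst ln_le_cancel_iff) auto
 then have L0: "L0 >= 2" by (simp add: L0_def)
 have rec: "\<exists>M. outer_ball n (set_plus K (Ell d s)) (L0 + C * (2 - 1 / 2 ^ j)) M"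
  if n: "n >= 1" and K: "rbody n r c K" and "\<forall>i<d. s i \<in> Rn n" "sandwich n A M (set_plus K (Ell d s))" "A >= 1" "ln A <= 2 ^ j * L0"
  for n K d s A M and j
  using that(3-)
 proof (induction j arbitrary: d s A M)
  case (0 d s A M)
  note K' = K[unfolded rbody_def, THEN conjunct1] K[unfolded rbody_def, THEN conjunct2, THEN conjunct1]
   K[unfolded rbody_def, THEN conjunct2, THEN conjunct2, THEN conjunct1]
  have s: "!!i. i < d ==> s i \<in> Rn n" using 0 by blast
  have G: "sym_body n (set_plus K (Ell d s))" "compact (set_plus K (Ell d s))"
   by (rule set_plus_body(1)[OF K' r s] set_plus_body(2)[OF K' r s], assumption)+
  have "cvol n {x. norm (M x) <= 1} <= A ^ n * cvol n (set_plus K (Ell d s))"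
   using 0 by (intro cvol_hilbert_ball[OF G(2) 0(2)]) auto
  also have "A ^ n = exp (real n * ln A)" using 0 by (simp add: exp_of_nat_mult)
  also have "... <= exp (real n * (L0 + C * (2 - 1 / 2 ^ 0)))" using 0 C by (simp add: mult_left_mono)
  finally have "cvol n {x. norm (M x) <= 1} <= exp (real n * (L0 + C * (2 - 1 / 2 ^ 0))) * cvol n (set_plus K (Ell d s))"
   by (simp add: mult_right_mono)
  then have "outer_ball n (set_plus K (Ell d s)) (L0 + C * (2 - 1 / 2 ^ 0)) M"
   using sandwich_inj[OF G(1) 0(2,3)] sandwichD[OF 0(2)] unfolding outer_ball_def by blast
  then show ?case by blast
 next
  case (Suc j d s A M)
  have incr: "L0 + C * (2 - 1 / 2 ^ j) + C / 2 ^ Suc j = L0 + C * (2 - 1 / 2 ^ Suc j)" by (simp add: field_simps)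
  show ?case
  proof (cases "ln A <= 2 ^ j * L0")
   case True
   obtain M' where "outer_ball n (set_plus K (Ell d s)) (L0 + C * (2 - 1 / 2 ^ j)) M'"
    using Suc.IH[OF Suc.prems(1-3) True] by blast
   then have "outer_ball n (set_plus K (Ell d s)) (L0 + C * (2 - 1 / 2 ^ Suc j)) M'"
  by (rule outer_ball_mono[where s=0]) (simp, simp, use incr divide_nonneg_nonneg[OF C, of "2 ^ Suc j"] in simp)
   then show ?thesis by blast
  next
   case False
   have LA: "ln A > 2 ^ j * L0" using False by simp
   have "1 * L0 <= 2 ^ j * L0" using L0 by (intro mult_right_mono) auto
   then have "ln A0 <= ln A" using LA by (simp add: L0_def)
   then have AA: "A0 <= A" using A0 Suc.prems(3) by simp
   obtain d' s' M1 where M1: "\<forall>i<d'. s' i \<in> Rn n" "set_plus K (Ell d s) <= set_plus K (Ell d' s')" "sandwich n (sqrt A) M1 (set_plus K (Ell d' s'))"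
    "cvol n (set_plus K (Ell d' s')) <= exp (real n * (C / (ln A)^2)) * cvol n (set_plus K (Ell d s))"
    using step[OF n K, unfolded improvable_def, rule_format, OF AA _ Suc.prems(2)] Suc.prems(1) by blast
   have sA: "sqrt A >= 1" "ln (sqrt A) <= 2 ^ j * L0" using Suc.prems(3,4) by (simp_all add: ln_sqrt)
   obtain M' where M': "outer_ball n (set_plus K (Ell d' s')) (L0 + C * (2 - 1 / 2 ^ j)) M'"
    using Suc.IH[OF M1(1,3) sA] by blast
   have "(ln A)^2 >= (2 ^ j * L0)\<^sup>2" using LA L0 by (intro power_mono) auto
   also have "(2 ^ j * L0)^2 = 2 ^ j * (2 ^ j * L0\<^sup>2)" by (simp add: power2_eq_square mult_ac)
   moreover have "2 ^ j * (1 * 2) <= 2 ^ j * (2 ^ j * L0\<^sup>2)"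
    using L0 power_mono[of 2 L0 2] by (intro mult_left_mono mult_mono) auto
   moreover have "(2::real) ^ Suc j = 2 ^ j * (1 * 2)" by simp
   ultimately have lA2: "(ln A)^2 >= 2 ^ Suc j" by linarith
   have "C / (ln A)^2 <= C / 2 ^ Suc j" by (rule frac_le[OF C order_refl _ lA2]) simp
   then have "L0 + C * (2 - 1 / 2 ^ j) + C / (ln A)^2 <= L0 + C * (2 - 1 / 2 ^ Suc j)" unfolding incr[symmetric] by simp
   then show ?thesis using outer_ball_mono[OF M' M1(2,4)] by blast
  qed
 qed
 have main: "\<exists>M. outer_ball n K (L0 + C * 2) M" if n: "n >= 1" and K: "rbody n r c K" for n K
 proof -
  have Ks: "sym_body n K" using K by (simp add: rbody_def)
  have KE: "set_plus K (Ell 0 (%_. 0)) = K" by (force simp: set_plus_def Ell_def image_iff intro: exI[of _ "0::fsvec"])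
  obtain R where R: "!!x. x \<in> K ==> norm x <= R" "R > 0" using sym_bodyD(2)[OF Ks] by (auto simp: bounded_pos)
  obtain rho where rho: "rho > 0" "!!x. x \<in> Rn n ==> norm x <= rho ==> x \<in> K" using Ks by (auto simp: sym_body_def)
  define A where "A = max 1 (R / rho)"
  have A: "A >= 1" "R / rho <= A" by (simp_all add: A_def)
  then have RA: "R / A <= rho" using rho(1) by (simp add: field_simps)
  define M :: "fsvec => fsvec" where "M x = (1 / R) *\<^sub>R x" for x
  have "linear M" unfolding M_def by (rule linearI) (simp_all add: scaleR_right_distrib)
  moreover have "x \<in> K" if "x \<in> Rn n" "norm (M x) <= 1 / A" for x
  proof -
   have "norm x <= R / A" using that(2) R(2) A(1) by (simp add: M_def field_simps)
   then show ?thesis using RA by (intro rho(2) that(1)) linarith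
  qed
  moreover have "norm (M x) <= 1" if "x \<in> K" for x using R that by (simp add: M_def field_simps)
  ultimately have S: "sandwich n A M K" by (simp add: sandwich_def)
  obtain j :: nat where "ln A < 2 ^ j" using real_arch_pow[of 2 "ln A"] by auto
  moreover have "(2::real) ^ j * 1 <= 2 ^ j * L0" using L0 by (intro mult_left_mono) auto
  ultimately have j: "ln A <= 2 ^ j * L0" by linarith
  obtain M' where "outer_ball n K (L0 + C * (2 - 1 / 2 ^ j)) M'"
   using rec[OF n K _ _ A(1) j, of 0 "%_. 0" M] S unfolding KE by auto
  then have "outer_ball n K (L0 + C * 2) M'" by (rule outer_ball_mono[where s=0]) (use C in \<open>auto intro: mult_left_mono\<close>)
  then show ?thesis by blast
 qed
 have "L0 + C * 2 >= 0" using L0 C by simp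
 then show ?thesis using main by blast
qed

section \<open>Quotients of a space with weak cotype 2 dual\<close>

lemma op_norm_bound: "norm (lmap n w z) <= op_norm n w * norm z" if z: "z \<in> Rn n" for w :: "nat => 'z::real_normed_vector"
proof (cases "z = 0")
 case True
 then show ?thesis by (simp add: linear_0[OF linear_lmap])
next
 case False
 define e where "e = (1 / norm z) *\<^sub>R z"
 have e: "e \<in> Rn n" "norm e = 1" using z False by (simp_all add: e_def)
 have "(\<Sum>k<n. (cf e k)^2) <= 1" using sq_norm_cvec_le[where n=n and x="cf e"] cvec_cf[OF e(1)] e(2) by simp
 then have "norm (lmap n w e) <= op_norm n w" unfolding lmap_def op_norm_def by (intro cSUP_upper op_norm_bdd) auto
 then show ?thesis using False by (simp add: e_def linear_scale[OF linear_lmap] field_simps)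
qed

lemma low_rank_span:
 fixes v :: "nat => 'z::real_vector"
 assumes "lin_rank n v < k"
 shows "\<exists>(e :: nat => 'z) (c :: nat => nat => real) m. m < k \<and> (\<forall>i<n. v i = (\<Sum>l<m. c i l *\<^sub>R e l))"
proof -
 obtain B where B: "B <= range (lin_map n v)" "independent B" "range (lin_map n v) <= span B" "card B = dim (range (lin_map n v))"
  using basis_exists by blast
 have "range (lin_map n v) <= span (v ` {..<n})"
  unfolding lin_map_def by (intro image_subsetI span_sum span_scale span_base) auto
 then have fin: "finite B" using independent_span_bound[of "v ` {..<n}" B] B by blast
 obtain e where e: "bij_betw e {..<card B} B" using ex_bij_betw_nat_finite[OF fin] by (auto simp: atLeast0LessThan)
 have "\<exists>c. v i = (\<Sum>l<card B. c l *\<^sub>R e l)" if "i < n" for i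
 proof -
  have "v i = lin_map n v (%j. if j = i then 1 else 0)"
   using that by (simp add: lin_map_def if_distrib[of "%x. x *\<^sub>R _"] cong: if_cong)
  then have "v i \<in> span B" using B(3) by blast
  then obtain u where "v i = (\<Sum>b\<in>B. u b *\<^sub>R b)" using span_finite[OF fin] by auto
  also have "... = (\<Sum>l<card B. u (e l) *\<^sub>R e l)" by (rule sum.reindex_bij_betw[OF e, symmetric])
  finally show ?thesis by (intro exI[of _ "%l. u (e l)"])
 qed
 then obtain c where "!!i. i < n ==> v i = (\<Sum>l<card B. c i l *\<^sub>R e l)" by metis
 moreover have "card B < k" using B(4) assms by (simp add: lin_rank_def)
 ultimately show ?thesis by blast
qed

lemma cball_of_body:
 assumes nu: "crn n r nu"
 shows "sym_body n (cball_of n nu)" "compact (cball_of n nu)" "rconv r (cball_of n nu)"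
proof -
 note B = cball_of_props[OF nu]
 show "sym_body n (cball_of n nu)"
  unfolding sym_body_def using B(2-4) by (auto simp: cball_of_def crn_minus[OF nu])
 obtain R where R: "!!x. x \<in> cball_of n nu ==> norm x <= R" using B(2) by (auto simp: bounded_iff)
 have "cball_of n nu = (Rn n \<inter> cball 0 R) \<inter> {x. nu x <= 1}" using R by (auto simp: cball_of_def)
 moreover have "closed {x. nu x <= 1}" by (intro closed_Collect_le crn_continuous[OF nu] continuous_on_const)
 ultimately show "compact (cball_of n nu)" using compact_Int_closed[OF compact_Rn_ball] by simp
 show "rconv r (cball_of n nu)"
  unfolding rconv_def
 proof (intro ballI allI impI)
  fix x y :: fsvec and a b :: real
  assume xy: "x \<in> cball_of n nu" "y \<in> cball_of n nu" and ab: "0 <= a" "0 <= b" "a powr r + b powr r <= 1"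
  have le: "nu (t *\<^sub>R z) powr r <= t powr r" if "t >= 0" "z \<in> cball_of n nu" for t z
  proof -
   have "nu (t *\<^sub>R z) <= t" using that mult_left_le[of "nu z" t] by (simp add: crnD(4)[OF nu] cball_of_def)
   then show ?thesis using crnD(1,3)[OF nu] by (intro powr_mono2) auto
  qed
  have "nu (a *\<^sub>R x + b *\<^sub>R y) powr r <= 1 powr r"
   using crnD(5)[OF nu, of "a *\<^sub>R x" "b *\<^sub>R y"] le[OF ab(1) xy(1)] le[OF ab(2) xy(2)] ab(3) by simp
  then have "nu (a *\<^sub>R x + b *\<^sub>R y) <= 1"
   by (rule powr_le_imp_le[OF _ crnD(1)[OF nu] crnD(3)[OF nu]]) simp
  then show "a *\<^sub>R x + b *\<^sub>R y \<in> cball_of n nu" using xy by (simp add: cball_of_def)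
 qed
qed

text \<open>Pull $\tau$ back to an operator into the dual of $X$ along the quotient map. An approximating operator of small rank spans few functionals, and their
coefficient vectors span the subspace to project on; it approximates on $K$ because each point of $K$ lifts to a point of norm at most $2/c$.\<close>
lemma wct_quotient:
 fixes p :: "'a::quasi_banach => real"
 assumes p: "is_r_norm r p" and cd: "c > 0" "d > 0" "!!x. c * qnorm x <= p x" "!!x. p x <= d * qnorm x" and eq: "equivalent_qnorm p"
  and N: "subspace N" "qclosed N" and b: "quotient_basis N n b"
  and wc: "!!n (u :: nat => 'a qdual) k. 1 <= k ==> k <= n ==> approx_number k n u <= C * real k powr (- 1 / 2) * ell_norm n u" and C: "C > 0"
 shows "wct n (4 * C * d / c) (cball_of n (coord_qnorm p N n b))"
proof -
 let ?nu = "coord_qnorm p N n b"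
 have nu: "crn n r ?nu" by (rule crn_quotient[OF p eq N b])
 define K where "K = cball_of n ?nu"
 have K: "sym_body n K" unfolding K_def by (rule cball_of_body(1)[OF nu])
 have "\<exists>a. a \<in> Rn n \<and> xi - lin_map n b (cf a) \<in> N" for xi
 proof -
  obtain a where "xi - lin_map n b a \<in> N" using b unfolding quotient_basis_def by blast
  moreover have "lin_map n b (cf (cvec n a)) = lin_map n b a" by (rule lin_map_cong) (simp add: cf_cvec)
  ultimately show ?thesis by (intro exI[of _ "cvec n a"]) auto
 qed
 then obtain co where co: "!!xi. co xi \<in> Rn n" "!!xi. xi - lin_map n b (cf (co xi)) \<in> N" by metis
 have lb: "lin_map n b (cf (x + y)) = lin_map n b (cf x) + lin_map n b (cf y)" "lin_map n b (cf (t *\<^sub>R x)) = t *\<^sub>R lin_map n b (cf x)" for x y t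
  by (simp_all add: cf_plus_fun cf_scaleR_fun lin_map_add lin_map_scale)
 have uniq: "co xi = x" if "x \<in> Rn n" "xi - lin_map n b (cf x) \<in> N" for xi x
 proof -
  have "lin_map n b (cf (co xi - x)) = (xi - lin_map n b (cf x)) - (xi - lin_map n b (cf (co xi)))"
   using lb(1)[of "co xi" "- x"] lb(2)[of "-1" x] by simp
  also have "... \<in> N" by (intro subspace_diff N(1) that(2) co(2))
  finally have "\<forall>i<n. cf (co xi - x) i = 0" using b by (auto simp: quotient_basis_def)
  moreover have "co xi - x \<in> Rn n" using co(1) that(1) by simp
  ultimately have "co xi - x = 0" by (intro fsvec_eqI) (auto simp: Rn_def not_less[symmetric])
  then show ?thesis by simp
 qed
 have lco: "linear co"
 proof (rule linearI)
  fix xi eta t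
  have "(xi + eta) - lin_map n b (cf (co xi + co eta)) = (xi - lin_map n b (cf (co xi))) + (eta - lin_map n b (cf (co eta)))" by (simp add: lb)
  also have "... \<in> N" using co(2) N(1) by (intro subspace_add)
  finally show "co (xi + eta) = co xi + co eta" using co(1) by (intro uniq) auto
  have "t *\<^sub>R xi - lin_map n b (cf (t *\<^sub>R co xi)) = t *\<^sub>R (xi - lin_map n b (cf (co xi)))" by (simp add: lb scaleR_diff_right)
  also have "... \<in> N" using co(2) N(1) by (intro subspace_scale)
  finally show "co (t *\<^sub>R xi) = t *\<^sub>R co xi" using co(1) by (intro uniq) auto
 qed
 have co_p: "?nu (co xi) <= d * qnorm xi" for xi
 proof -
  have "?nu (co xi) <= p (lin_map n b (cf (co xi)) + (xi - lin_map n b (cf (co xi))))"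
   unfolding coord_qnorm_def by (rule quotient_lower[OF p N(1) co(2)])
  also have "... = p xi" by simp
  also have "... <= d * qnorm xi" by (rule cd(4))
  finally show ?thesis .
 qed
 obtain c1 where c1: "c1 > 0" "!!x. x \<in> Rn n ==> c1 * norm x <= ?nu x" using crn_lower[OF nu] by blast
 have lift: "\<exists>xi. co xi = x \<and> qnorm xi <= 2 / c" if x: "x \<in> K" for x
 proof -
  have xK: "x \<in> Rn n" "?nu x <= 1" using x by (auto simp: K_def cball_of_def)
  obtain z where z: "z \<in> N" "p (lin_map n b (cf x) + z) < quotient_qnorm p N (lin_map n b (cf x)) + 1"
   using quotient_approx[OF p N(1), of 1] by auto
  define xi where "xi = lin_map n b (cf x) + z"
  have "co xi = x" using xK(1) z(1) by (intro uniq) (auto simp: xi_def)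
  moreover have "c * qnorm xi <= 2" using cd(3)[of xi] z(2) xK(2) by (simp add: xi_def coord_qnorm_def)
  then have "qnorm xi <= 2 / c" using cd(1) by (simp add: field_simps)
  ultimately show ?thesis by blast
 qed
 show ?thesis
  unfolding wct_def K_def[symmetric]
 proof (intro allI impI)
  fix tau and k :: nat assume tau: "\<forall>i<n. tau i \<in> Rn n" and k: "1 <= k"
  let ?T = "rows n tau"
  consider "k > n" | "k <= n" "ell n K tau <= 0" | "k <= n" "ell n K tau > 0" by linarith
  then show "\<exists>q m. m < k \<and> orthon q m \<and> (\<forall>l<m. q l \<in> Rn n) \<and>
   (\<forall>x\<in>K. norm (?T x - proj q m (?T x)) <= 4 * C * d / c * ell n K tau / sqrt (real k))"
  proof cases
   case 1
   have "orthon ax n" by (simp add: orthon_def cf_ax)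
   moreover have "?T x - proj ax n (?T x) = 0" for x
    using cvec_cf[OF rows_in[of n tau x]] by (simp add: proj_def cvec_def)
   ultimately show ?thesis
    using 1 ax_in_Rn cd C ell_nonneg[of n K tau] by (intro exI[of _ ax] exI[of _ n]) auto
  next
   case 2
   obtain rho where rho: "rho > 0" "!!x. x \<in> Rn n ==> rho * norm x <= supp K x" using supp_lower[OF K] by blast
   have "rho * sqrt (\<Sum>i<n. (norm (tau i))^2) <= 0" using ell_lower[OF K rho(2) less_imp_le[OF rho(1)], of tau] tau 2 by auto
   then have "(\<Sum>i<n. (norm (tau i))^2) <= 0" using rho(1) by (simp add: mult_le_0_iff)
   then have "!!i. i < n ==> tau i = 0" using sum_nonneg_eq_0_iff[of "{..<n}" "%i. (norm (tau i))^2"] by (simp add: sum_nonneg antisym)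
   then have "?T x = 0" for x by (intro fsvec_eqI) (simp add: cf_rows)
   then show ?thesis
    using k cd C ell_nonneg[of n K tau] by (intro exI[of _ ax] exI[of _ 0]) (auto simp: orthon_def proj_def)
  next
   case 3
   define f where "f i xi = tau i \<bullet> co xi" for i xi
   define u where "u i = Abs_qdual (f i)" for i
   have u: "qdual_apply (u i) = f i" for i
    unfolding u_def
   proof (rule qdual_apply_Abs)
    show "linear (f i)" unfolding f_def
     by (rule linearI) (simp_all add: linear_add[OF lco] linear_scale[OF lco] inner_add_right)
    fix xi
    have "c1 * norm (co xi) <= d * qnorm xi" using c1(2)[OF co(1)] co_p order_trans by blast
    then have "norm (co xi) <= d / c1 * qnorm xi" using c1(1) by (simp add: field_simps)
    then have "norm (tau i) * norm (co xi) <= norm (tau i) * (d / c1 * qnorm xi)" by (intro mult_left_mono) auto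
    then show "\<bar>f i xi\<bar> <= (norm (tau i) * (d / c1)) * qnorm xi"
     using Cauchy_Schwarz_ineq2[of "tau i" "co xi"] unfolding f_def by (simp add: mult.assoc)
   qed
   have uT: "qdual_apply (lmap n u z) xi = z \<bullet> ?T (co xi)" for z xi
    by (simp add: qdual_apply_lmap u f_def rows_def)
   have nu: "norm (lmap n u z) <= d * supp K (comb n tau z)" for z
   proof (rule qdual_norm_leI)
    let ?h = "supp K (comb n tau z)"
    show "0 <= d * ?h" using cd(2) seminorm_nonneg[OF seminorm_supp[OF K]] by simp
    fix xi
    have *: "\<bar>qdual_apply (lmap n u z) xi\<bar> <= ?h * t" if t: "t > 0" "d * qnorm xi <= t" for t
    proof -
     have "(1 / t) *\<^sub>R co xi \<in> K"
      using co(1) co_p[of xi] t by (simp add: K_def cball_of_def crnD(4)[OF nu] field_simps)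
     then have "\<bar>(comb n tau z) \<bullet> ((1 / t) *\<^sub>R co xi)\<bar> <= ?h" by (rule supp_abs_upper[OF K])
     then show ?thesis using t(1) by (simp add: uT rows_sum_adjoint[symmetric] abs_mult field_simps)
    qed
    show "\<bar>qdual_apply (lmap n u z) xi\<bar> <= d * ?h * qnorm xi"
    proof (cases "qnorm xi = 0")
     case True
     then have "xi = 0" by (simp add: qnorm_eq_zero)
     then show ?thesis using True by (simp add: linear_0[OF linear_qdual])
    next
     case False
     then have "qnorm xi > 0" using qnorm_ge_zero[of xi] by linarith
     then show ?thesis using *[of "d * qnorm xi"] cd(2) by (simp add: mult_ac)
    qed
   qed
   have ellu: "ell_norm n u <= d * ell n K tau"
   proof -
    have int: "integrable (gs n) (%a. (norm (lmap n u (cvec n a)))^2)"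
    proof -
     obtain L where L: "L >= 0" "!!z. norm (lmap n u z) <= L * norm z" using lmap_bound[of n u] by blast
     show ?thesis using L by (intro gs_square_integrable[where L=L] continuous_intros lmap_continuous) auto
    qed
    have "(\<integral>a. (norm (lmap n u (cvec n a)))^2 \<partial>gs n) <= (\<integral>a. d\<^sup>2 * (supp K (comb n tau (cvec n a)))^2 \<partial>gs n)"
    proof (rule integral_mono[OF int])
     show "integrable (gs n) (%a. d\<^sup>2 * (supp K (comb n tau (cvec n a)))^2)"
      by (intro integrable_mult_right nearly_normed_square_integrable(1)[OF nearly_normed_supp_linear[OF K]])
     show "(norm (lmap n u (cvec n a)))^2 <= d\<^sup>2 * (supp K (comb n tau (cvec n a)))^2" for a
      unfolding power_mult_distrib[symmetric] by (intro power_mono nu) auto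
    qed
    then have "ell_norm n u <= sqrt (d\<^sup>2 * (\<integral>a. (supp K (comb n tau (cvec n a)))^2 \<partial>gs n))"
     unfolding ell_norm_gs by (intro real_sqrt_le_mono) simp
    then show ?thesis using cd(2) by (simp add: ell_def gaussL2_def real_sqrt_mult)
   qed
   define alpha where "alpha = 2 * C * d * ell n K tau / sqrt (real k)"
   have "approx_number k n u <= C * real k powr (- 1 / 2) * ell_norm n u" by (rule wc[OF k 3(1)])
   also have "real k powr (- 1 / 2) = 1 / sqrt (real k)" using k by (simp add: powr_minus_divide powr_half_sqrt)
   also have "C * (1 / sqrt (real k)) * ell_norm n u <= C * (1 / sqrt (real k)) * (d * ell n K tau)"
    using ellu C by (intro mult_left_mono) auto
   also have "... < alpha" using C cd(2) 3(2) k by (simp add: alpha_def field_simps)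
   finally have "approx_number k n u < alpha" .
   then obtain v where v: "lin_rank n v < k" "op_norm n (%i. u i - v i) < alpha"
   proof -
    have "lin_rank n (%_. 0 :: 'a qdual) < k"
     using k dim_le_card[of "{0 :: 'a qdual}" "{}"] by (simp add: lin_rank_def lin_map_def image_constant_conv)
    then have "{v :: nat => 'a qdual. lin_rank n v < k} ~= {}" by blast
    moreover have "bdd_below ((%v. op_norm n (%i. u i - v i)) ` {v. lin_rank n v < k})"
     by (intro bdd_belowI2[where m=0] op_norm_nonneg)
    ultimately show ?thesis using `approx_number k n u < alpha` that
     unfolding approx_number_def by (subst (asm) cINF_less_iff) auto
   qed
   obtain e and cc :: "nat => nat => real" and m0 where e: "m0 < k" "!!i. i < n ==> v i = (\<Sum>l<m0. cc i l *\<^sub>R e l)"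
    using low_rank_span[OF v(1)] by blast
   define y where "y l = cvec n (%i. cc i l)" for l
   obtain q m where q: "m <= m0" "orthon q m" "span (q ` {..<m}) = span (y ` {..<m0})" using gram_schmidt by blast
   have qR: "q l \<in> Rn n" if "l < m" for l
   proof -
    have "y ` {..<m0} <= Rn n" by (auto simp: y_def)
    then have "span (q ` {..<m}) <= Rn n" unfolding q(3) by (intro span_minimal subspace_Rn)
    then show ?thesis using span_base[of "q l" "q ` {..<m}"] that by blast
   qed
   have "norm (?T x - proj q m (?T x)) <= 4 * C * d / c * ell n K tau / sqrt (real k)" if x: "x \<in> K" for x
   proof -
    obtain xi where xi: "co xi = x" "qnorm xi <= 2 / c" using lift[OF x] by blast
    define Y where "Y = cvec n (%i. qdual_apply (v i) xi)"
    have "Y = (\<Sum>l<m0. qdual_apply (e l) xi *\<^sub>R y l)"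
     by (rule fsvec_eqI) (auto simp: Y_def y_def cf_cvec cf_sum e qdual_apply_sum qdual_apply_scaleR mult.commute)
    also have "... \<in> span (y ` {..<m0})" by (intro span_sum span_scale span_base) auto
    finally have Ys: "Y \<in> span (q ` {..<m})" unfolding q(3) .
    define z where "z = ?T x - Y"
    have zR: "z \<in> Rn n" by (simp add: z_def Y_def)
    have lz: "lmap n (%i. u i - v i) z = lmap n u z - lmap n v z"
     by (simp add: lmap_def lin_map_def scaleR_right_diff_distrib sum_subtractf)
    have "norm z * norm z = z \<bullet> z" by (simp add: power2_norm_eq_inner[symmetric] power2_eq_square)
    also have "... = z \<bullet> ?T (co xi) - z \<bullet> Y" unfolding xi(1) by (simp add: inner_diff_right[symmetric] z_def[symmetric])
    also have "... = qdual_apply (lmap n (%i. u i - v i) z) xi"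
     unfolding lz qdual_apply_minus uT by (simp add: qdual_apply_lmap Y_def)
    also have "... <= norm (lmap n (%i. u i - v i) z) * qnorm xi" using qdual_le_norm abs_le_D1 by blast
    also have "... <= (op_norm n (%i. u i - v i) * norm z) * (2 / c)"
     using op_norm_bound[OF zR] xi(2) qnorm_ge_zero[of xi] op_norm_nonneg by (intro mult_mono mult_nonneg_nonneg) auto
    also have "... <= (alpha * norm z) * (2 / c)" using v(2) cd(1) by (intro mult_right_mono) auto
    finally have "norm z * norm z <= norm z * (alpha * (2 / c))" by (simp add: mult_ac)
    moreover have "alpha * (2 / c) >= 0" using C cd ell_nonneg[of n K tau] by (simp add: alpha_def)
    ultimately have "norm z <= alpha * (2 / c)" by (cases "norm z = 0") (simp, simp only: mult_le_cancel_left, simp)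
    then have "norm (?T x - proj q m (?T x)) <= alpha * (2 / c)"
     using norm_proj_compl_le[OF q(2) Ys, of "?T x"] by (simp add: z_def)
    also have "... = 4 * C * d / c * ell n K tau / sqrt (real k)" by (simp add: alpha_def mult_ac)
    finally show ?thesis .
   qed
   then show ?thesis using q e(1) qR by (intro exI[of _ q] exI[of _ m]) auto
  qed
 qed
qed

text \<open>The Hilbert ball of \<open>small_hilbert_ball\<close> is an ellipsoid around the unit ball, so the minimal one is at most as large.\<close>
theorem outer_volume_ratio_of_weak_cotype_2:
 fixes p :: "'a::quasi_banach => real"
 assumes p: "is_r_norm r p" and eq: "equivalent_qnorm p" and wc: "weak_cotype_2 TYPE('a qdual)"
 shows "\<exists>C. \<forall>N n b. subspace N \<and> qclosed N \<and> quotient_basis N n b --> quotient_outer_volume_ratio p N n b <= C"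
proof -
 obtain c d where cd: "c > 0" "d > 0" "!!x. c * qnorm x <= p x" "!!x. p x <= d * qnorm x"
  using eq by (auto simp: equivalent_qnorm_def)
 obtain C0 where C0: "!!n (u :: nat => 'a qdual) k. 1 <= k ==> k <= n ==> approx_number k n u <= C0 * real k powr (- 1 / 2) * ell_norm n u"
  using wc by (auto simp: weak_cotype_2_def)
 define C where "C = max C0 1"
 have C: "C > 0" by (simp add: C_def)
 have wcC: "approx_number k n u <= C * real k powr (- 1 / 2) * ell_norm n u" if "1 <= k" "k <= n" for n k and u :: "nat => 'a qdual"
 proof -
  have "C0 * real k powr (- 1 / 2) * ell_norm n u <= C * real k powr (- 1 / 2) * ell_norm n u"
   by (intro mult_right_mono) (auto simp: C_def ell_norm_gs)
  then show ?thesis using C0[OF that, of u] by linarith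
 qed
 note r = r_normD(1,2)[OF p]
 have "4 * C * d / c >= 0" using C cd by simp
 then obtain Psi where Psi: "Psi >= 0" "!!n K. n >= 1 ==> rbody n r (4 * C * d / c) K ==> \<exists>M. outer_ball n K Psi M"
  using small_hilbert_ball[OF r, of "4 * C * d / c"] by blast
 have "quotient_outer_volume_ratio p N n b <= exp Psi"
  if N: "subspace N" "qclosed N" and b: "quotient_basis N n b" for N n b
 proof (cases "n = 0")
  case True
  have "x powr (1 / real n) <= 1" for x using True by simp
  moreover have "1 <= exp Psi" using Psi(1) by simp
  ultimately show ?thesis unfolding quotient_outer_volume_ratio_def outer_volume_ratio_def Let_def by (meson order_trans)
 next
  case False
  then have n: "n >= 1" by simp
  define K where "K = cball_of n (coord_qnorm p N n b)"
  have nu: "crn n r (coord_qnorm p N n b)" by (rule crn_quotient[OF p eq N b])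
  have K: "sym_body n K" "compact K" "rconv r K" unfolding K_def by (rule cball_of_body[OF nu])+
  have Kw: "wct n (4 * C * d / c) K" unfolding K_def by (rule wct_quotient[OF p cd eq N b wcC C])
  have "rbody n r (4 * C * d / c) K" using K Kw by (simp add: rbody_def)
  then obtain M where "outer_ball n K Psi M" using Psi(2)[OF n] by blast
  then have M: "linear M" "!!x. x \<in> Rn n ==> M x = 0 ==> x = 0" "!!x. x \<in> K ==> norm (M x) <= 1"
   "cvol n {x. norm (M x) <= 1} <= exp (real n * Psi) * cvol n K" by (simp_all add: outer_ball_def)
  obtain v where v: "uppertri n v" "!!x. x \<in> Rn n ==> norm (rows n v x) = norm (M x)" using uppertri_of_linear[OF M(1,2)] by blast
  define G where "G = cset n (triell n v 0)"
  have KR: "K <= Rn n" by (rule sym_bodyD(1)[OF K(1)])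
  have G: "ellipsoid n G" "cset n K <= G"
  proof -
   show "ellipsoid n G" unfolding G_def by (rule triell_ellipsoid[OF v(1)]) simp
   have "K <= triell n v 0" using KR M(3) v(2) by (auto simp: triell_def)
   then show "cset n K <= G" by (auto simp: G_def cset_def)
  qed
  have "G = cset n {x. norm (M x) <= 1}" using v(2) by (auto simp: G_def cset_def triell_def)
  then have vG: "vol n G <= exp (real n * Psi) * cvol n K" using M(4) by (simp add: cvol_def)
  obtain rho where rho: "rho > 0" "!!x. x \<in> Rn n ==> norm x <= rho ==> x \<in> K" using K(1) by (auto simp: sym_body_def)
  obtain F0 where F0: "ellipsoid n F0" "cset n K <= F0" "!!G. ellipsoid n G ==> cset n K <= G ==> vol n F0 <= vol n G"
   using minimal_ellipsoid[OF sym_bodyD(2)[OF K(1)] rho KR] by blast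
  define F where "F = arg_min (vol n) (%F. ellipsoid n F \<and> cset n K <= F)"
  have "is_arg_min (vol n) (%F. ellipsoid n F \<and> cset n K <= F) F0"
   using F0 by (auto simp: is_arg_min_def not_less)
  then have "is_arg_min (vol n) (%F. ellipsoid n F \<and> cset n K <= F) F" unfolding F_def arg_min_def by (rule someI)
  then have "vol n F <= vol n G" using G unfolding is_arg_min_def by (auto simp: not_less)
  then have vF: "vol n F <= exp (real n * Psi) * cvol n K" using vG by linarith
  have Kpos: "cvol n K > 0"
  proof -
   have "cvol n {x. norm x < rho} <= cvol n K"
    using rho(2) by (intro cvol_mono cms_compact K(2) compact_imp_bounded) auto
   then show ?thesis using cvol_ball_pos[OF rho(1), of n] by linarith
  qed
  have "quotient_outer_volume_ratio p N n b = (vol n F / cvol n K) powr (1 / real n)"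
   unfolding quotient_outer_volume_ratio_def outer_volume_ratio_def Let_def outer_volume_ratio_coord K_def[symmetric] F_def cvol_def ..
  also have "... <= exp (real n * Psi) powr (1 / real n)"
  proof (rule powr_mono2)
   show "vol n F / cvol n K <= exp (real n * Psi)" using vF Kpos by (simp add: pos_divide_le_eq)
   show "0 <= vol n F / cvol n K" by (simp add: vol_def)
  qed simp
  also have "... = exp Psi" using n by (simp add: powr_def)
  finally show ?thesis .
 qed
 then show ?thesis by blast
qed

theorem theorem15:
  fixes p :: "'a::quasi_banach \<Rightarrow> real" and r :: real
  assumes "is_r_norm r p" and "equivalent_qnorm p"
  shows "weak_cotype_2 TYPE('a qdual) \<longleftrightarrow>
    (\<exists>C. \<forall>N n b. subspace N \<and> qclosed N \<and> quotient_basis N n b \<longrightarrow>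
       quotient_outer_volume_ratio p N n b \<le> C)"
  using outer_volume_ratio_of_weak_cotype_2[OF assms] weak_cotype_2_of_outer_volume_ratio[OF assms] by blast

end
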